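(* Let $\nu\in(0,1)$, let $\ell$ be the smallest integer such that $\nu\ell+\frac12>1$, and let $x=(x^1,\dots,x^\ell)$ be an $(L_4,\nu,\ell)$-rough path. Let $y=(y^{(0)},\dots,y^{(\ell-1)})$ be a discrete $\mathcal V$-valued process on $[0,1]$ controlled by $(x,\frac12)$ in $L_2$ or almost surely. Let $(h^n)_{n\ge1}$ be $\mathcal V'$-valued $1$-increments for which there is a constant $K$ independent of $n$ with $$|\mathcal J_s^t(x^i;h^n)|_{L_2}\le K(t-s)^{\frac12+\nu i},\qquad i=0,1,\dots,\ell-1,\ (s,t)\in\mathcal S_2'.$$ Suppose that: (i) $(x,h^n)\xrightarrow{f.d.d.}(x,W)$ as $n\to\infty$, where $W$ is a standard Brownian motion independent of $x$; (ii) for every $i=1,\dots,\ell-1$ and for any partition $0\le s_0<s_1<\cdots<s_m\le1$ such that $m\ll n$ and $|s_{j+1}-s_j|\le\frac1m$, one has, in probability, $$\lim_{m\to\infty}\limsup_{n\to\infty}\Big|\sum_{j=0}^{m-1}\mathcal J_{s_j}^{s_{j+1}}(x^i;h^n)\Big|=0 .$$ Then, as $n\to\infty$, $$(x,\mathcal J(y;h^n))\xrightarrow{f.d.d.}(x,v),\qquad v_{st}=\int_s^t y_u\otimes dW_u,$$ where the integral is understood as a conditional Wiener integral (conditionally on $x$, of which $W$ is independent).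
   Context: Grid. For $n\in\mathbb N$ let $t_k=k/n$ and $\mathcal D_n=\{t_0,\dots,t_n\}$. $\mathcal S_2=\{(s,t):0\le s\le t\le 1\}$, $\mathcal S_2'=\{(s,t)\in\mathcal D_n^2:s<t\}$. Put $\varepsilon(s)=t_k$ if $s\in(t_{k-1},t_k]$, and $\varepsilon(0)=0$. All random variables live on one probability space; $|\cdot|_{L_p}$ is the $L_p$-norm. $\delta f_{st}=f_t-f_s$ for a path $f$, and $\delta g_{sut}=g_{st}-g_{su}-g_{ut}$ for a two-parameter function $g$. $\mathcal V,\mathcal V'$ are finite-dimensional vector spaces. Rough path. For $p>1$ and an integer $\ell\le\lfloor1/\nu\rfloor$, an $(L_p,\nu,\ell)$-rough path is a continuous process $x=(x^1,\dots,x^\ell)$ on $\mathcal S_2$ with $x^k_{st}\in(\mathbb R^d)^{\otimes k}$, such that $\sup_{s<t}|x^k_{st}|_{L_p}^{1/k}/|t-s|^{\nu}<\infty$ for each $k$, $\delta x^1=0$, and $\delta x^k_{sut}=\sum_{j=1}^{k-1}x^{k-j}_{su}\otimes x^j_{ut}$ for $k\ge2$. By convention $x^0\equiv1$. Controlled process. Given $\alpha>0$, let $\ell$ be the smallest integer with $\nu\ell+\alpha>1$. Continuous processes $y=y^{(0)},y^{(1)},\dots,y^{(\ell-1)}$ on $[0,1]$, with $y_0=0$, $y^{(0)}$ valued in $\mathcal V$ and $y^{(k)}$ valued in $\mathcal L((\mathbb R^d)^{\otimes k},\mathcal V)$, have remainders $r^{(k)}_{st}=\delta y^{(k)}_{st}-\sum_{j=1}^{\ell-1-k}y^{(k+j)}_s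 x^j_{st}$ for $0\le k\le\ell-2$ and $r^{(\ell-1)}_{st}=\delta y^{(\ell-1)}_{st}$. They are controlled by $(x,\alpha)$ in $L_p$ if $|r^{(k)}_{st}|_{L_p}\le K(t-s)^{(\ell-k)\nu}$ for all $(s,t)\in\mathcal S_2$ and $k=0,\dots,\ell-1$, and almost surely if $|r^{(k)}_{st}|\le G_y(t-s)^{(\ell-k)\nu}$ for these $k$ and an a.s. finite random variable $G_y$. $1$-increments and discrete integrals. A $1$-increment $h^n$ is a two-parameter process on the grid $\mathcal D_n$, with $h^n_{st}=\sum_{s\le t_k<t}h^n_{t_kt_{k+1}}$. For the two-parameter processes $x^i$, $\mathcal J_s^t(x^i;h^n)=\sum_{s\le t_k<t}x^i_{\varepsilon(s)t_k}\otimes h^n_{t_kt_{k+1}}$ (in particular $\mathcal J(x^0;h^n)=h^n$); for the weight $y$, $\mathcal J_s^t(y;h^n)=\sum_{s\le t_k<t}y_{t_k}\otimes h^n_{t_kt_{k+1}}$. Convergence. $\xrightarrow{f.d.d.}$ is convergence of finite-dimensional distributions, for two-parameter processes over finitely many pairs $(s,t)\in\mathcal S_2$; convergence of $h^n$ to $W$ means to the increments $W_t-W_s$. "$\lim_m\limsup_n|A_{m,n}|=0$ in probability" means $\lim_m\limsup_n P(|A_{m,n}|>\eta)=0$ for all $\eta>0$. "$m\ll n$" indicates that $n\to\infty$ is taken before $m\to\infty$.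
   Formalization: It is additionally assumed that each y_t = y^{(0)}_t is almost surely a measurable function of x, as the Wiener integral conditional on x requires; without it the claim fails, e.g. x = 0, y_t = tB_1, h^n the increments of B, W independent of B. *)

theory Defs
  imports "HOL-Probability.Probability"
begin

text \<open>
  Tensors over \<open>\<real>\<^sup>d\<close> are given by coordinates: the coordinate of a tensor along
  \<open>e\<^bsub>w\<^sub>1\<^esub> \<otimes> \<dots> \<otimes> e\<^bsub>w\<^sub>k\<^esub>\<close> is its value at the word \<open>w = [w\<^sub>1, \<dots>, w\<^sub>k]\<close>. A function
  \<open>T :: 'd list \<Rightarrow> 'b\<close> collects one tensor for each level: its restriction to the words of
  length \<open>k\<close> is the component in \<open>(\<real>\<^sup>d)\<^bsup>\<otimes>k\<^esup> \<otimes> 'b\<close>, or, equivalently, a linear map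
  \<open>(\<real>\<^sup>d)\<^bsup>\<otimes>k\<^esup> \<rightarrow> 'b\<close> listed by its values on the basis tensors.
  So \<open>x s t \<omega> w\<close> is the \<open>w\<close>-coordinate of \<open>x\<^sup>k\<^sub>s\<^sub>t(\<omega>)\<close> and \<open>y t \<omega> w\<close> is
  \<open>y\<^bsup>(k)\<^esup>\<^sub>t(\<omega>)\<close> applied to \<open>e\<^bsub>w\<^sub>1\<^esub> \<otimes> \<dots> \<otimes> e\<^bsub>w\<^sub>k\<^esub>\<close>, where \<open>k = length w\<close>;
  in particular \<open>y t \<omega> []\<close> is \<open>y\<^bsup>(0)\<^esup>\<^sub>t(\<omega>)\<close>.
\<close>

definition words :: "nat \<Rightarrow> 'd::finite list set" where
  "words k = {w. length w = k}"

text \<open>Euclidean (Hilbert-Schmidt) norm of the level \<open>k\<close> component.\<close>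

definition tnorm :: "nat \<Rightarrow> ('d::finite list \<Rightarrow> 'b::real_normed_vector) \<Rightarrow> real" where
  "tnorm k T = L2_set (\<lambda>w. norm (T w)) (words k)"

definition trunc :: "nat \<Rightarrow> ('d list \<Rightarrow> real) \<Rightarrow> 'd list \<Rightarrow> real" where
  "trunc l T = (\<lambda>w. if 1 \<le> length w \<and> length w \<le> l then T w else 0)"

definition outer :: "real^'v \<Rightarrow> real^'w \<Rightarrow> real^'w^'v" where
  "outer a b = (\<chi> i j. a $ i * b $ j)"


definition ennreal_root :: "real \<Rightarrow> ennreal \<Rightarrow> ennreal" where
  "ennreal_root p a = (if a = \<infinity> then \<infinity> else ennreal (enn2real a powr (1 / p)))"

definition Lp_norm :: "real \<Rightarrow> 'a measure \<Rightarrow> ('a \<Rightarrow> real) \<Rightarrow> ennreal" where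
  "Lp_norm p M Z = ennreal_root p (\<integral>\<^sup>+ \<omega>. ennreal (\<bar>Z \<omega>\<bar> powr p) \<partial>M)"


definition grid :: "nat \<Rightarrow> nat \<Rightarrow> real" where
  "grid n k = real k / real n"

definition S2 :: "(real \<times> real) set" where
  "S2 = {(s, t). 0 \<le> s \<and> s \<le> t \<and> t \<le> 1}"

definition S2_grid :: "nat \<Rightarrow> (real \<times> real) set" where
  "S2_grid n = {(grid n i, grid n j) | i j. i < j \<and> j \<le> n}"

definition eps :: "nat \<Rightarrow> real \<Rightarrow> real" where
  "eps n s = real_of_int \<lceil>real n * s\<rceil> / real n"

lemma eps_0: "eps n 0 = 0"
  by (simp add: eps_def)

lemma eps_eq_grid:
  assumes "n \<ge> 1" and "s \<in> {grid n k <.. grid n (Suc k)}"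
  shows "eps n s = grid n (Suc k)"
proof -
  have "real k < real n * s" "real n * s \<le> real (Suc k)"
    using assms by (auto simp: grid_def field_simps)
  then have "\<lceil>real n * s\<rceil> = int (Suc k)"
    by (intro ceiling_unique) auto
  then show ?thesis
    by (simp add: eps_def grid_def)
qed


text \<open>
  The levels \<open>1, \<dots>, l\<close> of a rough path. Path properties are required almost surely, and the
  constant \<open>x\<^sup>0 = 1\<close> is stored at the empty word. The second clause of the almost sure
  condition is Chen's relation, read coordinatewise; for \<open>k = 1\<close> its right-hand side is the
  empty sum.
\<close>

definition rough_path ::
  "'a measure \<Rightarrow> real \<Rightarrow> real \<Rightarrow> nat \<Rightarrow> (real \<Rightarrow> real \<Rightarrow> 'a \<Rightarrow> 'd::finite list \<Rightarrow> real) \<Rightarrow> bool" where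
  "rough_path M p \<nu> l x \<longleftrightarrow>
     1 < p \<and> int l \<le> \<lfloor>1 / \<nu>\<rfloor> \<and>
     (\<forall>(s, t)\<in>S2. \<forall>k\<in>{1..l}. \<forall>w\<in>words k. (\<lambda>\<omega>. x s t \<omega> w) \<in> borel_measurable M) \<and>
     (\<forall>(s, t)\<in>S2. \<forall>\<omega>\<in>space M. x s t \<omega> [] = 1) \<and>
     (AE \<omega> in M.
        (\<forall>k\<in>{1..l}. \<forall>w\<in>words k. continuous_on S2 (\<lambda>(s, t). x s t \<omega> w)) \<and>
        (\<forall>s u t. 0 \<le> s \<and> s \<le> u \<and> u \<le> t \<and> t \<le> 1 \<longrightarrow>
           (\<forall>k\<in>{1..l}. \<forall>w\<in>words k.
              x s t \<omega> w - x s u \<omega> w - x u t \<omega> w =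
                (\<Sum>j = 1..k - 1. x s u \<omega> (take (k - j) w) * x u t \<omega> (drop (k - j) w))))) \<and>
     (\<forall>k\<in>{1..l}.
        (SUP (s, t)\<in>{(s, t). 0 \<le> s \<and> s < t \<and> t \<le> 1}.
           ennreal_root (real k) (Lp_norm p M (\<lambda>\<omega>. tnorm k (x s t \<omega>)))
             / ennreal ((t - s) powr \<nu>)) < \<infinity>)"

definition controlled_order :: "real \<Rightarrow> real \<Rightarrow> nat" where
  "controlled_order \<nu> \<alpha> = (LEAST l::nat. \<nu> * real l + \<alpha> > 1)"

text \<open>
  Level \<open>k\<close> of the remainder, for \<open>l\<close> the order of the controlled process. In
  \<open>y\<^bsup>(k+j)\<^esup>\<^sub>s x\<^sup>j\<^sub>s\<^sub>t\<close> the tensor \<open>x\<^sup>j\<^sub>s\<^sub>t\<close> fills the first \<open>j\<close> slots of \<open>y\<^bsup>(k+j)\<^esup>\<^sub>s\<close>; this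
  is the order compatible with the form of Chen's relation used above. For \<open>k = l - 1\<close> the sum is empty.
\<close>

definition remainder ::
  "nat \<Rightarrow> (real \<Rightarrow> real \<Rightarrow> 'a \<Rightarrow> 'd::finite list \<Rightarrow> real) \<Rightarrow> (real \<Rightarrow> 'a \<Rightarrow> 'd list \<Rightarrow> real^'v) \<Rightarrow>
   nat \<Rightarrow> real \<Rightarrow> real \<Rightarrow> 'a \<Rightarrow> 'd list \<Rightarrow> real^'v" where
  "remainder l x y k s t \<omega> w =
     y t \<omega> w - y s \<omega> w - (\<Sum>j = 1..l - 1 - k. \<Sum>u\<in>words j. x s t \<omega> u *\<^sub>R y s \<omega> (u @ w))"

definition controlled_paths ::
  "'a measure \<Rightarrow> nat \<Rightarrow> (real \<Rightarrow> 'a \<Rightarrow> 'd::finite list \<Rightarrow> real^'v) \<Rightarrow> bool" where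
  "controlled_paths M l y \<longleftrightarrow>
     (\<forall>k<l. \<forall>w\<in>words k. \<forall>t\<in>{0..1}. (\<lambda>\<omega>. y t \<omega> w) \<in> borel_measurable M) \<and>
     (AE \<omega> in M. \<forall>k<l. \<forall>w\<in>words k. continuous_on {0..1} (\<lambda>t. y t \<omega> w)) \<and>
     (AE \<omega> in M. y 0 \<omega> [] = 0)"

definition controlled_Lp ::
  "'a measure \<Rightarrow> real \<Rightarrow> real \<Rightarrow> real \<Rightarrow> (real \<Rightarrow> real \<Rightarrow> 'a \<Rightarrow> 'd::finite list \<Rightarrow> real) \<Rightarrow>
   (real \<Rightarrow> 'a \<Rightarrow> 'd list \<Rightarrow> real^'v) \<Rightarrow> bool" where
  "controlled_Lp M p \<nu> \<alpha> x y \<longleftrightarrow>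
     (let l = controlled_order \<nu> \<alpha> in
        controlled_paths M l y \<and>
        (\<exists>K::real. \<forall>k<l. \<forall>(s, t)\<in>S2.
           Lp_norm p M (\<lambda>\<omega>. tnorm k (remainder l x y k s t \<omega>))
             \<le> ennreal (K * (t - s) powr (real (l - k) * \<nu>))))"

definition controlled_as ::
  "'a measure \<Rightarrow> real \<Rightarrow> real \<Rightarrow> (real \<Rightarrow> real \<Rightarrow> 'a \<Rightarrow> 'd::finite list \<Rightarrow> real) \<Rightarrow>
   (real \<Rightarrow> 'a \<Rightarrow> 'd list \<Rightarrow> real^'v) \<Rightarrow> bool" where
  "controlled_as M \<nu> \<alpha> x y \<longleftrightarrow>
     (let l = controlled_order \<nu> \<alpha> in
        controlled_paths M l y \<and>
        (\<exists>G::'a \<Rightarrow> real. G \<in> borel_measurable M \<and>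
           (AE \<omega> in M. \<forall>k<l. \<forall>(s, t)\<in>S2.
              tnorm k (remainder l x y k s t \<omega>) \<le> G \<omega> * (t - s) powr (real (l - k) * \<nu>))))"


definition grid_between :: "nat \<Rightarrow> real \<Rightarrow> real \<Rightarrow> nat set" where
  "grid_between n s t = {k. k < n \<and> s \<le> grid n k \<and> grid n k < t}"

text \<open>\<open>increment n g\<close> extends a 1-increment \<open>g\<close> from the grid to all pairs of times.\<close>

definition increment ::
  "nat \<Rightarrow> (real \<Rightarrow> real \<Rightarrow> 'a \<Rightarrow> real^'w) \<Rightarrow> real \<Rightarrow> real \<Rightarrow> 'a \<Rightarrow> real^'w" where
  "increment n g s t \<omega> = (\<Sum>k\<in>grid_between n s t. g (grid n k) (grid n (Suc k)) \<omega>)"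

definition one_increment ::
  "'a measure \<Rightarrow> nat \<Rightarrow> (real \<Rightarrow> real \<Rightarrow> 'a \<Rightarrow> real^'w) \<Rightarrow> bool" where
  "one_increment M n g \<longleftrightarrow>
     (\<forall>i j. i \<le> j \<and> j \<le> n \<longrightarrow>
        g (grid n i) (grid n j) \<in> borel_measurable M \<and>
        (\<forall>\<omega>\<in>space M. g (grid n i) (grid n j) \<omega> = increment n g (grid n i) (grid n j) \<omega>))"

text \<open>
  The discrete integrals of all levels at once: the words of length \<open>i\<close> carry the integral of
  the level \<open>i\<close> of \<open>x\<close>.
\<close>

definition J_path ::
  "nat \<Rightarrow> (real \<Rightarrow> real \<Rightarrow> 'a \<Rightarrow> 'd list \<Rightarrow> real) \<Rightarrow> (real \<Rightarrow> real \<Rightarrow> 'a \<Rightarrow> real^'w) \<Rightarrow>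
   real \<Rightarrow> real \<Rightarrow> 'a \<Rightarrow> 'd list \<Rightarrow> real^'w" where
  "J_path n x g s t \<omega> w =
     (\<Sum>k\<in>grid_between n s t. x (eps n s) (grid n k) \<omega> w *\<^sub>R g (grid n k) (grid n (Suc k)) \<omega>)"

definition J_weight ::
  "nat \<Rightarrow> (real \<Rightarrow> 'a \<Rightarrow> real^'v) \<Rightarrow> (real \<Rightarrow> real \<Rightarrow> 'a \<Rightarrow> real^'w) \<Rightarrow>
   real \<Rightarrow> real \<Rightarrow> 'a \<Rightarrow> real^'w^'v" where
  "J_weight n z g s t \<omega> =
     (\<Sum>k\<in>grid_between n s t. outer (z (grid n k) \<omega>) (g (grid n k) (grid n (Suc k)) \<omega>))"


definition conv_in_distr ::
  "'a measure \<Rightarrow> (nat \<Rightarrow> 'a \<Rightarrow> 'b::topological_space) \<Rightarrow> ('a \<Rightarrow> 'b) \<Rightarrow> bool" where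
  "conv_in_distr M X Y \<longleftrightarrow>
     (\<forall>f :: 'b \<Rightarrow> real. continuous_on UNIV f \<and> bounded (range f) \<longrightarrow>
        (\<lambda>n. \<integral>\<omega>. f (X n \<omega>) \<partial>M) \<longlonglongrightarrow> (\<integral>\<omega>. f (Y \<omega>) \<partial>M))"

text \<open>
  The \<open>q\<close>-tuple of values at the pairs \<open>p 0, \<dots>, p (q - 1)\<close> is a function on \<open>{..<q}\<close>, with the
  product topology.
\<close>

definition fdd_conv ::
  "'a measure \<Rightarrow> (nat \<Rightarrow> real \<Rightarrow> real \<Rightarrow> 'a \<Rightarrow> 'b::topological_space) \<Rightarrow>
   (real \<Rightarrow> real \<Rightarrow> 'a \<Rightarrow> 'b) \<Rightarrow> bool" where
  "fdd_conv M X Y \<longleftrightarrow>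
     (\<forall>(q::nat) (p :: nat \<Rightarrow> real \<times> real). (\<forall>i<q. p i \<in> S2) \<longrightarrow>
        conv_in_distr M
          (\<lambda>n \<omega>. \<lambda>i\<in>{..<q}. X n (fst (p i)) (snd (p i)) \<omega>)
          (\<lambda>\<omega>. \<lambda>i\<in>{..<q}. Y (fst (p i)) (snd (p i)) \<omega>))"

text \<open>\<open>lim\<^sub>m limsup\<^sub>n |A m n| = 0\<close> in probability.\<close>

definition lim_limsup_in_prob :: "'a measure \<Rightarrow> (nat \<Rightarrow> nat \<Rightarrow> 'a \<Rightarrow> real) \<Rightarrow> bool" where
  "lim_limsup_in_prob M A \<longleftrightarrow>
     (\<forall>\<eta>>0. (\<lambda>m. limsup (\<lambda>n. ereal (measure M {\<omega> \<in> space M. \<bar>A m n \<omega>\<bar> > \<eta>}))) \<longlonglongrightarrow> 0)"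


definition standard_Brownian_motion :: "'a measure \<Rightarrow> (real \<Rightarrow> 'a \<Rightarrow> real^'w) \<Rightarrow> bool" where
  "standard_Brownian_motion M W \<longleftrightarrow>
     (\<forall>t\<in>{0..1}. W t \<in> borel_measurable M) \<and>
     (AE \<omega> in M. W 0 \<omega> = 0 \<and> continuous_on {0..1} (\<lambda>t. W t \<omega>)) \<and>
     (\<forall>s t i. 0 \<le> s \<and> s < t \<and> t \<le> 1 \<longrightarrow>
        distributed M lborel (\<lambda>\<omega>. (W t \<omega> - W s \<omega>) $ i)
          (\<lambda>z. ennreal (normal_density 0 (sqrt (t - s)) z))) \<and>
     (\<forall>(q::nat) (\<tau> :: nat \<Rightarrow> real).
        0 \<le> \<tau> 0 \<and> \<tau> q \<le> 1 \<and> (\<forall>k<q. \<tau> k < \<tau> (Suc k)) \<longrightarrow>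
        prob_space.indep_vars M (\<lambda>_. borel)
          (\<lambda>(k, i) \<omega>. (W (\<tau> (Suc k)) \<omega> - W (\<tau> k) \<omega>) $ i) ({..<q} \<times> UNIV))"

definition sigma_path ::
  "'a measure \<Rightarrow> nat \<Rightarrow> (real \<Rightarrow> real \<Rightarrow> 'a \<Rightarrow> 'd::finite list \<Rightarrow> real) \<Rightarrow> 'a measure" where
  "sigma_path M l x =
     vimage_algebra (space M) (\<lambda>\<omega>. \<lambda>p\<in>S2. trunc l (x (fst p) (snd p) \<omega>)) (\<Pi>\<^sub>M p\<in>S2. borel)"

definition sigma_process :: "'a measure \<Rightarrow> (real \<Rightarrow> 'a \<Rightarrow> real^'w) \<Rightarrow> 'a measure" where
  "sigma_process M W = vimage_algebra (space M) (\<lambda>\<omega>. \<lambda>t\<in>{0..1}. W t \<omega>) (\<Pi>\<^sub>M t\<in>{0..1}. borel)"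

text \<open>
  \<open>I\<close> is (a version of) \<open>\<integral>\<^sub>s\<^sup>t z \<otimes> dW\<close>, conditionally on the sub-sigma-algebra \<open>F\<close>: with
  \<open>z\<close> continuous and frozen by the conditioning, the Wiener integral is the limit in
  \<open>L\<^sub>2(P(\<cdot>|F))\<close> of the elementary integrals of the left-point step functions
  along every sequence of partitions of \<open>[s, t]\<close> with vanishing mesh. No unconditional
  integrability of \<open>z\<close> or \<open>I\<close> is involved; \<open>nn_cond_exp\<close> is the conditional expectation
  of nonnegative functions.
\<close>

definition conditional_Wiener_integral ::
  "'a measure \<Rightarrow> 'a measure \<Rightarrow> (real \<Rightarrow> 'a \<Rightarrow> real^'v) \<Rightarrow> (real \<Rightarrow> 'a \<Rightarrow> real^'w) \<Rightarrow>
   real \<Rightarrow> real \<Rightarrow> ('a \<Rightarrow> real^'w^'v) \<Rightarrow> bool" where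
  "conditional_Wiener_integral M F z W s t I \<longleftrightarrow>
     I \<in> borel_measurable M \<and>
     (\<forall>(N :: nat \<Rightarrow> nat) (\<pi> :: nat \<Rightarrow> nat \<Rightarrow> real).
        (\<forall>m. \<pi> m 0 = s \<and> \<pi> m (N m) = t \<and> (\<forall>j<N m. \<pi> m j \<le> \<pi> m (Suc j))) \<and>
        (\<forall>e>0. \<forall>\<^sub>F m in sequentially. \<forall>j<N m. \<pi> m (Suc j) - \<pi> m j < e) \<longrightarrow>
        (AE \<omega> in M.
           (\<lambda>m. nn_cond_exp M F
                  (\<lambda>\<omega>'. ennreal ((norm (I \<omega>' -
                     (\<Sum>j<N m. outer (z (\<pi> m j) \<omega>') (W (\<pi> m (Suc j)) \<omega>' - W (\<pi> m j) \<omega>'))))\<^sup>2)) \<omega>)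
             \<longlonglongrightarrow> 0))"

end

theory Submission
  imports Defs
begin

text \<open>
  Cut an interval \<open>[s, t]\<close> into \<open>m\<close> pieces \<open>[s\<^sub>j, s\<^sub>j\<^sub>+\<^sub>1]\<close> of equal length and expand the weight on each
  piece around its left end. By Chen's relation \<open>J(y; h\<^sup>n)\<close> over \<open>[s, t]\<close> is the sum over \<open>j\<close> of the
  main term \<open>y(s\<^sub>j) \<otimes> h\<^sup>n(s\<^sub>j, s\<^sub>j\<^sub>+\<^sub>1)\<close>, of the terms of level \<open>i\<close> given by the \<open>i\<close>-th coefficient of
  the weight at \<open>s\<^sub>j\<close> applied to \<open>J(x\<^sup>i; h\<^sup>n)\<close> over \<open>[s\<^sub>j, s\<^sub>j\<^sub>+\<^sub>1]\<close>, where \<open>1 \<le> i < l\<close>, and of a remainder.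
  The limits are taken for \<open>n \<rightarrow> \<infinity>\<close> first and for \<open>m \<rightarrow> \<infinity>\<close> afterwards.

  Main term. As \<open>n \<rightarrow> \<infinity>\<close> it converges in law, jointly with \<open>x\<close>, to the sum of the
  \<open>y(s\<^sub>j) \<otimes> (W(s\<^sub>j\<^sub>+\<^sub>1) - W(s\<^sub>j))\<close>. Convergence of finite-dimensional distributions gives this only for
  weights that are continuous functions of finitely many values of \<open>x\<close>; but every function measurable
  with respect to \<open>x\<close> is a limit in probability of those (\<open>approximable_vimage_algebra\<close>), and this is
  enough (\<open>joint_convergence\<close>). As \<open>m \<rightarrow> \<infinity>\<close> the Wiener sums converge in probability to the conditional
  Wiener integral, because conditionally on \<open>x\<close> the second moment of the difference of two such sums
  is the squared \<open>L\<^sub>2\<close>-distance of two step functions close to the same continuous path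
  (\<open>conditional_isometry\<close>, \<open>wiener_integral_exists\<close>). The two limits are combined by
  \<open>convergence_together\<close>.

  Remainder. The remainder over an interval of length \<open>r\<close> is additive in the interval up to a defect
  whose \<open>L\<^sub>1\<close>-norm is of order \<open>r\<^bsup>\<mu>\<^esup>\<close> with \<open>\<mu> = \<nu>l + 1/2 > 1\<close>. Discrete sewing turns this into a bound
  of the same order for the remainder itself (\<open>rem_sum_bound\<close>), so the \<open>m\<close> remainders add up to
  order \<open>m\<^bsup>1 - \<mu>\<^esup>\<close>.

  Terms of level \<open>i\<close>. Moment bounds on the separate pieces are too weak here. Instead, over a fixed
  interval the integral \<open>J(x\<^sup>i; h\<^sup>n)\<close> is itself a limit in probability of Riemann sums of \<open>h\<^sup>n\<close> with
  weights from \<open>x\<^sup>i\<close> (\<open>riemann_sums_converge_all\<close>, by induction on \<open>i\<close>; the term that the induction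
  does not reach is the sum of \<open>J(x\<^sup>i; h\<^sup>n)\<close> over the pieces, which vanishes by hypothesis). Replacing
  every \<open>J(x\<^sup>i; h\<^sup>n)\<close> by such a Riemann sum on a much finer partition makes the term of level \<open>i\<close> a
  weighted sum of increments of \<open>h\<^sup>n\<close>, whose limit is a Wiener sum with weights of size
  \<open>m\<^bsup>-\<nu>i\<^esup>\<close>; its second moment is of order \<open>m\<^bsup>-2\<nu>i\<^esup>\<close> (\<open>weighted_J_vanishes\<close>).

  Localisation. This argument needs coefficients that are bounded and measurable with respect to
  \<open>x\<close> at all levels, while only \<open>y\<^bsup>(0)\<^esup>\<close> is known to be a function of \<open>x\<close>. So \<open>y\<close> is multiplied by
  the indicator of an event \<open>E\<close> on which it is bounded and its remainders have the right order in \<open>L\<^sub>2\<close>, and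
  replaced by its conditional expectation given \<open>x\<close>. Since \<open>x\<close> itself passes through the conditional
  expectation, the result is again controlled by \<open>x\<close>, and its lowest level is \<open>P(E | x) y\<^bsup>(0)\<^esup>\<close>, where
  \<open>P(E | x)\<close> is close to one if \<open>E\<close> is large (\<open>localised_sums_vanish\<close>, \<open>weighted_sums_vanish\<close>).
\<close>

section \<open>Smallness in probability along a filter\<close>

text \<open>
  Smallness up to an exceptional event. Stating it with a covering event instead of the probability
  of \<open>\<bar>f\<bar> > \<eta>\<close> makes it monotone and subadditive for arbitrary functions, so that sums, products and
  case distinctions need no measurability.
\<close>

definition near :: "'a measure \<Rightarrow> real \<Rightarrow> real \<Rightarrow> ('a \<Rightarrow> real) \<Rightarrow> bool" where
  "near M \<eta> \<epsilon> f \<longleftrightarrow> (\<exists>B\<in>sets M. measure M B < \<epsilon> \<and> (\<forall>\<omega>\<in>space M - B. \<bar>f \<omega>\<bar> \<le> \<eta>))"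

text \<open>
  Convergence to zero in probability along a filter. The filter is \<open>sequentially\<close> for single limits
  and \<open>iter\<close> for iterated ones.
\<close>

definition vanishes :: "'a measure \<Rightarrow> 'i filter \<Rightarrow> ('i \<Rightarrow> 'a \<Rightarrow> real) \<Rightarrow> bool" where
  "vanishes M F A \<longleftrightarrow> (\<forall>\<eta>>0. \<forall>\<epsilon>>0. \<forall>\<^sub>F i in F. near M \<eta> \<epsilon> (A i))"

definition tight_along :: "'a measure \<Rightarrow> 'i filter \<Rightarrow> ('i \<Rightarrow> 'a \<Rightarrow> real) \<Rightarrow> bool" where
  "tight_along M F A \<longleftrightarrow> (\<forall>\<epsilon>>0. \<exists>R. \<forall>\<^sub>F i in F. near M R \<epsilon> (A i))"

text \<open>
  The filter of the iterated limit in which \<open>n \<rightarrow> \<infinity>\<close> is taken before \<open>m \<rightarrow> \<infinity>\<close>; along it the double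
  limits obey the same calculus as single limits.
\<close>

definition iter :: "(nat \<times> nat) filter" where
  "iter = Abs_filter (\<lambda>P. \<forall>\<^sub>F m in sequentially. \<forall>\<^sub>F n in sequentially. P (m, n))"

lemma eventually_iter:
  "eventually P iter \<longleftrightarrow> (\<forall>\<^sub>F m in sequentially. \<forall>\<^sub>F n in sequentially. P (m, n))"
  unfolding iter_def
  by (rule eventually_Abs_filter, rule is_filter.intro)
     (auto elim!: eventually_rev_mp intro!: always_eventually simp: eventually_conj_iff eventually_mono)

context prob_space
begin

lemma near_mono:
  assumes "near M a e f" "a \<le> b" "e \<le> d" "AE \<omega> in M. \<bar>g \<omega>\<bar> \<le> \<bar>f \<omega>\<bar>"
  shows "near M b d g"
proof -
  obtain B where B: "B \<in> sets M" "measure M B < e" "\<And>\<omega>. \<omega> \<in> space M - B \<Longrightarrow> \<bar>f \<omega>\<bar> \<le> a"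
    using assms(1) unfolding near_def by auto
  obtain N where N: "\<And>\<omega>. \<omega> \<in> space M - N \<Longrightarrow> \<bar>g \<omega>\<bar> \<le> \<bar>f \<omega>\<bar>" "N \<in> null_sets M"
    using AE_E3[OF assms(4)] by blast
  have "measure M (B \<union> N) = measure M B"
    by (rule measure_Un_null_set[OF B(1) N(2)])
  moreover have "\<forall>\<omega>\<in>space M - (B \<union> N). \<bar>g \<omega>\<bar> \<le> b"
  proof
    fix \<omega> assume w: "\<omega> \<in> space M - (B \<union> N)"
    then have "\<bar>g \<omega>\<bar> \<le> \<bar>f \<omega>\<bar>" using N(1)[of \<omega>] by auto
    then show "\<bar>g \<omega>\<bar> \<le> b" using B(3)[of \<omega>] w assms(2) by auto
  qed
  ultimately show ?thesis
    unfolding near_def using B N assms(3) by (intro bexI[of _ "B \<union> N"]) auto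
qed

lemma near_comb:
  assumes "near M a e f" "near M b d g"
    and "\<And>\<omega>. \<omega> \<in> space M \<Longrightarrow> \<bar>f \<omega>\<bar> \<le> a \<Longrightarrow> \<bar>g \<omega>\<bar> \<le> b \<Longrightarrow> \<bar>h \<omega>\<bar> \<le> c"
  shows "near M c (e + d) h"
proof -
  obtain B where B: "B \<in> sets M" "measure M B < e" "\<And>\<omega>. \<omega> \<in> space M - B \<Longrightarrow> \<bar>f \<omega>\<bar> \<le> a"
    using assms(1) unfolding near_def by auto
  obtain D where D: "D \<in> sets M" "measure M D < d" "\<And>\<omega>. \<omega> \<in> space M - D \<Longrightarrow> \<bar>g \<omega>\<bar> \<le> b"
    using assms(2) unfolding near_def by auto
  have "measure M (B \<union> D) \<le> measure M B + measure M D"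
    using B D by (simp add: measure_Un_le)
  then show ?thesis
    unfolding near_def using B D assms(3) by (intro bexI[of _ "B \<union> D"]) auto
qed

lemma near_0: "0 \<le> \<eta> \<Longrightarrow> 0 < \<epsilon> \<Longrightarrow> near M \<eta> \<epsilon> (\<lambda>\<omega>. 0)"
  unfolding near_def by (intro bexI[of _ "{}"]) auto

lemma near_nn_integral:
  assumes [measurable]: "f \<in> borel_measurable M"
    and "(\<integral>\<^sup>+\<omega>. ennreal \<bar>f \<omega>\<bar> \<partial>M) \<le> ennreal a" "a < \<eta> * \<epsilon>" "0 < \<eta>" "0 \<le> a"
  shows "near M \<eta> \<epsilon> f"
proof -
  let ?B = "{\<omega>\<in>space M. \<bar>f \<omega>\<bar> > \<eta>}"
  have "ennreal (\<eta> * measure M ?B) = (\<integral>\<^sup>+\<omega>. ennreal \<eta> * indicator ?B \<omega> \<partial>M)"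
    using assms(4) by (subst nn_integral_cmult_indicator) (auto simp: emeasure_eq_measure ennreal_mult)
  also have "\<dots> \<le> (\<integral>\<^sup>+\<omega>. ennreal \<bar>f \<omega>\<bar> \<partial>M)"
    by (intro nn_integral_mono) (auto simp: indicator_def intro!: ennreal_leI)
  also have "\<dots> \<le> ennreal a" by fact
  finally have "\<eta> * measure M ?B \<le> a"
    using assms(5) by simp
  then have "measure M ?B < \<epsilon>"
    using assms(3,4) by (smt (verit) mult_less_cancel_left_pos)
  then show ?thesis unfolding near_def by (intro bexI[of _ ?B]) auto
qed

lemma near_square:
  assumes [measurable]: "f \<in> borel_measurable M"
    and "(\<integral>\<^sup>+\<omega>. ennreal ((f \<omega>)\<^sup>2) \<partial>M) \<le> ennreal a" "a < \<eta>\<^sup>2 * \<epsilon>" "0 < \<eta>" "0 \<le> a"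
  shows "near M \<eta> \<epsilon> f"
proof -
  have "near M (\<eta>\<^sup>2) \<epsilon> (\<lambda>\<omega>. (f \<omega>)\<^sup>2)"
    using assms by (intro near_nn_integral[where a=a]) auto
  then show ?thesis
    unfolding near_def using assms(4) by (simp flip: abs_le_square_iff)
qed

lemma vanishes_comb:
  assumes "vanishes M F A" "vanishes M F B"
    and "\<And>i \<omega>. \<omega> \<in> space M \<Longrightarrow> \<bar>C i \<omega>\<bar> \<le> \<bar>A i \<omega>\<bar> + \<bar>B i \<omega>\<bar>"
  shows "vanishes M F C"
  unfolding vanishes_def
proof (intro allI impI)
  fix \<eta> \<epsilon> :: real assume "\<eta> > 0" "\<epsilon> > 0"
  then have "\<forall>\<^sub>F i in F. near M (\<eta>/2) (\<epsilon>/2) (A i)" "\<forall>\<^sub>F i in F. near M (\<eta>/2) (\<epsilon>/2) (B i)"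
    using assms(1,2) unfolding vanishes_def by (meson half_gt_zero)+
  then show "\<forall>\<^sub>F i in F. near M \<eta> \<epsilon> (C i)"
  proof eventually_elim
    case (elim i)
    have "near M \<eta> (\<epsilon>/2 + \<epsilon>/2) (C i)"
    proof (rule near_comb[OF elim])
      fix \<omega> assume "\<omega> \<in> space M" "\<bar>A i \<omega>\<bar> \<le> \<eta>/2" "\<bar>B i \<omega>\<bar> \<le> \<eta>/2"
      then show "\<bar>C i \<omega>\<bar> \<le> \<eta>" using assms(3)[of \<omega> i] by linarith
    qed
    then show ?case by simp
  qed
qed

lemma vanishes_mono:
  assumes "vanishes M F A" "\<forall>\<^sub>F i in F. AE \<omega> in M. \<bar>C i \<omega>\<bar> \<le> \<bar>A i \<omega>\<bar>"
  shows "vanishes M F C"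
  unfolding vanishes_def
proof (intro allI impI)
  fix \<eta> \<epsilon> :: real assume "\<eta> > 0" "\<epsilon> > 0"
  then have "\<forall>\<^sub>F i in F. near M \<eta> \<epsilon> (A i)"
    using assms(1) unfolding vanishes_def by blast
  then show "\<forall>\<^sub>F i in F. near M \<eta> \<epsilon> (C i)"
    using assms(2) by eventually_elim (rule near_mono, auto)
qed

lemma vanishes_cong:
  assumes "vanishes M F A" "\<forall>\<^sub>F i in F. AE \<omega> in M. C i \<omega> = A i \<omega>"
  shows "vanishes M F C"
  by (rule vanishes_mono[OF assms(1)]) (use assms(2) in \<open>auto elim!: eventually_mono\<close>)

lemma vanishes_add:
  "vanishes M F A \<Longrightarrow> vanishes M F B \<Longrightarrow> vanishes M F (\<lambda>i \<omega>. A i \<omega> + B i \<omega>)"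
  by (erule (1) vanishes_comb) auto

lemma vanishes_zero: "vanishes M F (\<lambda>i \<omega>. 0)"
  unfolding vanishes_def by (auto intro!: always_eventually near_0)

lemma vanishes_sum:
  assumes "\<And>k. k \<in> S \<Longrightarrow> vanishes M F (A k)"
  shows "vanishes M F (\<lambda>i \<omega>. \<Sum>k\<in>S. A k i \<omega>)"
  using assms
proof (induction S rule: infinite_finite_induct)
  case (insert k S)
  then show ?case by (simp add: vanishes_add)
qed (auto simp: vanishes_zero)

lemma vanishes_mult_tight:
  assumes "vanishes M F A" "tight_along M F B"
  shows "vanishes M F (\<lambda>i \<omega>. A i \<omega> * B i \<omega>)"
  unfolding vanishes_def
proof (intro allI impI)
  fix \<eta> \<epsilon> :: real assume h: "\<eta> > 0" "\<epsilon> > 0"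
  then obtain R where "\<forall>\<^sub>F i in F. near M R (\<epsilon>/2) (B i)"
    using assms(2) unfolding tight_along_def by (meson half_gt_zero)
  then have "\<forall>\<^sub>F i in F. near M (max R 1) (\<epsilon>/2) (B i)"
    by eventually_elim (rule near_mono, auto)
  moreover have "\<forall>\<^sub>F i in F. near M (\<eta> / max R 1) (\<epsilon>/2) (A i)"
    using assms(1) h unfolding vanishes_def by auto
  ultimately show "\<forall>\<^sub>F i in F. near M \<eta> \<epsilon> (\<lambda>\<omega>. A i \<omega> * B i \<omega>)"
  proof eventually_elim
    case (elim i)
    have "near M \<eta> (\<epsilon>/2 + \<epsilon>/2) (\<lambda>\<omega>. A i \<omega> * B i \<omega>)"
    proof (rule near_comb[OF elim])
      fix \<omega> assume h': "\<bar>B i \<omega>\<bar> \<le> max R 1" "\<bar>A i \<omega>\<bar> \<le> \<eta> / max R 1"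
      have "\<bar>A i \<omega>\<bar> * \<bar>B i \<omega>\<bar> \<le> \<eta> / max R 1 * max R 1"
        using h' h by (intro mult_mono) auto
      then show "\<bar>A i \<omega> * B i \<omega>\<bar> \<le> \<eta>"
        by (auto simp: abs_mult)
    qed
    then show ?case by simp
  qed
qed

lemma vanishes_nn_integral:
  assumes "\<forall>\<^sub>F i in F. A i \<in> borel_measurable M \<and> (\<integral>\<^sup>+\<omega>. ennreal \<bar>A i \<omega>\<bar> \<partial>M) \<le> ennreal (a i)"
    and "(a \<longlongrightarrow> 0) F"
  shows "vanishes M F A"
  unfolding vanishes_def
proof (intro allI impI)
  fix \<eta> \<epsilon> :: real assume h: "\<eta> > 0" "\<epsilon> > 0"
  then have "\<forall>\<^sub>F i in F. a i < \<eta> * \<epsilon>"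
    using assms(2) by (intro order_tendstoD) auto
  then show "\<forall>\<^sub>F i in F. near M \<eta> \<epsilon> (A i)"
    using assms(1)
  proof eventually_elim
    case (elim i)
    have "(\<integral>\<^sup>+\<omega>. ennreal \<bar>A i \<omega>\<bar> \<partial>M) \<le> ennreal (max (a i) 0)"
      using elim by (auto simp: max_def ennreal_neg)
    then show ?case using elim h by (intro near_nn_integral[where a="max (a i) 0"]) auto
  qed
qed

lemma tight_square:
  assumes "\<forall>\<^sub>F i in F. A i \<in> borel_measurable M \<and> (\<integral>\<^sup>+\<omega>. ennreal ((A i \<omega>)\<^sup>2) \<partial>M) \<le> ennreal C"
  shows "tight_along M F A"
  unfolding tight_along_def
proof (intro allI impI)
  fix \<epsilon> :: real assume h: "\<epsilon> > 0"
  define C' where "C' = max C 1"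
  have C': "0 < C'" "C \<le> C'" by (auto simp: C'_def)
  have e: "C' < (sqrt (2 * C' / \<epsilon>))\<^sup>2 * \<epsilon>"
    using C' h by (simp add: field_simps)
  show "\<exists>R. \<forall>\<^sub>F i in F. near M R \<epsilon> (A i)"
  proof (rule exI[of _ "sqrt (2 * C' / \<epsilon>)"], use assms in eventually_elim)
    case (elim i)
    then have "(\<integral>\<^sup>+\<omega>. ennreal ((A i \<omega>)\<^sup>2) \<partial>M) \<le> ennreal C'"
      using C' by (meson ennreal_leI order_trans)
    then show ?case
      using elim e C' h by (intro near_square[where a=C']) auto
  qed
qed

lemma near_large:
  assumes [measurable]: "A \<in> borel_measurable M" and e: "\<epsilon> > 0"
  shows "\<exists>R>0. near M R \<epsilon> A"
proof -
  have "(\<lambda>k::nat. measure M {\<omega>\<in>space M. \<bar>A \<omega>\<bar> > real k}) \<longlonglongrightarrow> measure M (\<Inter>k::nat. {\<omega>\<in>space M. \<bar>A \<omega>\<bar> > real k})"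
    by (intro finite_Lim_measure_decseq) (auto simp: decseq_def)
  moreover have "(\<Inter>k::nat. {\<omega>\<in>space M. \<bar>A \<omega>\<bar> > real k}) = {}"
    by auto (meson less_le_not_le linorder_not_less reals_Archimedean2)
  ultimately have "(\<lambda>k::nat. measure M {\<omega>\<in>space M. \<bar>A \<omega>\<bar> > real k}) \<longlonglongrightarrow> 0"
    by simp
  then have "\<forall>\<^sub>F k in sequentially. measure M {\<omega>\<in>space M. \<bar>A \<omega>\<bar> > real k} < \<epsilon>"
    using e by (rule order_tendstoD)
  then obtain k where "k > 0" "measure M {\<omega>\<in>space M. \<bar>A \<omega>\<bar> > real k} < \<epsilon>"
    by (metis (no_types, lifting) eventually_sequentially nat_le_linear not_less0 zero_less_Suc le_SucI neq0_conv)
  then have "near M (real k) \<epsilon> A"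
    unfolding near_def by (intro bexI[of _ "{\<omega>\<in>space M. \<bar>A \<omega>\<bar> > real k}"]) auto
  then show ?thesis using \<open>k > 0\<close> by (intro exI[of _ "real k"]) auto
qed

lemma tight_const: "A \<in> borel_measurable M \<Longrightarrow> tight_along M F (\<lambda>i. A)"
  unfolding tight_along_def using near_large by (metis eventually_True always_eventually)

lemma vanishes_AE_lim:
  assumes [measurable]: "\<And>n. A n \<in> borel_measurable M"
    and "AE \<omega> in M. (\<lambda>n. A n \<omega>) \<longlonglongrightarrow> 0"
  shows "vanishes M sequentially A"
proof -
  have "(\<lambda>n. \<integral>\<omega>. min 1 \<bar>A n \<omega>\<bar> \<partial>M) \<longlonglongrightarrow> (\<integral>\<omega>. 0 \<partial>M)"
  proof (rule integral_dominated_convergence[where w="\<lambda>_. 1"])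
    show "AE \<omega> in M. (\<lambda>n. min 1 \<bar>A n \<omega>\<bar>) \<longlonglongrightarrow> 0"
      using assms(2)
    proof eventually_elim
      case (elim \<omega>)
      have "(\<lambda>n. min 1 \<bar>A n \<omega>\<bar>) \<longlonglongrightarrow> min 1 \<bar>0\<bar>"
        by (intro tendsto_intros elim)
      then show ?case by simp
    qed
  qed auto
  then have *: "(\<lambda>n. \<integral>\<omega>. min 1 \<bar>A n \<omega>\<bar> \<partial>M) \<longlonglongrightarrow> 0" by simp
  have v: "vanishes M sequentially (\<lambda>n \<omega>. min 1 \<bar>A n \<omega>\<bar>)"
  proof (rule vanishes_nn_integral[OF always_eventually *], intro allI conjI)
    fix n
    have "integrable M (\<lambda>\<omega>. min 1 \<bar>A n \<omega>\<bar>)"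
      by (rule integrable_const_bound[where B=1]) auto
    then show "(\<integral>\<^sup>+\<omega>. ennreal \<bar>min 1 \<bar>A n \<omega>\<bar>\<bar> \<partial>M) \<le> ennreal (\<integral>\<omega>. min 1 \<bar>A n \<omega>\<bar> \<partial>M)"
      by (subst nn_integral_eq_integral[symmetric]) auto
  qed auto
  show ?thesis
    unfolding vanishes_def
  proof (intro allI impI)
    fix \<eta> \<epsilon> :: real assume h: "\<eta> > 0" "\<epsilon> > 0"
    then have "\<forall>\<^sub>F n in sequentially. near M (min (1/2) \<eta>) \<epsilon> (\<lambda>\<omega>. min 1 \<bar>A n \<omega>\<bar>)"
      using v unfolding vanishes_def by auto
    then show "\<forall>\<^sub>F n in sequentially. near M \<eta> \<epsilon> (A n)"
      unfolding near_def by (auto simp: min_def split: if_splits elim!: eventually_mono) (smt (verit) Diff_iff field_sum_of_halves)+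
  qed
qed

text \<open>
  Errors that disappear already as \<open>n \<rightarrow> \<infinity>\<close>, for each fixed number \<open>m\<close> of pieces, such as the
  replacement of a time by the next grid point.
\<close>

lemma vanishes_iterI:
  assumes "\<And>m. m \<ge> 1 \<Longrightarrow> vanishes M sequentially (\<lambda>n. A (m, n))"
  shows "vanishes M iter A"
  unfolding vanishes_def eventually_iter
proof (intro allI impI)
  fix \<eta> \<epsilon> :: real assume h: "\<eta> > 0" "\<epsilon> > 0"
  show "\<forall>\<^sub>F m in sequentially. \<forall>\<^sub>F n in sequentially. near M \<eta> \<epsilon> (A (m, n))"
    using eventually_ge_at_top[of 1]
    by eventually_elim (use assms h in \<open>auto simp: vanishes_def\<close>)
qed

lemma lim_limsup_imp_vanishes:
  assumes [measurable]: "\<And>m n. A m n \<in> borel_measurable M"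
    and *: "lim_limsup_in_prob M A"
  shows "vanishes M iter (\<lambda>(m, n). A m n)"
  unfolding vanishes_def eventually_iter
proof (intro allI impI)
  fix \<eta> \<epsilon> :: real assume h: "\<eta> > 0" "\<epsilon> > 0"
  have "(\<lambda>m. limsup (\<lambda>n. ereal (measure M {\<omega> \<in> space M. \<bar>A m n \<omega>\<bar> > \<eta>}))) \<longlonglongrightarrow> 0"
    using * h unfolding lim_limsup_in_prob_def by auto
  then have "\<forall>\<^sub>F m in sequentially. limsup (\<lambda>n. ereal (measure M {\<omega> \<in> space M. \<bar>A m n \<omega>\<bar> > \<eta>})) < ereal \<epsilon>"
    using h by (intro order_tendstoD) auto
  then show "\<forall>\<^sub>F m in sequentially. \<forall>\<^sub>F n in sequentially. near M \<eta> \<epsilon> (case (m, n) of (m, n) \<Rightarrow> A m n)"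
  proof eventually_elim
    case (elim m)
    then have "\<forall>\<^sub>F n in sequentially. ereal (measure M {\<omega> \<in> space M. \<bar>A m n \<omega>\<bar> > \<eta>}) < ereal \<epsilon>"
      by (rule Limsup_lessD)
    then show ?case
      by eventually_elim (auto simp: near_def intro!: bexI[of _ "{\<omega> \<in> space M. \<bar>A m _ \<omega>\<bar> > \<eta>}"])
  qed
qed

section \<open>Convergence in distribution\<close>

text \<open>
  The direction of the portmanteau theorem that needs a construction: a bounded continuous \<open>f\<close> is the
  increasing limit of the bounded Lipschitz functions \<open>g\<^sub>k(a) = inf\<^sub>b (f(b) + k d(a, b))\<close>, which gives
  \<open>liminf E f(X\<^sub>n) \<ge> E f(Y)\<close>; apply this to \<open>f\<close> and to \<open>-f\<close>.
\<close>

lemma conv_in_distr_lipschitz: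
  fixes X :: "nat \<Rightarrow> 'a \<Rightarrow> 'b::metric_space"
  assumes [measurable]: "\<And>n. X n \<in> borel_measurable M" "Y \<in> borel_measurable M"
    and lip: "\<And>(f :: 'b \<Rightarrow> real) L. L \<ge> 0 \<Longrightarrow> (\<And>a b. \<bar>f a - f b\<bar> \<le> L * dist a b) \<Longrightarrow> bounded (range f)
       \<Longrightarrow> (\<lambda>n. \<integral>\<omega>. f (X n \<omega>) \<partial>M) \<longlonglongrightarrow> (\<integral>\<omega>. f (Y \<omega>) \<partial>M)"
  shows "conv_in_distr M X Y"
proof -
  have lower: "\<exists>N. \<forall>n\<ge>N. (\<integral>\<omega>. f (Y \<omega>) \<partial>M) - e < (\<integral>\<omega>. f (X n \<omega>) \<partial>M)"
    if cont: "continuous_on UNIV f" and bd: "bounded (range f)" and e: "e > 0" for f :: "'b \<Rightarrow> real" and e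
  proof -
    obtain B where B: "\<And>a. \<bar>f a\<bar> \<le> B" using bd unfolding bounded_iff by auto
    define g where "g k a = (INF b. f b + real k * dist a b)" for k a
    have bdd: "bdd_below (range (\<lambda>b. f b + real k * dist a b))" for k a
    proof (rule bdd_belowI2)
      show "- B \<le> f b + real k * dist a b" for b
        using B[of b] by (smt (verit) mult_nonneg_nonneg of_nat_0_le_iff zero_le_dist)
    qed
    have gle: "g k a \<le> f b + real k * dist a b" for k a b
      unfolding g_def by (rule cINF_lower[OF bdd]) auto
    have gef: "g k a \<le> f a" for k a using gle[of k a a] by simp
    have gge: "- B \<le> g k a" for k a
      unfolding g_def
    proof (rule cINF_greatest)
      show "- B \<le> f b + real k * dist a b" for b
        using B[of b] by (smt (verit) mult_nonneg_nonneg of_nat_0_le_iff zero_le_dist)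
    qed auto
    have glip1: "g k a \<le> g k b + real k * dist a b" for k a b
    proof -
      have "g k a - real k * dist a b \<le> g k b"
        unfolding g_def[of k b]
      proof (rule cINF_greatest)
        fix c
        have "real k * dist a c \<le> real k * (dist a b + dist b c)"
          by (intro mult_left_mono dist_triangle) auto
        then show "g k a - real k * dist a b \<le> f c + real k * dist b c"
          using gle[of k a c] by (simp add: algebra_simps)
      qed auto
      then show ?thesis by simp
    qed
    have glip: "\<bar>g k a - g k b\<bar> \<le> real k * dist a b" for k a b
      using glip1[of k a b] glip1[of k b a] by (auto simp: dist_commute)
    have gbd: "\<bar>g k a\<bar> \<le> B" for k a
      using gge[of k a] gef[of k a] B[of a] by auto
    have gcont: "continuous_on UNIV (g k)" for k
    proof (rule lipschitz_on_continuous_on[of "real k"])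
      show "(real k)-lipschitz_on UNIV (g k)"
        using glip by (auto simp: lipschitz_on_def dist_real_def)
    qed
    have [measurable]: "g k \<in> borel_measurable borel" for k
      using gcont by (rule borel_measurable_continuous_onI)
    have [measurable]: "f \<in> borel_measurable borel"
      using cont by (rule borel_measurable_continuous_onI)
    have glim: "(\<lambda>k. g k a) \<longlonglongrightarrow> f a" for a
    proof (rule LIMSEQ_I)
      fix r :: real assume r: "r > 0"
      obtain d where d: "d > 0" "\<And>b. dist b a < d \<Longrightarrow> dist (f b) (f a) < r/2"
        using cont[unfolded continuous_on_iff, rule_format, of a "r/2"] r by auto
      obtain K :: nat where K: "real K * d > 2 * B" using reals_Archimedean3[OF d(1)] by blast
      show "\<exists>K. \<forall>k\<ge>K. norm (g k a - f a) < r"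
      proof (intro exI allI impI)
        fix k assume "k \<ge> K"
        have "f a - r/2 \<le> g k a"
          unfolding g_def
        proof (rule cINF_greatest)
          fix b
          show "f a - r/2 \<le> f b + real k * dist a b"
          proof (cases "dist b a < d")
            case True
            then have "f a - r/2 \<le> f b" using d(2)[OF True] unfolding dist_real_def by linarith
            then show ?thesis by (simp add: add_increasing2)
          next
            case False
            have "real K * d \<le> real k * dist a b"
              using False \<open>k \<ge> K\<close> d(1) by (intro mult_mono) (auto simp: dist_commute)
            then show ?thesis using K B[of a] B[of b] r unfolding abs_le_iff by linarith
          qed
        qed auto
        then show "norm (g k a - f a) < r" using gef[of k a] r by simp
      qed
    qed
    have "(\<lambda>k. \<integral>\<omega>. g k (Y \<omega>) \<partial>M) \<longlonglongrightarrow> (\<integral>\<omega>. f (Y \<omega>) \<partial>M)"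
      by (rule integral_dominated_convergence[where w="\<lambda>_. B"]) (use glim gbd in auto)
    then obtain k where k: "(\<integral>\<omega>. f (Y \<omega>) \<partial>M) - e/2 < (\<integral>\<omega>. g k (Y \<omega>) \<partial>M)"
      by (metis (no_types, lifting) e LIMSEQ_le_const2 diff_less_eq less_add_same_cancel1 half_gt_zero linorder_not_less le_cases nle_le)
    have "(\<lambda>n. \<integral>\<omega>. g k (X n \<omega>) \<partial>M) \<longlonglongrightarrow> (\<integral>\<omega>. g k (Y \<omega>) \<partial>M)"
      by (rule lip[of "real k"]) (use glip gbd in \<open>auto simp: bounded_iff intro!: exI[of _ B]\<close>)
    then have ev: "\<forall>\<^sub>F n in sequentially. (\<integral>\<omega>. g k (Y \<omega>) \<partial>M) - e/2 < (\<integral>\<omega>. g k (X n \<omega>) \<partial>M)"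
      using e by (intro order_tendstoD) auto
    have gf: "(\<integral>\<omega>. g k (X n \<omega>) \<partial>M) \<le> (\<integral>\<omega>. f (X n \<omega>) \<partial>M)" for n
      by (intro integral_mono integrable_const_bound[where B=B]) (use gbd B gef in auto)
    from ev have "\<forall>\<^sub>F n in sequentially. (\<integral>\<omega>. f (Y \<omega>) \<partial>M) - e < (\<integral>\<omega>. f (X n \<omega>) \<partial>M)"
    proof eventually_elim
      case (elim n)
      then show ?case using k gf[of n] by (smt (verit) field_sum_of_halves)
    qed
    then show ?thesis by (simp add: eventually_sequentially)
  qed
  show ?thesis
    unfolding conv_in_distr_def
  proof (intro allI impI, elim conjE)
    fix f :: "'b \<Rightarrow> real" assume f: "continuous_on UNIV f" "bounded (range f)"
    have f': "continuous_on UNIV (\<lambda>a. - f a)" "bounded (range (\<lambda>a. - f a))"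
      using f by (auto intro!: continuous_intros simp: bounded_iff)
    show "(\<lambda>n. \<integral>\<omega>. f (X n \<omega>) \<partial>M) \<longlonglongrightarrow> (\<integral>\<omega>. f (Y \<omega>) \<partial>M)"
    proof (rule LIMSEQ_I)
      fix r :: real assume r: "r > 0"
      obtain N1 where N1: "\<forall>n\<ge>N1. (\<integral>\<omega>. f (Y \<omega>) \<partial>M) - r < (\<integral>\<omega>. f (X n \<omega>) \<partial>M)"
        using lower[OF f r] by auto
      obtain N2 where N2: "\<forall>n\<ge>N2. (\<integral>\<omega>. - f (Y \<omega>) \<partial>M) - r < (\<integral>\<omega>. - f (X n \<omega>) \<partial>M)"
        using lower[OF f' r] by auto
      show "\<exists>no. \<forall>n\<ge>no. norm ((\<integral>\<omega>. f (X n \<omega>) \<partial>M) - (\<integral>\<omega>. f (Y \<omega>) \<partial>M)) < r"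
        using N1 N2 by (intro exI[of _ "max N1 N2"]) (auto simp: abs_less_iff)
    qed
  qed
qed

lemma integrable_indicator_event: "E \<in> sets M \<Longrightarrow> integrable M (indicator E :: 'a \<Rightarrow> real)"
  by (rule integrable_const_bound[where B=1]) auto

lemma near_expectation:
  fixes f :: "'b::metric_space \<Rightarrow> real"
  assumes [measurable]: "U \<in> borel_measurable M" "V \<in> borel_measurable M"
    and lip: "\<And>a b. \<bar>f a - f b\<bar> \<le> L * dist a b" and L: "L \<ge> 0" and B: "\<And>a. \<bar>f a\<bar> \<le> B"
    and near: "near M \<delta> \<delta> (\<lambda>\<omega>. dist (U \<omega>) (V \<omega>))" and d: "\<delta> > 0"
  shows "\<bar>(\<integral>\<omega>. f (U \<omega>) \<partial>M) - (\<integral>\<omega>. f (V \<omega>) \<partial>M)\<bar> \<le> (L + 2 * B) * \<delta>"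
proof -
  have "continuous_on UNIV f"
  proof (rule lipschitz_on_continuous_on[of L])
    show "L-lipschitz_on UNIV f"
      using lip L by (auto simp: lipschitz_on_def dist_real_def)
  qed
  then have [measurable]: "f \<in> borel_measurable borel"
    by (rule borel_measurable_continuous_onI)
  obtain E where E [measurable]: "E \<in> sets M" and E2: "measure M E < \<delta>" "\<And>\<omega>. \<omega> \<in> space M - E \<Longrightarrow> dist (U \<omega>) (V \<omega>) \<le> \<delta>"
    using near unfolding near_def by auto
  have B0: "B \<ge> 0" using B[of undefined] by linarith
  have i: "integrable M (\<lambda>\<omega>. f (U \<omega>))" "integrable M (\<lambda>\<omega>. f (V \<omega>))"
    by (rule integrable_const_bound[where B=B]; use B in simp)+
  have "\<bar>(\<integral>\<omega>. f (U \<omega>) \<partial>M) - (\<integral>\<omega>. f (V \<omega>) \<partial>M)\<bar> = \<bar>\<integral>\<omega>. f (U \<omega>) - f (V \<omega>) \<partial>M\<bar>"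
    using i by simp
  also have "\<dots> \<le> (\<integral>\<omega>. L * \<delta> + 2 * B * indicator E \<omega> \<partial>M)"
  proof (rule order_trans[OF integral_abs_bound], rule integral_mono)
    fix \<omega> assume w: "\<omega> \<in> space M"
    show "\<bar>f (U \<omega>) - f (V \<omega>)\<bar> \<le> L * \<delta> + 2 * B * indicator E \<omega>"
    proof (cases "\<omega> \<in> E")
      case True
      have "0 \<le> L * \<delta>" using L d by simp
      then show ?thesis using True B[of "U \<omega>"] B[of "V \<omega>"] by (auto simp: abs_le_iff)
    next
      case False
      then show ?thesis using lip[of "U \<omega>" "V \<omega>"] E2(2)[of \<omega>] w L
        by (simp) (meson mult_left_mono order_trans)
    qed
  qed (use i integrable_indicator_event[OF E] in \<open>auto intro!: Bochner_Integration.integrable_diff Bochner_Integration.integrable_add\<close>)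
  also have "\<dots> = L * \<delta> + 2 * B * measure M E"
    by (subst Bochner_Integration.integral_add) (auto simp: prob_space emeasure_eq_measure)
  also have "\<dots> \<le> L * \<delta> + 2 * B * \<delta>" using E2(1) B0 by (intro add_left_mono mult_left_mono) auto
  finally show ?thesis by (simp add: algebra_simps)
qed

text \<open>
  Billingsley's interchange of limits: if \<open>X\<^sub>n\<close> is approximated by \<open>U\<^sub>m\<^sub>n\<close> in the iterated limit,
  \<open>U\<^sub>m\<^sub>n\<close> converges in law to \<open>V\<^sub>m\<close> for each \<open>m\<close>, and \<open>V\<^sub>m\<close> approaches \<open>Y\<close>, then \<open>X\<^sub>n\<close> converges in law
  to \<open>Y\<close>. Lipschitz test functions suffice, and for them closeness off a small event controls the
  difference of expectations.
\<close>

lemma convergence_together: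
  fixes X :: "nat \<Rightarrow> 'a \<Rightarrow> 'b::metric_space"
  assumes meas: "\<And>n. X n \<in> borel_measurable M" "Y \<in> borel_measurable M"
      "\<And>m n. U m n \<in> borel_measurable M" "\<And>m. V m \<in> borel_measurable M"
    and conv: "\<And>m. m \<ge> 1 \<Longrightarrow> conv_in_distr M (U m) (V m)"
    and approx: "\<And>\<delta>. \<delta> > 0 \<Longrightarrow> \<exists>m\<ge>1. near M \<delta> \<delta> (\<lambda>\<omega>. dist (V m \<omega>) (Y \<omega>)) \<and>
        (\<forall>\<^sub>F n in sequentially. near M \<delta> \<delta> (\<lambda>\<omega>. dist (X n \<omega>) (U m n \<omega>)))"
  shows "conv_in_distr M X Y"
proof (rule conv_in_distr_lipschitz[OF meas(1,2)])
  fix f :: "'b \<Rightarrow> real" and L :: real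
  assume L: "L \<ge> 0" and lip: "\<And>a b. \<bar>f a - f b\<bar> \<le> L * dist a b" and bd: "bounded (range f)"
  obtain B where B: "\<And>a. \<bar>f a\<bar> \<le> B" using bd unfolding bounded_iff by auto
  have B0: "B \<ge> 0" using B[of undefined] by linarith
  show "(\<lambda>n. \<integral>\<omega>. f (X n \<omega>) \<partial>M) \<longlonglongrightarrow> (\<integral>\<omega>. f (Y \<omega>) \<partial>M)"
  proof (rule tendstoI)
    fix r :: real assume r: "r > 0"
    \<comment> \<open>each of the two approximations may cost \<open>(L + 2 B) \<delta>\<close>, a third of \<open>r\<close>\<close>
    define \<delta> where "\<delta> = r / (3 * (L + 2 * B + 1))"
    have d: "\<delta> > 0" using r L B0 by (simp add: \<delta>_def)
    have d3: "(L + 2 * B) * \<delta> < r / 3"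
      using r L B0 unfolding \<delta>_def by (simp add: field_simps)
    obtain m where m: "m \<ge> 1" "near M \<delta> \<delta> (\<lambda>\<omega>. dist (V m \<omega>) (Y \<omega>))"
        "\<forall>\<^sub>F n in sequentially. near M \<delta> \<delta> (\<lambda>\<omega>. dist (X n \<omega>) (U m n \<omega>))"
      using approx[OF d] by auto
    have "continuous_on UNIV f"
    proof (rule lipschitz_on_continuous_on[of L])
      show "L-lipschitz_on UNIV f"
        using lip L by (auto simp: lipschitz_on_def dist_real_def)
    qed
    then have "(\<lambda>n. \<integral>\<omega>. f (U m n \<omega>) \<partial>M) \<longlonglongrightarrow> (\<integral>\<omega>. f (V m \<omega>) \<partial>M)"
      using conv[OF m(1)] bd unfolding conv_in_distr_def by auto
    then have "\<forall>\<^sub>F n in sequentially. dist (\<integral>\<omega>. f (U m n \<omega>) \<partial>M) (\<integral>\<omega>. f (V m \<omega>) \<partial>M) < r/3"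
      using r by (intro tendstoD) auto
    then show "\<forall>\<^sub>F n in sequentially. dist (\<integral>\<omega>. f (X n \<omega>) \<partial>M) (\<integral>\<omega>. f (Y \<omega>) \<partial>M) < r"
      using m(3)
    proof eventually_elim
      case (elim n)
      have "\<bar>(\<integral>\<omega>. f (X n \<omega>) \<partial>M) - (\<integral>\<omega>. f (U m n \<omega>) \<partial>M)\<bar> \<le> (L + 2 * B) * \<delta>"
        by (rule near_expectation[OF meas(1) meas(3) lip L B elim(2) d])
      moreover have "\<bar>(\<integral>\<omega>. f (V m \<omega>) \<partial>M) - (\<integral>\<omega>. f (Y \<omega>) \<partial>M)\<bar> \<le> (L + 2 * B) * \<delta>"
        by (rule near_expectation[OF meas(4) meas(2) lip L B m(2) d])
      ultimately show ?case using elim(1) d3 unfolding dist_real_def by linarith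
    qed
  qed
qed

text \<open>
  A limit in law with small second moment makes the sequence itself small in probability: Markov's
  inequality is applied in the limit to the bounded continuous function \<open>min 1 (z\<^sup>2 / \<eta>\<^sup>2)\<close>.
\<close>

lemma conv_in_distr_near:
  assumes [measurable]: "\<And>n. X n \<in> borel_measurable M" "Y \<in> borel_measurable M"
    and conv: "conv_in_distr M X Y"
    and Y: "(\<integral>\<^sup>+\<omega>. ennreal ((Y \<omega>)\<^sup>2) \<partial>M) \<le> ennreal C" "0 \<le> C" "C < \<eta>\<^sup>2 * \<epsilon>" "0 < \<eta>"
  shows "\<forall>\<^sub>F n in sequentially. near M \<eta> \<epsilon> (X n)"
proof -
  define f where "f z = min 1 (z\<^sup>2 / \<eta>\<^sup>2)" for z :: real
  have f: "continuous_on UNIV f" "bounded (range f)" "\<And>z. 0 \<le> f z" "\<And>z. f z \<le> 1"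
    unfolding f_def using Y(4) by (auto intro!: continuous_intros simp: bounded_iff intro: exI[of _ 1])
  have [measurable]: "f \<in> borel_measurable borel" unfolding f_def by measurable
  have i: "integrable M (\<lambda>\<omega>. f (Z \<omega>))" if [measurable]: "Z \<in> borel_measurable M" for Z
    by (rule integrable_const_bound[where B=1]) (use f in auto)
  have "ennreal (\<integral>\<omega>. f (Y \<omega>) \<partial>M) = (\<integral>\<^sup>+\<omega>. ennreal (f (Y \<omega>)) \<partial>M)"
    using f i[OF assms(2)] by (subst nn_integral_eq_integral) auto
  also have "\<dots> \<le> (\<integral>\<^sup>+\<omega>. ennreal (1/\<eta>\<^sup>2) * ennreal ((Y \<omega>)\<^sup>2) \<partial>M)"
    by (intro nn_integral_mono) (auto simp: f_def min_def intro!: ennreal_leI simp flip: ennreal_mult')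
  also have "\<dots> = ennreal (1/\<eta>\<^sup>2) * (\<integral>\<^sup>+\<omega>. ennreal ((Y \<omega>)\<^sup>2) \<partial>M)"
    by (intro nn_integral_cmult) auto
  also have "\<dots> \<le> ennreal (1/\<eta>\<^sup>2) * ennreal C"
    using Y(1) by (rule mult_left_mono) auto
  also have "\<dots> = ennreal (C / \<eta>\<^sup>2)"
    using Y by (subst ennreal_mult[symmetric]) auto
  finally have "(\<integral>\<omega>. f (Y \<omega>) \<partial>M) \<le> C / \<eta>\<^sup>2"
    using Y by (subst (asm) ennreal_le_iff) auto
  also have "\<dots> < \<epsilon>" using Y by (simp add: field_simps)
  finally have "\<forall>\<^sub>F n in sequentially. (\<integral>\<omega>. f (X n \<omega>) \<partial>M) < \<epsilon>"
    using conv f unfolding conv_in_distr_def by (intro order_tendstoD) auto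
  then show ?thesis
  proof eventually_elim
    case (elim n)
    have "(\<integral>\<^sup>+\<omega>. ennreal \<bar>f (X n \<omega>)\<bar> \<partial>M) = ennreal (\<integral>\<omega>. f (X n \<omega>) \<partial>M)"
      using f i[OF assms(1)] by (subst nn_integral_eq_integral) auto
    let ?B = "{\<omega>\<in>space M. \<bar>X n \<omega>\<bar> > \<eta>}"
    have "measure M ?B = (\<integral>\<omega>. indicator ?B \<omega> \<partial>M)" by simp
    also have "\<dots> \<le> (\<integral>\<omega>. f (X n \<omega>) \<partial>M)"
    proof (rule integral_mono)
      fix \<omega> assume "\<omega> \<in> space M"
      show "indicator ?B \<omega> \<le> f (X n \<omega>)"
      proof (cases "\<omega> \<in> ?B")
        case True
        then have "\<eta>\<^sup>2 \<le> (X n \<omega>)\<^sup>2" using Y(4) by (auto simp: abs_le_square_iff[symmetric])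
        then show ?thesis using True Y(4) by (simp add: f_def field_simps)
      qed (use f in auto)
    qed (use i in \<open>auto intro!: integrable_indicator_event\<close>)
    finally show ?case unfolding near_def using elim by (intro bexI[of _ ?B]) auto
  qed
qed

end

section \<open>Cylinder approximation\<close>

text \<open>
  Continuous functions of finitely many values of a process. Convergence of finite-dimensional
  distributions carries them along as additional coordinates.
\<close>

definition cylinder ::
  "'p set \<Rightarrow> ('p \<Rightarrow> 'a \<Rightarrow> 'c::topological_space) \<Rightarrow> ('a \<Rightarrow> 'b::topological_space) \<Rightarrow> bool" where
  "cylinder P X g \<longleftrightarrow> (\<exists>\<psi>. continuous_on UNIV \<psi> \<and> (\<forall>\<omega>. g \<omega> = \<psi> (\<lambda>p\<in>P. X p \<omega>)))"

lemma continuous_on_restrict_fun: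
  "continuous_on UNIV (\<lambda>z :: 'p \<Rightarrow> 'c::topological_space. \<lambda>p\<in>P. z p)"
proof (rule continuous_on_coordinatewise_then_product)
  fix i show "continuous_on UNIV (\<lambda>z :: 'p \<Rightarrow> 'c. (\<lambda>p\<in>P. z p) i)"
    by (cases "i \<in> P") (auto simp: restrict_def)
qed

lemma cylinder_mono:
  assumes "cylinder P X g" "P \<subseteq> Q"
  shows "cylinder Q X g"
proof -
  obtain \<psi> where \<psi>: "continuous_on UNIV \<psi>" "\<And>\<omega>. g \<omega> = \<psi> (\<lambda>p\<in>P. X p \<omega>)"
    using assms(1) unfolding cylinder_def by auto
  have "(\<lambda>p\<in>P. (\<lambda>p\<in>Q. X p \<omega>) p) = (\<lambda>p\<in>P. X p \<omega>)" for \<omega>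
    using assms(2) by (auto simp: restrict_def fun_eq_iff)
  moreover have "continuous_on UNIV (\<lambda>z. \<psi> (\<lambda>p\<in>P. z p))"
    using \<psi>(1) by (rule continuous_on_compose2[OF _ continuous_on_restrict_fun]) auto
  ultimately show ?thesis
    unfolding cylinder_def using \<psi>(2) by (intro exI[of _ "\<lambda>z. \<psi> (\<lambda>p\<in>P. z p)"]) auto
qed

lemma cylinder_const: "cylinder P X (\<lambda>\<omega>. c)"
  unfolding cylinder_def by (intro exI[of _ "\<lambda>_. c"]) auto

lemma cylinder_coord: "p \<in> P \<Longrightarrow> cylinder P X (X p)"
  unfolding cylinder_def by (intro exI[of _ "\<lambda>z. z p"]) auto

lemma cylinder_Pair:
  assumes "cylinder P X f" "cylinder P X g"
  shows "cylinder P X (\<lambda>\<omega>. (f \<omega>, g \<omega>))"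
proof -
  obtain \<psi> \<phi> where "continuous_on UNIV \<psi>" "\<And>\<omega>. f \<omega> = \<psi> (\<lambda>p\<in>P. X p \<omega>)"
    "continuous_on UNIV \<phi>" "\<And>\<omega>. g \<omega> = \<phi> (\<lambda>p\<in>P. X p \<omega>)"
    using assms unfolding cylinder_def by blast
  then show ?thesis
    unfolding cylinder_def by (intro exI[of _ "\<lambda>z. (\<psi> z, \<phi> z)"]) (auto intro!: continuous_intros)
qed

lemma cylinder_compose:
  assumes "cylinder P X f" "continuous_on UNIV h"
  shows "cylinder P X (\<lambda>\<omega>. h (f \<omega>))"
proof -
  obtain \<psi> where \<psi>: "continuous_on UNIV \<psi>" "\<And>\<omega>. f \<omega> = \<psi> (\<lambda>p\<in>P. X p \<omega>)"
    using assms unfolding cylinder_def by blast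
  have "continuous_on UNIV (\<lambda>z. h (\<psi> z))"
    using assms(2) \<psi>(1) by (rule continuous_on_compose2) auto
  then show ?thesis
    unfolding cylinder_def using \<psi>(2) by (intro exI[of _ "\<lambda>z. h (\<psi> z)"]) auto
qed

definition approximable ::
  "'a measure \<Rightarrow> 'p set \<Rightarrow> ('p \<Rightarrow> 'a \<Rightarrow> 'c::topological_space) \<Rightarrow> ('a \<Rightarrow> real) \<Rightarrow> bool" where
  "approximable M I X Z \<longleftrightarrow>
     (\<forall>\<epsilon>>0. \<exists>P g. finite P \<and> P \<subseteq> I \<and> cylinder P X g \<and> near M \<epsilon> \<epsilon> (\<lambda>\<omega>. Z \<omega> - g \<omega>))"

context prob_space
begin

lemma approximable_limit:
  assumes "\<And>\<epsilon>. \<epsilon> > 0 \<Longrightarrow> \<exists>Z'. approximable M I X Z' \<and> near M \<epsilon> \<epsilon> (\<lambda>\<omega>. Z \<omega> - Z' \<omega>)"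
  shows "approximable M I X Z"
  unfolding approximable_def
proof (intro allI impI)
  fix \<epsilon> :: real assume e: "\<epsilon> > 0"
  then have e2: "\<epsilon>/2 > 0" by simp
  obtain Z' where Z': "approximable M I X Z'" "near M (\<epsilon>/2) (\<epsilon>/2) (\<lambda>\<omega>. Z \<omega> - Z' \<omega>)"
    using assms[OF e2] by auto
  obtain P g where g: "finite P" "P \<subseteq> I" "cylinder P X g" "near M (\<epsilon>/2) (\<epsilon>/2) (\<lambda>\<omega>. Z' \<omega> - g \<omega>)"
    using Z'(1) e2 unfolding approximable_def by blast
  have "near M \<epsilon> (\<epsilon>/2 + \<epsilon>/2) (\<lambda>\<omega>. Z \<omega> - g \<omega>)"
    by (rule near_comb[OF Z'(2) g(4)]) linarith
  then show "\<exists>P g. finite P \<and> P \<subseteq> I \<and> cylinder P X g \<and> near M \<epsilon> \<epsilon> (\<lambda>\<omega>. Z \<omega> - g \<omega>)"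
    using g by (intro exI[of _ P] exI[of _ g]) auto
qed

lemma approximable_comb:
  fixes h :: "real \<Rightarrow> real \<Rightarrow> real"
  assumes "approximable M I X Y" "approximable M I X Z"
    and h: "continuous_on UNIV (\<lambda>(a, b). h a b)"
    and lip: "\<And>a b a' b'. \<bar>h a b - h a' b'\<bar> \<le> L * (\<bar>a - a'\<bar> + \<bar>b - b'\<bar>)" and L: "L \<ge> 0"
    and eq: "\<And>\<omega>. \<omega> \<in> space M \<Longrightarrow> V \<omega> = h (Y \<omega>) (Z \<omega>)"
  shows "approximable M I X V"
  unfolding approximable_def
proof (intro allI impI)
  fix \<epsilon> :: real assume e: "\<epsilon> > 0"
  define d where "d = \<epsilon> / (2 * (L + 1))"
  have "d = (\<epsilon> / (L + 1)) / 2" by (simp add: d_def)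
  then have d2: "d + d = \<epsilon> / (L + 1)" by (simp only: field_sum_of_halves)
  have d: "d > 0" "L * (d + d) \<le> \<epsilon>" "d + d \<le> \<epsilon>"
    using e L unfolding d2 by (auto simp: d_def pos_divide_le_eq algebra_simps)
  obtain P f where f: "finite P" "P \<subseteq> I" "cylinder P X f" "near M d d (\<lambda>\<omega>. Y \<omega> - f \<omega>)"
    using assms(1) d(1) unfolding approximable_def by blast
  obtain Q g where g: "finite Q" "Q \<subseteq> I" "cylinder Q X g" "near M d d (\<lambda>\<omega>. Z \<omega> - g \<omega>)"
    using assms(2) d(1) unfolding approximable_def by blast
  have c: "cylinder (P \<union> Q) X (\<lambda>\<omega>. (f \<omega>, g \<omega>))"
    by (intro cylinder_Pair cylinder_mono[OF f(3)] cylinder_mono[OF g(3)]) auto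
  have "near M \<epsilon> (d + d) (\<lambda>\<omega>. V \<omega> - h (f \<omega>) (g \<omega>))"
  proof (rule near_comb[OF f(4) g(4)])
    fix \<omega> assume *: "\<omega> \<in> space M" "\<bar>Y \<omega> - f \<omega>\<bar> \<le> d" "\<bar>Z \<omega> - g \<omega>\<bar> \<le> d"
    have "\<bar>h (Y \<omega>) (Z \<omega>) - h (f \<omega>) (g \<omega>)\<bar> \<le> L * (d + d)"
      by (rule order_trans[OF lip]) (use * L in \<open>intro mult_left_mono add_mono, auto\<close>)
    then show "\<bar>V \<omega> - h (f \<omega>) (g \<omega>)\<bar> \<le> \<epsilon>"
      using eq[OF *(1)] d by simp
  qed
  then have "near M \<epsilon> \<epsilon> (\<lambda>\<omega>. V \<omega> - h (f \<omega>) (g \<omega>))"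
    by (rule near_mono) (use d in auto)
  moreover have "cylinder (P \<union> Q) X (\<lambda>\<omega>. h (f \<omega>) (g \<omega>))"
    using cylinder_compose[OF c h] by simp
  ultimately show "\<exists>P g. finite P \<and> P \<subseteq> I \<and> cylinder P X g \<and> near M \<epsilon> \<epsilon> (\<lambda>\<omega>. V \<omega> - g \<omega>)"
    using f g by (intro exI[of _ "P \<union> Q"] exI[of _ "\<lambda>\<omega>. h (f \<omega>) (g \<omega>)"]) auto
qed

lemma approximable_const: "approximable M I X (\<lambda>\<omega>. c)"
  unfolding approximable_def
  by (intro allI impI exI[of _ "{}"] exI[of _ "\<lambda>_. c"]) (auto simp: cylinder_const near_0)

lemma approximable_empty: "approximable M I X (indicator {})"
proof -
  have "indicator {} = (\<lambda>\<omega> :: 'a. 0 :: real)" by auto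
  then show ?thesis using approximable_const[of I X 0] by simp
qed

lemma approximable_sum:
  assumes "finite S" "\<And>k. k \<in> S \<Longrightarrow> approximable M I X (Z k)"
  shows "approximable M I X (\<lambda>\<omega>. \<Sum>k\<in>S. c k * Z k \<omega>)"
  using assms
proof (induction S rule: finite_induct)
  case empty
  then show ?case by (simp add: approximable_const)
next
  case (insert k S)
  have lip: "\<bar>c k * a + b - (c k * a' + b')\<bar> \<le> (\<bar>c k\<bar> + 1) * (\<bar>a - a'\<bar> + \<bar>b - b'\<bar>)" for a b a' b'
  proof -
    have "c k * a + b - (c k * a' + b') = c k * (a - a') + (b - b')" by (simp add: algebra_simps)
    then have "\<bar>c k * a + b - (c k * a' + b')\<bar> \<le> \<bar>c k\<bar> * \<bar>a - a'\<bar> + \<bar>b - b'\<bar>"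
      by (metis abs_mult abs_triangle_ineq)
    also have "\<dots> \<le> (\<bar>c k\<bar> + 1) * (\<bar>a - a'\<bar> + \<bar>b - b'\<bar>)"
      by (simp add: algebra_simps)
    finally show ?thesis .
  qed
  have cont: "continuous_on UNIV (\<lambda>(a, b). c k * a + b)"
    by (auto intro!: continuous_intros simp: case_prod_unfold)
  have Z: "approximable M I X (Z k)" and S: "approximable M I X (\<lambda>\<omega>. \<Sum>k\<in>S. c k * Z k \<omega>)"
    using insert by auto
  show ?case
    by (rule approximable_comb[OF Z S cont lip]) (simp_all only: sum.insert[OF insert(1,2)] abs_ge_zero add_nonneg_nonneg zero_le_one)
qed

lemma approximable_compl:
  assumes "approximable M I X (indicator A)"
  shows "approximable M I X (indicator (space M - A))"
proof (rule approximable_comb[OF assms approximable_const[of _ _ 0], where h="\<lambda>a b. 1 - a" and L=1])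
  show "\<bar>1 - a - (1 - a')\<bar> \<le> 1 * (\<bar>a - a'\<bar> + \<bar>b - b'\<bar>)" for a b a' b' :: real
    using abs_minus_commute[of a a'] abs_ge_zero[of "b - b'"] by simp
qed (auto simp: indicator_def case_prod_unfold intro!: continuous_intros)

lemma approximable_max:
  fixes A B :: "'a set"
  assumes "approximable M I X (indicator A)" "approximable M I X (indicator B)"
  shows "approximable M I X (indicator (A \<union> B))"
proof (rule approximable_comb[OF assms, where h="\<lambda>a b. max a b" and L=1])
  show "\<bar>max a b - max a' b'\<bar> \<le> 1 * (\<bar>a - a'\<bar> + \<bar>b - b'\<bar>)" for a b a' b' :: real
    by (cases "a \<le> b"; cases "a' \<le> b'"; simp add: max_def; linarith)
qed (auto simp: indicator_def case_prod_unfold intro!: continuous_intros)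

lemma vanishes_near:
  assumes "vanishes M sequentially A" "\<epsilon> > 0"
  shows "\<exists>k. near M \<epsilon> \<epsilon> (A k)"
  using assms unfolding vanishes_def eventually_sequentially by blast

lemma approximable_UNION:
  fixes A :: "nat \<Rightarrow> 'a set"
  assumes [measurable]: "\<And>i. A i \<in> sets M" and A: "\<And>i. approximable M I X (indicator (A i))"
  shows "approximable M I X (indicator (\<Union>i. A i))"
proof (rule approximable_limit)
  fix \<epsilon> :: real assume e: "\<epsilon> > 0"
  have fin: "approximable M I X (indicator (\<Union>i<k. A i))" for k
  proof (induction k)
    case 0
    show ?case using approximable_const[of I X 0] by simp
  next
    case (Suc k)
    then show ?case using approximable_max[OF Suc A[of k]] by (simp add: lessThan_Suc Un_commute)
  qed
  have "vanishes M sequentially (\<lambda>k \<omega>. indicator (\<Union>i. A i) \<omega> - indicator (\<Union>i<k. A i) \<omega>)"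
  proof (rule vanishes_AE_lim)
    show "AE \<omega> in M. (\<lambda>k. indicator (\<Union>i. A i) \<omega> - indicator (\<Union>i<k. A i) \<omega> :: real) \<longlonglongrightarrow> 0"
    proof (rule AE_I2)
      fix \<omega>
      have "(\<lambda>k. indicator (\<Union>i<k. A i) \<omega> :: real) \<longlonglongrightarrow> indicator (\<Union>i. A i) \<omega>"
        by (rule LIMSEQ_indicator_UN)
      from tendsto_diff[OF tendsto_const[of "indicator (\<Union>i. A i) \<omega>"] this]
      show "(\<lambda>k. indicator (\<Union>i. A i) \<omega> - indicator (\<Union>i<k. A i) \<omega> :: real) \<longlonglongrightarrow> 0" by simp
    qed
  qed measurable
  from vanishes_near[OF this e] obtain k
    where "near M \<epsilon> \<epsilon> (\<lambda>\<omega>. indicator (\<Union>i. A i) \<omega> - indicator (\<Union>i<k. A i) \<omega>)" by auto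
  then show "\<exists>Z'. approximable M I X Z' \<and> near M \<epsilon> \<epsilon> (\<lambda>\<omega>. indicator (\<Union>i. A i) \<omega> - Z' \<omega>)"
    using fin by blast
qed

text \<open>
  The functions \<open>max 0 (1 - k d(z, C))\<close> are continuous and decrease to the indicator of the closed
  set \<open>C\<close>.
\<close>

lemma approximable_closed:
  fixes X :: "'p \<Rightarrow> 'a \<Rightarrow> 'c::metric_space"
  assumes [measurable]: "X p \<in> borel_measurable M" and p: "p \<in> I" and C: "closed C"
  shows "approximable M I X (indicator (X p -` C \<inter> space M))"
proof (cases "C = {}")
  case True
  then show ?thesis using approximable_const[of I X 0] approximable_empty by simp
next
  case False
  define g where "g k \<omega> = max 0 (1 - real k * infdist (X p \<omega>) C)" for k \<omega>
  have [measurable]: "closed C" "C \<in> sets borel" using C by auto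
  have gm [measurable]: "g k \<in> borel_measurable M" for k
    unfolding g_def by (intro borel_measurable_max borel_measurable_diff borel_measurable_times
        measurable_compose[OF assms(1)] borel_measurable_continuous_onI continuous_on_infdist) (auto intro!: continuous_intros)
  have cyl: "cylinder {p} X (g k)" for k
  proof -
    have "cylinder {p} X (\<lambda>\<omega>. (\<lambda>z. max 0 (1 - real k * infdist z C)) (X p \<omega>))"
      by (rule cylinder_compose[OF cylinder_coord]) (auto intro!: continuous_intros)
    then show ?thesis by (simp add: g_def[abs_def])
  qed
  have app: "approximable M I X (g k)" for k
    unfolding approximable_def using cyl p
    by (intro allI impI exI[of _ "{p}"] exI[of _ "g k"]) (auto simp: near_0)
  have "vanishes M sequentially (\<lambda>k \<omega>. indicator (X p -` C \<inter> space M) \<omega> - g k \<omega>)"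
  proof (rule vanishes_AE_lim)
    show "AE \<omega> in M. (\<lambda>k. indicator (X p -` C \<inter> space M) \<omega> - g k \<omega>) \<longlonglongrightarrow> 0"
    proof (rule AE_I2)
      fix \<omega> assume w: "\<omega> \<in> space M"
      show "(\<lambda>k. indicator (X p -` C \<inter> space M) \<omega> - g k \<omega>) \<longlonglongrightarrow> 0"
      proof (cases "X p \<omega> \<in> C")
        case True
        then show ?thesis using w by (simp add: g_def)
      next
        case F: False
        then have pos: "infdist (X p \<omega>) C > 0"
          using C False by (metis in_closed_iff_infdist_zero infdist_nonneg less_eq_real_def)
        have "\<forall>\<^sub>F k in sequentially. 1 / infdist (X p \<omega>) C \<le> real k"
          using filterlim_real_sequentially unfolding filterlim_at_top by auto
        then have "\<forall>\<^sub>F k in sequentially. indicator (X p -` C \<inter> space M) \<omega> - g k \<omega> = 0"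
          by eventually_elim (use F pos in \<open>auto simp: g_def field_simps\<close>)
        then show ?thesis by (simp add: tendsto_eventually)
      qed
    qed
  qed measurable
  then show ?thesis
    by (intro approximable_limit) (use vanishes_near app in blast)
qed

text \<open>
  Every function measurable with respect to a process is a limit in probability of cylinder functions.
  The events whose indicators can be approximated form a sigma-algebra which contains the preimages
  of closed sets under the single values of the process; simple functions and their limits follow.
\<close>

theorem approximable_vimage_algebra:
  fixes X :: "'p \<Rightarrow> 'a \<Rightarrow> 'c::metric_space"
  assumes X [measurable]: "\<And>p. p \<in> I \<Longrightarrow> X p \<in> borel_measurable M"
    and Z: "Z \<in> borel_measurable (vimage_algebra (space M) (\<lambda>\<omega>. \<lambda>p\<in>I. X p \<omega>) (\<Pi>\<^sub>M p\<in>I. borel))"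
  shows "approximable M I X Z"
proof -
  let ?F = "vimage_algebra (space M) (\<lambda>\<omega>. \<lambda>p\<in>I. X p \<omega>) (\<Pi>\<^sub>M p\<in>I. borel)"
  have one: "approximable M I X (indicator (X p -` B \<inter> space M)) \<and> X p -` B \<inter> space M \<in> sets M"
    if p: "p \<in> I" and B: "B \<in> sets borel" for p B
  proof -
    have "B \<in> sigma_sets UNIV (Collect closed)"
      using B by (simp add: borel_eq_closed)
    then show ?thesis
    proof induction
      case (Basic C)
      then show ?case using approximable_closed[of X p] p by (auto intro!: measurable_sets[OF X])
    next
      case Empty
      then show ?case using approximable_const[of I X 0] approximable_empty by simp
    next
      case (Compl C)
      have "X p -` (UNIV - C) \<inter> space M = space M - (X p -` C \<inter> space M)" by auto
      then show ?case using Compl by (auto intro!: approximable_compl)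
    next
      case (Union C)
      have *: "X p -` (\<Union>i. C i) \<inter> space M = (\<Union>i. X p -` C i \<inter> space M)" by auto
      show ?case unfolding * using Union by (intro conjI approximable_UNION sets.countable_UN) (auto simp del: restrict_apply)
    qed
  qed
  have ind: "approximable M I X (indicator A) \<and> A \<in> sets M" if AF: "A \<in> sets ?F" for A
  proof -
    have sp: "(\<lambda>\<omega>. \<lambda>p\<in>I. X p \<omega>) \<in> space M \<rightarrow> space (\<Pi>\<^sub>M p\<in>I. borel)"
      by (auto simp: space_PiM)
    obtain B where B: "B \<in> sets (\<Pi>\<^sub>M p\<in>I. borel :: 'c measure)" "A = (\<lambda>\<omega>. \<lambda>p\<in>I. X p \<omega>) -` B \<inter> space M"
      using AF unfolding sets_vimage_algebra2[OF sp] by auto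
    have "B \<in> sigma_sets (\<Pi>\<^sub>E i\<in>I. UNIV) {{f\<in>\<Pi>\<^sub>E i\<in>I. UNIV. f i \<in> A} | i A. i \<in> I \<and> A \<in> sets (borel :: 'c measure)}"
      using B(1) unfolding sets_PiM_single by simp
    then have "approximable M I X (indicator ((\<lambda>\<omega>. \<lambda>p\<in>I. X p \<omega>) -` B \<inter> space M))
       \<and> (\<lambda>\<omega>. \<lambda>p\<in>I. X p \<omega>) -` B \<inter> space M \<in> sets M"
    proof induction
      case (Basic C)
      then obtain i D where D: "i \<in> I" "D \<in> sets borel" "C = {f\<in>\<Pi>\<^sub>E i\<in>I. UNIV. f i \<in> D}" by auto
      have *: "(\<lambda>\<omega>. \<lambda>p\<in>I. X p \<omega>) -` C \<inter> space M = X i -` D \<inter> space M"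
        using D by auto
      show ?case unfolding * using one D by simp
    next
      case Empty
      then show ?case using approximable_const[of I X 0] approximable_empty by simp
    next
      case (Compl C)
      have *: "(\<lambda>\<omega>. \<lambda>p\<in>I. X p \<omega>) -` ((\<Pi>\<^sub>E i\<in>I. UNIV) - C) \<inter> space M
         = space M - ((\<lambda>\<omega>. \<lambda>p\<in>I. X p \<omega>) -` C \<inter> space M)" by auto
      show ?case unfolding * by (intro conjI approximable_compl sets.Diff sets.top) (use Compl in blast)+
    next
      case (Union C)
      have *: "(\<lambda>\<omega>. \<lambda>p\<in>I. X p \<omega>) -` (\<Union>i. C i) \<inter> space M = (\<Union>i. (\<lambda>\<omega>. \<lambda>p\<in>I. X p \<omega>) -` C i \<inter> space M)" by auto
      show ?case unfolding * using Union by (intro conjI approximable_UNION sets.countable_UN) (auto simp del: restrict_apply)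
    qed
    then show ?thesis using B(2) by simp
  qed
  have spF: "space ?F = space M" by simp
  have sub: "sets ?F \<subseteq> sets M" using ind by auto
  have subF: "subalgebra M ?F" using sub by (auto simp: subalgebra_def)
  have simple: "approximable M I X f" if f: "simple_function ?F f" for f :: "'a \<Rightarrow> real"
  proof -
    have fin: "finite (f ` space M)" using simple_functionD(1)[OF f] by simp
    have s: "approximable M I X (\<lambda>\<omega>. \<Sum>y\<in>f ` space M. y * indicator (f -` {y} \<inter> space M) \<omega>)"
      using simple_functionD(2)[OF f] fin ind by (intro approximable_sum) auto
    show ?thesis
    proof (rule approximable_limit)
      fix \<epsilon> :: real assume e: "\<epsilon> > 0"
      have "near M \<epsilon> \<epsilon> (\<lambda>\<omega>. f \<omega> - (\<Sum>y\<in>f ` space M. y * indicator (f -` {y} \<inter> space M) \<omega>))"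
      proof (rule near_mono[OF near_0[of \<epsilon> \<epsilon>]])
        show "AE \<omega> in M. \<bar>f \<omega> - (\<Sum>y\<in>f ` space M. y * indicator (f -` {y} \<inter> space M) \<omega>)\<bar> \<le> \<bar>0\<bar>"
        proof (rule AE_I2)
          fix \<omega> assume w: "\<omega> \<in> space M"
          have "f \<omega> = (\<Sum>y\<in>f ` space M. indicator (f -` {y} \<inter> space M) \<omega> *\<^sub>R y)"
            using simple_function_indicator_representation_banach[OF f, of \<omega>] w unfolding spF by (rule meta_mp)
          also have "\<dots> = (\<Sum>y\<in>f ` space M. y * indicator (f -` {y} \<inter> space M) \<omega>)"
            by (intro sum.cong) auto
          finally show "\<bar>f \<omega> - (\<Sum>y\<in>f ` space M. y * indicator (f -` {y} \<inter> space M) \<omega>)\<bar> \<le> \<bar>0\<bar>"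
            by linarith
        qed
      qed (use e in auto)
      then show "\<exists>Z'. approximable M I X Z' \<and> near M \<epsilon> \<epsilon> (\<lambda>\<omega>. f \<omega> - Z' \<omega>)"
        using s by blast
    qed
  qed
  obtain f where f: "\<And>i. simple_function ?F (f i)" "\<And>\<omega>. \<omega> \<in> space M \<Longrightarrow> (\<lambda>i. f i \<omega>) \<longlonglongrightarrow> Z \<omega>"
    using borel_measurable_implies_sequence_metric[OF Z, of 0] spF by auto
  have m: "f i \<in> borel_measurable M" "Z \<in> borel_measurable M" for i
    using measurable_from_subalg[OF subF] Z borel_measurable_simple_function[OF f(1)] by auto
  have "vanishes M sequentially (\<lambda>i \<omega>. Z \<omega> - f i \<omega>)"
  proof (rule vanishes_AE_lim)
    show "AE \<omega> in M. (\<lambda>i. Z \<omega> - f i \<omega>) \<longlonglongrightarrow> 0"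
    proof (rule AE_I2)
      fix \<omega> assume "\<omega> \<in> space M"
      from tendsto_diff[OF tendsto_const[of "Z \<omega>"] f(2)[OF this]]
      show "(\<lambda>i. Z \<omega> - f i \<omega>) \<longlonglongrightarrow> 0" by simp
    qed
  qed (use m in auto)
  then show ?thesis
    by (intro approximable_limit) (use vanishes_near simple[OF f(1)] in blast)
qed

end

section \<open>Discrete sewing\<close>

text \<open>
  Induction on the length of the interval: an interval of \<open>j - i \<ge> 2\<close> steps is split near its middle,
  so that both parts have at most two thirds of its length, whatever the parity. Since \<open>\<mu> > 1\<close>, the
  sum of the \<open>\<mu>\<close>-th powers of the two lengths is at most \<open>(2/3)\<^bsup>\<mu> - 1\<^esup>\<close> times the \<open>\<mu>\<close>-th power of the whole, and the
  constant is the sum of the resulting geometric series.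
\<close>

lemma discrete_sewing:
  fixes N :: "nat \<Rightarrow> nat \<Rightarrow> ennreal"
  assumes \<mu>: "\<mu> > 1" and C: "C \<ge> 0"
    and step: "\<And>i. i < n \<Longrightarrow> N i (Suc i) = 0"
    and tri: "\<And>i k j. i < k \<Longrightarrow> k < j \<Longrightarrow> j \<le> n \<Longrightarrow> N i j \<le> N i k + N k j + ennreal (C * real (j - i) powr \<mu>)"
    and ij: "i < j" "j \<le> n"
  shows "N i j \<le> ennreal (C / (1 - (2/3) powr (\<mu> - 1)) * real (j - i) powr \<mu>)"
  using ij
proof (induction "j - i" arbitrary: i j rule: less_induct)
  case less
  define \<rho> :: real where "\<rho> = (2/3) powr (\<mu> - 1)"
  define D where "D = C / (1 - \<rho>)"
  have \<rho>: "0 < \<rho>" "\<rho> < 1"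
    unfolding \<rho>_def using \<mu> powr_less_mono2[of "\<mu> - 1" "2/3" 1] by auto
  have D: "D \<ge> 0" "D * \<rho> + C = D" using \<rho> C by (auto simp: D_def field_simps)
  show ?case
  proof (cases "j = Suc i")
    case True
    then show ?thesis using step[of i] less.prems by simp
  next
    case False
    define k where "k = (i + j) div 2"
    have k: "i < k" "k < j" "3 * (k - i) \<le> 2 * (j - i)" "3 * (j - k) \<le> 2 * (j - i)"
      using less.prems False unfolding k_def by auto
    have half: "real a powr \<mu> \<le> \<rho> * real (j - i) powr (\<mu> - 1) * real a"
      if a: "a > 0" "3 * a \<le> 2 * (j - i)" for a
    proof -
      have "real a powr (\<mu> - 1) \<le> (2/3 * real (j - i)) powr (\<mu> - 1)"
        using a \<mu> by (intro powr_mono2) auto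
      also have "\<dots> = \<rho> * real (j - i) powr (\<mu> - 1)"
        unfolding \<rho>_def by (rule powr_mult)
      finally have "real a powr (\<mu> - 1) * real a \<le> \<rho> * real (j - i) powr (\<mu> - 1) * real a"
        by (intro mult_right_mono) auto
      then show ?thesis using a by (simp add: powr_diff)
    qed
    have sum: "real (k - i) powr \<mu> + real (j - k) powr \<mu> \<le> \<rho> * real (j - i) powr \<mu>"
    proof -
      have "real (k - i) powr \<mu> + real (j - k) powr \<mu> \<le> \<rho> * real (j - i) powr (\<mu> - 1) * (real (k - i) + real (j - k))"
        using half[of "k - i"] half[of "j - k"] k by (simp only: distrib_left) (intro add_mono; simp)
      also have "real (k - i) + real (j - k) = real (j - i)" using k by (simp add: of_nat_diff)
      also have "\<rho> * real (j - i) powr (\<mu> - 1) * real (j - i) = \<rho> * real (j - i) powr \<mu>"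
        using k by (simp add: powr_diff)
      finally show ?thesis .
    qed
    have "N i j \<le> N i k + N k j + ennreal (C * real (j - i) powr \<mu>)"
      using tri k less.prems by auto
    also have "\<dots> \<le> ennreal (D * real (k - i) powr \<mu>) + ennreal (D * real (j - k) powr \<mu>) + ennreal (C * real (j - i) powr \<mu>)"
      using less.hyps[of k i] less.hyps[of j k] k less.prems
      by (intro add_mono) (auto simp: D_def \<rho>_def)
    also have "\<dots> = ennreal (D * (real (k - i) powr \<mu> + real (j - k) powr \<mu>) + C * real (j - i) powr \<mu>)"
      using D C by (simp add: ennreal_plus[symmetric] distrib_left del: ennreal_plus)
    also have "\<dots> \<le> ennreal (D * (\<rho> * real (j - i) powr \<mu>) + C * real (j - i) powr \<mu>)"
      using sum D C by (intro ennreal_leI add_mono mult_left_mono) auto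
    also have "D * (\<rho> * real (j - i) powr \<mu>) + C * real (j - i) powr \<mu> = (D * \<rho> + C) * real (j - i) powr \<mu>"
      by (simp add: algebra_simps)
    finally show ?thesis using D by (simp add: D_def \<rho>_def)
  qed
qed

section \<open>The conditional Wiener isometry\<close>

text \<open>
  The covariance of the Brownian increments over \<open>[p, q]\<close> and \<open>[p', q']\<close>; the length of the
  intersection when \<open>p \<le> q\<close> and \<open>p' \<le> q'\<close>.
\<close>

definition cell_overlap :: "real \<Rightarrow> real \<Rightarrow> real \<Rightarrow> real \<Rightarrow> real" where
  "cell_overlap p q p' q' = min q q' - min q p' - min p q' + min p p'"

lemma integral_indicator_min:
  assumes "s \<in> {0..1}" "t \<in> {0..1::real}"
  shows "(\<integral>u. indicator {0<..s} u * indicator {0<..t} u \<partial>lborel) = min s t"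
proof -
  have "(\<lambda>u. indicator {0<..s} u * indicator {0<..t} u) = (indicator {0<..min s t} :: real \<Rightarrow> real)"
    by (auto simp: indicator_def fun_eq_iff)
  then show ?thesis using assms by simp
qed

text \<open>
  The quadratic form of the overlaps is the squared norm in \<open>L\<^sub>2\<close> of the associated step function. The
  integral makes it visibly nonnegative and lets it be estimated by comparing paths.
\<close>

lemma overlap_form_integral:
  fixes z :: "'i \<Rightarrow> real"
  assumes "finite S" "\<And>a. a \<in> S \<Longrightarrow> p a \<in> {0..1} \<and> q a \<in> {0..1}"
  defines "\<phi> \<equiv> \<lambda>u. \<Sum>a\<in>S. z a * (indicator {0<..q a} u - indicator {0<..p a} u)"
  shows "(\<Sum>a\<in>S. \<Sum>b\<in>S. z a * z b * cell_overlap (p a) (q a) (p b) (q b)) = (\<integral>u. (\<phi> u)\<^sup>2 \<partial>lborel)"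
    and "integrable lborel (\<lambda>u. (\<phi> u)\<^sup>2)"
proof -
  let ?I = "\<lambda>a u. indicator {0<..q a} u - indicator {0<..p a} u :: real"
  have int: "integrable lborel (\<lambda>u. indicator {0<..s} u * indicator {0<..t} u :: real)" for s t :: real
  proof -
    have "(\<lambda>u. indicator {0<..s} u * indicator {0<..t} u) = (indicator {0<..min s t} :: real \<Rightarrow> real)"
      by (auto simp: indicator_def fun_eq_iff)
    moreover have "integrable lborel (indicator {0<..min s t} :: real \<Rightarrow> real)"
      using emeasure_bounded_finite[of "{0<..min s t}"] by (intro integrable_real_indicator) auto
    ultimately show ?thesis by simp
  qed
  have exp: "?I a u * ?I b u = indicator {0<..q a} u * indicator {0<..q b} u - indicator {0<..q a} u * indicator {0<..p b} u
      - indicator {0<..p a} u * indicator {0<..q b} u + indicator {0<..p a} u * indicator {0<..p b} u" for a b u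
    by (simp add: algebra_simps)
  have i2: "integrable lborel (\<lambda>u. ?I a u * ?I b u)" for a b
    unfolding exp using int by (intro Bochner_Integration.integrable_add Bochner_Integration.integrable_diff) auto
  have v2: "(\<integral>u. ?I a u * ?I b u \<partial>lborel) = cell_overlap (p a) (q a) (p b) (q b)" if "a \<in> S" "b \<in> S" for a b
    unfolding exp cell_overlap_def using int integral_indicator_min assms(2)[OF that(1)] assms(2)[OF that(2)]
    by (simp add: Bochner_Integration.integrable_diff Bochner_Integration.integrable_add)
  have sq: "(\<phi> u)\<^sup>2 = (\<Sum>a\<in>S. \<Sum>b\<in>S. z a * z b * (?I a u * ?I b u))" for u
    unfolding \<phi>_def power2_eq_square sum_product by (intro sum.cong) (auto simp: algebra_simps)
  show "integrable lborel (\<lambda>u. (\<phi> u)\<^sup>2)"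
    unfolding sq using i2 by (intro Bochner_Integration.integrable_sum integrable_mult_right) auto
  show "(\<Sum>a\<in>S. \<Sum>b\<in>S. z a * z b * cell_overlap (p a) (q a) (p b) (q b)) = (\<integral>u. (\<phi> u)\<^sup>2 \<partial>lborel)"
    unfolding sq using i2 v2 by simp
qed

locale indep_brownian = prob_space M for M :: "'a measure" +
  fixes F :: "'a measure" and W :: "real \<Rightarrow> 'a \<Rightarrow> real^'w"
  assumes subalgF: "subalgebra M F"
    and BM: "standard_Brownian_motion M W"
    and indep: "indep_set (sets F) (sets (sigma_process M W))"
begin

sublocale finite_measure_subalgebra M F
  by unfold_locales (rule subalgF)

lemma space_F: "space F = space M"
  using subalgF by (auto simp: subalgebra_def)

lemma F_events: "A \<in> sets F \<Longrightarrow> A \<in> sets M"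
  using subalgF by (auto simp: subalgebra_def)

lemma measurable_F: "f \<in> borel_measurable F \<Longrightarrow> f \<in> borel_measurable M"
  using measurable_from_subalg[OF subalgF] by auto

lemma W_measurable: "t \<in> {0..1} \<Longrightarrow> W t \<in> borel_measurable M"
  using BM unfolding standard_Brownian_motion_def by auto

lemma W_measurable_proc:
  assumes "t \<in> {0..1}"
  shows "W t \<in> borel_measurable (sigma_process M W)"
proof -
  have "(\<lambda>\<omega>. \<lambda>t\<in>{0..1}. W t \<omega>) \<in> measurable (sigma_process M W) (\<Pi>\<^sub>M t\<in>{0..1}. borel)"
    unfolding sigma_process_def by (rule measurable_vimage_algebra1) (auto simp: space_PiM)
  from measurable_compose[OF this measurable_component_singleton[OF assms]]
  show ?thesis using assms by simp
qed

lemma indep_product: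
  fixes Z V :: "'a \<Rightarrow> real"
  assumes Z: "Z \<in> borel_measurable F" "integrable M Z"
    and V: "V \<in> borel_measurable (sigma_process M W)" "integrable M V"
  shows "integrable M (\<lambda>\<omega>. Z \<omega> * V \<omega>)" "(\<integral>\<omega>. Z \<omega> * V \<omega> \<partial>M) = (\<integral>\<omega>. Z \<omega> \<partial>M) * (\<integral>\<omega>. V \<omega> \<partial>M)"
proof -
  have sp: "space (sigma_process M W) = space M" by (simp add: sigma_process_def)
  have 1: "sigma_sets (space M) {Z -` A \<inter> space M |A. A \<in> sets borel} \<subseteq> sets F"
    using sets.sigma_sets_subset[of "{Z -` A \<inter> space M |A. A \<in> sets borel}" F] measurable_sets[OF Z(1)] space_F by auto
  have 2: "sigma_sets (space M) {V -` A \<inter> space M |A. A \<in> sets borel} \<subseteq> sets (sigma_process M W)"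
    using sets.sigma_sets_subset[of "{V -` A \<inter> space M |A. A \<in> sets borel}" "sigma_process M W"] measurable_sets[OF V(1)] sp by auto
  have "indep_set (sigma_sets (space M) {Z -` A \<inter> space M |A. A \<in> sets borel})
     (sigma_sets (space M) {V -` A \<inter> space M |A. A \<in> sets borel})"
    using indep 1 2 unfolding indep_sets2_eq by (meson subset_iff)
  then have iv: "indep_var borel Z borel V"
    unfolding indep_var_eq using Z(2) V(2) by auto
  show "integrable M (\<lambda>\<omega>. Z \<omega> * V \<omega>)" "(\<integral>\<omega>. Z \<omega> * V \<omega> \<partial>M) = (\<integral>\<omega>. Z \<omega> \<partial>M) * (\<integral>\<omega>. V \<omega> \<partial>M)"
    using indep_var_integrable[OF iv Z(2) V(2)] indep_var_lebesgue_integral[OF iv Z(2) V(2)] by auto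
qed

lemma increment_moments:
  fixes \<kappa> :: 'w
  assumes st: "0 \<le> s" "s < t" "t \<le> 1"
  defines "V \<equiv> \<lambda>\<omega>. (W t \<omega> - W s \<omega>) $ \<kappa>"
  shows "integrable M V" "(\<integral>\<omega>. V \<omega> \<partial>M) = 0" "integrable M (\<lambda>\<omega>. (V \<omega>)\<^sup>2)" "(\<integral>\<omega>. (V \<omega>)\<^sup>2 \<partial>M) = t - s"
proof -
  have D: "distributed M lborel V (\<lambda>z. ennreal (normal_density 0 (sqrt (t - s)) z))"
    unfolding V_def using BM st unfolding standard_Brownian_motion_def by blast
  have pos: "sqrt (t - s) > 0" using st by simp
  have 1: "integrable lborel (\<lambda>z. normal_density 0 (sqrt (t - s)) z * z ^ k)" for k
    using integrable_normal_moment[OF pos, of 0 k] by simp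
  show "integrable M V"
    using distributed_integrable[OF D, of "\<lambda>z. z"] 1[of 1] by simp
  show "(\<integral>\<omega>. V \<omega> \<partial>M) = 0"
    by (rule normal_distributed_expectation[OF pos D])
  show "integrable M (\<lambda>\<omega>. (V \<omega>)\<^sup>2)"
    using distributed_integrable[OF D, of "\<lambda>z. z\<^sup>2"] 1[of 2] by simp
  have "(\<integral>\<omega>. (V \<omega>)\<^sup>2 \<partial>M) = (\<integral>z. normal_density 0 (sqrt (t - s)) z * z\<^sup>2 \<partial>lborel)"
    using distributed_integral[OF D, of "\<lambda>z. z\<^sup>2"] by simp
  also have "\<dots> = t - s"
    using integral_normal_moment_even[OF pos, of 0 1] st by simp
  finally show "(\<integral>\<omega>. (V \<omega>)\<^sup>2 \<partial>M) = t - s" .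
qed

lemma W0: "AE \<omega> in M. W 0 \<omega> = 0"
  using BM unfolding standard_Brownian_motion_def by auto

lemma W_covariance:
  assumes "s \<in> {0..1}" "t \<in> {0..1}"
  shows "integrable M (\<lambda>\<omega>. W s \<omega> $ \<kappa> * W t \<omega> $ \<kappa>) \<and> (\<integral>\<omega>. W s \<omega> $ \<kappa> * W t \<omega> $ \<kappa> \<partial>M) = min s t"
proof -
  have meas: "(\<lambda>\<omega>. W r \<omega> $ \<kappa>) \<in> borel_measurable M" if "r \<in> {0..1}" for r
    using W_measurable[OF that] by (rule measurable_compose) auto
  have single: "integrable M (\<lambda>\<omega>. W t \<omega> $ \<kappa> * W t \<omega> $ \<kappa>) \<and> (\<integral>\<omega>. W t \<omega> $ \<kappa> * W t \<omega> $ \<kappa> \<partial>M) = t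
      \<and> integrable M (\<lambda>\<omega>. W t \<omega> $ \<kappa>)" if t: "t \<in> {0<..1}" for t
  proof -
    have eq: "AE \<omega> in M. (W t \<omega> - W 0 \<omega>) $ \<kappa> = W t \<omega> $ \<kappa>"
      "AE \<omega> in M. ((W t \<omega> - W 0 \<omega>) $ \<kappa>)\<^sup>2 = W t \<omega> $ \<kappa> * W t \<omega> $ \<kappa>"
      using W0 by (auto simp: power2_eq_square elim!: eventually_mono)
    have [measurable]: "(\<lambda>\<omega>. W t \<omega> $ \<kappa>) \<in> borel_measurable M" "(\<lambda>\<omega>. W 0 \<omega> $ \<kappa>) \<in> borel_measurable M"
      using meas t by auto
    have "integrable M (\<lambda>\<omega>. (W t \<omega> - W 0 \<omega>) $ \<kappa>) \<longleftrightarrow> integrable M (\<lambda>\<omega>. W t \<omega> $ \<kappa>)"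
      by (rule integrable_cong_AE[OF _ _ eq(1)]) (auto simp: vector_minus_component)
    moreover have "integrable M (\<lambda>\<omega>. ((W t \<omega> - W 0 \<omega>) $ \<kappa>)\<^sup>2) \<longleftrightarrow> integrable M (\<lambda>\<omega>. W t \<omega> $ \<kappa> * W t \<omega> $ \<kappa>)"
      by (rule integrable_cong_AE[OF _ _ eq(2)]) (auto simp: vector_minus_component)
    moreover have "(\<integral>\<omega>. ((W t \<omega> - W 0 \<omega>) $ \<kappa>)\<^sup>2 \<partial>M) = (\<integral>\<omega>. W t \<omega> $ \<kappa> * W t \<omega> $ \<kappa> \<partial>M)"
      by (rule integral_cong_AE[OF _ _ eq(2)]) (auto simp: vector_minus_component)
    ultimately show ?thesis
      using increment_moments[of 0 t \<kappa>] t by simp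
  qed
  have ord: "integrable M (\<lambda>\<omega>. W s \<omega> $ \<kappa> * W t \<omega> $ \<kappa>) \<and> (\<integral>\<omega>. W s \<omega> $ \<kappa> * W t \<omega> $ \<kappa> \<partial>M) = s"
    if st: "0 \<le> s" "s \<le> t" "t \<le> 1" for s t
  proof -
    consider "s = 0" | "0 < s" "s = t" | "0 < s" "s < t" using st by linarith
    then show ?thesis
    proof cases
      case 1
      have ae: "AE \<omega> in M. W s \<omega> $ \<kappa> * W t \<omega> $ \<kappa> = 0" using W0 1 by (auto elim!: eventually_mono)
      have [measurable]: "(\<lambda>\<omega>. W t \<omega> $ \<kappa>) \<in> borel_measurable M" "(\<lambda>\<omega>. W s \<omega> $ \<kappa>) \<in> borel_measurable M"
        using meas st by auto
      have "integrable M (\<lambda>\<omega>. W s \<omega> $ \<kappa> * W t \<omega> $ \<kappa>)"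
        by (subst integrable_cong_AE[OF _ _ ae]) auto
      then show ?thesis using integral_eq_zero_AE[OF ae] 1 by simp
    next
      case 2
      then show ?thesis using single[of t] st by simp
    next
      case 3
      define \<tau> where "\<tau> k = (if k = 0 then 0 else if k = 1 then s else t)" for k :: nat
      define V where "V = (\<lambda>(k, i) \<omega>. (W (\<tau> (Suc k)) \<omega> - W (\<tau> k) \<omega>) $ i)"
      have "0 \<le> \<tau> 0 \<and> \<tau> 2 \<le> 1 \<and> (\<forall>k<2. \<tau> k < \<tau> (Suc k))"
        using 3 st by (auto simp: \<tau>_def less_Suc_eq numeral_2_eq_2)
      then have "indep_vars (\<lambda>_. borel) V ({..<2} \<times> UNIV)"
        unfolding V_def using BM unfolding standard_Brownian_motion_def by blast
      then have iv: "indep_vars (\<lambda>_. borel) V {(0, \<kappa>), (Suc 0, \<kappa>)}"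
        by (rule indep_vars_subset) auto
      have V: "V (0, \<kappa>) = (\<lambda>\<omega>. (W s \<omega> - W 0 \<omega>) $ \<kappa>)" "V (Suc 0, \<kappa>) = (\<lambda>\<omega>. (W t \<omega> - W s \<omega>) $ \<kappa>)"
        by (auto simp: V_def \<tau>_def)
      have int: "integrable M (V i)" if "i \<in> {(0, \<kappa>), (Suc 0, \<kappa>)}" for i
        using that increment_moments(1)[of 0 s \<kappa>] increment_moments(1)[of s t \<kappa>] 3 st V by auto
      have p: "integrable M (\<lambda>\<omega>. (W s \<omega> - W 0 \<omega>) $ \<kappa> * (W t \<omega> - W s \<omega>) $ \<kappa>)"
        "(\<integral>\<omega>. (W s \<omega> - W 0 \<omega>) $ \<kappa> * (W t \<omega> - W s \<omega>) $ \<kappa> \<partial>M) = 0"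
        using indep_vars_integrable[OF _ iv int] indep_vars_lebesgue_integral[OF _ iv int]
          increment_moments(2)[of 0 s \<kappa>] 3 st by (simp_all add: V)
      have [measurable]: "(\<lambda>\<omega>. W t \<omega> $ \<kappa>) \<in> borel_measurable M" "(\<lambda>\<omega>. W s \<omega> $ \<kappa>) \<in> borel_measurable M"
          "(\<lambda>\<omega>. W 0 \<omega> $ \<kappa>) \<in> borel_measurable M"
        using meas st by auto
      have ae: "AE \<omega> in M. W s \<omega> $ \<kappa> * W t \<omega> $ \<kappa>
          = (W s \<omega> - W 0 \<omega>) $ \<kappa> * (W t \<omega> - W s \<omega>) $ \<kappa> + W s \<omega> $ \<kappa> * W s \<omega> $ \<kappa>"
        using W0 by (auto elim!: eventually_mono simp: algebra_simps)
      have "integrable M (\<lambda>\<omega>. (W s \<omega> - W 0 \<omega>) $ \<kappa> * (W t \<omega> - W s \<omega>) $ \<kappa> + W s \<omega> $ \<kappa> * W s \<omega> $ \<kappa>)"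
        using p single[of s] 3 st by (intro Bochner_Integration.integrable_add) auto
      moreover have "(\<integral>\<omega>. (W s \<omega> - W 0 \<omega>) $ \<kappa> * (W t \<omega> - W s \<omega>) $ \<kappa> + W s \<omega> $ \<kappa> * W s \<omega> $ \<kappa> \<partial>M) = 0 + s"
        using p single[of s] 3 st by (subst Bochner_Integration.integral_add) auto
      moreover have "integrable M (\<lambda>\<omega>. W s \<omega> $ \<kappa> * W t \<omega> $ \<kappa>) \<longleftrightarrow>
          integrable M (\<lambda>\<omega>. (W s \<omega> - W 0 \<omega>) $ \<kappa> * (W t \<omega> - W s \<omega>) $ \<kappa> + W s \<omega> $ \<kappa> * W s \<omega> $ \<kappa>)"
        by (rule integrable_cong_AE[OF _ _ ae]) (auto simp: vector_minus_component)
      moreover have "(\<integral>\<omega>. W s \<omega> $ \<kappa> * W t \<omega> $ \<kappa> \<partial>M) =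
          (\<integral>\<omega>. (W s \<omega> - W 0 \<omega>) $ \<kappa> * (W t \<omega> - W s \<omega>) $ \<kappa> + W s \<omega> $ \<kappa> * W s \<omega> $ \<kappa> \<partial>M)"
        by (rule integral_cong_AE[OF _ _ ae]) (auto simp: vector_minus_component)
      ultimately show ?thesis by simp
    qed
  qed
  show ?thesis
  proof (cases "s \<le> t")
    case True
    then show ?thesis using ord[of s t] assms by auto
  next
    case False
    then show ?thesis using ord[of t s] assms by (auto simp: mult.commute)
  qed
qed

lemma increment_covariance:
  assumes "p \<in> {0..1}" "q \<in> {0..1}" "p' \<in> {0..1}" "q' \<in> {0..1}"
  shows "integrable M (\<lambda>\<omega>. (W q \<omega> $ \<kappa> - W p \<omega> $ \<kappa>) * (W q' \<omega> $ \<kappa> - W p' \<omega> $ \<kappa>))"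
    "(\<integral>\<omega>. (W q \<omega> $ \<kappa> - W p \<omega> $ \<kappa>) * (W q' \<omega> $ \<kappa> - W p' \<omega> $ \<kappa>) \<partial>M) = cell_overlap p q p' q'"
proof -
  have exp: "(W q \<omega> $ \<kappa> - W p \<omega> $ \<kappa>) * (W q' \<omega> $ \<kappa> - W p' \<omega> $ \<kappa>)
     = W q \<omega> $ \<kappa> * W q' \<omega> $ \<kappa> - W q \<omega> $ \<kappa> * W p' \<omega> $ \<kappa> - W p \<omega> $ \<kappa> * W q' \<omega> $ \<kappa> + W p \<omega> $ \<kappa> * W p' \<omega> $ \<kappa>" for \<omega>
    by (simp add: algebra_simps)
  show "integrable M (\<lambda>\<omega>. (W q \<omega> $ \<kappa> - W p \<omega> $ \<kappa>) * (W q' \<omega> $ \<kappa> - W p' \<omega> $ \<kappa>))"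
    "(\<integral>\<omega>. (W q \<omega> $ \<kappa> - W p \<omega> $ \<kappa>) * (W q' \<omega> $ \<kappa> - W p' \<omega> $ \<kappa>) \<partial>M) = cell_overlap p q p' q'"
    unfolding exp cell_overlap_def using W_covariance assms
    by (simp_all add: Bochner_Integration.integrable_diff Bochner_Integration.integrable_add)
qed

text \<open>
  The Wiener isometry conditionally on \<open>F\<close>, tested on events of \<open>F\<close>: a product of two weights is
  independent of the product of the two increments. The weights need not be square integrable, so the
  identity is proved on the events where they are bounded by \<open>k\<close>, which also belong to \<open>F\<close>, and
  passes to the limit by monotone convergence; both sides may be infinite.
\<close>

theorem conditional_isometry:
  assumes S: "finite S" and pq: "\<And>a. a \<in> S \<Longrightarrow> p a \<in> {0..1} \<and> q a \<in> {0..1}"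
    and Z: "\<And>a. a \<in> S \<Longrightarrow> Z a \<in> borel_measurable F" and A: "A \<in> sets F"
  shows "(\<integral>\<^sup>+\<omega>\<in>A. ennreal ((\<Sum>a\<in>S. Z a \<omega> * (W (q a) \<omega> $ \<kappa> - W (p a) \<omega> $ \<kappa>))\<^sup>2) \<partial>M)
    = (\<integral>\<^sup>+\<omega>\<in>A. ennreal (\<Sum>a\<in>S. \<Sum>b\<in>S. Z a \<omega> * Z b \<omega> * cell_overlap (p a) (q a) (p b) (q b)) \<partial>M)"
proof -
  define f where "f \<omega> = (\<Sum>a\<in>S. Z a \<omega> * (W (q a) \<omega> $ \<kappa> - W (p a) \<omega> $ \<kappa>))\<^sup>2" for \<omega>
  define g where "g \<omega> = (\<Sum>a\<in>S. \<Sum>b\<in>S. Z a \<omega> * Z b \<omega> * cell_overlap (p a) (q a) (p b) (q b))" for \<omega>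
  \<comment> \<open>truncating by events of \<open>F\<close> keeps the weights independent of \<open>W\<close>\<close>
  define B where "B k = A \<inter> {\<omega>\<in>space M. \<forall>a\<in>S. \<bar>Z a \<omega>\<bar> \<le> real k}" for k :: nat
  have ZM: "Z a \<in> borel_measurable M" if "a \<in> S" for a using Z[OF that] measurable_F by auto
  have Wk: "(\<lambda>\<omega>. W t \<omega> $ \<kappa>) \<in> borel_measurable M" if "t \<in> {0..1}" for t
    using W_measurable[OF that] by (rule measurable_compose) auto
  have [measurable]: "f \<in> borel_measurable M"
    unfolding f_def using ZM Wk pq by (intro borel_measurable_power borel_measurable_sum borel_measurable_times borel_measurable_diff) auto
  have [measurable]: "g \<in> borel_measurable M"
    unfolding g_def using ZM by (intro borel_measurable_sum borel_measurable_times) auto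
  have BF: "B k \<in> sets F" for k
  proof -
    have "{\<omega>\<in>space F. \<forall>a\<in>S. \<bar>Z a \<omega>\<bar> \<le> real k} \<in> sets F"
      using S Z by (intro sets.sets_Collect_finite_All borel_measurable_le) auto
    then show ?thesis unfolding B_def using A space_F by auto
  qed
  then have [measurable]: "B k \<in> sets M" for k using F_events by auto
  have bounded: "(\<integral>\<^sup>+\<omega>\<in>B k. ennreal (f \<omega>) \<partial>M) = (\<integral>\<^sup>+\<omega>\<in>B k. ennreal (g \<omega>) \<partial>M)" for k
  proof -
    define \<zeta> where "\<zeta> a \<omega> = Z a \<omega> * indicator (B k) \<omega>" for a \<omega>
    have \<zeta>F: "\<zeta> a \<in> borel_measurable F" if "a \<in> S" for a
      unfolding \<zeta>_def using Z[OF that] BF by auto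
    have \<zeta>b: "\<bar>\<zeta> a \<omega>\<bar> \<le> real k" if "a \<in> S" for a \<omega>
      unfolding \<zeta>_def B_def using that by (auto simp: indicator_def)
    let ?D = "\<lambda>a \<omega>. W (q a) \<omega> $ \<kappa> - W (p a) \<omega> $ \<kappa>"
    have pair: "integrable M (\<lambda>\<omega>. \<zeta> a \<omega> * \<zeta> b \<omega> * (?D a \<omega> * ?D b \<omega>))"
      "(\<integral>\<omega>. \<zeta> a \<omega> * \<zeta> b \<omega> * (?D a \<omega> * ?D b \<omega>) \<partial>M) = (\<integral>\<omega>. \<zeta> a \<omega> * \<zeta> b \<omega> \<partial>M) * cell_overlap (p a) (q a) (p b) (q b)"
      "integrable M (\<lambda>\<omega>. \<zeta> a \<omega> * \<zeta> b \<omega>)"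
      if ab: "a \<in> S" "b \<in> S" for a b
    proof -
      have m: "(\<lambda>\<omega>. \<zeta> a \<omega> * \<zeta> b \<omega>) \<in> borel_measurable F"
        using \<zeta>F ab by auto
      show i: "integrable M (\<lambda>\<omega>. \<zeta> a \<omega> * \<zeta> b \<omega>)"
      proof (rule integrable_const_bound[where B="real k * real k"])
        show "AE \<omega> in M. norm (\<zeta> a \<omega> * \<zeta> b \<omega>) \<le> real k * real k"
          using \<zeta>b ab by (auto simp: abs_mult intro!: mult_mono)
      qed (use measurable_F[OF m] in auto)
      have m2: "(\<lambda>\<omega>. ?D a \<omega> * ?D b \<omega>) \<in> borel_measurable (sigma_process M W)"
        using W_measurable_proc pq ab
        by (intro borel_measurable_times borel_measurable_diff measurable_compose[OF W_measurable_proc]) auto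
      have i2: "integrable M (\<lambda>\<omega>. ?D a \<omega> * ?D b \<omega>)" "(\<integral>\<omega>. ?D a \<omega> * ?D b \<omega> \<partial>M) = cell_overlap (p a) (q a) (p b) (q b)"
        using increment_covariance[of "p a" "q a" "p b" "q b" \<kappa>] pq[OF ab(1)] pq[OF ab(2)] by auto
      show "integrable M (\<lambda>\<omega>. \<zeta> a \<omega> * \<zeta> b \<omega> * (?D a \<omega> * ?D b \<omega>))"
        "(\<integral>\<omega>. \<zeta> a \<omega> * \<zeta> b \<omega> * (?D a \<omega> * ?D b \<omega>) \<partial>M) = (\<integral>\<omega>. \<zeta> a \<omega> * \<zeta> b \<omega> \<partial>M) * cell_overlap (p a) (q a) (p b) (q b)"
        using indep_product[OF m i m2 i2(1)] i2(2) by auto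
    qed
    have f\<zeta>: "f \<omega> * indicator (B k) \<omega> = (\<Sum>a\<in>S. \<Sum>b\<in>S. \<zeta> a \<omega> * \<zeta> b \<omega> * (?D a \<omega> * ?D b \<omega>))" for \<omega>
      unfolding f_def power2_eq_square sum_product \<zeta>_def
      by (auto simp: indicator_def sum_distrib_right algebra_simps intro!: sum.cong)
    have g\<zeta>: "g \<omega> * indicator (B k) \<omega> = (\<Sum>a\<in>S. \<Sum>b\<in>S. \<zeta> a \<omega> * \<zeta> b \<omega> * cell_overlap (p a) (q a) (p b) (q b))" for \<omega>
      unfolding g_def \<zeta>_def by (auto simp: indicator_def)
    have g0: "0 \<le> g \<omega>" for \<omega>
      unfolding g_def 
      by (subst overlap_form_integral(1)[OF S pq]) auto
    have fi: "integrable M (\<lambda>\<omega>. f \<omega> * indicator (B k) \<omega>)"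
      unfolding f\<zeta> using pair by (intro Bochner_Integration.integrable_sum) auto
    have gi: "integrable M (\<lambda>\<omega>. g \<omega> * indicator (B k) \<omega>)"
      unfolding g\<zeta> using pair by (intro Bochner_Integration.integrable_sum integrable_mult_left) auto
    have eq: "(\<integral>\<omega>. f \<omega> * indicator (B k) \<omega> \<partial>M) = (\<integral>\<omega>. g \<omega> * indicator (B k) \<omega> \<partial>M)"
      unfolding f\<zeta> g\<zeta> using pair by simp
    have "(\<integral>\<^sup>+\<omega>\<in>B k. ennreal (f \<omega>) \<partial>M) = (\<integral>\<^sup>+\<omega>. ennreal (f \<omega> * indicator (B k) \<omega>) \<partial>M)"
      by (intro nn_integral_cong) (auto simp: indicator_def)
    also have "\<dots> = ennreal (\<integral>\<omega>. f \<omega> * indicator (B k) \<omega> \<partial>M)"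
      by (rule nn_integral_eq_integral[OF fi]) (auto simp: f_def)
    also have "\<dots> = (\<integral>\<^sup>+\<omega>. ennreal (g \<omega> * indicator (B k) \<omega>) \<partial>M)"
      unfolding eq by (rule nn_integral_eq_integral[OF gi, symmetric]) (auto simp: g0)
    also have "\<dots> = (\<integral>\<^sup>+\<omega>\<in>B k. ennreal (g \<omega>) \<partial>M)"
      by (intro nn_integral_cong) (auto simp: indicator_def)
    finally show ?thesis .
  qed
  have inc: "incseq B"
    unfolding B_def incseq_def by fastforce
  have un: "(\<Union>k. B k) = A"
  proof -
    have "\<exists>k::nat. \<forall>a\<in>S. \<bar>Z a \<omega>\<bar> \<le> real k" for \<omega>
    proof -
      obtain k :: nat where k: "Max (insert 0 ((\<lambda>a. \<bar>Z a \<omega>\<bar>) ` S)) \<le> real k" using real_arch_simple by blast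
      have "\<bar>Z a \<omega>\<bar> \<le> real k" if "a \<in> S" for a
        using S that by (intro order_trans[OF Max_ge k]) auto
      then show ?thesis by auto
    qed
    then show ?thesis unfolding B_def using F_events[OF A] sets.sets_into_space by fastforce
  qed
  have lim: "(\<integral>\<^sup>+\<omega>\<in>A. u \<omega> \<partial>M) = (SUP k. (\<integral>\<^sup>+\<omega>\<in>B k. u \<omega> \<partial>M))"
    if [measurable]: "u \<in> borel_measurable M" for u :: "'a \<Rightarrow> ennreal"
  proof -
    have "(SUP k. emeasure (density M u) (B k)) = emeasure (density M u) (\<Union>k. B k)"
      by (rule SUP_emeasure_incseq) (use inc in auto)
    then show ?thesis using un F_events[OF A] by (simp add: emeasure_density)
  qed
  have "(\<integral>\<^sup>+\<omega>\<in>A. ennreal (f \<omega>) \<partial>M) = (\<integral>\<^sup>+\<omega>\<in>A. ennreal (g \<omega>) \<partial>M)"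
    using lim[of "\<lambda>\<omega>. ennreal (f \<omega>)"] lim[of "\<lambda>\<omega>. ennreal (g \<omega>)"] bounded by simp
  then show ?thesis unfolding f_def g_def .
qed

end

lemma cell_overlap_self: "p \<le> q \<Longrightarrow> cell_overlap p q p q = q - p"
  by (simp add: cell_overlap_def)

lemma cell_overlap_disjoint:
  assumes "p \<le> q" "p' \<le> q'" "q \<le> p' \<or> q' \<le> p"
  shows "cell_overlap p q p' q' = 0"
  using assms unfolding cell_overlap_def by (auto simp: min_def)

lemma disjoint_cells_form:
  fixes z :: "'i \<Rightarrow> real"
  assumes S: "finite S" and le: "\<And>a. a \<in> S \<Longrightarrow> p a \<le> q a"
    and dj: "\<And>a b. a \<in> S \<Longrightarrow> b \<in> S \<Longrightarrow> a \<noteq> b \<Longrightarrow> q a \<le> p b \<or> q b \<le> p a"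
  shows "(\<Sum>a\<in>S. \<Sum>b\<in>S. z a * z b * cell_overlap (p a) (q a) (p b) (q b)) = (\<Sum>a\<in>S. (z a)\<^sup>2 * (q a - p a))"
proof (rule sum.cong)
  fix a assume a: "a \<in> S"
  have "(\<Sum>b\<in>S. z a * z b * cell_overlap (p a) (q a) (p b) (q b)) = (\<Sum>b\<in>S. if b = a then (z a)\<^sup>2 * (q a - p a) else 0)"
  proof (rule sum.cong)
    fix b assume b: "b \<in> S"
    show "z a * z b * cell_overlap (p a) (q a) (p b) (q b) = (if b = a then (z a)\<^sup>2 * (q a - p a) else 0)"
    proof (cases "b = a")
      case True
      then show ?thesis using cell_overlap_self[OF le[OF a]] by (simp add: power2_eq_square)
    next
      case False
      then show ?thesis using cell_overlap_disjoint[OF le[OF a] le[OF b]] dj[OF a b] by auto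
    qed
  qed auto
  also have "\<dots> = (z a)\<^sup>2 * (q a - p a)"
    using S a by simp
  finally show "(\<Sum>b\<in>S. z a * z b * cell_overlap (p a) (q a) (p b) (q b)) = (z a)\<^sup>2 * (q a - p a)" .
qed auto

section \<open>Conditional Wiener integrals of continuous weights\<close>

definition partition_of :: "real \<Rightarrow> real \<Rightarrow> nat \<Rightarrow> (nat \<Rightarrow> real) \<Rightarrow> bool" where
  "partition_of s t N \<pi> \<longleftrightarrow> \<pi> 0 = s \<and> \<pi> N = t \<and> (\<forall>j<N. \<pi> j \<le> \<pi> (Suc j))"

lemma partition_of_mono:
  assumes "partition_of s t N \<pi>" "i \<le> j" "j \<le> N"
  shows "\<pi> i \<le> \<pi> j"
  using assms(2,3)
proof (induction j)
  case 0
  then show ?case by simp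
next
  case (Suc j)
  then show ?case using assms(1) unfolding partition_of_def
    by (metis Suc_le_eq le_Suc_eq order.refl order.trans le_SucI Suc_leD)
qed

lemma partition_of_bounds:
  assumes "partition_of s t N \<pi>" "j \<le> N"
  shows "s \<le> \<pi> j" "\<pi> j \<le> t"
  using partition_of_mono[OF assms(1), of 0 j] partition_of_mono[OF assms(1), of j N] assms
  unfolding partition_of_def by auto

definition step_path :: "nat \<Rightarrow> (nat \<Rightarrow> real) \<Rightarrow> (real \<Rightarrow> real) \<Rightarrow> real \<Rightarrow> real" where
  "step_path N \<pi> \<zeta> u = (\<Sum>j<N. \<zeta> (\<pi> j) * (indicator {0<..\<pi> (Suc j)} u - indicator {0<..\<pi> j} u))"

text \<open>
  Left-point step functions of a path are uniformly close to it when the mesh is below the scale at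
  which the path oscillates by at most \<open>e\<close>.
\<close>

lemma step_path_close:
  assumes P: "partition_of s t N \<pi>" and st: "0 \<le> s" "t \<le> 1"
    and mesh: "\<And>j. j < N \<Longrightarrow> \<pi> (Suc j) - \<pi> j < \<delta>"
    and osc: "\<And>u v. u \<in> {0..1} \<Longrightarrow> v \<in> {0..1} \<Longrightarrow> \<bar>u - v\<bar> < \<delta> \<Longrightarrow> \<bar>\<zeta> u - \<zeta> v\<bar> \<le> e"
  shows "\<bar>step_path N \<pi> \<zeta> u - \<zeta> u * (indicator {0<..t} u - indicator {0<..s} u)\<bar>
     \<le> e * (indicator {0<..t} u - indicator {0<..s} u)"
proof -
  let ?c = "\<lambda>j. indicator {0<..\<pi> (Suc j)} u - indicator {0<..\<pi> j} u :: real"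
  have tel: "(\<Sum>j<N. ?c j) = indicator {0<..t} u - indicator {0<..s} u"
    using P unfolding partition_of_def by (subst sum_lessThan_telescope) auto
  have cell: "\<bar>(\<zeta> (\<pi> j) - \<zeta> u) * ?c j\<bar> \<le> e * ?c j" if j: "j < N" for j
  proof -
    have mono: "\<pi> j \<le> \<pi> (Suc j)" using P j unfolding partition_of_def by auto
    have b: "0 \<le> \<pi> j" "\<pi> (Suc j) \<le> 1"
      using partition_of_bounds(1)[OF P, of j] partition_of_bounds(2)[OF P, of "Suc j"] j st by auto
    show ?thesis
    proof (cases "u \<in> {\<pi> j<..\<pi> (Suc j)}")
      case True
      then have "?c j = 1" using b by (auto simp: indicator_def)
      moreover have "\<bar>\<zeta> (\<pi> j) - \<zeta> u\<bar> \<le> e"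
        using True b mesh[OF j] by (intro osc) auto
      ultimately show ?thesis by simp
    next
      case False
      then have "?c j = 0" using mono b by (auto simp: indicator_def)
      then show ?thesis by simp
    qed
  qed
  have "step_path N \<pi> \<zeta> u - \<zeta> u * (indicator {0<..t} u - indicator {0<..s} u) = (\<Sum>j<N. (\<zeta> (\<pi> j) - \<zeta> u) * ?c j)"
    unfolding step_path_def tel[symmetric] sum_distrib_left sum_subtractf[symmetric] by (simp add: left_diff_distrib)
  also have "\<bar>\<dots>\<bar> \<le> (\<Sum>j<N. e * ?c j)"
    by (rule order_trans[OF sum_abs]) (rule sum_mono, use cell in auto)
  also have "\<dots> = e * (indicator {0<..t} u - indicator {0<..s} u)"
    unfolding tel[symmetric] sum_distrib_left ..
  finally show ?thesis .
qed

text \<open>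
  The difference of the Wiener sums along two partitions is a single sum over the disjoint union of
  the cells of both, the second family entering with the opposite sign. The quadratic form of this
  family is the conditional second moment of the difference.
\<close>

definition pair_weight :: "(nat \<Rightarrow> real) \<Rightarrow> (nat \<Rightarrow> real) \<Rightarrow> (real \<Rightarrow> real) \<Rightarrow> nat + nat \<Rightarrow> real" where
  "pair_weight \<pi> \<pi>' \<zeta> a = (case a of Inl j \<Rightarrow> \<zeta> (\<pi> j) | Inr j \<Rightarrow> - \<zeta> (\<pi>' j))"

definition pair_left :: "(nat \<Rightarrow> real) \<Rightarrow> (nat \<Rightarrow> real) \<Rightarrow> nat + nat \<Rightarrow> real" where
  "pair_left \<pi> \<pi>' a = (case a of Inl j \<Rightarrow> \<pi> j | Inr j \<Rightarrow> \<pi>' j)"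

definition pair_right :: "(nat \<Rightarrow> real) \<Rightarrow> (nat \<Rightarrow> real) \<Rightarrow> nat + nat \<Rightarrow> real" where
  "pair_right \<pi> \<pi>' a = (case a of Inl j \<Rightarrow> \<pi> (Suc j) | Inr j \<Rightarrow> \<pi>' (Suc j))"

definition pair_form :: "nat \<Rightarrow> (nat \<Rightarrow> real) \<Rightarrow> nat \<Rightarrow> (nat \<Rightarrow> real) \<Rightarrow> (real \<Rightarrow> real) \<Rightarrow> real" where
  "pair_form N \<pi> N' \<pi>' \<zeta> = (\<Sum>a\<in>{..<N} <+> {..<N'}. \<Sum>b\<in>{..<N} <+> {..<N'}.
      pair_weight \<pi> \<pi>' \<zeta> a * pair_weight \<pi> \<pi>' \<zeta> b *
      cell_overlap (pair_left \<pi> \<pi>' a) (pair_right \<pi> \<pi>' a) (pair_left \<pi> \<pi>' b) (pair_right \<pi> \<pi>' b))"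

text \<open>
  Both step functions are within \<open>e\<close> of the path, so their difference is at most \<open>2 e\<close> on an interval
  of length at most one.
\<close>

lemma pair_form_bound:
  assumes P: "partition_of s t N \<pi>" "partition_of s t N' \<pi>'" and st: "0 \<le> s" "s \<le> t" "t \<le> 1"
    and mesh: "\<And>j. j < N \<Longrightarrow> \<pi> (Suc j) - \<pi> j < \<delta>" "\<And>j. j < N' \<Longrightarrow> \<pi>' (Suc j) - \<pi>' j < \<delta>"
    and osc: "\<And>u v. u \<in> {0..1} \<Longrightarrow> v \<in> {0..1} \<Longrightarrow> \<bar>u - v\<bar> < \<delta> \<Longrightarrow> \<bar>\<zeta> u - \<zeta> v\<bar> \<le> e"
    and e: "e \<ge> 0"
  shows "pair_form N \<pi> N' \<pi>' \<zeta> \<le> 4 * e\<^sup>2" "0 \<le> pair_form N \<pi> N' \<pi>' \<zeta>"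
proof -
  let ?S = "{..<N} <+> {..<N'}"
  let ?\<phi> = "\<lambda>u. \<Sum>a\<in>?S. pair_weight \<pi> \<pi>' \<zeta> a *
      (indicator {0<..pair_right \<pi> \<pi>' a} u - indicator {0<..pair_left \<pi> \<pi>' a} u)"
  have fin: "finite ?S" by simp
  have rng: "pair_left \<pi> \<pi>' a \<in> {0..1} \<and> pair_right \<pi> \<pi>' a \<in> {0..1}" if "a \<in> ?S" for a
  proof -
    have b: "0 \<le> \<pi> j \<and> \<pi> j \<le> 1" if "j \<le> N" for j
      using partition_of_bounds[OF P(1) that] st by auto
    have b': "0 \<le> \<pi>' j \<and> \<pi>' j \<le> 1" if "j \<le> N'" for j
      using partition_of_bounds[OF P(2) that] st by auto
    show ?thesis
      using that b b' by (auto simp: pair_left_def pair_right_def)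
  qed
  have \<phi>: "?\<phi> u = step_path N \<pi> \<zeta> u - step_path N' \<pi>' \<zeta> u" for u
    by (subst sum.Plus) (auto simp: step_path_def pair_weight_def pair_left_def pair_right_def sum_negf)
  let ?i = "\<lambda>u. indicator {0<..t} u - indicator {0<..s} u :: real"
  have i: "?i u = indicator {s<..t} u" for u using st by (auto simp: indicator_def)
  have bd: "\<bar>?\<phi> u\<bar> \<le> 2 * e * indicator {s<..t} u" for u
  proof -
    have "\<bar>step_path N \<pi> \<zeta> u - \<zeta> u * ?i u\<bar> \<le> e * ?i u"
      by (rule step_path_close[OF P(1) st(1,3), where \<delta>=\<delta>]) (use mesh osc in auto)
    moreover have "\<bar>step_path N' \<pi>' \<zeta> u - \<zeta> u * ?i u\<bar> \<le> e * ?i u"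
      by (rule step_path_close[OF P(2) st(1,3), where \<delta>=\<delta>]) (use mesh osc in auto)
    ultimately show ?thesis
      unfolding \<phi> i by linarith
  qed
  have form: "pair_form N \<pi> N' \<pi>' \<zeta> = (\<integral>u. (?\<phi> u)\<^sup>2 \<partial>lborel)" and int: "integrable lborel (\<lambda>u. (?\<phi> u)\<^sup>2)"
    unfolding pair_form_def using overlap_form_integral[OF fin rng, where z="pair_weight \<pi> \<pi>' \<zeta>"] by auto
  have "(\<integral>u. (?\<phi> u)\<^sup>2 \<partial>lborel) \<le> (\<integral>u. 4 * e\<^sup>2 * indicator {s<..t} u \<partial>lborel)"
  proof (rule integral_mono[OF int])
    show "integrable lborel (\<lambda>u. 4 * e\<^sup>2 * indicator {s<..t} u :: real)"
      using emeasure_bounded_finite[of "{s<..t}"] by (intro integrable_mult_right integrable_real_indicator) auto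
    fix u
    have "(?\<phi> u)\<^sup>2 \<le> (2 * e * indicator {s<..t} u)\<^sup>2"
      using bd[of u] by (intro abs_le_square_iff[THEN iffD1]) (simp add: e)
    also have "\<dots> = 4 * e\<^sup>2 * indicator {s<..t} u"
      by (auto simp: power2_eq_square indicator_def)
    finally show "(?\<phi> u)\<^sup>2 \<le> 4 * e\<^sup>2 * indicator {s<..t} u" .
  qed
  also have "\<dots> = 4 * e\<^sup>2 * (t - s)" using st by simp
  also have "\<dots> \<le> 4 * e\<^sup>2 * 1" using st by (intro mult_left_mono) auto
  finally show "pair_form N \<pi> N' \<pi>' \<zeta> \<le> 4 * e\<^sup>2" unfolding form by simp
  show "0 \<le> pair_form N \<pi> N' \<pi>' \<zeta>" unfolding form by simp
qed

text \<open>
  Uniform continuity of a path on the unit interval supplies the scale for \<open>pair_form_bound\<close>. The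
  filter is arbitrary so that the same statement serves a single sequence and two independent indices.
\<close>

lemma pair_form_tendsto:
  fixes N N' :: "'m \<Rightarrow> nat"
  assumes P: "\<And>m. partition_of s t (N m) (\<pi> m)" "\<And>m. partition_of s t (N' m) (\<pi>' m)"
    and st: "0 \<le> s" "s \<le> t" "t \<le> 1"
    and mesh: "\<And>e. e > 0 \<Longrightarrow> \<forall>\<^sub>F m in F. \<forall>j<N m. \<pi> m (Suc j) - \<pi> m j < e"
      "\<And>e. e > 0 \<Longrightarrow> \<forall>\<^sub>F m in F. \<forall>j<N' m. \<pi>' m (Suc j) - \<pi>' m j < e"
    and cont: "continuous_on {0..1} \<zeta>"
  shows "((\<lambda>m. pair_form (N m) (\<pi> m) (N' m) (\<pi>' m) \<zeta>) \<longlongrightarrow> 0) F"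
proof (rule tendstoI)
  fix r :: real assume r: "r > 0"
  define e where "e = sqrt (r / 5)"
  have e: "e > 0" "4 * e\<^sup>2 < r" using r by (auto simp: e_def)
  have "uniformly_continuous_on {0..1} \<zeta>"
    using cont by (rule compact_uniformly_continuous) simp
  then obtain \<delta> where \<delta>: "\<delta> > 0" "\<And>u v. u \<in> {0..1} \<Longrightarrow> v \<in> {0..1} \<Longrightarrow> dist u v < \<delta> \<Longrightarrow> dist (\<zeta> u) (\<zeta> v) < e"
    unfolding uniformly_continuous_on_def using e(1) by metis
  show "\<forall>\<^sub>F m in F. dist (pair_form (N m) (\<pi> m) (N' m) (\<pi>' m) \<zeta>) 0 < r"
    using mesh(1)[OF \<delta>(1)] mesh(2)[OF \<delta>(1)]
  proof eventually_elim
    case (elim m)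
    have osc: "\<bar>\<zeta> u - \<zeta> v\<bar> \<le> e" if "u \<in> {0..1}" "v \<in> {0..1}" "\<bar>u - v\<bar> < \<delta>" for u v
      using \<delta>(2)[of u v] that by (auto simp: dist_real_def)
    have m1: "\<pi> m (Suc j) - \<pi> m j < \<delta>" if "j < N m" for j using elim(1) that by auto
    have m2: "\<pi>' m (Suc j) - \<pi>' m j < \<delta>" if "j < N' m" for j using elim(2) that by auto
    note b = pair_form_bound[OF P(1)[of m] P(2)[of m] st m1 m2 osc less_imp_le[OF e(1)]]
    have "pair_form (N m) (\<pi> m) (N' m) (\<pi>' m) \<zeta> \<le> 4 * e\<^sup>2" "0 \<le> pair_form (N m) (\<pi> m) (N' m) (\<pi>' m) \<zeta>"
      by (rule b; assumption)+
    then show ?case using e(2) by (simp add: dist_real_def)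
  qed
qed

definition unif_point :: "real \<Rightarrow> real \<Rightarrow> nat \<Rightarrow> nat \<Rightarrow> real" where
  "unif_point s t m j = s + real j * (t - s) / real m"

lemma unif_point_step: "m \<ge> 1 \<Longrightarrow> unif_point s t m (Suc j) - unif_point s t m j = (t - s) / real m"
  by (simp add: unif_point_def field_simps)

lemma unif_partition: "m \<ge> 1 \<Longrightarrow> s \<le> t \<Longrightarrow> partition_of s t m (unif_point s t m)"
  unfolding partition_of_def by (auto simp: unif_point_def intro!: divide_right_mono mult_right_mono)

lemma unif_mesh:
  assumes "filterlim m at_top F" "e > 0"
  shows "\<forall>\<^sub>F i in F. \<forall>j<m i. unif_point s t (m i) (Suc j) - unif_point s t (m i) j < e"
proof -
  obtain k :: nat where k: "real k * e > t - s" using reals_Archimedean3[OF assms(2)] by blast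
  have "\<forall>\<^sub>F i in F. max k 1 \<le> m i"
    using assms(1)[unfolded filterlim_at_top] by blast
  then show ?thesis
  proof eventually_elim
    case (elim i)
    then have mi: "m i \<ge> 1" "real k \<le> real (m i)" by auto
    have "t - s < real (m i) * e"
      using k mult_right_mono[OF mi(2), of e] assms(2) by linarith
    then have "(t - s) / real (m i) < e"
      using mi(1) by (simp add: field_simps)
    then show ?case using unif_point_step[OF mi(1)] by simp
  qed
qed

context indep_brownian
begin

lemma second_moment_bound:
  assumes S: "finite S" and pq: "\<And>a. a \<in> S \<Longrightarrow> p a \<in> {0..1} \<and> q a \<in> {0..1} \<and> p a \<le> q a"
    and dj: "\<And>a b. a \<in> S \<Longrightarrow> b \<in> S \<Longrightarrow> a \<noteq> b \<Longrightarrow> q a \<le> p b \<or> q b \<le> p a"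
    and Z: "\<And>a. a \<in> S \<Longrightarrow> Z a \<in> borel_measurable F"
    and c: "\<And>a. a \<in> S \<Longrightarrow> (\<integral>\<^sup>+\<omega>. ennreal ((Z a \<omega>)\<^sup>2) \<partial>M) \<le> ennreal (c a)" "\<And>a. a \<in> S \<Longrightarrow> 0 \<le> c a"
  shows "(\<integral>\<^sup>+\<omega>. ennreal ((\<Sum>a\<in>S. Z a \<omega> * (W (q a) \<omega> $ \<kappa> - W (p a) \<omega> $ \<kappa>))\<^sup>2) \<partial>M)
    \<le> ennreal (\<Sum>a\<in>S. c a * (q a - p a))"
proof -
  have ZM: "Z a \<in> borel_measurable M" if "a \<in> S" for a using Z[OF that] measurable_F by auto
  have "(\<integral>\<^sup>+\<omega>. ennreal ((\<Sum>a\<in>S. Z a \<omega> * (W (q a) \<omega> $ \<kappa> - W (p a) \<omega> $ \<kappa>))\<^sup>2) \<partial>M)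
     = (\<integral>\<^sup>+\<omega>\<in>space M. ennreal ((\<Sum>a\<in>S. Z a \<omega> * (W (q a) \<omega> $ \<kappa> - W (p a) \<omega> $ \<kappa>))\<^sup>2) \<partial>M)"
    by (rule nn_integral_cong) simp
  also have "\<dots> = (\<integral>\<^sup>+\<omega>\<in>space M. ennreal (\<Sum>a\<in>S. \<Sum>b\<in>S. Z a \<omega> * Z b \<omega> * cell_overlap (p a) (q a) (p b) (q b)) \<partial>M)"
    using sets.top[of F] unfolding space_F by (intro conditional_isometry[OF S _ Z]) (use pq in auto)
  also have "\<dots> = (\<integral>\<^sup>+\<omega>. (\<Sum>a\<in>S. ennreal ((Z a \<omega>)\<^sup>2) * ennreal (q a - p a)) \<partial>M)"
  proof (rule nn_integral_cong)
    fix \<omega> assume "\<omega> \<in> space M"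
    have "(\<Sum>a\<in>S. \<Sum>b\<in>S. Z a \<omega> * Z b \<omega> * cell_overlap (p a) (q a) (p b) (q b)) = (\<Sum>a\<in>S. (Z a \<omega>)\<^sup>2 * (q a - p a))"
      using disjoint_cells_form[OF S _ dj, where z="\<lambda>a. Z a \<omega>"] pq by auto
    moreover have "ennreal (\<Sum>a\<in>S. (Z a \<omega>)\<^sup>2 * (q a - p a)) = (\<Sum>a\<in>S. ennreal ((Z a \<omega>)\<^sup>2 * (q a - p a)))"
      using pq by (intro sum_ennreal[symmetric]) auto
    moreover have "(\<Sum>a\<in>S. ennreal ((Z a \<omega>)\<^sup>2 * (q a - p a))) = (\<Sum>a\<in>S. ennreal ((Z a \<omega>)\<^sup>2) * ennreal (q a - p a))"
      using pq by (intro sum.cong ennreal_mult) auto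
    ultimately show "ennreal (\<Sum>a\<in>S. \<Sum>b\<in>S. Z a \<omega> * Z b \<omega> * cell_overlap (p a) (q a) (p b) (q b)) * indicator (space M) \<omega>
       = (\<Sum>a\<in>S. ennreal ((Z a \<omega>)\<^sup>2) * ennreal (q a - p a))"
      using \<open>\<omega> \<in> space M\<close> by simp
  qed
  also have "\<dots> = (\<Sum>a\<in>S. (\<integral>\<^sup>+\<omega>. ennreal ((Z a \<omega>)\<^sup>2) \<partial>M) * ennreal (q a - p a))"
    using ZM by (subst nn_integral_sum) (auto intro!: sum.cong nn_integral_multc)
  also have "\<dots> \<le> (\<Sum>a\<in>S. ennreal (c a) * ennreal (q a - p a))"
    using c by (intro sum_mono mult_right_mono) auto
  also have "\<dots> = (\<Sum>a\<in>S. ennreal (c a * (q a - p a)))"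
    using c pq by (intro sum.cong) (auto simp: ennreal_mult)
  also have "\<dots> = ennreal (\<Sum>a\<in>S. c a * (q a - p a))"
    using c pq by (intro sum_ennreal) auto
  finally show ?thesis .
qed

lemma nn_cond_exp_SUP:
  assumes [measurable]: "\<And>k. X k \<in> borel_measurable M" and inc: "incseq X"
  shows "AE \<omega> in M. nn_cond_exp M F (\<lambda>\<omega>. SUP k. X k \<omega>) \<omega> = (SUP k. nn_cond_exp M F (X k) \<omega>)"
proof -
  have "AE \<omega> in M. (SUP k. nn_cond_exp M F (X k) \<omega>) = nn_cond_exp M F (\<lambda>\<omega>. SUP k. X k \<omega>) \<omega>"
  proof (rule nn_cond_exp_charact)
    fix A assume A [measurable]: "A \<in> sets F"
    have [measurable]: "A \<in> sets M" using F_events[OF A] .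
    have mono: "AE \<omega> in M. nn_cond_exp M F (X k) \<omega> * indicator A \<omega> \<le> nn_cond_exp M F (X (Suc k)) \<omega> * indicator A \<omega>" for k
    proof -
      have "AE \<omega> in M. nn_cond_exp M F (X k) \<omega> \<le> nn_cond_exp M F (X (Suc k)) \<omega>"
        using inc by (intro nn_cond_exp_mono) (auto simp: incseq_Suc_iff le_fun_def)
      then show ?thesis by eventually_elim (auto intro: mult_right_mono)
    qed
    have "(\<integral>\<^sup>+\<omega>\<in>A. (SUP k. X k \<omega>) \<partial>M) = (\<integral>\<^sup>+\<omega>. (SUP k. X k \<omega> * indicator A \<omega>) \<partial>M)"
      by (simp add: SUP_mult_right_ennreal)
    also have "\<dots> = (SUP k. (\<integral>\<^sup>+\<omega>\<in>A. X k \<omega> \<partial>M))"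
      using inc by (intro nn_integral_monotone_convergence_SUP) (auto simp: incseq_def le_fun_def intro!: mult_right_mono)
    also have "\<dots> = (SUP k. (\<integral>\<^sup>+\<omega>\<in>A. nn_cond_exp M F (X k) \<omega> \<partial>M))"
    proof (rule SUP_cong)
      fix k
      have "(\<integral>\<^sup>+\<omega>. indicator A \<omega> * nn_cond_exp M F (X k) \<omega> \<partial>M) = (\<integral>\<^sup>+\<omega>. indicator A \<omega> * X k \<omega> \<partial>M)"
        by (rule nn_cond_exp_intg) auto
      then show "(\<integral>\<^sup>+\<omega>\<in>A. X k \<omega> \<partial>M) = (\<integral>\<^sup>+\<omega>\<in>A. nn_cond_exp M F (X k) \<omega> \<partial>M)"
        by (simp add: mult.commute)
    qed simp
    also have "\<dots> = (\<integral>\<^sup>+\<omega>. (SUP k. nn_cond_exp M F (X k) \<omega> * indicator A \<omega>) \<partial>M)"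
      using mono by (intro nn_integral_monotone_convergence_SUP_AE[symmetric]) auto
    also have "\<dots> = (\<integral>\<^sup>+\<omega>\<in>A. (SUP k. nn_cond_exp M F (X k) \<omega>) \<partial>M)"
      by (simp add: SUP_mult_right_ennreal)
    finally show "(\<integral>\<^sup>+\<omega>\<in>A. (SUP k. X k \<omega>) \<partial>M) = (\<integral>\<^sup>+\<omega>\<in>A. (SUP k. nn_cond_exp M F (X k) \<omega>) \<partial>M)" .
  qed auto
  then show ?thesis by (auto elim: eventually_mono)
qed

text \<open>
  Conditional Fatou lemma, by monotone convergence of the infima of the tails.
\<close>

lemma nn_cond_exp_liminf:
  assumes [measurable]: "\<And>k. X k \<in> borel_measurable M"
  shows "AE \<omega> in M. nn_cond_exp M F (\<lambda>\<omega>. liminf (\<lambda>k. X k \<omega>)) \<omega> \<le> liminf (\<lambda>k. nn_cond_exp M F (X k) \<omega>)"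
proof -
  define Y where "Y k \<omega> = (INF j\<in>{k..}. X j \<omega>)" for k \<omega>
  have [measurable]: "Y k \<in> borel_measurable M" for k unfolding Y_def by measurable
  have inc: "incseq Y"
    unfolding Y_def incseq_def le_fun_def by (auto intro!: INF_superset_mono)
  have le: "AE \<omega> in M. nn_cond_exp M F (Y k) \<omega> \<le> nn_cond_exp M F (X j) \<omega>" if "j \<ge> k" for k j
    using that by (intro nn_cond_exp_mono) (auto simp: Y_def intro!: INF_lower)
  have "AE \<omega> in M. \<forall>k. \<forall>j\<in>{k..}. nn_cond_exp M F (Y k) \<omega> \<le> nn_cond_exp M F (X j) \<omega>"
    unfolding AE_all_countable by (intro allI AE_ball_countable'[OF le]) auto
  then show ?thesis
    using nn_cond_exp_SUP[of Y, OF _ inc, simplified]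
  proof eventually_elim
    case (elim \<omega>)
    have "nn_cond_exp M F (\<lambda>\<omega>. liminf (\<lambda>k. X k \<omega>)) \<omega> = (SUP k. nn_cond_exp M F (Y k) \<omega>)"
      using elim(2) unfolding liminf_SUP_INF Y_def by simp
    also have "\<dots> \<le> (SUP k. INF j\<in>{k..}. nn_cond_exp M F (X j) \<omega>)"
      using elim(1) by (intro SUP_mono' INF_greatest) auto
    finally show ?case unfolding liminf_SUP_INF .
  qed
qed

text \<open>
  Conditional second moments that tend to zero almost surely need not have small expectations. On the
  event of \<open>F\<close> where the conditional second moment is below a threshold Chebyshev's inequality
  applies, and the probability of this event tends to one.
\<close>

lemma vanishes_cond_square:
  assumes [measurable]: "\<And>k. X k \<in> borel_measurable M"
    and lim: "AE \<omega> in M. (\<lambda>k. nn_cond_exp M F (\<lambda>\<omega>. ennreal ((X k \<omega>)\<^sup>2)) \<omega>) \<longlonglongrightarrow> 0"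
  shows "vanishes M sequentially X"
  unfolding vanishes_def
proof (intro allI impI)
  fix \<eta> \<epsilon> :: real assume h: "\<eta> > 0" "\<epsilon> > 0"
  define Y where "Y k = nn_cond_exp M F (\<lambda>\<omega>. ennreal ((X k \<omega>)\<^sup>2))" for k
  have YF [measurable]: "Y k \<in> borel_measurable F" for k by (simp add: Y_def)
  have [measurable]: "Y k \<in> borel_measurable M" for k by (rule measurable_from_subalg[OF subalgF YF])
  define \<delta> where "\<delta> = \<eta>\<^sup>2 * (\<epsilon> / 2) / 2"
  have \<delta>: "\<delta> > 0" "\<delta> < \<eta>\<^sup>2 * (\<epsilon> / 2)" using h by (auto simp: \<delta>_def)
  define A where "A k = {\<omega>\<in>space M. Y k \<omega> \<le> ennreal \<delta>}" for k
  have AF [measurable]: "A k \<in> sets F" for k unfolding A_def space_F[symmetric] by measurable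
  have [measurable]: "A k \<in> sets M" for k using AF F_events by auto
  have "vanishes M sequentially (\<lambda>k. indicator (space M - A k))"
  proof (rule vanishes_AE_lim)
    show "AE \<omega> in M. (\<lambda>k. indicator (space M - A k) \<omega> :: real) \<longlonglongrightarrow> 0"
      using lim
    proof eventually_elim
      case (elim \<omega>)
      then have "\<forall>\<^sub>F k in sequentially. Y k \<omega> < ennreal \<delta>"
        unfolding Y_def using \<delta> by (intro order_tendstoD) auto
      then have "\<forall>\<^sub>F k in sequentially. (indicator (space M - A k) \<omega> :: real) = 0"
        by eventually_elim (auto simp: A_def indicator_def)
      then show ?case by (rule tendsto_eventually)
    qed
  qed measurable
  then have "\<forall>\<^sub>F k in sequentially. near M (1/2) (\<epsilon>/2) (indicator (space M - A k))"
    using h unfolding vanishes_def by auto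
  then show "\<forall>\<^sub>F k in sequentially. near M \<eta> \<epsilon> (X k)"
  proof eventually_elim
    case (elim k)
    have "(\<integral>\<^sup>+\<omega>. ennreal ((X k \<omega> * indicator (A k) \<omega>)\<^sup>2) \<partial>M) = (\<integral>\<^sup>+\<omega>. indicator (A k) \<omega> * ennreal ((X k \<omega>)\<^sup>2) \<partial>M)"
      by (intro nn_integral_cong) (auto simp: indicator_def)
    also have "\<dots> = (\<integral>\<^sup>+\<omega>. indicator (A k) \<omega> * Y k \<omega> \<partial>M)"
      unfolding Y_def by (rule nn_cond_exp_intg[symmetric]) auto
    also have "\<dots> \<le> (\<integral>\<^sup>+\<omega>. ennreal \<delta> \<partial>M)"
      by (intro nn_integral_mono) (auto simp: A_def indicator_def)
    also have "\<dots> = ennreal \<delta>" by (simp add: emeasure_space_1)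
    finally have "near M \<eta> (\<epsilon>/2) (\<lambda>\<omega>. X k \<omega> * indicator (A k) \<omega>)"
      using \<delta> h by (intro near_square[where a=\<delta>]) auto
    then have "near M \<eta> (\<epsilon>/2 + \<epsilon>/2) (X k)"
      by (rule near_comb[OF _ elim]) (auto simp: indicator_def of_bool_def split: if_splits)
    then show ?case by simp
  qed
qed

lemma W_comp_measurable: "t \<in> {0..1} \<Longrightarrow> (\<lambda>\<omega>. W t \<omega> $ \<kappa>) \<in> borel_measurable M"
  by (rule measurable_compose[OF W_measurable]) auto

definition wiener_sum :: "'w \<Rightarrow> (real \<Rightarrow> 'a \<Rightarrow> real) \<Rightarrow> nat \<Rightarrow> (nat \<Rightarrow> real) \<Rightarrow> 'a \<Rightarrow> real" where
  "wiener_sum \<kappa> z N \<pi> \<omega> = (\<Sum>j<N. z (\<pi> j) \<omega> * (W (\<pi> (Suc j)) \<omega> $ \<kappa> - W (\<pi> j) \<omega> $ \<kappa>))"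

lemma wiener_sum_measurable:
  assumes "\<And>t. t \<in> {0..1} \<Longrightarrow> z t \<in> borel_measurable M" "partition_of s t N \<pi>" "0 \<le> s" "t \<le> 1"
  shows "wiener_sum \<kappa> z N \<pi> \<in> borel_measurable M"
proof -
  have "\<pi> j \<in> {0..1}" if "j \<le> N" for j
    using partition_of_bounds[OF assms(2) that] assms(3,4) by auto
  then show ?thesis
    unfolding wiener_sum_def using assms(1)
    by (intro borel_measurable_sum borel_measurable_times borel_measurable_diff W_comp_measurable) auto
qed

lemma cond_square_difference:
  assumes z: "\<And>t. t \<in> {0..1} \<Longrightarrow> z t \<in> borel_measurable F"
    and P: "partition_of s t N \<pi>" "partition_of s t N' \<pi>'" and st: "0 \<le> s" "t \<le> 1"
  shows "AE \<omega> in M. nn_cond_exp M F (\<lambda>\<omega>. ennreal ((wiener_sum \<kappa> z N \<pi> \<omega> - wiener_sum \<kappa> z N' \<pi>' \<omega>)\<^sup>2)) \<omega>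
     = ennreal (pair_form N \<pi> N' \<pi>' (\<lambda>t. z t \<omega>))"
proof -
  let ?S = "{..<N} <+> {..<N'}"
  define Z where "Z a \<omega> = pair_weight \<pi> \<pi>' (\<lambda>t. z t \<omega>) a" for a \<omega>
  have b: "\<pi> j \<in> {0..1}" if "j \<le> N" for j
    using partition_of_bounds[OF P(1) that] st by auto
  have b': "\<pi>' j \<in> {0..1}" if "j \<le> N'" for j
    using partition_of_bounds[OF P(2) that] st by auto
  have rng: "pair_left \<pi> \<pi>' a \<in> {0..1} \<and> pair_right \<pi> \<pi>' a \<in> {0..1}" if "a \<in> ?S" for a
    using that b b' by (auto simp: pair_left_def pair_right_def)
  have ZF: "Z a \<in> borel_measurable F" if "a \<in> ?S" for a
    using that z b b' by (auto simp: Z_def[abs_def] pair_weight_def)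
  have eq: "wiener_sum \<kappa> z N \<pi> \<omega> - wiener_sum \<kappa> z N' \<pi>' \<omega>
      = (\<Sum>a\<in>?S. Z a \<omega> * (W (pair_right \<pi> \<pi>' a) \<omega> $ \<kappa> - W (pair_left \<pi> \<pi>' a) \<omega> $ \<kappa>))" for \<omega>
    by (subst sum.Plus) (auto simp: wiener_sum_def Z_def pair_weight_def pair_left_def pair_right_def sum_negf)
  have zM: "z t \<in> borel_measurable M" if "t \<in> {0..1}" for t
    using z[OF that] by (rule measurable_F)
  have "AE \<omega> in M. ennreal (pair_form N \<pi> N' \<pi>' (\<lambda>t. z t \<omega>))
     = nn_cond_exp M F (\<lambda>\<omega>. ennreal ((wiener_sum \<kappa> z N \<pi> \<omega> - wiener_sum \<kappa> z N' \<pi>' \<omega>)\<^sup>2)) \<omega>"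
  proof (rule nn_cond_exp_charact)
    show "(\<lambda>\<omega>. ennreal ((wiener_sum \<kappa> z N \<pi> \<omega> - wiener_sum \<kappa> z N' \<pi>' \<omega>)\<^sup>2)) \<in> borel_measurable M"
      using wiener_sum_measurable[OF zM P(1) st] wiener_sum_measurable[OF zM P(2) st] by measurable
    show "(\<lambda>\<omega>. ennreal (pair_form N \<pi> N' \<pi>' (\<lambda>t. z t \<omega>))) \<in> borel_measurable F"
      unfolding pair_form_def Z_def[symmetric] using ZF
      by (intro measurable_compose[OF _ measurable_ennreal] borel_measurable_sum borel_measurable_times) auto
    fix A assume A: "A \<in> sets F"
    show "(\<integral>\<^sup>+\<omega>\<in>A. ennreal ((wiener_sum \<kappa> z N \<pi> \<omega> - wiener_sum \<kappa> z N' \<pi>' \<omega>)\<^sup>2) \<partial>M)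
       = (\<integral>\<^sup>+\<omega>\<in>A. ennreal (pair_form N \<pi> N' \<pi>' (\<lambda>t. z t \<omega>)) \<partial>M)"
      unfolding eq pair_form_def Z_def[symmetric]
      by (rule conditional_isometry[OF _ rng ZF A]) auto
  qed
  then show ?thesis by (auto elim: eventually_mono)
qed

lemma borel_cantelli_near:
  assumes "\<And>k. near M ((1/2)^k) ((1/2)^k) (D k)"
  shows "AE \<omega> in M. \<forall>\<^sub>F k in sequentially. \<bar>D k \<omega>\<bar> \<le> (1/2)^k"
proof -
  have "\<exists>B. \<forall>k. B k \<in> sets M \<and> measure M (B k) < (1/2)^k \<and> (\<forall>\<omega>\<in>space M - B k. \<bar>D k \<omega>\<bar> \<le> (1/2)^k)"
    using assms unfolding near_def by (intro choice) blast
  then obtain B where B: "\<And>k. B k \<in> sets M" "\<And>k. measure M (B k) < (1/2)^k"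
    "\<And>k \<omega>. \<omega> \<in> space M - B k \<Longrightarrow> \<bar>D k \<omega>\<bar> \<le> (1/2)^k" by blast
  have "summable (\<lambda>k. measure M (B k))"
    by (rule summable_comparison_test'[of "\<lambda>k. (1/2)^k" 0]) (use B(2) in \<open>auto simp: less_imp_le intro!: summable_geometric\<close>)
  then have "AE \<omega> in M. \<forall>\<^sub>F k in sequentially. \<omega> \<in> space M - B k"
    using B(1) by (intro borel_cantelli_AE1) (auto simp: emeasure_eq_measure)
  then show ?thesis
    by eventually_elim (auto elim!: eventually_mono intro: B(3))
qed

text \<open>
  By the conditional isometry the Wiener sums along the uniform partitions are Cauchy in probability:
  conditionally, the second moments of the differences are the quadratic forms \<open>pair_form\<close>, which
  tend to zero along the continuous paths of \<open>y\<close>. A fast subsequence converges almost surely and defines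
  \<open>I\<close>; the conditional Fatou lemma compares \<open>I\<close> with the sums along any other partitions.
\<close>

theorem wiener_integral_exists:
  fixes y :: "real \<Rightarrow> 'a \<Rightarrow> real"
  assumes yM: "\<And>t. t \<in> {0..1} \<Longrightarrow> y t \<in> borel_measurable M"
    and cont: "AE \<omega> in M. continuous_on {0..1} (\<lambda>t. y t \<omega>)"
    and ver: "\<And>t. t \<in> {0..1} \<Longrightarrow> \<exists>z\<in>borel_measurable F. AE \<omega> in M. y t \<omega> = z \<omega>"
    and st: "0 \<le> s" "s \<le> t" "t \<le> 1"
  shows "\<exists>I\<in>borel_measurable M.
     vanishes M sequentially (\<lambda>m \<omega>. wiener_sum \<kappa> y m (unif_point s t m) \<omega> - I \<omega>) \<and>
     (\<forall>N \<pi>. (\<forall>m. partition_of s t (N m) (\<pi> m)) \<longrightarrow>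
        (\<forall>e>0. \<forall>\<^sub>F m in sequentially. \<forall>j<N m. \<pi> m (Suc j) - \<pi> m j < e) \<longrightarrow>
        (AE \<omega> in M. (\<lambda>m. nn_cond_exp M F (\<lambda>\<omega>. ennreal ((I \<omega> - wiener_sum \<kappa> y (N m) (\<pi> m) \<omega>)\<^sup>2)) \<omega>) \<longlonglongrightarrow> 0))"
proof -
  obtain z where z: "\<And>t. t \<in> {0..1} \<Longrightarrow> z t \<in> borel_measurable F"
      "\<And>t. t \<in> {0..1} \<Longrightarrow> AE \<omega> in M. y t \<omega> = z t \<omega>"
    using ver by metis
  have pts: "\<pi> j \<in> {0..1}" if "partition_of s t N \<pi>" "j \<le> N" for \<pi> N j
    using partition_of_bounds[OF that] st by auto
  note meas = wiener_sum_measurable[OF yM _ st(1,3)]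
  have at_points: "AE \<omega> in M. \<forall>j\<le>N. y (\<pi> j) \<omega> = z (\<pi> j) \<omega>" if "partition_of s t N \<pi>" for N \<pi>
  proof -
    have "AE \<omega> in M. \<forall>j\<in>{..N}. y (\<pi> j) \<omega> = z (\<pi> j) \<omega>"
      by (rule AE_finite_allI) (use z(2) pts[OF that] in auto)
    then show ?thesis by (auto elim: eventually_mono)
  qed
  have cond: "AE \<omega> in M. nn_cond_exp M F (\<lambda>\<omega>. ennreal ((wiener_sum \<kappa> y N \<pi> \<omega> - wiener_sum \<kappa> y N' \<pi>' \<omega>)\<^sup>2)) \<omega>
     = ennreal (pair_form N \<pi> N' \<pi>' (\<lambda>t. y t \<omega>))"
    if P: "partition_of s t N \<pi>" and P': "partition_of s t N' \<pi>'" for N \<pi> N' \<pi>'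
  proof -
    have zM: "z t \<in> borel_measurable M" if "t \<in> {0..1}" for t using z(1)[OF that] by (rule measurable_F)
    have ws: "wiener_sum \<kappa> y N \<pi> \<omega> = wiener_sum \<kappa> z N \<pi> \<omega>" if "\<forall>j\<le>N. y (\<pi> j) \<omega> = z (\<pi> j) \<omega>" for \<omega> N \<pi>
      unfolding wiener_sum_def using that by (intro sum.cong) auto
    have pf: "pair_form N \<pi> N' \<pi>' (\<lambda>t. y t \<omega>) = pair_form N \<pi> N' \<pi>' (\<lambda>t. z t \<omega>)"
      if "\<forall>j\<le>N. y (\<pi> j) \<omega> = z (\<pi> j) \<omega>" "\<forall>j\<le>N'. y (\<pi>' j) \<omega> = z (\<pi>' j) \<omega>" for \<omega>
    proof -
      have "pair_weight \<pi> \<pi>' (\<lambda>t. y t \<omega>) a = pair_weight \<pi> \<pi>' (\<lambda>t. z t \<omega>) a" if "a \<in> {..<N} <+> {..<N'}" for a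
        using that \<open>\<forall>j\<le>N. y (\<pi> j) \<omega> = z (\<pi> j) \<omega>\<close> \<open>\<forall>j\<le>N'. y (\<pi>' j) \<omega> = z (\<pi>' j) \<omega>\<close>
        by (auto simp: pair_weight_def)
      then show ?thesis unfolding pair_form_def by (intro sum.cong refl) simp
    qed
    have "AE \<omega> in M. nn_cond_exp M F (\<lambda>\<omega>. ennreal ((wiener_sum \<kappa> y N \<pi> \<omega> - wiener_sum \<kappa> y N' \<pi>' \<omega>)\<^sup>2)) \<omega>
       = nn_cond_exp M F (\<lambda>\<omega>. ennreal ((wiener_sum \<kappa> z N \<pi> \<omega> - wiener_sum \<kappa> z N' \<pi>' \<omega>)\<^sup>2)) \<omega>"
    proof (rule nn_cond_exp_cong)
      show "AE \<omega> in M. ennreal ((wiener_sum \<kappa> y N \<pi> \<omega> - wiener_sum \<kappa> y N' \<pi>' \<omega>)\<^sup>2)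
        = ennreal ((wiener_sum \<kappa> z N \<pi> \<omega> - wiener_sum \<kappa> z N' \<pi>' \<omega>)\<^sup>2)"
        using at_points[OF P] at_points[OF P'] by eventually_elim (simp add: ws)
    qed (use meas[OF _ P] meas[OF _ P'] wiener_sum_measurable[OF zM P st(1,3)] wiener_sum_measurable[OF zM P' st(1,3)] in measurable)
    moreover have "AE \<omega> in M. nn_cond_exp M F (\<lambda>\<omega>. ennreal ((wiener_sum \<kappa> z N \<pi> \<omega> - wiener_sum \<kappa> z N' \<pi>' \<omega>)\<^sup>2)) \<omega>
       = ennreal (pair_form N \<pi> N' \<pi>' (\<lambda>t. z t \<omega>))"
      by (rule cond_square_difference[OF _ P P' st(1,3)]) (rule z(1))
    moreover note at_points[OF P] at_points[OF P']
    ultimately show ?thesis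
      by eventually_elim (simp add: pf)
  qed
  have diff: "vanishes M sequentially (\<lambda>m \<omega>. wiener_sum \<kappa> y (N m) (\<pi> m) \<omega> - wiener_sum \<kappa> y (N' m) (\<pi>' m) \<omega>)"
    if P: "\<And>m. partition_of s t (N m) (\<pi> m)" "\<And>m. partition_of s t (N' m) (\<pi>' m)"
    and mesh: "\<And>e. e > 0 \<Longrightarrow> \<forall>\<^sub>F m in sequentially. \<forall>j<N m. \<pi> m (Suc j) - \<pi> m j < e"
      "\<And>e. e > 0 \<Longrightarrow> \<forall>\<^sub>F m in sequentially. \<forall>j<N' m. \<pi>' m (Suc j) - \<pi>' m j < e" for N N' \<pi> \<pi>'
  proof (rule vanishes_cond_square)
    show "(\<lambda>\<omega>. wiener_sum \<kappa> y (N m) (\<pi> m) \<omega> - wiener_sum \<kappa> y (N' m) (\<pi>' m) \<omega>) \<in> borel_measurable M" for m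
      using meas P by auto
    have "AE \<omega> in M. \<forall>m. nn_cond_exp M F (\<lambda>\<omega>. ennreal ((wiener_sum \<kappa> y (N m) (\<pi> m) \<omega> - wiener_sum \<kappa> y (N' m) (\<pi>' m) \<omega>)\<^sup>2)) \<omega>
      = ennreal (pair_form (N m) (\<pi> m) (N' m) (\<pi>' m) (\<lambda>t. y t \<omega>))"
      unfolding AE_all_countable using cond[OF P] by blast
    then show "AE \<omega> in M. (\<lambda>m. nn_cond_exp M F (\<lambda>\<omega>. ennreal ((wiener_sum \<kappa> y (N m) (\<pi> m) \<omega> - wiener_sum \<kappa> y (N' m) (\<pi>' m) \<omega>)\<^sup>2)) \<omega>) \<longlonglongrightarrow> 0"
      using cont
    proof eventually_elim
      case (elim \<omega>)
      have "(\<lambda>m. ennreal (pair_form (N m) (\<pi> m) (N' m) (\<pi>' m) (\<lambda>t. y t \<omega>))) \<longlonglongrightarrow> ennreal 0"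
        by (intro tendsto_ennrealI pair_form_tendsto[OF P st mesh elim(2)])
      then show ?case using elim(1) by simp
    qed
  qed
  define S where "S m = wiener_sum \<kappa> y (Suc m) (unif_point s t (Suc m))" for m
  have Smeas [measurable]: "S m \<in> borel_measurable M" for m
    unfolding S_def by (intro meas unif_partition) (use st in auto)
  have part: "partition_of s t (Suc m) (unif_point s t (Suc m))" for m
    by (rule unif_partition) (use st in auto)
  have cauchy: "\<exists>m0. \<forall>m\<ge>m0. \<forall>m'\<ge>m0. near M \<epsilon> \<epsilon> (\<lambda>\<omega>. S m \<omega> - S m' \<omega>)" if e: "\<epsilon> > 0" for \<epsilon>
  proof (rule ccontr)
    assume "\<nexists>m0. \<forall>m\<ge>m0. \<forall>m'\<ge>m0. near M \<epsilon> \<epsilon> (\<lambda>\<omega>. S m \<omega> - S m' \<omega>)"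
    then have "\<forall>r. \<exists>m m'. r \<le> m \<and> r \<le> m' \<and> \<not> near M \<epsilon> \<epsilon> (\<lambda>\<omega>. S m \<omega> - S m' \<omega>)" by blast
    then obtain f g where fg: "\<And>r. r \<le> f r" "\<And>r. r \<le> g r" "\<And>r. \<not> near M \<epsilon> \<epsilon> (\<lambda>\<omega>. S (f r) \<omega> - S (g r) \<omega>)"
      by metis
    have lim: "filterlim (\<lambda>r. Suc (f r)) at_top sequentially" "filterlim (\<lambda>r. Suc (g r)) at_top sequentially"
      by (rule filterlim_at_top_mono[OF filterlim_ident], use fg in \<open>auto intro!: always_eventually le_SucI\<close>)+
    have "vanishes M sequentially (\<lambda>r \<omega>. S (f r) \<omega> - S (g r) \<omega>)"
      unfolding S_def by (rule diff) (use part unif_mesh[OF lim(1)] unif_mesh[OF lim(2)] in auto)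
    then show False using vanishes_near[OF _ e] fg(3) by blast
  qed
  have "\<forall>k. \<exists>m0. \<forall>m\<ge>m0. \<forall>m'\<ge>m0. near M ((1/2)^k) ((1/2)^k) (\<lambda>\<omega>. S m \<omega> - S m' \<omega>)"
    using cauchy by simp
  then obtain f where f: "\<And>k m m'. m \<ge> f k \<Longrightarrow> m' \<ge> f k \<Longrightarrow> near M ((1/2)^k) ((1/2)^k) (\<lambda>\<omega>. S m \<omega> - S m' \<omega>)"
    by metis
  \<comment> \<open>monotone and above each \<open>f k\<close>, so that consecutive differences satisfy the bound of rank \<open>k\<close>\<close>
  define r where "r k = k + (\<Sum>i\<le>k. f i)" for k :: nat
  have r: "f k \<le> r k" "f k \<le> r (Suc k)" "k \<le> r k" for k
    using member_le_sum[of k "{..k}" f] unfolding r_def by auto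
  have "AE \<omega> in M. \<forall>\<^sub>F k in sequentially. \<bar>S (r (Suc k)) \<omega> - S (r k) \<omega>\<bar> \<le> (1/2)^k"
    by (rule borel_cantelli_near) (intro f r)
  then have conv: "AE \<omega> in M. convergent (\<lambda>k. S (r k) \<omega>)"
  proof eventually_elim
    case (elim \<omega>)
    have "summable (\<lambda>k. S (r (Suc k)) \<omega> - S (r k) \<omega>)"
      by (rule summable_comparison_test_ev[of _ "\<lambda>k. (1/2)^k"]) (use elim in auto)
    then have "convergent (\<lambda>n. \<Sum>k<n. S (r (Suc k)) \<omega> - S (r k) \<omega>)"
      by (simp add: summable_iff_convergent)
    moreover have "(\<Sum>k<n. S (r (Suc k)) \<omega> - S (r k) \<omega>) = S (r n) \<omega> - S (r 0) \<omega>" for n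
      by (rule sum_lessThan_telescope)
    ultimately have "convergent (\<lambda>n. S (r n) \<omega> - S (r 0) \<omega>)" by simp
    then have "convergent (\<lambda>n. (S (r n) \<omega> - S (r 0) \<omega>) + S (r 0) \<omega>)"
      by (intro convergent_add convergent_const)
    then show ?case by simp
  qed
  define I where "I \<omega> = lim (\<lambda>k. S (r k) \<omega>)" for \<omega>
  have Imeas [measurable]: "I \<in> borel_measurable M"
    unfolding I_def by (rule borel_measurable_lim_metric) measurable
  have Ilim: "AE \<omega> in M. (\<lambda>k. S (r k) \<omega>) \<longlonglongrightarrow> I \<omega>"
    using conv unfolding I_def convergent_LIMSEQ_iff .
  have main: "AE \<omega> in M. (\<lambda>m. nn_cond_exp M F (\<lambda>\<omega>. ennreal ((I \<omega> - wiener_sum \<kappa> y (N m) (\<pi> m) \<omega>)\<^sup>2)) \<omega>) \<longlonglongrightarrow> 0"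
    if P: "\<And>m. partition_of s t (N m) (\<pi> m)"
    and mesh: "\<And>e. e > 0 \<Longrightarrow> \<forall>\<^sub>F m in sequentially. \<forall>j<N m. \<pi> m (Suc j) - \<pi> m j < e" for N \<pi>
  proof -
    let ?T = "\<lambda>m. wiener_sum \<kappa> y (N m) (\<pi> m)"
    let ?Q = "\<lambda>k m \<omega>. pair_form (Suc (r k)) (unif_point s t (Suc (r k))) (N m) (\<pi> m) (\<lambda>t. y t \<omega>)"
    have Tm [measurable]: "?T m \<in> borel_measurable M" for m by (rule meas[OF _ P])
    have le: "AE \<omega> in M. nn_cond_exp M F (\<lambda>\<omega>. ennreal ((I \<omega> - ?T m \<omega>)\<^sup>2)) \<omega> \<le> liminf (\<lambda>k. ennreal (?Q k m \<omega>))" for m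
    proof -
      have "AE \<omega> in M. nn_cond_exp M F (\<lambda>\<omega>. ennreal ((I \<omega> - ?T m \<omega>)\<^sup>2)) \<omega>
         = nn_cond_exp M F (\<lambda>\<omega>. liminf (\<lambda>k. ennreal ((S (r k) \<omega> - ?T m \<omega>)\<^sup>2))) \<omega>"
      proof (rule nn_cond_exp_cong)
        show "AE \<omega> in M. ennreal ((I \<omega> - ?T m \<omega>)\<^sup>2) = liminf (\<lambda>k. ennreal ((S (r k) \<omega> - ?T m \<omega>)\<^sup>2))"
          using Ilim
        proof eventually_elim
          case (elim \<omega>)
          have "(\<lambda>k. ennreal ((S (r k) \<omega> - ?T m \<omega>)\<^sup>2)) \<longlonglongrightarrow> ennreal ((I \<omega> - ?T m \<omega>)\<^sup>2)"
            by (intro tendsto_ennrealI tendsto_intros elim)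
          then show ?case by (metis lim_imp_Liminf trivial_limit_sequentially)
        qed
      qed measurable
      moreover have "AE \<omega> in M. nn_cond_exp M F (\<lambda>\<omega>. liminf (\<lambda>k. ennreal ((S (r k) \<omega> - ?T m \<omega>)\<^sup>2))) \<omega>
         \<le> liminf (\<lambda>k. nn_cond_exp M F (\<lambda>\<omega>. ennreal ((S (r k) \<omega> - ?T m \<omega>)\<^sup>2)) \<omega>)"
        by (rule nn_cond_exp_liminf) measurable
      moreover have "AE \<omega> in M. \<forall>k. nn_cond_exp M F (\<lambda>\<omega>. ennreal ((S (r k) \<omega> - ?T m \<omega>)\<^sup>2)) \<omega> = ennreal (?Q k m \<omega>)"
        unfolding AE_all_countable S_def using cond[OF part P] by blast
      ultimately show ?thesis by eventually_elim simp
    qed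
    then have "AE \<omega> in M. \<forall>m. nn_cond_exp M F (\<lambda>\<omega>. ennreal ((I \<omega> - ?T m \<omega>)\<^sup>2)) \<omega> \<le> liminf (\<lambda>k. ennreal (?Q k m \<omega>))"
      unfolding AE_all_countable by blast
    then show ?thesis
      using cont
    proof eventually_elim
      case (elim \<omega>)
      have rl: "filterlim (\<lambda>k. Suc (r k)) at_top sequentially"
        by (rule filterlim_at_top_mono[OF filterlim_ident], use r in \<open>auto intro!: always_eventually le_SucI\<close>)
      \<comment> \<open>the limit inferior over \<open>k\<close> is taken for each \<open>m\<close>, so the form has to be small in both
        indices simultaneously\<close>
      have "((\<lambda>(k, m). ?Q k m \<omega>) \<longlongrightarrow> 0) (sequentially \<times>\<^sub>F sequentially)"
        unfolding case_prod_unfold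
      proof (rule pair_form_tendsto[OF _ _ st _ _ elim(2)])
        show "partition_of s t (Suc (r (fst p))) (unif_point s t (Suc (r (fst p))))" for p :: "nat \<times> nat" by (rule part)
        show "partition_of s t (N (snd p)) (\<pi> (snd p))" for p :: "nat \<times> nat" by (rule P)
        fix e :: real assume e: "e > 0"
        show "\<forall>\<^sub>F x in sequentially \<times>\<^sub>F sequentially. \<forall>j<Suc (r (fst x)). unif_point s t (Suc (r (fst x))) (Suc j) - unif_point s t (Suc (r (fst x))) j < e"
          using eventually_compose_filterlim[OF unif_mesh[OF rl e] filterlim_fst] .
        show "\<forall>\<^sub>F x in sequentially \<times>\<^sub>F sequentially. \<forall>j<N (snd x). \<pi> (snd x) (Suc j) - \<pi> (snd x) j < e"
          using eventually_compose_filterlim[OF mesh[OF e] filterlim_snd] .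
      qed
      show ?case
      proof (rule order_tendstoI)
        fix a :: ennreal assume "a > 0"
        then obtain b where b: "b > 0" "ennreal b < a"
          by (metis dense ennreal_cases ennreal_less_zero_iff less_top_ennreal not_less_zero order.strict_trans top.not_eq_extremum)
        have "\<forall>\<^sub>F x in sequentially \<times>\<^sub>F sequentially. (case x of (k, m) \<Rightarrow> ?Q k m \<omega>) < b"
          by (rule order_tendstoD(2)[OF \<open>((\<lambda>(k, m). ?Q k m \<omega>) \<longlongrightarrow> 0) _\<close> b(1)])
        then obtain n0 where n0: "\<And>k m. k \<ge> n0 \<Longrightarrow> m \<ge> n0 \<Longrightarrow> ?Q k m \<omega> < b"
          unfolding eventually_prod_sequentially by auto
        have "liminf (\<lambda>k. ennreal (?Q k m \<omega>)) \<le> ennreal b" if "m \<ge> n0" for m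
        proof -
          have "liminf (\<lambda>k. ennreal (?Q k m \<omega>)) \<le> liminf (\<lambda>k. ennreal b)"
            using n0[OF _ that] by (intro Liminf_mono) (auto simp: eventually_sequentially less_imp_le intro!: exI[of _ n0] ennreal_leI)
          then show ?thesis by (simp add: Liminf_const)
        qed
        then show "\<forall>\<^sub>F m in sequentially. nn_cond_exp M F (\<lambda>\<omega>. ennreal ((I \<omega> - ?T m \<omega>)\<^sup>2)) \<omega> < a"
          unfolding eventually_sequentially using elim(1) b(2) by (meson order.strict_trans1 order_trans)
      qed auto
    qed
  qed
  have "vanishes M sequentially (\<lambda>m \<omega>. I \<omega> - S m \<omega>)"
  proof (rule vanishes_cond_square)
    show "AE \<omega> in M. (\<lambda>m. nn_cond_exp M F (\<lambda>\<omega>. ennreal ((I \<omega> - S m \<omega>)\<^sup>2)) \<omega>) \<longlonglongrightarrow> 0"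
      unfolding S_def by (rule main[OF part]) (rule unif_mesh[OF filterlim_Suc])
  qed measurable
  then have "vanishes M sequentially (\<lambda>m \<omega>. wiener_sum \<kappa> y m (unif_point s t m) \<omega> - I \<omega>)"
    unfolding vanishes_def S_def
    by (subst eventually_sequentially_Suc[symmetric]) (simp add: near_def abs_minus_commute)
  then show ?thesis using main by (intro bexI[OF _ Imeas]) blast
qed

end

section \<open>The grid and the discrete integrals\<close>

lemma ennreal_root_le:
  assumes "ennreal_root p a \<le> ennreal c" "p > 0" "c \<ge> 0"
  shows "a \<le> ennreal (c powr p)"
proof (cases a)
  case top
  then show ?thesis using assms(1) by (simp add: ennreal_root_def top_unique)
next
  case (real r)
  then have "ennreal (r powr (1/p)) \<le> ennreal c"
    using assms(1) by (simp add: ennreal_root_def)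
  then have "r powr (1/p) \<le> c"
    using assms(3) by (simp add: ennreal_le_iff)
  then have "(r powr (1/p)) powr p \<le> c powr p"
    using assms(2) by (intro powr_mono2) auto
  then show ?thesis using real assms(2) by (auto simp: powr_powr intro: ennreal_leI)
qed

lemma ennreal_divide_le:
  assumes "X / ennreal d \<le> ennreal C" "d > 0"
  shows "X \<le> ennreal (C * d)"
proof (cases X)
  case top
  then show ?thesis using assms by (simp add: ennreal_top_divide top_unique)
next
  case (real r)
  then have *: "ennreal (r / d) \<le> ennreal C" using assms by (simp add: divide_ennreal)
  show ?thesis
  proof (cases "C \<ge> 0")
    case True
    then have "r / d \<le> C" using * by (simp add: ennreal_le_iff)
    then show ?thesis using real assms(2) by (auto simp: field_simps intro!: ennreal_leI)
  next
    case False
    then have "ennreal (r / d) \<le> 0" using * by (simp add: ennreal_neg)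
    then have "r / d \<le> 0" by (simp add: ennreal_eq_0_iff)
    then have "r = 0" using real assms(2) by (simp add: divide_le_0_iff)
    then show ?thesis using real by simp
  qed
qed

lemma finite_words: "finite (words k :: 'd::finite list set)"
  using finite_lists_length_eq[of "UNIV :: 'd set" k] by (simp add: words_def)

lemma finite_words_less: "finite {w :: 'd::finite list. length w < l}"
proof -
  have "{w :: 'd list. length w < l} = (\<Union>k<l. words k)" by (auto simp: words_def)
  then show ?thesis by (simp add: finite_words)
qed

lemma norm_le_tnorm: "norm (T w) \<le> tnorm (length w) T" for w :: "'d::finite list"
  unfolding tnorm_def by (rule member_le_L2_set) (use finite_words in \<open>auto simp: words_def\<close>)

lemma Lp_norm_2_le:
  assumes "Lp_norm 2 M f \<le> ennreal c" "c \<ge> 0"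
  shows "(\<integral>\<^sup>+\<omega>. ennreal ((f \<omega>)\<^sup>2) \<partial>M) \<le> ennreal (c\<^sup>2)"
proof -
  have "(\<integral>\<^sup>+\<omega>. ennreal (\<bar>f \<omega>\<bar> powr 2) \<partial>M) \<le> ennreal (c powr 2)"
    using assms unfolding Lp_norm_def by (intro ennreal_root_le) auto
  moreover have "\<bar>f \<omega>\<bar> powr 2 = (f \<omega>)\<^sup>2" for \<omega>
    by (cases "f \<omega> = 0") auto
  moreover have "c powr 2 = c\<^sup>2" using assms(2) by (cases "c = 0") auto
  ultimately show ?thesis by simp
qed

text \<open>
  The number of the grid point \<open>eps n s\<close>. Since the grid points in \<open>[s, t)\<close> are those with numbers from
  \<open>grid_index n s\<close> up to \<open>grid_index n t\<close>, sums over arbitrary intervals become sums over intervals of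
  natural numbers.
\<close>

definition grid_index :: "nat \<Rightarrow> real \<Rightarrow> nat" where
  "grid_index n s = nat \<lceil>real n * s\<rceil>"

lemma grid_index_mono: "s \<le> t \<Longrightarrow> grid_index n s \<le> grid_index n t"
  unfolding grid_index_def by (intro nat_mono ceiling_mono mult_left_mono) auto

lemma grid_index_le: "t \<le> 1 \<Longrightarrow> grid_index n t \<le> n"
  unfolding grid_index_def using mult_left_mono[of t 1 "real n"] by (simp add: nat_le_iff ceiling_le_iff)

lemma eps_eq: "0 \<le> s \<Longrightarrow> eps n s = grid n (grid_index n s)"
  by (simp add: eps_def grid_def grid_index_def)

lemma grid_between_eq:
  assumes "n \<ge> 1" "0 \<le> s" "t \<le> 1"
  shows "grid_between n s t = {grid_index n s..<grid_index n t}"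
proof -
  have 1: "s \<le> grid n k \<longleftrightarrow> grid_index n s \<le> k" for k
    using assms(1) unfolding grid_def grid_index_def
    by (simp add: nat_le_iff ceiling_le_iff pos_le_divide_eq mult.commute)
  have 2: "grid n k < t \<longleftrightarrow> k < grid_index n t" for k
    using assms(1) unfolding grid_def grid_index_def
    by (simp add: zless_nat_eq_int_zless less_ceiling_iff pos_divide_less_eq mult.commute)
  show ?thesis
    unfolding grid_between_def 1 2 using grid_index_le[OF assms(3), of n] by auto
qed

lemma grid_mono: "i \<le> j \<Longrightarrow> grid n i \<le> grid n j"
  unfolding grid_def by (intro divide_right_mono) auto

lemma grid_unit: "k \<le> n \<Longrightarrow> 0 \<le> grid n k \<and> grid n k \<le> 1"
  by (auto simp: grid_def divide_le_eq_1)

lemma eps_grid: "n \<ge> 1 \<Longrightarrow> eps n (grid n k) = grid n k"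
  by (simp add: eps_def grid_def)

lemma grid_index_grid: "n \<ge> 1 \<Longrightarrow> grid_index n (grid n k) = k"
  by (simp add: grid_index_def grid_def)

lemma eps_unit: "s \<in> {0..1} \<Longrightarrow> eps n s \<in> {0..1}"
  using eps_eq[of s n] grid_unit[OF grid_index_le[of s n]] by auto

lemma eps_mono: "s \<le> t \<Longrightarrow> eps n s \<le> eps n t"
  unfolding eps_def by (intro divide_right_mono) (auto intro!: ceiling_mono mult_left_mono)

lemma eps_bounds: "n \<ge> 1 \<Longrightarrow> s \<le> eps n s" "n \<ge> 1 \<Longrightarrow> eps n s \<le> s + 1 / real n"
proof -
  assume n: "n \<ge> 1"
  show "s \<le> eps n s" unfolding eps_def using n by (simp add: field_simps)
  have "real_of_int \<lceil>real n * s\<rceil> \<le> real n * s + 1" by linarith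
  then show "eps n s \<le> s + 1 / real n" unfolding eps_def using n by (simp add: field_simps)
qed

lemma eps_tendsto: "(\<lambda>n. eps n s) \<longlonglongrightarrow> s"
proof (rule tendsto_sandwich)
  show "\<forall>\<^sub>F n in sequentially. s \<le> eps n s"
    using eventually_ge_at_top[of 1] by eventually_elim (rule eps_bounds)
  show "\<forall>\<^sub>F n in sequentially. eps n s \<le> s + 1 / real n"
    using eventually_ge_at_top[of 1] by eventually_elim (rule eps_bounds)
  have "(\<lambda>n. s + 1 / real n) \<longlonglongrightarrow> s + 0" by (intro tendsto_add tendsto_const lim_1_over_n)
  then show "(\<lambda>n. s + 1 / real n) \<longlonglongrightarrow> s" by simp
qed simp

lemma S2_D: "(s, t) \<in> S2 \<Longrightarrow> 0 \<le> s \<and> s \<le> t \<and> t \<le> 1"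
  by (simp add: S2_def)

text \<open>
  The factor is the sum of the weights \<open>2\<^bsup>-k\<^esup>\<close> in the metric of the product topology.
\<close>

lemma dist_fun_le:
  fixes f g :: "'c::countable \<Rightarrow> 'b::metric_space"
  assumes "\<And>c. dist (f c) (g c) \<le> \<eta>"
  shows "dist f g \<le> 2 * \<eta>"
proof -
  have e: "0 \<le> \<eta>" using assms zero_le_dist order_trans by blast
  have "dist f g \<le> (\<Sum>n. (1/2)^n * \<eta>)"
    unfolding dist_fun_def
  proof (rule suminf_le)
    show "(1/2)^n * min (dist (f (from_nat n)) (g (from_nat n))) 1 \<le> (1/2)^n * \<eta>" for n
      using assms[of "from_nat n"] by (intro mult_left_mono) auto
    show "summable (\<lambda>n. (1/2)^n * min (dist (f (from_nat n)) (g (from_nat n))) 1)"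
      by (rule summable_comparison_test'[of "\<lambda>n. (1/2)^n"]) (auto simp: summable_geometric_iff)
  qed (auto intro!: summable_mult2 summable_geometric)
  also have "\<dots> = (\<Sum>n. (1/2)^n) * \<eta>"
    by (rule suminf_mult2[symmetric]) (auto simp: summable_geometric_iff)
  also have "\<dots> = 2 * \<eta>" using suminf_geometric[of "1/2 :: real"] by simp
  finally show ?thesis .
qed

lemma unif_point_bounds:
  assumes "m \<ge> 1" "a \<le> b" "j \<le> m"
  shows "a \<le> unif_point a b m j" "unif_point a b m j \<le> b"
  using partition_of_bounds[OF unif_partition[OF assms(1,2)] assms(3)] by auto

lemma unif_point_0: "unif_point a b m 0 = a" by (simp add: unif_point_def)

lemma unif_point_last: "m \<ge> 1 \<Longrightarrow> unif_point a b m m = b" by (simp add: unif_point_def)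

lemma unif_point_less: "m \<ge> 1 \<Longrightarrow> a < b \<Longrightarrow> unif_point a b m j < unif_point a b m (Suc j)"
  by (auto simp: unif_point_def intro!: divide_strict_right_mono mult_strict_right_mono)

lemma unif_point_mono: "m \<ge> 1 \<Longrightarrow> a \<le> b \<Longrightarrow> i \<le> j \<Longrightarrow> unif_point a b m i \<le> unif_point a b m j"
  unfolding unif_point_def by (intro add_left_mono divide_right_mono mult_right_mono) auto

lemma sum_partition:
  fixes g :: "nat \<Rightarrow> 'b::comm_monoid_add"
  assumes "\<And>j. j < m \<Longrightarrow> c j \<le> (c (Suc j) :: nat)"
  shows "(\<Sum>j<m. \<Sum>k\<in>{c j..<c (Suc j)}. g k) = (\<Sum>k\<in>{c 0..<c m}. g k)"
  using assms
proof (induction m)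
  case 0
  then show ?case by simp
next
  case (Suc m)
  have "c 0 \<le> c m"
    using Suc.prems by (induction m) (auto intro: order_trans)
  then show ?case
    using Suc by (simp add: sum.atLeastLessThan_concat)
qed

text \<open>
  The part of the setting that does not involve the weight: the results on the discrete integrals of
  \<open>x\<close> are applied both to the given weight and to its localised versions.
\<close>

locale rough_increments = prob_space M for M :: "'a measure" +
  fixes \<nu> K :: real and l :: nat
    and x :: "real \<Rightarrow> real \<Rightarrow> 'a \<Rightarrow> 'd::finite list \<Rightarrow> real"
    and h :: "nat \<Rightarrow> real \<Rightarrow> real \<Rightarrow> 'a \<Rightarrow> real^'w"
    and W :: "real \<Rightarrow> 'a \<Rightarrow> real^'w"
  assumes nu: "0 < \<nu>"
    and l_def: "l = controlled_order \<nu> (1/2)"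
    and rough: "rough_path M 4 \<nu> l x"
    and one_inc: "\<forall>n\<ge>1. one_increment M n (h n)"
    and J_bound: "\<forall>n\<ge>1. \<forall>i<l. \<forall>(s, t)\<in>S2_grid n.
           Lp_norm 2 M (\<lambda>\<omega>. tnorm i (J_path n x (h n) s t \<omega>))
             \<le> ennreal (K * (t - s) powr (1/2 + \<nu> * real i))"
    and BM: "standard_Brownian_motion M W"
    and indep: "indep_set (sets (sigma_path M l x)) (sets (sigma_process M W))"
    and fdd: "fdd_conv M
           (\<lambda>n s t \<omega>. (trunc l (x s t \<omega>), increment n (h n) s t \<omega>))
           (\<lambda>s t \<omega>. (trunc l (x s t \<omega>), W t \<omega> - W s \<omega>))"
    and small: "\<forall>i\<in>{1..l - 1}. \<forall>\<sigma> :: nat \<Rightarrow> nat \<Rightarrow> real.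
           (\<forall>m\<ge>1. 0 \<le> \<sigma> m 0 \<and> \<sigma> m m \<le> 1 \<and>
              (\<forall>j<m. \<sigma> m j < \<sigma> m (Suc j) \<and> \<sigma> m (Suc j) - \<sigma> m j \<le> 1 / real m)) \<longrightarrow>
           lim_limsup_in_prob M
             (\<lambda>m n \<omega>. tnorm i (\<lambda>w. \<Sum>j<m. J_path n x (h n) (\<sigma> m j) (\<sigma> m (Suc j)) \<omega> w))"
begin

lemma l_exponent: "\<nu> * real l + 1/2 > 1"
proof -
  obtain k :: nat where "real k * \<nu> > 1" using reals_Archimedean3[OF nu] by blast
  then have "\<nu> * real k + 1/2 > 1" by (simp add: mult.commute)
  then show ?thesis unfolding l_def controlled_order_def by (rule LeastI)
qed

lemma l_pos: "1 \<le> l"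
  using l_exponent by (cases l) auto

lemma x_empty: "(s, t) \<in> S2 \<Longrightarrow> \<omega> \<in> space M \<Longrightarrow> x s t \<omega> [] = 1"
  using rough unfolding rough_path_def by blast

lemma x_measurable:
  assumes "(s, t) \<in> S2" "length w \<le> l"
  shows "(\<lambda>\<omega>. x s t \<omega> w) \<in> borel_measurable M"
proof (cases "w = []")
  case True
  then show ?thesis using x_empty[OF assms(1)] by (subst measurable_cong[of _ _ "\<lambda>_. 1"]) auto
next
  case False
  then have "length w \<in> {1..l}" "w \<in> words (length w)" using assms(2) by (auto simp: words_def Suc_le_eq)
  then show ?thesis using rough assms(1) unfolding rough_path_def by blast
qed

lemma trunc_measurable:
  assumes "(s, t) \<in> S2"
  shows "(\<lambda>\<omega>. trunc l (x s t \<omega>)) \<in> borel_measurable M"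
proof (rule measurable_coordinatewise_then_product)
  fix w show "(\<lambda>\<omega>. trunc l (x s t \<omega>) w) \<in> borel_measurable M"
    using x_measurable[OF assms, of w] by (cases "1 \<le> length w \<and> length w \<le> l") (auto simp: trunc_def)
qed

lemma sigma_path_eq:
  "sigma_path M l x = vimage_algebra (space M) (\<lambda>\<omega>. \<lambda>p\<in>S2. (\<lambda>p \<omega>. trunc l (x (fst p) (snd p) \<omega>)) p \<omega>) (\<Pi>\<^sub>M p\<in>S2. borel)"
  unfolding sigma_path_def ..

lemma trunc_pair_measurable: "p \<in> S2 \<Longrightarrow> (\<lambda>\<omega>. trunc l (x (fst p) (snd p) \<omega>)) \<in> borel_measurable M"
  using trunc_measurable[of "fst p" "snd p"] by simp

lemma subalgebra_sigma_path: "subalgebra M (sigma_path M l x)"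
proof -
  have "(\<lambda>\<omega>. \<lambda>p\<in>S2. trunc l (x (fst p) (snd p) \<omega>)) \<in> measurable M (\<Pi>\<^sub>M p\<in>S2. borel)"
    by (rule measurable_restrict) (rule trunc_pair_measurable)
  then show ?thesis
    unfolding subalgebra_def sigma_path_def by (simp add: sets_image_in_sets)
qed

sublocale indep_brownian M "sigma_path M l x" W
  by unfold_locales (rule subalgebra_sigma_path BM indep)+

abbreviation "F \<equiv> sigma_path M l x"

lemma trunc_F_measurable:
  assumes "p \<in> S2"
  shows "(\<lambda>\<omega>. trunc l (x (fst p) (snd p) \<omega>)) \<in> borel_measurable F"
proof -
  have "(\<lambda>\<omega>. \<lambda>p\<in>S2. trunc l (x (fst p) (snd p) \<omega>)) \<in> measurable F (\<Pi>\<^sub>M p\<in>S2. borel)"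
    unfolding sigma_path_def by (rule measurable_vimage_algebra1) (auto simp: space_PiM)
  from measurable_compose[OF this measurable_component_singleton[OF assms]]
  show ?thesis using assms by simp
qed

lemma x_F_measurable:
  assumes "(s, t) \<in> S2" "length w \<le> l"
  shows "(\<lambda>\<omega>. x s t \<omega> w) \<in> borel_measurable F"
proof (cases "w = []")
  case True
  then show ?thesis using x_empty[OF assms(1)] by (subst measurable_cong[of _ _ "\<lambda>_. 1"]) (auto simp: space_F)
next
  case False
  have c: "(\<lambda>z :: 'd list \<Rightarrow> real. z w) \<in> borel_measurable borel"
    by (rule borel_measurable_continuous_onI) (rule continuous_on_product_coordinates)
  have "(\<lambda>\<omega>. trunc l (x s t \<omega>) w) \<in> borel_measurable F"
    using measurable_compose[OF trunc_F_measurable[OF assms(1)] c] by simp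
  then show ?thesis using False assms(2) by (simp add: trunc_def Suc_le_eq)
qed

text \<open>
  Chen's relation for whole words: with the value one at the empty word the two outer terms \<open>i = 0\<close>
  and \<open>i = length w\<close> join the sum, and all levels are treated alike.
\<close>

lemma chen:
  "AE \<omega> in M. \<forall>s u t w. 0 \<le> s \<and> s \<le> u \<and> u \<le> t \<and> t \<le> 1 \<and> length w \<le> l \<longrightarrow>
     x s t \<omega> w = (\<Sum>i\<le>length w. x s u \<omega> (take i w) * x u t \<omega> (drop i w))"
proof -
  have "AE \<omega> in M. (\<forall>s u t. 0 \<le> s \<and> s \<le> u \<and> u \<le> t \<and> t \<le> 1 \<longrightarrow>
           (\<forall>k\<in>{1..l}. \<forall>w\<in>words k.
              x s t \<omega> w - x s u \<omega> w - x u t \<omega> w =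
                (\<Sum>j = 1..k - 1. x s u \<omega> (take (k - j) w) * x u t \<omega> (drop (k - j) w))))"
    using rough unfolding rough_path_def by (auto elim!: eventually_mono)
  moreover have "AE \<omega> in M. \<omega> \<in> space M" by simp
  ultimately show ?thesis
  proof eventually_elim
    case (elim \<omega>)
    show ?case
    proof (intro allI impI, elim conjE)
      fix s u t :: real and w :: "'d list"
      assume o: "0 \<le> s" "s \<le> u" "u \<le> t" "t \<le> 1" "length w \<le> l"
      have S2: "(s, u) \<in> S2" "(u, t) \<in> S2" "(s, t) \<in> S2" using o by (auto simp: S2_def)
      note e = x_empty[OF S2(1) elim(2)] x_empty[OF S2(2) elim(2)] x_empty[OF S2(3) elim(2)]
      show "x s t \<omega> w = (\<Sum>i\<le>length w. x s u \<omega> (take i w) * x u t \<omega> (drop i w))"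
      proof (cases "length w")
        case 0
        then show ?thesis using e by simp
      next
        case (Suc n)
        define k where "k = length w"
        have k: "k \<in> {1..l}" "w \<in> words k" "k = Suc n" using Suc o by (auto simp: k_def words_def)
        have "(\<Sum>j = 1..k - 1. x s u \<omega> (take (k - j) w) * x u t \<omega> (drop (k - j) w))
          = (\<Sum>i = 1..k - 1. x s u \<omega> (take i w) * x u t \<omega> (drop i w))"
          by (rule sum.reindex_bij_witness[of _ "\<lambda>i. k - i" "\<lambda>i. k - i"]) auto
        then have "x s t \<omega> w = x s u \<omega> w + x u t \<omega> w + (\<Sum>i = 1..n. x s u \<omega> (take i w) * x u t \<omega> (drop i w))"
          using elim(1)[rule_format, of s u t k w] o(1-4) k by (simp add: algebra_simps)
        also have "\<dots> = (\<Sum>i\<le>k. x s u \<omega> (take i w) * x u t \<omega> (drop i w))"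
        proof -
          have "{..k} = insert 0 (insert k {1..n})" using k by auto
          moreover have "0 \<notin> insert k {1..n}" "k \<notin> {1..n}" using k by auto
          ultimately show ?thesis using e by (simp add: k_def)
        qed
        finally show ?thesis by (simp add: k_def)
      qed
    qed
  qed
qed

text \<open>
  Chen's relation at a single time reads \<open>x = x + x\<close> modulo products of lower levels, which vanish by
  induction.
\<close>

lemma x_diagonal:
  "AE \<omega> in M. \<forall>t w. 0 \<le> t \<and> t \<le> 1 \<and> w \<noteq> [] \<and> length w \<le> l \<longrightarrow> x t t \<omega> w = 0"
proof -
  have "AE \<omega> in M. \<omega> \<in> space M" by simp
  with chen show ?thesis
  proof eventually_elim
    case (elim \<omega>)
    have "x t t \<omega> w = 0" if "0 \<le> t" "t \<le> 1" "w \<noteq> []" "length w \<le> l" for t w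
      using that(3,4)
    proof (induction "length w" arbitrary: w rule: less_induct)
      case less
      define k where "k = length w"
      have k: "k \<ge> 1" using less.prems by (cases w) (auto simp: k_def)
      have "(t, t) \<in> S2" using that by (auto simp: S2_def)
      note e = x_empty[OF this elim(2)]
      have "x t t \<omega> w = (\<Sum>i\<le>k. x t t \<omega> (take i w) * x t t \<omega> (drop i w))"
        using elim(1) that less.prems unfolding k_def by blast
      also have "\<dots> = (\<Sum>i\<in>{0, k}. x t t \<omega> (take i w) * x t t \<omega> (drop i w))"
      proof (rule sum.mono_neutral_right)
        show "\<forall>i\<in>{..k} - {0, k}. x t t \<omega> (take i w) * x t t \<omega> (drop i w) = 0"
        proof
          fix i assume i: "i \<in> {..k} - {0, k}"
          have "x t t \<omega> (take i w) = 0"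
            by (rule less.hyps) (use i less.prems in \<open>auto simp: k_def\<close>)
          then show "x t t \<omega> (take i w) * x t t \<omega> (drop i w) = 0" by simp
        qed
      qed auto
      also have "\<dots> = x t t \<omega> w + x t t \<omega> w" using k e by (subst sum.insert) (auto simp: k_def)
      finally show ?case by simp
    qed
    then show ?case by blast
  qed
qed

lemma x_continuous:
  "AE \<omega> in M. \<forall>w. w \<noteq> [] \<and> length w \<le> l \<longrightarrow> continuous_on S2 (\<lambda>(s, t). x s t \<omega> w)"
proof -
  have "AE \<omega> in M. \<forall>k\<in>{1..l}. \<forall>w\<in>words k. continuous_on S2 (\<lambda>(s, t). x s t \<omega> w)"
    using rough unfolding rough_path_def by (auto elim!: eventually_mono)
  then show ?thesis
  proof eventually_elim
    case (elim \<omega>)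
    show ?case
    proof (intro allI impI, elim conjE)
      fix w :: "'d list" assume w: "w \<noteq> []" "length w \<le> l"
      then have "length w \<in> {1..l}" "w \<in> words (length w)" by (auto simp: words_def Suc_le_eq)
      then show "continuous_on S2 (\<lambda>(s, t). x s t \<omega> w)" using elim by blast
    qed
  qed
qed

lemma x_L4_level:
  assumes k: "k \<in> {1..l}"
  shows "\<exists>C\<ge>0. \<forall>s t. \<forall>w\<in>words k. 0 \<le> s \<and> s < t \<and> t \<le> 1 \<longrightarrow>
     (\<integral>\<^sup>+\<omega>. ennreal ((x s t \<omega> w)^4) \<partial>M) \<le> ennreal (C * (t - s) powr (4 * \<nu> * real k))"
proof -
  let ?D = "{(s, t). 0 \<le> s \<and> s < t \<and> t \<le> 1} :: (real \<times> real) set"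
  let ?g = "\<lambda>(s, t). ennreal_root (real k) (Lp_norm 4 M (\<lambda>\<omega>. tnorm k (x s t \<omega>))) / ennreal ((t - s) powr \<nu>)"
  have "(SUP p\<in>?D. ?g p) < \<infinity>" using rough k unfolding rough_path_def by blast
  then obtain C where C: "(SUP p\<in>?D. ?g p) = ennreal C" "C \<ge> 0"
    by (cases "SUP p\<in>?D. ?g p") auto
  show ?thesis
  proof (intro exI[of _ "(C powr real k) powr 4"] conjI allI ballI impI)
    fix s t :: real and w :: "'d list" assume w: "w \<in> words k" and st: "0 \<le> s \<and> s < t \<and> t \<le> 1"
    have "?g (s, t) \<le> (SUP p\<in>?D. ?g p)" using st by (intro SUP_upper) auto
    then have "ennreal_root (real k) (Lp_norm 4 M (\<lambda>\<omega>. tnorm k (x s t \<omega>))) / ennreal ((t - s) powr \<nu>) \<le> ennreal C"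
      using C by simp
    then have "ennreal_root (real k) (Lp_norm 4 M (\<lambda>\<omega>. tnorm k (x s t \<omega>))) \<le> ennreal (C * (t - s) powr \<nu>)"
      using st by (intro ennreal_divide_le) auto
    then have "Lp_norm 4 M (\<lambda>\<omega>. tnorm k (x s t \<omega>)) \<le> ennreal ((C * (t - s) powr \<nu>) powr real k)"
      using k C by (intro ennreal_root_le) auto
    then have *: "(\<integral>\<^sup>+\<omega>. ennreal (\<bar>tnorm k (x s t \<omega>)\<bar> powr 4) \<partial>M) \<le> ennreal (((C * (t - s) powr \<nu>) powr real k) powr 4)"
      unfolding Lp_norm_def by (rule ennreal_root_le) auto
    have "(\<integral>\<^sup>+\<omega>. ennreal ((x s t \<omega> w)^4) \<partial>M) \<le> (\<integral>\<^sup>+\<omega>. ennreal (\<bar>tnorm k (x s t \<omega>)\<bar> powr 4) \<partial>M)"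
    proof (intro nn_integral_mono ennreal_leI)
      fix \<omega>
      have le: "\<bar>x s t \<omega> w\<bar> \<le> \<bar>tnorm k (x s t \<omega>)\<bar>"
        using norm_le_tnorm[of "x s t \<omega>" w] w by (simp add: words_def)
      have "(x s t \<omega> w)^4 = \<bar>x s t \<omega> w\<bar>^4" by simp
      also have "\<dots> \<le> \<bar>tnorm k (x s t \<omega>)\<bar>^4" using le by (intro power_mono) auto
      also have "\<dots> = \<bar>tnorm k (x s t \<omega>)\<bar> powr 4"
        by (cases "tnorm k (x s t \<omega>) = 0") (auto simp: powr_numeral)
      finally show "(x s t \<omega> w)^4 \<le> \<bar>tnorm k (x s t \<omega>)\<bar> powr 4" .
    qed
    also note *
    also have "((C * (t - s) powr \<nu>) powr real k) powr 4 = (C powr real k) powr 4 * (t - s) powr (4 * \<nu> * real k)"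
      by (simp add: powr_mult powr_powr algebra_simps)
    finally show "(\<integral>\<^sup>+\<omega>. ennreal ((x s t \<omega> w)^4) \<partial>M) \<le> ennreal ((C powr real k) powr 4 * (t - s) powr (4 * \<nu> * real k))" .
  qed simp
qed

lemma x_L4:
  "\<exists>C\<ge>0. \<forall>s t w. (s, t) \<in> S2 \<and> w \<noteq> [] \<and> length w \<le> l \<longrightarrow>
     (\<integral>\<^sup>+\<omega>. ennreal ((x s t \<omega> w)^4) \<partial>M) \<le> ennreal (C * (t - s) powr (4 * \<nu> * real (length w)))"
proof -
  obtain C where C: "\<And>k. k \<in> {1..l} \<Longrightarrow> C k \<ge> 0"
    "\<And>k s t w. k \<in> {1..l} \<Longrightarrow> w \<in> words k \<Longrightarrow> 0 \<le> s \<and> s < t \<and> t \<le> 1 \<Longrightarrow>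
       (\<integral>\<^sup>+\<omega>. ennreal ((x s t \<omega> w)^4) \<partial>M) \<le> ennreal (C k * (t - s) powr (4 * \<nu> * real k))"
    using x_L4_level by metis
  show ?thesis
  proof (intro exI[of _ "\<Sum>k=1..l. C k"] conjI allI impI)
    show "0 \<le> (\<Sum>k=1..l. C k)" using C(1) by (intro sum_nonneg) auto
    fix s t :: real and w :: "'d list" assume a: "(s, t) \<in> S2 \<and> w \<noteq> [] \<and> length w \<le> l"
    then have k: "length w \<in> {1..l}" "w \<in> words (length w)" by (auto simp: words_def Suc_le_eq)
    show "(\<integral>\<^sup>+\<omega>. ennreal ((x s t \<omega> w)^4) \<partial>M) \<le> ennreal ((\<Sum>k=1..l. C k) * (t - s) powr (4 * \<nu> * real (length w)))"
    proof (cases "s < t")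
      case True
      then have "(\<integral>\<^sup>+\<omega>. ennreal ((x s t \<omega> w)^4) \<partial>M) \<le> ennreal (C (length w) * (t - s) powr (4 * \<nu> * real (length w)))"
        using a k by (intro C(2)) (auto simp: S2_def)
      also have "\<dots> \<le> ennreal ((\<Sum>k=1..l. C k) * (t - s) powr (4 * \<nu> * real (length w)))"
        using k C(1) by (intro ennreal_leI mult_right_mono member_le_sum) auto
      finally show ?thesis .
    next
      case False
      then have "t = s" using a by (auto simp: S2_def)
      then have "AE \<omega> in M. x s t \<omega> w = 0" using x_diagonal a by (auto simp: S2_def elim!: eventually_mono)
      then have "(\<integral>\<^sup>+\<omega>. ennreal ((x s t \<omega> w)^4) \<partial>M) = (\<integral>\<^sup>+\<omega>. 0 \<partial>M)"
        by (intro nn_integral_cong_AE) (auto elim!: eventually_mono)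
      then show ?thesis by simp
    qed
  qed
qed

text \<open>
  Coordinates of \<open>h\<^sup>n\<close> over one cell of the grid, of its increments, and of the discrete integrals; all
  estimates are made coordinatewise.
\<close>

definition cell :: "'w \<Rightarrow> nat \<Rightarrow> nat \<Rightarrow> 'a \<Rightarrow> real" where
  "cell \<kappa> n k \<omega> = h n (grid n k) (grid n (Suc k)) \<omega> $ \<kappa>"

definition incr :: "'w \<Rightarrow> nat \<Rightarrow> real \<Rightarrow> real \<Rightarrow> 'a \<Rightarrow> real" where
  "incr \<kappa> n s t \<omega> = increment n (h n) s t \<omega> $ \<kappa>"

definition Jx :: "'w \<Rightarrow> nat \<Rightarrow> real \<Rightarrow> real \<Rightarrow> 'd list \<Rightarrow> 'a \<Rightarrow> real" where
  "Jx \<kappa> n s t w \<omega> = J_path n x (h n) s t \<omega> w $ \<kappa>"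

lemma h_measurable: "k < n \<Longrightarrow> h n (grid n k) (grid n (Suc k)) \<in> borel_measurable M"
  using one_inc unfolding one_increment_def by (auto simp: Suc_le_eq)

lemma cell_measurable: "k < n \<Longrightarrow> cell \<kappa> n k \<in> borel_measurable M"
  unfolding cell_def by (rule measurable_compose[OF h_measurable]) auto

lemma increment_measurable: "increment n (h n) s t \<in> borel_measurable M"
  unfolding increment_def by (intro borel_measurable_sum h_measurable) (auto simp: grid_between_def)

lemma incr_measurable: "incr \<kappa> n s t \<in> borel_measurable M"
  unfolding incr_def by (rule measurable_compose[OF increment_measurable]) auto

lemma incr_eq: "incr \<kappa> n s t \<omega> = (\<Sum>k\<in>grid_between n s t. cell \<kappa> n k \<omega>)"
  by (simp add: incr_def increment_def cell_def)

lemma Jx_eq: "Jx \<kappa> n s t w \<omega> = (\<Sum>k\<in>grid_between n s t. x (eps n s) (grid n k) \<omega> w * cell \<kappa> n k \<omega>)"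
  by (simp add: Jx_def J_path_def cell_def)

lemma eps_grid_S2:
  assumes "n \<ge> 1" "(s, t) \<in> S2" "k \<in> grid_between n s t"
  shows "(eps n s, grid n k) \<in> S2" "k < n"
proof -
  have st: "0 \<le> s" "s \<le> t" "t \<le> 1" using S2_D[OF assms(2)] by auto
  have k: "grid_index n s \<le> k" "k < grid_index n t" using assms grid_between_eq[OF assms(1) st(1,3)] by auto
  show "k < n" using k(2) grid_index_le[OF st(3), of n] by linarith
  then show "(eps n s, grid n k) \<in> S2"
    using k grid_unit[of k n] grid_mono[OF k(1), of n] grid_unit[of "grid_index n s" n] by (simp add: S2_def eps_eq[OF st(1)])
qed

lemma Jx_empty:
  assumes "n \<ge> 1" "(s, t) \<in> S2" "\<omega> \<in> space M"
  shows "Jx \<kappa> n s t [] \<omega> = incr \<kappa> n s t \<omega>"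
  unfolding Jx_eq incr_eq using eps_grid_S2[OF assms(1,2)] x_empty assms(3) by (intro sum.cong) auto

lemma J_path_measurable:
  assumes "(s, t) \<in> S2" "length w \<le> l"
  shows "(\<lambda>\<omega>. J_path n x (h n) s t \<omega> w) \<in> borel_measurable M"
proof (cases "n \<ge> 1")
  case True
  then show ?thesis
    unfolding J_path_def
    using eps_grid_S2[OF True assms(1)] x_measurable assms(2) h_measurable
    by (intro borel_measurable_sum borel_measurable_scaleR) auto
next
  case False
  then show ?thesis by (simp add: J_path_def grid_between_def)
qed

lemma Jx_measurable: "(s, t) \<in> S2 \<Longrightarrow> length w \<le> l \<Longrightarrow> Jx \<kappa> n s t w \<in> borel_measurable M"
  unfolding Jx_def by (rule measurable_compose[OF J_path_measurable]) auto

text \<open>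
  The moment bound extends from grid points to all times, because both sides only depend on the grid
  points that follow the two times.
\<close>

lemma Jx_L2:
  assumes n: "n \<ge> 1" and st: "(s, t) \<in> S2" and w: "length w < l"
  shows "(\<integral>\<^sup>+\<omega>. ennreal ((Jx \<kappa> n s t w \<omega>)\<^sup>2) \<partial>M)
     \<le> ennreal ((\<bar>K\<bar> * (eps n t - eps n s) powr (1/2 + \<nu> * real (length w)))\<^sup>2)"
proof -
  have o: "0 \<le> s" "s \<le> t" "t \<le> 1" using S2_D[OF st] by auto
  define i j where "i = grid_index n s" "j = grid_index n t"
  have ij: "i \<le> j" "j \<le> n" "eps n s = grid n i" "eps n t = grid n j"
    unfolding i_j_def using grid_index_mono[OF o(2)] grid_index_le[OF o(3)] eps_eq o by auto
  have gb: "grid_between n s t = {i..<j}" using grid_between_eq[OF n o(1,3)] by (simp add: i_j_def)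
  show ?thesis
  proof (cases "i < j")
    case False
    then show ?thesis using gb by (simp add: Jx_eq)
  next
    case True
    have gb': "grid_between n (grid n i) (grid n j) = {i..<j}"
      using grid_between_eq[OF n, of "grid n i" "grid n j"] grid_unit ij n by (simp add: grid_index_grid)
    have J: "J_path n x (h n) s t \<omega> = J_path n x (h n) (grid n i) (grid n j) \<omega>" for \<omega>
      unfolding J_path_def gb gb' ij(3) eps_grid[OF n] ..
    have "(grid n i, grid n j) \<in> S2_grid n" using True ij by (auto simp: S2_grid_def)
    then have "Lp_norm 2 M (\<lambda>\<omega>. tnorm (length w) (J_path n x (h n) (grid n i) (grid n j) \<omega>))
        \<le> ennreal (K * (grid n j - grid n i) powr (1/2 + \<nu> * real (length w)))"
      using J_bound n w by blast
    also have "\<dots> \<le> ennreal (\<bar>K\<bar> * (grid n j - grid n i) powr (1/2 + \<nu> * real (length w)))"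
      by (intro ennreal_leI mult_right_mono) auto
    finally have "(\<integral>\<^sup>+\<omega>. ennreal ((tnorm (length w) (J_path n x (h n) (grid n i) (grid n j) \<omega>))\<^sup>2) \<partial>M)
        \<le> ennreal ((\<bar>K\<bar> * (grid n j - grid n i) powr (1/2 + \<nu> * real (length w)))\<^sup>2)"
      by (rule Lp_norm_2_le) simp
    moreover have "(\<integral>\<^sup>+\<omega>. ennreal ((Jx \<kappa> n s t w \<omega>)\<^sup>2) \<partial>M)
        \<le> (\<integral>\<^sup>+\<omega>. ennreal ((tnorm (length w) (J_path n x (h n) (grid n i) (grid n j) \<omega>))\<^sup>2) \<partial>M)"
    proof (intro nn_integral_mono ennreal_leI)
      fix \<omega>
      have a: "\<bar>Jx \<kappa> n s t w \<omega>\<bar> \<le> norm (J_path n x (h n) s t \<omega> w)"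
        unfolding Jx_def by (rule component_le_norm_cart)
      also have "\<dots> \<le> tnorm (length w) (J_path n x (h n) (grid n i) (grid n j) \<omega>)"
        unfolding J by (rule norm_le_tnorm)
      finally show "(Jx \<kappa> n s t w \<omega>)\<^sup>2 \<le> (tnorm (length w) (J_path n x (h n) (grid n i) (grid n j) \<omega>))\<^sup>2"
        using abs_ge_self order_trans by (intro abs_le_square_iff[THEN iffD1]) blast
    qed
    ultimately show ?thesis unfolding ij(3,4) by (rule order_trans[rotated])
  qed
qed

lemma Jx_tight:
  assumes st: "(s, t) \<in> S2" and w: "length w < l"
  shows "tight_along M sequentially (\<lambda>n. Jx \<kappa> n s t w)"
proof (rule tight_square[where C="\<bar>K\<bar>\<^sup>2"])
  show "\<forall>\<^sub>F n in sequentially. Jx \<kappa> n s t w \<in> borel_measurable M \<and>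
      (\<integral>\<^sup>+\<omega>. ennreal ((Jx \<kappa> n s t w \<omega>)\<^sup>2) \<partial>M) \<le> ennreal (\<bar>K\<bar>\<^sup>2)"
    using eventually_ge_at_top[of 1]
  proof eventually_elim
    case (elim n)
    have e: "eps n s \<in> {0..1}" "eps n t \<in> {0..1}" "eps n s \<le> eps n t"
      using S2_D[OF st] eps_unit eps_mono by auto
    have "(eps n t - eps n s) powr (1/2 + \<nu> * real (length w)) \<le> 1"
      using e nu by (intro powr_le1) auto
    then have "(\<bar>K\<bar> * (eps n t - eps n s) powr (1/2 + \<nu> * real (length w)))\<^sup>2 \<le> (\<bar>K\<bar> * 1)\<^sup>2"
      by (intro power_mono mult_left_mono) auto
    then have "ennreal ((\<bar>K\<bar> * (eps n t - eps n s) powr (1/2 + \<nu> * real (length w)))\<^sup>2) \<le> ennreal (\<bar>K\<bar>\<^sup>2)"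
      by (intro ennreal_leI) simp
    then show ?case
      by (intro conjI Jx_measurable[OF st less_imp_le[OF w]] order_trans[OF Jx_L2[OF elim st w]])
  qed
qed

lemma x_eps_vanishes:
  assumes st: "(s, t) \<in> S2" and w: "length w \<le> l"
  shows "vanishes M sequentially (\<lambda>n \<omega>. x (eps n s) (eps n t) \<omega> w - x s t \<omega> w)"
proof (cases "w = []")
  case True
  have S: "(eps n s, eps n t) \<in> S2" for n
    using S2_D[OF st] eps_unit[of s n] eps_unit[of t n] eps_mono[of s t n] by (auto simp: S2_def)
  show ?thesis
    by (rule vanishes_cong[OF vanishes_zero])
       (intro always_eventually allI AE_I2, simp add: True x_empty[OF S] x_empty[OF st])
next
  case False
  have S: "(eps n s, eps n t) \<in> S2" for n
    using S2_D[OF st] eps_unit[of s n] eps_unit[of t n] eps_mono[of s t n] by (auto simp: S2_def)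
  show ?thesis
  proof (rule vanishes_AE_lim)
    show "(\<lambda>\<omega>. x (eps n s) (eps n t) \<omega> w - x s t \<omega> w) \<in> borel_measurable M" for n
      using x_measurable[OF S w] x_measurable[OF st w] by auto
    show "AE \<omega> in M. (\<lambda>n. x (eps n s) (eps n t) \<omega> w - x s t \<omega> w) \<longlonglongrightarrow> 0"
      using x_continuous
    proof eventually_elim
      case (elim \<omega>)
      then have c: "continuous_on S2 (\<lambda>p. x (fst p) (snd p) \<omega> w)" using False w by (simp add: case_prod_unfold)
      have "(\<lambda>n. x (fst (eps n s, eps n t)) (snd (eps n s, eps n t)) \<omega> w) \<longlonglongrightarrow> x (fst (s, t)) (snd (s, t)) \<omega> w"
        by (rule continuous_on_tendsto_compose[OF c]) (use S st in \<open>auto intro!: tendsto_Pair eps_tendsto\<close>)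
      then have "(\<lambda>n. x (eps n s) (eps n t) \<omega> w) \<longlonglongrightarrow> x s t \<omega> w" by simp
      from tendsto_diff[OF this tendsto_const[of "x s t \<omega> w"]] show ?case by simp
    qed
  qed
qed

end

section \<open>Joint convergence with weights measurable with respect to the rough path\<close>

lemma eventually_sequentially_ge1:
  assumes "\<forall>\<^sub>F m in sequentially. Q m"
  shows "\<exists>m\<ge>1. Q m"
  using assms unfolding eventually_sequentially by (metis nle_le)

lemma conv_in_distr_compose:
  assumes "conv_in_distr M X Y" "continuous_on UNIV \<Phi>"
  shows "conv_in_distr M (\<lambda>n \<omega>. \<Phi> (X n \<omega>)) (\<lambda>\<omega>. \<Phi> (Y \<omega>))"
  unfolding conv_in_distr_def
proof (intro allI impI, elim conjE)
  fix f :: "'c \<Rightarrow> real" assume f: "continuous_on UNIV f" "bounded (range f)"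
  have "continuous_on UNIV (\<lambda>z. f (\<Phi> z))"
    using f(1) assms(2) by (rule continuous_on_compose2) auto
  moreover have "bounded (range (\<lambda>z. f (\<Phi> z)))"
    by (rule bounded_subset[OF f(2)]) auto
  ultimately show "(\<lambda>n. \<integral>\<omega>. f (\<Phi> (X n \<omega>)) \<partial>M) \<longlonglongrightarrow> (\<integral>\<omega>. f (\<Phi> (Y \<omega>)) \<partial>M)"
    using assms(1) unfolding conv_in_distr_def by blast
qed

lemma continuous_on_restrict_family:
  assumes "\<And>i. i \<in> I \<Longrightarrow> continuous_on UNIV (\<lambda>z. f i z)"
  shows "continuous_on UNIV (\<lambda>z. \<lambda>i\<in>I. f i z)"
proof (rule continuous_on_coordinatewise_then_product)
  fix i show "continuous_on UNIV (\<lambda>z. (\<lambda>i\<in>I. f i z) i)"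
    by (cases "i \<in> I") (auto simp: restrict_def assms)
qed

lemma measurable_restrict_family:
  fixes f :: "'i::countable \<Rightarrow> 'a \<Rightarrow> 'b::second_countable_topology"
  assumes "\<And>i. i \<in> I \<Longrightarrow> f i \<in> borel_measurable M"
  shows "(\<lambda>\<omega>. \<lambda>i\<in>I. f i \<omega>) \<in> borel_measurable M"
proof (rule measurable_coordinatewise_then_product)
  fix i show "(\<lambda>\<omega>. (\<lambda>i\<in>I. f i \<omega>) i) \<in> borel_measurable M"
    by (cases "i \<in> I") (auto simp: restrict_def assms)
qed

lemma Cauchy_Schwarz_product:
  assumes [measurable]: "f \<in> borel_measurable M" "g \<in> borel_measurable M"
    and "(\<integral>\<^sup>+\<omega>. ennreal ((f \<omega>)\<^sup>2) \<partial>M) \<le> ennreal (a\<^sup>2)" "(\<integral>\<^sup>+\<omega>. ennreal ((g \<omega>)\<^sup>2) \<partial>M) \<le> ennreal (b\<^sup>2)"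
    and ab: "a \<ge> 0" "b \<ge> 0"
  shows "(\<integral>\<^sup>+\<omega>. ennreal \<bar>f \<omega> * g \<omega>\<bar> \<partial>M) \<le> ennreal (a * b)"
proof -
  have "(\<integral>\<^sup>+\<omega>. ennreal \<bar>f \<omega>\<bar> * ennreal \<bar>g \<omega>\<bar> \<partial>M)\<^sup>2
     \<le> (\<integral>\<^sup>+\<omega>. (ennreal \<bar>f \<omega>\<bar>)\<^sup>2 \<partial>M) * (\<integral>\<^sup>+\<omega>. (ennreal \<bar>g \<omega>\<bar>)\<^sup>2 \<partial>M)"
    by (rule Cauchy_Schwarz_nn_integral) auto
  also have "\<dots> \<le> ennreal (a\<^sup>2) * ennreal (b\<^sup>2)"
    using assms(3,4) by (intro mult_mono) (simp_all add: ennreal_power)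
  also have "\<dots> = (ennreal (a * b))\<^sup>2"
    using ab by (simp add: ennreal_power ennreal_mult[symmetric] power_mult_distrib)
  finally have sq: "(\<integral>\<^sup>+\<omega>. ennreal \<bar>f \<omega>\<bar> * ennreal \<bar>g \<omega>\<bar> \<partial>M)\<^sup>2 \<le> (ennreal (a * b))\<^sup>2" .
  define X where "X = (\<integral>\<^sup>+\<omega>. ennreal \<bar>f \<omega>\<bar> * ennreal \<bar>g \<omega>\<bar> \<partial>M)"
  have sq': "X\<^sup>2 \<le> ennreal ((a * b)\<^sup>2)"
    using sq unfolding X_def ennreal_power[OF mult_nonneg_nonneg[OF ab]] .
  have "X \<le> ennreal (a * b)"
  proof (cases X)
    case (real r)
    have "ennreal (r\<^sup>2) \<le> ennreal ((a * b)\<^sup>2)" using sq' unfolding real(2) ennreal_power[OF real(1)] .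
    then have "r\<^sup>2 \<le> (a * b)\<^sup>2" by (rule ennreal_le_iff[THEN iffD1, rotated]) (rule zero_le_power2)
    then have "r \<le> a * b" by (rule power2_le_imp_le) (rule mult_nonneg_nonneg[OF ab])
    then show ?thesis unfolding real(2) by (rule ennreal_leI)
  next
    case top
    have "X\<^sup>2 = \<top>" unfolding top by (simp add: power2_eq_square)
    then have False using sq' by (simp only: top_unique ennreal_neq_top)
    then show ?thesis ..
  qed
  then have "(\<integral>\<^sup>+\<omega>. ennreal \<bar>f \<omega>\<bar> * ennreal \<bar>g \<omega>\<bar> \<partial>M) \<le> ennreal (a * b)" unfolding X_def .
  then show ?thesis by (simp add: abs_mult ennreal_mult)
qed

context rough_increments
begin

lemma fdd_finite:
  fixes P :: "(real \<times> real) set"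
  assumes P: "finite P" "P \<subseteq> S2"
  shows "conv_in_distr M
     (\<lambda>n \<omega>. \<lambda>p\<in>P. (trunc l (x (fst p) (snd p) \<omega>), increment n (h n) (fst p) (snd p) \<omega>))
     (\<lambda>\<omega>. \<lambda>p\<in>P. (trunc l (x (fst p) (snd p) \<omega>), W (snd p) \<omega> - W (fst p) \<omega>))"
proof -
  obtain e where e: "bij_betw e {..<card P} P"
    using ex_bij_betw_nat_finite[OF P(1)] by (auto simp: atLeast0LessThan)
  define g where "g = the_inv_into {..<card P} e"
  have g: "g p \<in> {..<card P}" "e (g p) = p" if "p \<in> P" for p
    using that e unfolding g_def
    by (metis bij_betw_def order_refl the_inv_into_into) (metis bij_betw_def e f_the_inv_into_f_bij_betw that)
  have c: "conv_in_distr M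
     (\<lambda>n \<omega>. \<lambda>k\<in>{..<card P}. (trunc l (x (fst (e k)) (snd (e k)) \<omega>), increment n (h n) (fst (e k)) (snd (e k)) \<omega>))
     (\<lambda>\<omega>. \<lambda>k\<in>{..<card P}. (trunc l (x (fst (e k)) (snd (e k)) \<omega>), W (snd (e k)) \<omega> - W (fst (e k)) \<omega>))"
  proof -
    have "\<forall>k<card P. e k \<in> S2" using e P(2) unfolding bij_betw_def by blast
    then show ?thesis using fdd unfolding fdd_conv_def by blast
  qed
  have cont: "continuous_on UNIV (\<lambda>z. \<lambda>p\<in>P. z (g p))"
    by (rule continuous_on_restrict_family) (rule continuous_on_product_coordinates)
  have eq: "(\<lambda>p\<in>P. (\<lambda>k\<in>{..<card P}. (trunc l (x (fst (e k)) (snd (e k)) \<omega>), Y (fst (e k)) (snd (e k)))) (g p))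
      = (\<lambda>p\<in>P. (trunc l (x (fst p) (snd p) \<omega>), Y (fst p) (snd p)))" for \<omega> and Y :: "real \<Rightarrow> real \<Rightarrow> real^'w"
    using g by (auto simp: restrict_def fun_eq_iff)
  show ?thesis
    using conv_in_distr_compose[OF c cont]
    unfolding eq[of _ "\<lambda>s t. increment n (h n) s t \<omega>" for n \<omega>] eq[of _ "\<lambda>s t. W t \<omega> - W s \<omega>" for \<omega>] .
qed

text \<open>
  Convergence with \<open>x\<close> extends to convergence with arbitrary functions \<open>Z\<close> of \<open>x\<close> as additional
  coordinates (stable convergence): \<open>Z\<close> is approximated in probability by cylinder functions \<open>g\<close>, for
  which the claim is contained in the convergence of finite-dimensional distributions, and the error
  is the same on both sides since it does not involve \<open>n\<close>.
\<close>

theorem joint_convergence: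
  fixes p :: "'i::countable \<Rightarrow> real \<times> real" and Z :: "'c::countable \<Rightarrow> 'a \<Rightarrow> real"
  assumes I: "finite I" "\<And>i. i \<in> I \<Longrightarrow> p i \<in> S2"
    and C: "finite C" "\<And>c. c \<in> C \<Longrightarrow> Z c \<in> borel_measurable F"
  shows "conv_in_distr M
     (\<lambda>n \<omega>. (\<lambda>i\<in>I. (trunc l (x (fst (p i)) (snd (p i)) \<omega>), increment n (h n) (fst (p i)) (snd (p i)) \<omega>), \<lambda>c\<in>C. Z c \<omega>))
     (\<lambda>\<omega>. (\<lambda>i\<in>I. (trunc l (x (fst (p i)) (snd (p i)) \<omega>), W (snd (p i)) \<omega> - W (fst (p i)) \<omega>), \<lambda>c\<in>C. Z c \<omega>))"
proof -
  let ?X = "\<lambda>p \<omega>. trunc l (x (fst p) (snd p) \<omega>)"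
  let ?H = "\<lambda>n \<omega>. \<lambda>i\<in>I. (?X (p i) \<omega>, increment n (h n) (fst (p i)) (snd (p i)) \<omega>)"
  let ?W = "\<lambda>\<omega>. \<lambda>i\<in>I. (?X (p i) \<omega>, W (snd (p i)) \<omega> - W (fst (p i)) \<omega>)"
  have ZM: "Z c \<in> borel_measurable M" if "c \<in> C" for c using C(2)[OF that] by (rule measurable_F)
  have app: "approximable M S2 ?X (Z c)" if "c \<in> C" for c
    using C(2)[OF that] unfolding sigma_path_eq
    by (intro approximable_vimage_algebra trunc_pair_measurable)
  define R where "R c m u \<longleftrightarrow> finite (fst u) \<and> fst u \<subseteq> S2 \<and> cylinder (fst u) ?X (snd u) \<and>
      near M (1 / real (Suc m)) (1 / real (Suc m)) (\<lambda>\<omega>. Z c \<omega> - snd u \<omega>)" for c m u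
  have ex: "\<exists>u. R c m u" if "c \<in> C" for c m
  proof -
    have "\<exists>P g. finite P \<and> P \<subseteq> S2 \<and> cylinder P ?X g \<and> near M (1 / real (Suc m)) (1 / real (Suc m)) (\<lambda>\<omega>. Z c \<omega> - g \<omega>)"
      using app[OF that] unfolding approximable_def by (rule allE[of _ "1 / real (Suc m)"]) simp
    then show ?thesis unfolding R_def by auto
  qed
  define P where "P c m = fst (SOME u. R c m u)" for c m
  define g where "g c m = snd (SOME u. R c m u)" for c m
  have g: "\<And>c m. c \<in> C \<Longrightarrow> finite (P c m)" "\<And>c m. c \<in> C \<Longrightarrow> P c m \<subseteq> S2"
    "\<And>c m. c \<in> C \<Longrightarrow> cylinder (P c m) ?X (g c m)"
    "\<And>c m. c \<in> C \<Longrightarrow> near M (1 / real (Suc m)) (1 / real (Suc m)) (\<lambda>\<omega>. Z c \<omega> - g c m \<omega>)"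
    using someI_ex[OF ex] unfolding P_def g_def R_def by blast+
  have van: "vanishes M sequentially (\<lambda>m \<omega>. Z c \<omega> - g c m \<omega>)" if "c \<in> C" for c
    unfolding vanishes_def
  proof (intro allI impI)
    fix \<eta> \<epsilon> :: real assume "\<eta> > 0" "\<epsilon> > 0"
    then have "\<forall>\<^sub>F m in sequentially. 1 / real (Suc m) < min \<eta> \<epsilon>"
      by (intro order_tendstoD[OF LIMSEQ_Suc[OF lim_1_over_n]]) auto
    then show "\<forall>\<^sub>F m in sequentially. near M \<eta> \<epsilon> (\<lambda>\<omega>. Z c \<omega> - g c m \<omega>)"
    proof eventually_elim
      case (elim m)
      show ?case by (rule near_mono[OF g(4)[OF that, of m]]) (use elim in auto)
    qed
  qed
  have tot: "vanishes M sequentially (\<lambda>m \<omega>. \<Sum>c\<in>C. \<bar>Z c \<omega> - g c m \<omega>\<bar>)"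
  proof (rule vanishes_sum)
    fix c assume "c \<in> C"
    show "vanishes M sequentially (\<lambda>m \<omega>. \<bar>Z c \<omega> - g c m \<omega>\<bar>)"
      by (rule vanishes_mono[OF van[OF \<open>c \<in> C\<close>]]) auto
  qed
  have Hm: "?H n \<in> borel_measurable M" for n
    using I by (intro measurable_restrict_family borel_measurable_Pair trunc_pair_measurable increment_measurable) auto
  have Wm: "?W \<in> borel_measurable M"
  proof (intro measurable_restrict_family borel_measurable_Pair trunc_pair_measurable borel_measurable_diff W_measurable)
    fix i assume i: "i \<in> I"
    show "p i \<in> S2" "fst (p i) \<in> {0..1}" "snd (p i) \<in> {0..1}"
      using I(2)[OF i] S2_D[of "fst (p i)" "snd (p i)"] by auto
  qed
  have cylM: "G \<in> borel_measurable M" if cyl: "cylinder Q ?X G" and Q: "finite Q" "Q \<subseteq> S2" for Q and G :: "'a \<Rightarrow> real"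
  proof -
    obtain \<psi> where \<psi>: "continuous_on UNIV \<psi>" "\<And>\<omega>. G \<omega> = \<psi> (\<lambda>p\<in>Q. ?X p \<omega>)"
      using cyl unfolding cylinder_def by auto
    obtain e :: "nat \<Rightarrow> real \<times> real" where e: "bij_betw e {..<card Q} Q"
      using ex_bij_betw_nat_finite[OF Q(1)] by (auto simp: atLeast0LessThan)
    define k where "k = the_inv_into {..<card Q} e"
    have k: "k q \<in> {..<card Q}" "e (k q) = q" if "q \<in> Q" for q
      using that e unfolding k_def
      by (metis bij_betw_def order_refl the_inv_into_into) (metis bij_betw_def e f_the_inv_into_f_bij_betw that)
    have eq: "(\<lambda>p\<in>Q. ?X p \<omega>) = (\<lambda>p\<in>Q. (\<lambda>i\<in>{..<card Q}. ?X (e i) \<omega>) (k p))" for \<omega>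
      using k by (auto simp: restrict_def fun_eq_iff)
    have c: "continuous_on UNIV (\<lambda>z. \<psi> (\<lambda>p\<in>Q. z (k p)))"
      by (rule continuous_on_compose2[OF \<psi>(1)], rule continuous_on_restrict_family)
         (auto intro: continuous_on_product_coordinates)
    have "(\<lambda>\<omega>. \<lambda>i\<in>{..<card Q}. ?X (e i) \<omega>) \<in> borel_measurable M"
      using e Q(2) by (intro measurable_restrict_family trunc_pair_measurable) (auto simp: bij_betw_def)
    from measurable_compose[OF this borel_measurable_continuous_onI[OF c]]
    have "(\<lambda>\<omega>. \<psi> (\<lambda>p\<in>Q. (\<lambda>i\<in>{..<card Q}. ?X (e i) \<omega>) (k p))) \<in> borel_measurable M" .
    moreover have "G = (\<lambda>\<omega>. \<psi> (\<lambda>p\<in>Q. (\<lambda>i\<in>{..<card Q}. ?X (e i) \<omega>) (k p)))"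
      by (rule ext) (simp only: \<psi>(2) eq)
    ultimately show ?thesis by (simp only:)
  qed
  have gM: "g c m \<in> borel_measurable M" if "c \<in> C" for c m
    using cylM[OF g(3)[OF that] g(1)[OF that] g(2)[OF that]] .
  show ?thesis
  proof (rule convergence_together[where U="\<lambda>m n \<omega>. (?H n \<omega>, \<lambda>c\<in>C. g c m \<omega>)" and V="\<lambda>m \<omega>. (?W \<omega>, \<lambda>c\<in>C. g c m \<omega>)"])
    show "(\<lambda>\<omega>. (?H n \<omega>, \<lambda>c\<in>C. Z c \<omega>)) \<in> borel_measurable M" for n
      by (intro borel_measurable_Pair Hm measurable_restrict_family ZM)
    show "(\<lambda>\<omega>. (?W \<omega>, \<lambda>c\<in>C. Z c \<omega>)) \<in> borel_measurable M"
      by (intro borel_measurable_Pair Wm measurable_restrict_family ZM)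
    show "(\<lambda>\<omega>. (?H n \<omega>, \<lambda>c\<in>C. g c m \<omega>)) \<in> borel_measurable M" for m n
      by (intro borel_measurable_Pair Hm measurable_restrict_family gM)
    show "(\<lambda>\<omega>. (?W \<omega>, \<lambda>c\<in>C. g c m \<omega>)) \<in> borel_measurable M" for m
      by (intro borel_measurable_Pair Wm measurable_restrict_family gM)
    show "conv_in_distr M (\<lambda>n \<omega>. (?H n \<omega>, \<lambda>c\<in>C. g c m \<omega>)) (\<lambda>\<omega>. (?W \<omega>, \<lambda>c\<in>C. g c m \<omega>))" for m
    proof -
      define Q where "Q = p ` I \<union> (\<Union>c\<in>C. P c m)"
      have "(\<Union>c\<in>C. P c m) \<subseteq> S2" by (rule UN_least) (rule g(2))
      moreover have "finite (\<Union>c\<in>C. P c m)" by (rule finite_UN_I[OF C(1)]) (rule g(1))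
      ultimately have Q: "finite Q" "Q \<subseteq> S2" unfolding Q_def using I by auto
      have "\<forall>c\<in>C. \<exists>\<psi>. continuous_on UNIV \<psi> \<and> (\<forall>\<omega>. g c m \<omega> = \<psi> (\<lambda>p\<in>Q. ?X p \<omega>))"
      proof
        fix c assume c: "c \<in> C"
        have "P c m \<subseteq> Q" unfolding Q_def using c by blast
        from cylinder_mono[OF g(3)[OF c] this]
        show "\<exists>\<psi>. continuous_on UNIV \<psi> \<and> (\<forall>\<omega>. g c m \<omega> = \<psi> (\<lambda>p\<in>Q. ?X p \<omega>))"
          unfolding cylinder_def .
      qed
      then obtain \<psi> where "\<forall>c\<in>C. continuous_on UNIV (\<psi> c) \<and> (\<forall>\<omega>. g c m \<omega> = \<psi> c (\<lambda>p\<in>Q. ?X p \<omega>))"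
        by (rule bchoice[THEN exE])
      then have \<psi>: "\<And>c. c \<in> C \<Longrightarrow> continuous_on UNIV (\<psi> c)"
          "\<And>c \<omega>. c \<in> C \<Longrightarrow> g c m \<omega> = \<psi> c (\<lambda>p\<in>Q. ?X p \<omega>)"
        by blast+
      let ?\<Phi> = "\<lambda>z :: (real \<times> real) \<Rightarrow> ('d list \<Rightarrow> real) \<times> (real^'w). (\<lambda>i\<in>I. z (p i), \<lambda>c\<in>C. \<psi> c (\<lambda>q\<in>Q. fst (z q)))"
      have cont: "continuous_on UNIV ?\<Phi>"
      proof (intro continuous_on_Pair continuous_on_restrict_family)
        fix c assume "c \<in> C"
        show "continuous_on UNIV (\<lambda>z :: (real \<times> real) \<Rightarrow> ('d list \<Rightarrow> real) \<times> (real^'w). \<psi> c (\<lambda>q\<in>Q. fst (z q)))"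
          by (rule continuous_on_compose2[OF \<psi>(1)[OF \<open>c \<in> C\<close>]], rule continuous_on_restrict_family)
             (auto intro!: continuous_on_fst continuous_on_product_coordinates)
      qed (rule continuous_on_product_coordinates)
      have e1: "?\<Phi> (\<lambda>p\<in>Q. (?X p \<omega>, Y p)) = (\<lambda>i\<in>I. (?X (p i) \<omega>, Y (p i)), \<lambda>c\<in>C. g c m \<omega>)" for \<omega> and Y :: "real \<times> real \<Rightarrow> real^'w"
      proof -
        have r: "(\<lambda>q\<in>Q. fst ((\<lambda>p\<in>Q. (?X p \<omega>, Y p)) q)) = (\<lambda>q\<in>Q. ?X q \<omega>)"
          by (rule restrict_ext) simp
        have pI: "p i \<in> Q" if "i \<in> I" for i using that by (simp add: Q_def)
        have A: "(\<lambda>i\<in>I. (\<lambda>p\<in>Q. (?X p \<omega>, Y p)) (p i)) = (\<lambda>i\<in>I. (?X (p i) \<omega>, Y (p i)))"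
          by (rule restrict_ext) (simp only: pI restrict_apply if_True)
        have B: "(\<lambda>c\<in>C. \<psi> c (\<lambda>q\<in>Q. ?X q \<omega>)) = (\<lambda>c\<in>C. g c m \<omega>)"
          by (rule restrict_ext) (rule \<psi>(2)[symmetric])
        show ?thesis unfolding r A B ..
      qed
      show ?thesis
        using conv_in_distr_compose[OF fdd_finite[OF Q] cont] unfolding e1 .
    qed
    fix \<delta> :: real assume \<delta>: "\<delta> > 0"
    then have "\<forall>\<^sub>F m in sequentially. near M (\<delta>/2) \<delta> (\<lambda>\<omega>. \<Sum>c\<in>C. \<bar>Z c \<omega> - g c m \<omega>\<bar>)"
      using tot unfolding vanishes_def by auto
    from eventually_sequentially_ge1[OF this] obtain m where m: "m \<ge> 1" "near M (\<delta>/2) \<delta> (\<lambda>\<omega>. \<Sum>c\<in>C. \<bar>Z c \<omega> - g c m \<omega>\<bar>)"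
      by blast
    have d: "dist (a, \<lambda>c\<in>C. g c m \<omega>) (a, \<lambda>c\<in>C. Z c \<omega>) \<le> 2 * (\<Sum>c\<in>C. \<bar>Z c \<omega> - g c m \<omega>\<bar>)" for \<omega> and a :: "'i \<Rightarrow> ('d list \<Rightarrow> real) \<times> (real^'w)"
    proof -
      have *: "dist ((\<lambda>c\<in>C. g c m \<omega>) c) ((\<lambda>c\<in>C. Z c \<omega>) c) \<le> (\<Sum>c\<in>C. \<bar>Z c \<omega> - g c m \<omega>\<bar>)" for c
      proof (cases "c \<in> C")
        case True
        then have "\<bar>Z c \<omega> - g c m \<omega>\<bar> \<le> (\<Sum>c\<in>C. \<bar>Z c \<omega> - g c m \<omega>\<bar>)" using C(1) by (intro member_le_sum) auto
        then show ?thesis using True by (simp add: dist_real_def abs_minus_commute)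
      qed (auto intro!: sum_nonneg)
      have "dist (\<lambda>c\<in>C. g c m \<omega>) (\<lambda>c\<in>C. Z c \<omega>) \<le> 2 * (\<Sum>c\<in>C. \<bar>Z c \<omega> - g c m \<omega>\<bar>)"
        by (rule dist_fun_le) (rule *)
      then show ?thesis by (simp only: dist_Pair_Pair dist_self power_zero_numeral add_0 real_sqrt_abs abs_of_nonneg[OF zero_le_dist])
    qed
    have n1: "near M \<delta> \<delta> (\<lambda>\<omega>. dist (A \<omega>, \<lambda>c\<in>C. g c m \<omega>) (A \<omega>, \<lambda>c\<in>C. Z c \<omega>))" for A :: "'a \<Rightarrow> 'i \<Rightarrow> ('d list \<Rightarrow> real) \<times> (real^'w)"
    proof -
      obtain B where B: "B \<in> sets M" "measure M B < \<delta>" "\<And>\<omega>. \<omega> \<in> space M - B \<Longrightarrow> \<bar>\<Sum>c\<in>C. \<bar>Z c \<omega> - g c m \<omega>\<bar>\<bar> \<le> \<delta>/2"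
        using m(2) unfolding near_def by auto
      have "\<bar>dist (A \<omega>, \<lambda>c\<in>C. g c m \<omega>) (A \<omega>, \<lambda>c\<in>C. Z c \<omega>)\<bar> \<le> \<delta>" if "\<omega> \<in> space M - B" for \<omega>
        using d[of "A \<omega>" \<omega>] B(3)[OF that] zero_le_dist[of "(A \<omega>, \<lambda>c\<in>C. g c m \<omega>)" "(A \<omega>, \<lambda>c\<in>C. Z c \<omega>)"] unfolding abs_le_iff by linarith
      then show ?thesis unfolding near_def using B by blast
    qed
    show "\<exists>m\<ge>1. near M \<delta> \<delta> (\<lambda>\<omega>. dist (?W \<omega>, \<lambda>c\<in>C. g c m \<omega>) (?W \<omega>, \<lambda>c\<in>C. Z c \<omega>)) \<and>
        (\<forall>\<^sub>F n in sequentially. near M \<delta> \<delta> (\<lambda>\<omega>. dist (?H n \<omega>, \<lambda>c\<in>C. Z c \<omega>) (?H n \<omega>, \<lambda>c\<in>C. g c m \<omega>)))"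
      using m(1) n1 by (intro exI[of _ m]) (simp add: dist_commute)
  qed
qed

text \<open>
  Over disjoint intervals the limit of a weighted sum of increments is a Wiener sum, whose second
  moment is at most the sum of the second moments of the weights times the lengths. In contrast to
  an estimate of the sums themselves this uses the orthogonality of the Brownian increments.
\<close>

corollary weighted_increments_near:
  fixes p q :: "'c::countable \<Rightarrow> real" and Z :: "'c \<Rightarrow> 'a \<Rightarrow> real"
  assumes C: "finite C" and pq: "\<And>c. c \<in> C \<Longrightarrow> p c \<in> {0..1} \<and> q c \<in> {0..1} \<and> p c \<le> q c"
    and dj: "\<And>a b. a \<in> C \<Longrightarrow> b \<in> C \<Longrightarrow> a \<noteq> b \<Longrightarrow> q a \<le> p b \<or> q b \<le> p a"
    and Z: "\<And>c. c \<in> C \<Longrightarrow> Z c \<in> borel_measurable F"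
    and c: "\<And>c. c \<in> C \<Longrightarrow> (\<integral>\<^sup>+\<omega>. ennreal ((Z c \<omega>)\<^sup>2) \<partial>M) \<le> ennreal (b c)" "\<And>c. c \<in> C \<Longrightarrow> 0 \<le> b c"
    and small: "(\<Sum>c\<in>C. b c * (q c - p c)) < \<eta>\<^sup>2 * \<epsilon>" and \<eta>: "0 < \<eta>"
  shows "\<forall>\<^sub>F n in sequentially. near M \<eta> \<epsilon> (\<lambda>\<omega>. \<Sum>c\<in>C. Z c \<omega> * incr \<kappa> n (p c) (q c) \<omega>)"
proof -
  have S: "(p c, q c) \<in> S2" if "c \<in> C" for c using pq[OF that] by (auto simp: S2_def)
  have ZM: "Z c \<in> borel_measurable M" if "c \<in> C" for c using Z[OF that] by (rule measurable_F)
  let ?\<Phi> = "\<lambda>(z, u). \<Sum>c\<in>C. u c * (snd (z c) $ \<kappa>)"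
  have cont: "continuous_on UNIV (?\<Phi> :: ('c \<Rightarrow> ('d list \<Rightarrow> real) \<times> (real^'w)) \<times> ('c \<Rightarrow> real) \<Rightarrow> real)"
    unfolding case_prod_unfold
  proof (intro continuous_on_sum continuous_on_mult continuous_on_component continuous_on_snd)
    fix c
    show "continuous_on UNIV (\<lambda>z :: ('c \<Rightarrow> ('d list \<Rightarrow> real) \<times> (real^'w)) \<times> ('c \<Rightarrow> real). snd z c)"
      by (rule continuous_on_product_then_coordinatewise) (intro continuous_intros)
    show "continuous_on UNIV (\<lambda>z :: ('c \<Rightarrow> ('d list \<Rightarrow> real) \<times> (real^'w)) \<times> ('c \<Rightarrow> real). fst z c)"
      by (rule continuous_on_product_then_coordinatewise) (intro continuous_intros)
  qed
  have J: "conv_in_distr M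
     (\<lambda>n \<omega>. (\<lambda>c\<in>C. (trunc l (x (p c) (q c) \<omega>), increment n (h n) (p c) (q c) \<omega>), \<lambda>c\<in>C. Z c \<omega>))
     (\<lambda>\<omega>. (\<lambda>c\<in>C. (trunc l (x (p c) (q c) \<omega>), W (q c) \<omega> - W (p c) \<omega>), \<lambda>c\<in>C. Z c \<omega>))"
    by (rule joint_convergence[where p="\<lambda>c. (p c, q c)", unfolded fst_conv snd_conv, OF C S C Z])
  have e: "?\<Phi> (\<lambda>c\<in>C. (A c, B c), \<lambda>c\<in>C. Z c \<omega>) = (\<Sum>c\<in>C. Z c \<omega> * (B c $ \<kappa>))" for A :: "'c \<Rightarrow> 'd list \<Rightarrow> real" and B :: "'c \<Rightarrow> real^'w" and \<omega>
    unfolding prod.case by (intro sum.cong) auto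
  have conv: "conv_in_distr M
    (\<lambda>n \<omega>. \<Sum>c\<in>C. Z c \<omega> * incr \<kappa> n (p c) (q c) \<omega>)
    (\<lambda>\<omega>. \<Sum>c\<in>C. Z c \<omega> * (W (q c) \<omega> $ \<kappa> - W (p c) \<omega> $ \<kappa>))"
    using conv_in_distr_compose[OF J cont] unfolding e incr_def vector_minus_component .
  show ?thesis
  proof (rule conv_in_distr_near[OF _ _ conv])
    show "(\<lambda>\<omega>. \<Sum>c\<in>C. Z c \<omega> * incr \<kappa> n (p c) (q c) \<omega>) \<in> borel_measurable M" for n
      using ZM by (intro borel_measurable_sum borel_measurable_times incr_measurable) auto
    show "(\<lambda>\<omega>. \<Sum>c\<in>C. Z c \<omega> * (W (q c) \<omega> $ \<kappa> - W (p c) \<omega> $ \<kappa>)) \<in> borel_measurable M"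
      using ZM pq by (intro borel_measurable_sum borel_measurable_times borel_measurable_diff W_comp_measurable) auto
    show "(\<integral>\<^sup>+\<omega>. ennreal ((\<Sum>c\<in>C. Z c \<omega> * (W (q c) \<omega> $ \<kappa> - W (p c) \<omega> $ \<kappa>))\<^sup>2) \<partial>M) \<le> ennreal (\<Sum>c\<in>C. b c * (q c - p c))"
      by (rule second_moment_bound[OF C pq dj Z c])
    show "0 \<le> (\<Sum>c\<in>C. b c * (q c - p c))"
      using c(2) pq by (intro sum_nonneg mult_nonneg_nonneg) auto
  qed (use small \<eta> in auto)
qed

lemma x_eps_S2:
  assumes "(s, t) \<in> S2"
  shows "(eps n s, eps n t) \<in> S2"
  using S2_D[OF assms] eps_unit[of s n] eps_unit[of t n] eps_mono[of s t n] by (auto simp: S2_def)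

section \<open>Riemann sums for the discrete integrals of the rough path\<close>

text \<open>
  Over every interval the integral \<open>J(x; h\<^sup>n)\<close> at the word \<open>w\<close> is approximated in the iterated limit by
  Riemann sums of \<open>h\<^sup>n\<close> along uniform partitions.
\<close>

definition riemann_sums_converge :: "'w \<Rightarrow> 'd list \<Rightarrow> bool" where
  "riemann_sums_converge \<kappa> w \<longleftrightarrow> (\<forall>a b. 0 \<le> a \<and> a < b \<and> b \<le> 1 \<longrightarrow>
     vanishes M iter (\<lambda>(m, n) \<omega>. Jx \<kappa> n a b w \<omega> -
       (\<Sum>j<m. x a (unif_point a b m j) \<omega> w * incr \<kappa> n (unif_point a b m j) (unif_point a b m (Suc j)) \<omega>)))"

lemma unif_S2:
  assumes "m \<ge> 1" "0 \<le> a" "a \<le> b" "b \<le> 1" "i \<le> j" "j \<le> m"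
  shows "(unif_point a b m i, unif_point a b m j) \<in> S2"
  using unif_point_bounds[OF assms(1,3), of i] unif_point_bounds[OF assms(1,3), of j]
    unif_point_mono[OF assms(1,3,5)] assms by (auto simp: S2_def)

text \<open>
  On each of the \<open>m\<close> pieces the integral is replaced by a Riemann sum with \<open>m'\<close> terms. For fixed \<open>m\<close>
  the error vanishes as first \<open>n\<close> and then \<open>m'\<close> tend to infinity, and what remains is a sum of
  weighted increments over disjoint intervals of total length at most one. Its limit as \<open>n \<rightarrow> \<infinity>\<close> has
  second moment at most \<open>C m\<^bsup>-2\<nu>|w|\<^esup>\<close>, uniformly in \<open>m'\<close>.
\<close>

lemma weighted_J_vanishes:
  assumes ref: "riemann_sums_converge \<kappa> w" and w: "w \<noteq> []" "length w < l" and ab: "0 \<le> a" "a < b" "b \<le> 1"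
    and Z: "\<And>m j. m \<ge> 1 \<Longrightarrow> j < m \<Longrightarrow> Z m j \<in> borel_measurable F"
    and C: "C \<ge> 0" "\<And>m j u. m \<ge> 1 \<Longrightarrow> j < m \<Longrightarrow> unif_point a b m j \<le> u \<Longrightarrow> u \<le> unif_point a b m (Suc j) \<Longrightarrow>
      (\<integral>\<^sup>+\<omega>. ennreal ((Z m j \<omega> * x (unif_point a b m j) u \<omega> w)\<^sup>2) \<partial>M) \<le> ennreal (C * (1 / real m) powr (2 * \<nu> * real (length w)))"
  shows "vanishes M iter (\<lambda>(m, n) \<omega>. \<Sum>j<m. Z m j \<omega> * Jx \<kappa> n (unif_point a b m j) (unif_point a b m (Suc j)) w \<omega>)"
  unfolding vanishes_def eventually_iter
proof (intro allI impI)
  fix \<eta> \<epsilon> :: real assume h: "\<eta> > 0" "\<epsilon> > 0"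
  define \<beta> where "\<beta> = 2 * \<nu> * real (length w)"
  have \<beta>: "\<beta> > 0" using nu w by (simp add: \<beta>_def)
  have "(\<lambda>m. (1 / real m) powr \<beta>) \<longlonglongrightarrow> 0"
  proof -
    have "(\<lambda>m. (1 / real m) powr \<beta>) \<longlonglongrightarrow> 0 powr \<beta>"
      by (intro tendsto_powr' lim_1_over_n tendsto_const) (use \<beta> in auto)
    then show ?thesis by simp
  qed
  then have "(\<lambda>m. C * (1 / real m) powr \<beta>) \<longlonglongrightarrow> C * 0"
    by (intro tendsto_mult tendsto_const)
  then have "\<forall>\<^sub>F m in sequentially. C * (1 / real m) powr \<beta> < (\<eta>/2)\<^sup>2 * (\<epsilon>/2)"
    by (rule order_tendstoD) (use h in simp)
  then show "\<forall>\<^sub>F m in sequentially. \<forall>\<^sub>F n in sequentially. near M \<eta> \<epsilon>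
       ((\<lambda>(m, n) \<omega>. \<Sum>j<m. Z m j \<omega> * Jx \<kappa> n (unif_point a b m j) (unif_point a b m (Suc j)) w \<omega>) (m, n))"
    using eventually_ge_at_top[of 1]
  proof eventually_elim
    case (elim m)
    note m = elim(2)
    let ?s = "unif_point a b m"
    let ?u = "\<lambda>j m'. unif_point (?s j) (?s (Suc j)) m'"
    have s: "0 \<le> ?s j" "?s j < ?s (Suc j)" "?s (Suc j) \<le> 1" if "j < m" for j
      using unif_point_bounds(1)[OF m, of a b j] unif_point_bounds(2)[OF m, of a b "Suc j"] unif_point_less[OF m ab(2)] ab that
      by auto
    have ZM: "Z m j \<in> borel_measurable M" if "j < m" for j using Z[OF m that] by (rule measurable_F)
    have fine: "vanishes M iter (\<lambda>(m', n) \<omega>. Z m j \<omega> * (Jx \<kappa> n (?s j) (?s (Suc j)) w \<omega> -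
       (\<Sum>j'<m'. x (?s j) (?u j m' j') \<omega> w * incr \<kappa> n (?u j m' j') (?u j m' (Suc j')) \<omega>)))" if j: "j < m" for j
    proof -
      have "vanishes M iter (\<lambda>i \<omega>. (\<lambda>(m', n) \<omega>. Jx \<kappa> n (?s j) (?s (Suc j)) w \<omega> -
       (\<Sum>j'<m'. x (?s j) (?u j m' j') \<omega> w * incr \<kappa> n (?u j m' j') (?u j m' (Suc j')) \<omega>)) i \<omega> * Z m j \<omega>)"
        using ref s[OF j] unfolding riemann_sums_converge_def by (intro vanishes_mult_tight tight_const ZM j) blast
      then show ?thesis by (simp add: case_prod_unfold mult.commute)
    qed
    have "vanishes M iter (\<lambda>i \<omega>. \<Sum>j<m. (\<lambda>(m', n) \<omega>. Z m j \<omega> * (Jx \<kappa> n (?s j) (?s (Suc j)) w \<omega> -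
       (\<Sum>j'<m'. x (?s j) (?u j m' j') \<omega> w * incr \<kappa> n (?u j m' j') (?u j m' (Suc j')) \<omega>))) i \<omega>)"
      by (rule vanishes_sum) (use fine in auto)
    then have "\<forall>\<^sub>F m' in sequentially. \<forall>\<^sub>F n in sequentially. near M (\<eta>/2) (\<epsilon>/2)
       (\<lambda>\<omega>. \<Sum>j<m. Z m j \<omega> * (Jx \<kappa> n (?s j) (?s (Suc j)) w \<omega> -
       (\<Sum>j'<m'. x (?s j) (?u j m' j') \<omega> w * incr \<kappa> n (?u j m' j') (?u j m' (Suc j')) \<omega>)))"
      unfolding vanishes_def eventually_iter using h by simp
    from eventually_sequentially_ge1[OF this] obtain m' where m': "m' \<ge> 1" and N: "\<forall>\<^sub>F n in sequentially. near M (\<eta>/2) (\<epsilon>/2)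
       (\<lambda>\<omega>. \<Sum>j<m. Z m j \<omega> * (Jx \<kappa> n (?s j) (?s (Suc j)) w \<omega> -
       (\<Sum>j'<m'. x (?s j) (?u j m' j') \<omega> w * incr \<kappa> n (?u j m' j') (?u j m' (Suc j')) \<omega>)))"
      by blast
    let ?C = "{..<m} \<times> {..<m'}"
    let ?p = "\<lambda>(j, j'). ?u j m' j'"
    let ?q = "\<lambda>(j, j'). ?u j m' (Suc j')"
    let ?Z = "\<lambda>(j, j') \<omega>. Z m j \<omega> * x (?s j) (?u j m' j') \<omega> w"
    have ub: "?s j \<le> ?u j m' j'" "?u j m' j' \<le> ?s (Suc j)" if "j < m" "j' \<le> m'" for j j'
      using unif_point_bounds[OF m' less_imp_le[OF s(2)[OF that(1)]] that(2)] by auto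
    have "\<forall>\<^sub>F n in sequentially. near M (\<eta>/2) (\<epsilon>/2) (\<lambda>\<omega>. \<Sum>c\<in>?C. ?Z c \<omega> * incr \<kappa> n (?p c) (?q c) \<omega>)"
    proof (rule weighted_increments_near[where b="\<lambda>_. C * (1 / real m) powr \<beta>"])
      fix c assume "c \<in> ?C"
      then obtain j j' where c: "c = (j, j')" "j < m" "j' < m'" by auto
      have le: "?u j m' j' \<le> ?u j m' (Suc j')" using unif_point_less[OF m' s(2)[OF c(2)]] by (simp add: less_imp_le)
      show "?p c \<in> {0..1} \<and> ?q c \<in> {0..1} \<and> ?p c \<le> ?q c"
        using ub[OF c(2), of j'] ub[OF c(2), of "Suc j'"] c le s[OF c(2)] by auto
      show "?Z c \<in> borel_measurable F"
        unfolding c prod.case using ub[OF c(2), of j'] s[OF c(2)] c w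
        by (intro borel_measurable_times Z[OF m c(2)] x_F_measurable) (auto simp: S2_def)
      show "(\<integral>\<^sup>+\<omega>. ennreal ((?Z c \<omega>)\<^sup>2) \<partial>M) \<le> ennreal (C * (1 / real m) powr \<beta>)"
        unfolding c prod.case \<beta>_def using ub[OF c(2), of j'] c by (intro C(2)[OF m c(2)]) auto
      show "0 \<le> C * (1 / real m) powr \<beta>" using C(1) by simp
    next
      fix c d assume "c \<in> ?C" "d \<in> ?C" "c \<noteq> d"
      then obtain j j' i i' where c: "c = (j, j')" "j < m" "j' < m'" and d: "d = (i, i')" "i < m" "i' < m'" by auto
      have sep: "?u j m' (Suc j') \<le> ?u i m' i'" if "j < i" "j < m" "i < m" "j' < m'" "i' < m'" for i i' j j'
        using ub(2)[of j "Suc j'"] ub(1)[of i i'] unif_point_mono[OF m, of a b "Suc j" i] that ab by auto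
      have sep': "?u j m' (Suc j') \<le> ?u j m' i'" if "j' < i'" "j < m" for i' j j'
        using unif_point_mono[OF m', of "?s j" "?s (Suc j)" "Suc j'" i'] s[OF that(2)] that by auto
      consider "j < i" | "i < j" | "j = i" "j' < i'" | "j = i" "i' < j'" using \<open>c \<noteq> d\<close> c d by fastforce
      then show "?q c \<le> ?p d \<or> ?q d \<le> ?p c"
        by cases (use sep sep' c d in auto)
    next
      have "(\<Sum>c\<in>?C. ?q c - ?p c) = (\<Sum>j<m. \<Sum>j'<m'. ?u j m' (Suc j') - ?u j m' j')"
        by (simp add: sum.cartesian_product case_prod_unfold)
      also have "\<dots> = (\<Sum>j<m. ?s (Suc j) - ?s j)"
        unfolding sum_lessThan_telescope unif_point_last[OF m'] unif_point_0 ..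
      also have "\<dots> = b - a" unfolding sum_lessThan_telescope unif_point_last[OF m] unif_point_0 ..
      finally have tot: "(\<Sum>c\<in>?C. ?q c - ?p c) = b - a" .
      have "(\<Sum>c\<in>?C. C * (1 / real m) powr \<beta> * (?q c - ?p c)) = C * (1 / real m) powr \<beta> * (b - a)"
        unfolding sum_distrib_left[symmetric] tot ..
      also have "\<dots> \<le> C * (1 / real m) powr \<beta> * 1" using ab C(1) by (intro mult_left_mono) auto
      finally show "(\<Sum>c\<in>?C. C * (1 / real m) powr \<beta> * (?q c - ?p c)) < (\<eta>/2)\<^sup>2 * (\<epsilon>/2)" using elim(1) by simp
    qed (use h in auto)
    with N show ?case
    proof eventually_elim
      case (elim n)
      have eq: "(\<Sum>c\<in>?C. ?Z c \<omega> * incr \<kappa> n (?p c) (?q c) \<omega>) = (\<Sum>j<m. Z m j \<omega> *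
          (\<Sum>j'<m'. x (?s j) (?u j m' j') \<omega> w * incr \<kappa> n (?u j m' j') (?u j m' (Suc j')) \<omega>))" for \<omega>
        by (simp add: sum.cartesian_product sum_distrib_left mult.assoc case_prod_unfold)
      have "near M \<eta> (\<epsilon>/2 + \<epsilon>/2) (\<lambda>\<omega>. \<Sum>j<m. Z m j \<omega> * Jx \<kappa> n (?s j) (?s (Suc j)) w \<omega>)"
      proof (rule near_comb[OF elim])
        fix \<omega>
        assume 1: "\<bar>\<Sum>j<m. Z m j \<omega> * (Jx \<kappa> n (?s j) (?s (Suc j)) w \<omega> -
          (\<Sum>j'<m'. x (?s j) (?u j m' j') \<omega> w * incr \<kappa> n (?u j m' j') (?u j m' (Suc j')) \<omega>))\<bar> \<le> \<eta>/2"
        assume 2: "\<bar>\<Sum>c\<in>?C. ?Z c \<omega> * incr \<kappa> n (?p c) (?q c) \<omega>\<bar> \<le> \<eta>/2"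
        show "\<bar>\<Sum>j<m. Z m j \<omega> * Jx \<kappa> n (?s j) (?s (Suc j)) w \<omega>\<bar> \<le> \<eta>"
          using 1 2 unfolding eq right_diff_distrib sum_subtractf by linarith
      qed
      then show ?case by simp
    qed
  qed
qed

end

context rough_increments
begin

lemma grid_sum_split:
  assumes n: "n \<ge> 1" and m: "m \<ge> 1" and ab: "0 \<le> a" "a \<le> b" "b \<le> 1"
  shows "(\<Sum>k\<in>grid_between n a b. g k :: real)
    = (\<Sum>j<m. \<Sum>k\<in>grid_between n (unif_point a b m j) (unif_point a b m (Suc j)). g k)"
proof -
  define c where "c j = grid_index n (unif_point a b m j)" for j
  have gb: "grid_between n (unif_point a b m j) (unif_point a b m (Suc j)) = {c j..<c (Suc j)}" if "j < m" for j
    unfolding c_def using unif_point_bounds[OF m ab(2), of j] unif_point_bounds[OF m ab(2), of "Suc j"] that ab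
    by (intro grid_between_eq[OF n]) auto
  have "(\<Sum>j<m. \<Sum>k\<in>grid_between n (unif_point a b m j) (unif_point a b m (Suc j)). g k)
     = (\<Sum>j<m. \<Sum>k\<in>{c j..<c (Suc j)}. g k)"
    by (rule sum.cong) (use gb in auto)
  also have "\<dots> = (\<Sum>k\<in>{c 0..<c m}. g k)"
    unfolding c_def by (intro sum_partition grid_index_mono unif_point_mono[OF m ab(2)]) auto
  also have "{c 0..<c m} = grid_between n a b"
    unfolding c_def unif_point_0 unif_point_last[OF m] using grid_between_eq[OF n ab(1,3)] by simp
  finally show ?thesis by simp
qed

text \<open>
  The second bound concerns a weight from \<open>x\<close> multiplied by a further value of \<open>x\<close>; the fourth moments
  of the rough path enter here, through the Cauchy-Schwarz inequality.
\<close>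

lemma x_L2_bounds:
  "\<exists>C\<ge>0. (\<forall>s t w. (s, t) \<in> S2 \<and> w \<noteq> [] \<and> length w \<le> l \<longrightarrow>
       (\<integral>\<^sup>+\<omega>. ennreal ((x s t \<omega> w)\<^sup>2) \<partial>M) \<le> ennreal (C * (t - s) powr (2 * \<nu> * real (length w)))) \<and>
     (\<forall>a b s t v w. (a, b) \<in> S2 \<and> v \<noteq> [] \<and> length v \<le> l \<and> (s, t) \<in> S2 \<and> w \<noteq> [] \<and> length w \<le> l \<longrightarrow>
       (\<integral>\<^sup>+\<omega>. ennreal ((x a b \<omega> v * x s t \<omega> w)\<^sup>2) \<partial>M) \<le> ennreal (C * (t - s) powr (2 * \<nu> * real (length w))))"
proof -
  obtain C where C: "C \<ge> 0" "\<And>s t w. (s, t) \<in> S2 \<Longrightarrow> w \<noteq> [] \<Longrightarrow> length w \<le> l \<Longrightarrow>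
     (\<integral>\<^sup>+\<omega>. ennreal ((x s t \<omega> w)^4) \<partial>M) \<le> ennreal (C * (t - s) powr (4 * \<nu> * real (length w)))"
    using x_L4 by blast
  have half: "C * (t - s) powr (4 * \<nu> * real k) = (sqrt C * (t - s) powr (2 * \<nu> * real k))\<^sup>2" for t s k
  proof -
    have p: "(t - s) powr (4 * \<nu> * real k) = ((t - s) powr (2 * \<nu> * real k))\<^sup>2"
      by (simp add: power2_eq_square powr_add[symmetric] mult.assoc)
    show ?thesis unfolding p power_mult_distrib using C(1) by simp
  qed
  have sq: "(\<integral>\<^sup>+\<omega>. ennreal (((x s t \<omega> w)\<^sup>2)\<^sup>2) \<partial>M) \<le> ennreal ((sqrt C * (t - s) powr (2 * \<nu> * real (length w)))\<^sup>2)"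
    if "(s, t) \<in> S2" "w \<noteq> []" "length w \<le> l" for s t w
    using C(2)[OF that] unfolding half by simp
  have meas: "(\<lambda>\<omega>. (x s t \<omega> w)\<^sup>2) \<in> borel_measurable M" if "(s, t) \<in> S2" "length w \<le> l" for s t w
    using x_measurable[OF that] by simp
  show ?thesis
  proof (intro exI[of _ "C + sqrt C"] conjI allI impI)
    show "0 \<le> C + sqrt C" using C(1) by simp
  next
    fix s t :: real and w :: "'d list" assume w: "(s, t) \<in> S2 \<and> w \<noteq> [] \<and> length w \<le> l"
    have "(\<integral>\<^sup>+\<omega>. ennreal \<bar>(x s t \<omega> w)\<^sup>2 * 1\<bar> \<partial>M) \<le> ennreal (sqrt C * (t - s) powr (2 * \<nu> * real (length w)) * 1)"
    proof (rule Cauchy_Schwarz_product)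
      show "(\<integral>\<^sup>+\<omega>. ennreal (1\<^sup>2) \<partial>M) \<le> ennreal (1\<^sup>2)" by (simp add: emeasure_space_1)
    qed (use sq w C(1) meas in auto)
    also have "\<dots> \<le> ennreal ((C + sqrt C) * (t - s) powr (2 * \<nu> * real (length w)))"
      using C(1) by (intro ennreal_leI) (simp add: distrib_right)
    finally show "(\<integral>\<^sup>+\<omega>. ennreal ((x s t \<omega> w)\<^sup>2) \<partial>M) \<le> ennreal ((C + sqrt C) * (t - s) powr (2 * \<nu> * real (length w)))"
      by simp
  next
    fix a b s t :: real and v w :: "'d list"
    assume w: "(a, b) \<in> S2 \<and> v \<noteq> [] \<and> length v \<le> l \<and> (s, t) \<in> S2 \<and> w \<noteq> [] \<and> length w \<le> l"
    have "(\<integral>\<^sup>+\<omega>. ennreal \<bar>(x a b \<omega> v)\<^sup>2 * (x s t \<omega> w)\<^sup>2\<bar> \<partial>M)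
       \<le> ennreal (sqrt C * (b - a) powr (2 * \<nu> * real (length v)) * (sqrt C * (t - s) powr (2 * \<nu> * real (length w))))"
      by (rule Cauchy_Schwarz_product) (use sq w C(1) meas in auto)
    also have "\<dots> \<le> ennreal ((C + sqrt C) * (t - s) powr (2 * \<nu> * real (length w)))"
    proof (rule ennreal_leI)
      have "(b - a) powr (2 * \<nu> * real (length v)) \<le> 1"
        using w nu by (intro powr_le1) (auto simp: S2_def)
      then have "sqrt C * (b - a) powr (2 * \<nu> * real (length v)) * (sqrt C * (t - s) powr (2 * \<nu> * real (length w)))
         \<le> sqrt C * 1 * (sqrt C * (t - s) powr (2 * \<nu> * real (length w)))"
        using C(1) by (intro mult_right_mono mult_left_mono) auto
      also have "\<dots> = C * (t - s) powr (2 * \<nu> * real (length w))" using C(1) by simp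
      also have "\<dots> \<le> (C + sqrt C) * (t - s) powr (2 * \<nu> * real (length w))"
        using C(1) by (intro mult_right_mono) auto
      finally show "sqrt C * (b - a) powr (2 * \<nu> * real (length v)) * (sqrt C * (t - s) powr (2 * \<nu> * real (length w)))
         \<le> (C + sqrt C) * (t - s) powr (2 * \<nu> * real (length w))" .
    qed
    finally show "(\<integral>\<^sup>+\<omega>. ennreal ((x a b \<omega> v * x s t \<omega> w)\<^sup>2) \<partial>M) \<le> ennreal ((C + sqrt C) * (t - s) powr (2 * \<nu> * real (length w)))"
      by (simp add: power_mult_distrib)
  qed
qed

lemma mesh_powr:
  assumes "m \<ge> 1" "0 \<le> a" "a < b" "b \<le> 1" "unif_point a b m j \<le> u" "u \<le> unif_point a b m (Suc j)"
  shows "(u - unif_point a b m j) powr (2 * \<nu> * real k) \<le> (1 / real m) powr (2 * \<nu> * real k)"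
proof (rule powr_mono2)
  have "u - unif_point a b m j \<le> (b - a) / real m" using unif_point_step[OF assms(1), of a b j] assms(6) by linarith
  also have "\<dots> \<le> 1 / real m" using assms by (intro divide_right_mono) auto
  finally show "u - unif_point a b m j \<le> 1 / real m" .
qed (use assms nu in auto)

text \<open>
  Changing the base point of the integrand from \<open>a\<close> to \<open>s\<close>. Both are moved to the grid, since the
  discrete integral from \<open>s\<close> has its integrand based at \<open>eps n s\<close>.
\<close>

lemma chen_shift:
  "AE \<omega> in M. \<forall>n\<ge>1. \<forall>a s t w. 0 \<le> a \<and> a \<le> s \<and> s \<le> t \<and> t \<le> 1 \<and> length w \<le> l \<longrightarrow>
     (\<Sum>k\<in>grid_between n s t. x (eps n a) (grid n k) \<omega> w * cell \<kappa> n k \<omega>)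
       = (\<Sum>i\<le>length w. x (eps n a) (eps n s) \<omega> (take i w) * Jx \<kappa> n s t (drop i w) \<omega>)"
  using chen
proof eventually_elim
  case (elim \<omega>)
  show ?case
  proof (intro allI impI, elim conjE)
    fix n :: nat and a s t :: real and w :: "'d list"
    assume n: "1 \<le> n" and o: "0 \<le> a" "a \<le> s" "s \<le> t" "t \<le> 1" and w: "length w \<le> l"
    have st: "(s, t) \<in> S2" using o by (auto simp: S2_def)
    have "(\<Sum>k\<in>grid_between n s t. x (eps n a) (grid n k) \<omega> w * cell \<kappa> n k \<omega>)
      = (\<Sum>k\<in>grid_between n s t. \<Sum>i\<le>length w. x (eps n a) (eps n s) \<omega> (take i w) * (x (eps n s) (grid n k) \<omega> (drop i w) * cell \<kappa> n k \<omega>))"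
    proof (rule sum.cong)
      fix k assume k: "k \<in> grid_between n s t"
      have "x (eps n a) (grid n k) \<omega> w = (\<Sum>i\<le>length w. x (eps n a) (eps n s) \<omega> (take i w) * x (eps n s) (grid n k) \<omega> (drop i w))"
        using elim eps_grid_S2[OF n st k] eps_unit[of a n] eps_mono[OF o(2), of n] o w by (auto simp: S2_def)
      then show "x (eps n a) (grid n k) \<omega> w * cell \<kappa> n k \<omega>
        = (\<Sum>i\<le>length w. x (eps n a) (eps n s) \<omega> (take i w) * (x (eps n s) (grid n k) \<omega> (drop i w) * cell \<kappa> n k \<omega>))"
        by (simp add: sum_distrib_right mult.assoc)
    qed simp
    also have "\<dots> = (\<Sum>i\<le>length w. x (eps n a) (eps n s) \<omega> (take i w) * Jx \<kappa> n s t (drop i w) \<omega>)"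
      unfolding Jx_eq sum_distrib_left by (rule sum.swap)
    finally show "(\<Sum>k\<in>grid_between n s t. x (eps n a) (grid n k) \<omega> w * cell \<kappa> n k \<omega>)
       = (\<Sum>i\<le>length w. x (eps n a) (eps n s) \<omega> (take i w) * Jx \<kappa> n s t (drop i w) \<omega>)" .
  qed
qed

lemma uniform_sums_vanish:
  assumes w: "w \<noteq> []" "length w < l" and ab: "0 \<le> a" "a < b" "b \<le> 1"
  shows "vanishes M iter (\<lambda>(m, n) \<omega>. \<Sum>j<m. Jx \<kappa> n (unif_point a b m j) (unif_point a b m (Suc j)) w \<omega>)"
proof -
  let ?s = "unif_point a b"
  let ?k = "length w"
  let ?A = "\<lambda>m n \<omega>. tnorm ?k (\<lambda>w. \<Sum>j<m. J_path n x (h n) (?s m j) (?s m (Suc j)) \<omega> w)"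
  have k: "?k \<in> {1..l - 1}" using w by (auto simp: Suc_le_eq)
  have "0 \<le> ?s m 0 \<and> ?s m m \<le> 1 \<and> (\<forall>j<m. ?s m j < ?s m (Suc j) \<and> ?s m (Suc j) - ?s m j \<le> 1 / real m)" if m: "m \<ge> 1" for m
    using unif_point_less[OF m ab(2)] unif_point_step[OF m, of a b] ab m
    by (auto simp: unif_point_0 unif_point_last[OF m] intro!: divide_right_mono)
  then have lim: "lim_limsup_in_prob M ?A" using small k by blast
  have meas: "?A m n \<in> borel_measurable M" for m n
  proof (cases "m \<ge> 1")
    case True
    have "(\<lambda>\<omega>. J_path n x (h n) (?s m j) (?s m (Suc j)) \<omega> v) \<in> borel_measurable M" if "v \<in> words ?k" "j < m" for v j
      using unif_S2[OF True, of a b j "Suc j"] ab that w by (intro J_path_measurable) (auto simp: words_def)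
    then have "(\<lambda>\<omega>. \<Sum>v\<in>words ?k. (norm (\<Sum>j<m. J_path n x (h n) (?s m j) (?s m (Suc j)) \<omega> v))\<^sup>2) \<in> borel_measurable M"
      by (intro borel_measurable_sum borel_measurable_power borel_measurable_norm) auto
    then show ?thesis
      unfolding tnorm_def L2_set_def by (rule measurable_compose) simp
  next
    case False
    then have "m = 0" by simp
    then show ?thesis by (simp add: tnorm_def L2_set_def)
  qed
  have v: "vanishes M iter (\<lambda>(m, n). ?A m n)"
    by (rule lim_limsup_imp_vanishes[OF meas lim])
  show ?thesis
  proof (rule vanishes_mono[OF v], intro always_eventually allI AE_I2)
    fix i :: "nat \<times> nat" and \<omega>
    obtain m n where i: "i = (m, n)" by (cases i)
    have "\<bar>\<Sum>j<m. Jx \<kappa> n (?s m j) (?s m (Suc j)) w \<omega>\<bar> = \<bar>(\<Sum>j<m. J_path n x (h n) (?s m j) (?s m (Suc j)) \<omega> w) $ \<kappa>\<bar>"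
      by (simp add: Jx_def sum_component)
    also have "\<dots> \<le> norm (\<Sum>j<m. J_path n x (h n) (?s m j) (?s m (Suc j)) \<omega> w)"
      by (rule component_le_norm_cart)
    also have "\<dots> \<le> ?A m n \<omega>" by (rule norm_le_tnorm)
    also have "\<dots> \<le> \<bar>?A m n \<omega>\<bar>" by simp
    finally show "\<bar>(case i of (m, n) \<Rightarrow> \<lambda>\<omega>. \<Sum>j<m. Jx \<kappa> n (?s m j) (?s m (Suc j)) w \<omega>) \<omega>\<bar> \<le> \<bar>(case i of (m, n) \<Rightarrow> ?A m n) \<omega>\<bar>"
      unfolding i prod.case .
  qed
qed

text \<open>
  Chen's relation splits the integral from \<open>a\<close> to \<open>b\<close> along the partition. The terms in which \<open>h\<^sup>n\<close> is
  integrated against a word of length zero are the Riemann sum; those in which all of \<open>w\<close> is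
  integrated afresh on each piece add up to a sum that vanishes by hypothesis; in the mixed terms the
  integrated word is shorter, so they vanish by the induction hypothesis and \<open>weighted_J_vanishes\<close>.
\<close>

theorem riemann_sums_converge_all:
  assumes "w \<noteq> []" "length w < l"
  shows "riemann_sums_converge \<kappa> w"
  using assms
proof (induction "length w" arbitrary: w rule: less_induct)
  case less
  note w = less.prems
  let ?k = "length w"
  show ?case
    unfolding riemann_sums_converge_def
  proof (intro allI impI, elim conjE)
    fix a b :: real assume ab: "0 \<le> a" "a < b" "b \<le> 1"
    let ?s = "unif_point a b"
    let ?J = "\<lambda>m n j v \<omega>. Jx \<kappa> n (?s m j) (?s m (Suc j)) v \<omega>"
    \<comment> \<open>the cost of moving the times of the weights from the grid to the partition\<close>
    define Freeze where "Freeze = (\<lambda>(m, n) \<omega>. \<Sum>i\<in>{1..?k}. \<Sum>j<m.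
        (x (eps n a) (eps n (?s m j)) \<omega> (take i w) - x a (?s m j) \<omega> (take i w)) * ?J m n j (drop i w) \<omega>)"
    define Mixed where "Mixed = (\<lambda>(m, n) \<omega>. \<Sum>i\<in>{1..<?k}. \<Sum>j<m. x a (?s m j) \<omega> (take i w) * ?J m n j (drop i w) \<omega>)"
    define Top where "Top = (\<lambda>(m, n) \<omega>. \<Sum>j<m. ?J m n j w \<omega>)"
    have S2: "(a, ?s m j) \<in> S2" "(?s m j, ?s m (Suc j)) \<in> S2" if "m \<ge> 1" "j < m" for m j
      using unif_S2[OF that(1), of a b 0 j] unif_S2[OF that(1), of a b j "Suc j"] ab that by (auto simp: unif_point_0)
    have V1: "vanishes M iter Freeze"
    proof (rule vanishes_iterI)
      fix m :: nat assume m: "m \<ge> 1"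
      show "vanishes M sequentially (\<lambda>n. Freeze (m, n))"
        unfolding Freeze_def prod.case
        by (intro vanishes_sum vanishes_mult_tight x_eps_vanishes Jx_tight S2[OF m]) (use w in auto)
    qed
    obtain C where C: "C \<ge> 0" "\<And>a b s t v w. (a, b) \<in> S2 \<Longrightarrow> v \<noteq> [] \<Longrightarrow> length v \<le> l \<Longrightarrow> (s, t) \<in> S2 \<Longrightarrow> w \<noteq> [] \<Longrightarrow> length w \<le> l \<Longrightarrow>
       (\<integral>\<^sup>+\<omega>. ennreal ((x a b \<omega> v * x s t \<omega> w)\<^sup>2) \<partial>M) \<le> ennreal (C * (t - s) powr (2 * \<nu> * real (length w)))"
      using x_L2_bounds by blast
    have "vanishes M iter (\<lambda>q \<omega>. \<Sum>i\<in>{1..<?k}. (\<lambda>(m, n) \<omega>. \<Sum>j<m. x a (?s m j) \<omega> (take i w) * ?J m n j (drop i w) \<omega>) q \<omega>)"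
    proof (rule vanishes_sum)
      fix i assume i: "i \<in> {1..<?k}"
      have d: "drop i w \<noteq> []" "length (drop i w) < l" "length (drop i w) < ?k" "take i w \<noteq> []" "length (take i w) \<le> l"
        using i w by auto
      show "vanishes M iter (\<lambda>(m, n) \<omega>. \<Sum>j<m. x a (?s m j) \<omega> (take i w) * ?J m n j (drop i w) \<omega>)"
      proof (rule weighted_J_vanishes[OF less.hyps[OF d(3,1,2)] d(1,2) ab, where C=C])
        show "(\<lambda>\<omega>. x a (?s m j) \<omega> (take i w)) \<in> borel_measurable F" if "m \<ge> 1" "j < m" for m j
          by (rule x_F_measurable[OF S2(1)[OF that] d(5)])
        fix m j u assume m: "m \<ge> 1" "j < m" and u: "?s m j \<le> u" "u \<le> ?s m (Suc j)"
        have "(?s m j, u) \<in> S2" using S2(2)[OF m] u by (auto simp: S2_def)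
        then have "(\<integral>\<^sup>+\<omega>. ennreal ((x a (?s m j) \<omega> (take i w) * x (?s m j) u \<omega> (drop i w))\<^sup>2) \<partial>M)
           \<le> ennreal (C * (u - ?s m j) powr (2 * \<nu> * real (length (drop i w))))"
          using d by (intro C(2) S2(1)[OF m]) auto
        also have "\<dots> \<le> ennreal (C * (1 / real m) powr (2 * \<nu> * real (length (drop i w))))"
          using C(1) by (intro ennreal_leI mult_left_mono mesh_powr[OF m(1) ab u])
        finally show "(\<integral>\<^sup>+\<omega>. ennreal ((x a (?s m j) \<omega> (take i w) * x (?s m j) u \<omega> (drop i w))\<^sup>2) \<partial>M)
           \<le> ennreal (C * (1 / real m) powr (2 * \<nu> * real (length (drop i w))))" .
      qed (rule C(1))
    qed
    then have V2: "vanishes M iter Mixed"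
      unfolding Mixed_def by (simp add: case_prod_unfold)
    have V3: "vanishes M iter Top"
      unfolding Top_def by (rule uniform_sums_vanish[OF w ab])
    have "vanishes M iter (\<lambda>q \<omega>. Freeze q \<omega> + Mixed q \<omega> + Top q \<omega>)"
      by (intro vanishes_add V1 V2 V3)
    then show "vanishes M iter (\<lambda>(m, n) \<omega>. Jx \<kappa> n a b w \<omega> -
       (\<Sum>j<m. x a (?s m j) \<omega> w * incr \<kappa> n (?s m j) (?s m (Suc j)) \<omega>))"
    proof (rule vanishes_cong)
      show "\<forall>\<^sub>F q in iter. AE \<omega> in M. (case q of (m, n) \<Rightarrow> \<lambda>\<omega>. Jx \<kappa> n a b w \<omega> -
       (\<Sum>j<m. x a (?s m j) \<omega> w * incr \<kappa> n (?s m j) (?s m (Suc j)) \<omega>)) \<omega> = Freeze q \<omega> + Mixed q \<omega> + Top q \<omega>"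
        unfolding eventually_iter prod.case
        using eventually_ge_at_top[of 1]
      proof eventually_elim
        case (elim m)
        note m = elim
        show ?case
          using eventually_ge_at_top[of 1]
        proof eventually_elim
          case (elim n)
          note n = elim
          have "AE \<omega> in M. \<omega> \<in> space M" by simp
          with chen_shift[of \<kappa>] show ?case
          proof eventually_elim
            case (elim \<omega>)
            have one: "x (eps n a) (eps n (?s m j)) \<omega> [] = 1" if "j < m" for j
              using x_empty[OF x_eps_S2[OF S2(1)[OF m that]] elim(2)] .
            have "Jx \<kappa> n a b w \<omega> = (\<Sum>j<m. \<Sum>k\<in>grid_between n (?s m j) (?s m (Suc j)). x (eps n a) (grid n k) \<omega> w * cell \<kappa> n k \<omega>)"
              unfolding Jx_eq using ab by (intro grid_sum_split[OF n m]) auto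
            also have "\<dots> = (\<Sum>j<m. \<Sum>i\<le>?k. x (eps n a) (eps n (?s m j)) \<omega> (take i w) * ?J m n j (drop i w) \<omega>)"
            proof (rule sum.cong)
              fix j assume "j \<in> {..<m}"
              then have "0 \<le> a \<and> a \<le> ?s m j \<and> ?s m j \<le> ?s m (Suc j) \<and> ?s m (Suc j) \<le> 1 \<and> ?k \<le> l"
                using S2[OF m, of j] w by (auto simp: S2_def)
              then show "(\<Sum>k\<in>grid_between n (?s m j) (?s m (Suc j)). x (eps n a) (grid n k) \<omega> w * cell \<kappa> n k \<omega>)
                = (\<Sum>i\<le>?k. x (eps n a) (eps n (?s m j)) \<omega> (take i w) * ?J m n j (drop i w) \<omega>)"
                using elim(1) n by blast
            qed simp
            also have "\<dots> = (\<Sum>j<m. ?J m n j w \<omega> + (\<Sum>i\<in>{1..?k}. x (eps n a) (eps n (?s m j)) \<omega> (take i w) * ?J m n j (drop i w) \<omega>))"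
            proof (rule sum.cong)
              fix j assume "j \<in> {..<m}"
              have "{..?k} = insert 0 {1..?k}" by auto
              then show "(\<Sum>i\<le>?k. x (eps n a) (eps n (?s m j)) \<omega> (take i w) * ?J m n j (drop i w) \<omega>)
                = ?J m n j w \<omega> + (\<Sum>i\<in>{1..?k}. x (eps n a) (eps n (?s m j)) \<omega> (take i w) * ?J m n j (drop i w) \<omega>)"
                using one[of j] \<open>j \<in> {..<m}\<close> by simp
            qed simp
            also have "\<dots> = Top (m, n) \<omega> + (\<Sum>i\<in>{1..?k}. \<Sum>j<m. x (eps n a) (eps n (?s m j)) \<omega> (take i w) * ?J m n j (drop i w) \<omega>)"
              unfolding Top_def prod.case sum.distrib by (subst sum.swap) simp
            finally have J: "Jx \<kappa> n a b w \<omega> = Top (m, n) \<omega>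
              + (\<Sum>i\<in>{1..?k}. \<Sum>j<m. x (eps n a) (eps n (?s m j)) \<omega> (take i w) * ?J m n j (drop i w) \<omega>)" .
            have split: "{1..?k} = insert ?k {1..<?k}" using w by (cases w) auto
            have last: "(\<Sum>i\<in>{1..?k}. \<Sum>j<m. x a (?s m j) \<omega> (take i w) * ?J m n j (drop i w) \<omega>)
               = Mixed (m, n) \<omega> + (\<Sum>j<m. x a (?s m j) \<omega> w * incr \<kappa> n (?s m j) (?s m (Suc j)) \<omega>)"
              unfolding split Mixed_def prod.case using Jx_empty[OF n S2(2)[OF m] elim(2)] by simp
            have "Freeze (m, n) \<omega> = (\<Sum>i\<in>{1..?k}. \<Sum>j<m. x (eps n a) (eps n (?s m j)) \<omega> (take i w) * ?J m n j (drop i w) \<omega>)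
               - (\<Sum>i\<in>{1..?k}. \<Sum>j<m. x a (?s m j) \<omega> (take i w) * ?J m n j (drop i w) \<omega>)"
              unfolding Freeze_def prod.case by (simp only: left_diff_distrib sum_subtractf)
            then show ?case using J last by linarith
          qed
        qed
      qed
    qed
  qed
qed

end

section \<open>Sums with bounded adapted controlled weights\<close>

lemma sum_words_split:
  fixes f :: "'d::finite list \<Rightarrow> 'd list \<Rightarrow> real"
  shows "(\<Sum>v\<in>{v. length v < l}. \<Sum>i\<le>length v. f (take i v) (drop i v))
    = (\<Sum>w\<in>{w. length w < l}. \<Sum>p\<in>{p. length p + length w < l}. f p w)"
proof -
  have fin: "finite {p :: 'd list. length p + length w < l}" for w :: "'d list"
    by (rule finite_subset[OF _ finite_words_less[of l]]) auto
  have "(\<Sum>v\<in>{v. length v < l}. \<Sum>i\<le>length v. f (take i v) (drop i v))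
     = (\<Sum>(v, i)\<in>Sigma {v. length v < l} (\<lambda>v. {..length v}). f (take i v) (drop i v))"
    by (rule sum.Sigma) (auto simp: finite_words_less)
  also have "\<dots> = (\<Sum>(w, p)\<in>Sigma {w. length w < l} (\<lambda>w. {p. length p + length w < l}). f p w)"
    by (rule sum.reindex_bij_witness[of _ "\<lambda>(w, p). (p @ w, length p)" "\<lambda>(v, i). (drop i v, take i v)"]) auto
  also have "\<dots> = (\<Sum>w\<in>{w. length w < l}. \<Sum>p\<in>{p. length p + length w < l}. f p w)"
    by (rule sum.Sigma[symmetric]) (auto simp: finite_words_less fin)
  finally show ?thesis .
qed

context rough_increments
begin

text \<open>
  The remainder of a scalar controlled process, with the increment absorbed into the sum as the term of
  the empty word.
\<close>

definition rho :: "(real \<Rightarrow> 'd list \<Rightarrow> 'a \<Rightarrow> real) \<Rightarrow> real \<Rightarrow> real \<Rightarrow> 'd list \<Rightarrow> 'a \<Rightarrow> real" where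
  "rho Y s t w \<omega> = Y t w \<omega> - (\<Sum>v\<in>{v. length v + length w < l}. x s t \<omega> v * Y s (v @ w) \<omega>)"

text \<open>
  Re-expanding around a later base point \<open>u\<close> costs the remainders of all levels between \<open>s\<close> and \<open>u\<close>,
  multiplied by \<open>x\<close> from \<open>u\<close> on: Chen's relation is used for \<open>x\<close> from \<open>s\<close> to \<open>v\<close>.
\<close>

lemma rho_difference:
  "AE \<omega> in M. \<forall>s u v. 0 \<le> s \<and> s \<le> u \<and> u \<le> v \<and> v \<le> 1 \<longrightarrow>
     rho Y s v [] \<omega> - rho Y u v [] \<omega> = (\<Sum>w\<in>{w. length w < l}. rho Y s u w \<omega> * x u v \<omega> w)"
  using chen
proof eventually_elim
  case (elim \<omega>)
  show ?case
  proof (intro allI impI)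
    fix s u v :: real assume o: "0 \<le> s \<and> s \<le> u \<and> u \<le> v \<and> v \<le> 1"
    have "(\<Sum>w\<in>{w. length w < l}. x s v \<omega> w * Y s w \<omega>)
      = (\<Sum>w\<in>{w. length w < l}. \<Sum>i\<le>length w. x s u \<omega> (take i w) * x u v \<omega> (drop i w) * Y s (take i w @ drop i w) \<omega>)"
    proof (rule sum.cong)
      fix w :: "'d list" assume "w \<in> {w. length w < l}"
      then have "x s v \<omega> w = (\<Sum>i\<le>length w. x s u \<omega> (take i w) * x u v \<omega> (drop i w))"
        using elim o by auto
      then show "x s v \<omega> w * Y s w \<omega> = (\<Sum>i\<le>length w. x s u \<omega> (take i w) * x u v \<omega> (drop i w) * Y s (take i w @ drop i w) \<omega>)"
        by (simp add: sum_distrib_right)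
    qed simp
    also have "\<dots> = (\<Sum>w\<in>{w. length w < l}. \<Sum>p\<in>{p. length p + length w < l}. x s u \<omega> p * x u v \<omega> w * Y s (p @ w) \<omega>)"
      by (rule sum_words_split[where f="\<lambda>p w. x s u \<omega> p * x u v \<omega> w * Y s (p @ w) \<omega>"])
    also have "\<dots> = (\<Sum>w\<in>{w. length w < l}. (\<Sum>p\<in>{p. length p + length w < l}. x s u \<omega> p * Y s (p @ w) \<omega>) * x u v \<omega> w)"
      unfolding sum_distrib_right by (intro sum.cong refl) (simp add: mult_ac)
    finally have 1: "(\<Sum>w\<in>{w. length w < l}. x s v \<omega> w * Y s w \<omega>)
       = (\<Sum>w\<in>{w. length w < l}. (\<Sum>p\<in>{p. length p + length w < l}. x s u \<omega> p * Y s (p @ w) \<omega>) * x u v \<omega> w)" .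
    have 2: "rho Y s v [] \<omega> = Y v [] \<omega> - (\<Sum>w\<in>{w. length w < l}. x s v \<omega> w * Y s w \<omega>)"
      "rho Y u v [] \<omega> = Y v [] \<omega> - (\<Sum>w\<in>{w. length w < l}. x u v \<omega> w * Y u w \<omega>)"
      by (simp_all add: rho_def)
    have 3: "(\<Sum>w\<in>{w. length w < l}. rho Y s u w \<omega> * x u v \<omega> w)
      = (\<Sum>w\<in>{w. length w < l}. x u v \<omega> w * Y u w \<omega>)
       - (\<Sum>w\<in>{w. length w < l}. (\<Sum>p\<in>{p. length p + length w < l}. x s u \<omega> p * Y s (p @ w) \<omega>) * x u v \<omega> w)"
      unfolding rho_def left_diff_distrib sum_subtractf by (simp add: mult.commute)
    show "rho Y s v [] \<omega> - rho Y u v [] \<omega> = (\<Sum>w\<in>{w. length w < l}. rho Y s u w \<omega> * x u v \<omega> w)"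
      unfolding 2 3 1 by simp
  qed
qed

context
  fixes Y :: "real \<Rightarrow> 'd list \<Rightarrow> 'a \<Rightarrow> real" and K1 R :: real
  assumes YF: "\<And>t w. t \<in> {0..1} \<Longrightarrow> length w < l \<Longrightarrow> Y t w \<in> borel_measurable F"
    and YR: "\<And>t w. t \<in> {0..1} \<Longrightarrow> length w < l \<Longrightarrow> AE \<omega> in M. \<bar>Y t w \<omega>\<bar> \<le> R"
    and Ycont: "\<And>t w. t \<in> {0..1} \<Longrightarrow> length w < l \<Longrightarrow> vanishes M sequentially (\<lambda>n \<omega>. Y (eps n t) w \<omega> - Y t w \<omega>)"
    and K1: "K1 \<ge> 0"
    and rem: "\<And>s t w. (s, t) \<in> S2 \<Longrightarrow> length w < l \<Longrightarrow>
       (\<integral>\<^sup>+\<omega>. ennreal ((rho Y s t w \<omega>)\<^sup>2) \<partial>M) \<le> ennreal ((K1 * (t - s) powr (real (l - length w) * \<nu>))\<^sup>2)"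
begin

lemma Y_measurable: "t \<in> {0..1} \<Longrightarrow> length w < l \<Longrightarrow> Y t w \<in> borel_measurable M"
  using YF by (rule measurable_F)

lemma rho_measurable:
  assumes st: "(s, t) \<in> S2" and w: "length w < l"
  shows "rho Y s t w \<in> borel_measurable M"
proof -
  have o: "s \<in> {0..1}" "t \<in> {0..1}" using S2_D[OF st] by auto
  show ?thesis
    unfolding rho_def using w
    by (intro borel_measurable_diff borel_measurable_sum borel_measurable_times Y_measurable o x_measurable[OF st]) auto
qed

text \<open>
  What the expansion of the weight at the grid point \<open>i\<close> leaves of its discrete integral up to the
  grid point \<open>j\<close>.
\<close>

definition rem_sum :: "'w \<Rightarrow> nat \<Rightarrow> nat \<Rightarrow> nat \<Rightarrow> 'a \<Rightarrow> real" where
  "rem_sum \<kappa> n i j \<omega> = (\<Sum>k\<in>{i..<j}. rho Y (grid n i) (grid n k) [] \<omega> * cell \<kappa> n k \<omega>)"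

lemma grid_S2: "i \<le> j \<Longrightarrow> j \<le> n \<Longrightarrow> (grid n i, grid n j) \<in> S2"
  using grid_unit[of i n] grid_unit[of j n] grid_mono[of i j n] by (simp add: S2_def)

lemma rem_sum_measurable: "j \<le> n \<Longrightarrow> rem_sum \<kappa> n i j \<in> borel_measurable M"
  unfolding rem_sum_def using l_pos
  by (intro borel_measurable_sum borel_measurable_times rho_measurable grid_S2 cell_measurable) auto

text \<open>
  By \<open>rho_difference\<close> the defect of additivity at an intermediate point is the sum over all words of a
  remainder before that point times a discrete integral after it. The \<open>L\<^sub>2\<close>-norms of the two factors have
  the orders \<open>(l - |w|)\<nu>\<close> and \<open>1/2 + \<nu>|w|\<close> in the length of the interval, so the orders add up to \<open>\<mu> = \<nu>l + 1/2 > 1\<close> for every word, and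
  sewing applies.
\<close>

lemma rem_sum_bound:
  "\<exists>D\<ge>0. \<forall>n\<ge>1. \<forall>i j. i \<le> j \<and> j \<le> n \<longrightarrow>
     (\<integral>\<^sup>+\<omega>. ennreal \<bar>rem_sum \<kappa> n i j \<omega>\<bar> \<partial>M) \<le> ennreal (D * (grid n j - grid n i) powr (\<nu> * real l + 1/2))"
proof -
  define \<mu> where "\<mu> = \<nu> * real l + 1/2"
  have \<mu>: "\<mu> > 1" using l_exponent by (simp add: \<mu>_def)
  define c0 where "c0 = real (card {w :: 'd list. length w < l}) * (K1 * \<bar>K\<bar>)"
  have c0: "c0 \<ge> 0" using K1 by (simp add: c0_def)
  define D where "D = c0 / (1 - (2/3) powr (\<mu> - 1))"
  have "(2/3 :: real) powr (\<mu> - 1) < 1" using \<mu> powr_less_mono2[of "\<mu> - 1" "2/3" 1] by auto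
  then have D: "D \<ge> 0" using c0 by (simp add: D_def)
  show ?thesis
  proof (intro exI[of _ D] conjI allI impI D, elim conjE)
    fix n i j :: nat assume n: "1 \<le> n" and ij: "i \<le> j" "j \<le> n"
    define N where "N i j = (\<integral>\<^sup>+\<omega>. ennreal \<bar>rem_sum \<kappa> n i j \<omega>\<bar> \<partial>M)" for i j
    define C where "C = c0 / real n powr \<mu>"
    have C: "C \<ge> 0" using c0 by (simp add: C_def)
    have gd: "grid n j - grid n i = real (j - i) / real n" if "i \<le> j" for i j
      using that by (simp add: grid_def of_nat_diff diff_divide_distrib)
    have Cg: "C * real (j - i) powr \<mu> = c0 * (grid n j - grid n i) powr \<mu>" if "i \<le> j" for i j
      unfolding gd[OF that] C_def by (simp add: powr_divide)
    have step: "N i (Suc i) = 0" if "i < n" for i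
    proof -
      have S: "(grid n i, grid n i) \<in> S2" using that by (intro grid_S2) auto
      have "(\<integral>\<^sup>+\<omega>. ennreal ((rho Y (grid n i) (grid n i) [] \<omega>)\<^sup>2) \<partial>M) = 0"
        using rem[OF S, of "[]"] l_pos by simp
      then have "AE \<omega> in M. ennreal ((rho Y (grid n i) (grid n i) [] \<omega>)\<^sup>2) = 0"
        using rho_measurable[OF S, of "[]"] l_pos by (subst (asm) nn_integral_0_iff_AE) auto
      then have "AE \<omega> in M. ennreal \<bar>rem_sum \<kappa> n i (Suc i) \<omega>\<bar> = 0"
        by eventually_elim (simp add: rem_sum_def)
      then have "N i (Suc i) = (\<integral>\<^sup>+\<omega>. 0 \<partial>M)" unfolding N_def by (rule nn_integral_cong_AE)
      then show ?thesis by simp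
    qed
    have tri: "N i j \<le> N i k + N k j + ennreal (C * real (j - i) powr \<mu>)" if "i < k" "k < j" "j \<le> n" for i k j
    proof -
      have S: "(grid n i, grid n k) \<in> S2" "(grid n k, grid n j) \<in> S2" using that by (auto intro!: grid_S2)
      let ?P = "\<lambda>w \<omega>. rho Y (grid n i) (grid n k) w \<omega> * Jx \<kappa> n (grid n k) (grid n j) w \<omega>"
      let ?W = "{w :: 'd list. length w < l}"
      have gb: "grid_between n (grid n k) (grid n j) = {k..<j}"
        using that grid_unit[of k n] grid_unit[of j n] by (subst grid_between_eq[OF n]) (auto simp: grid_index_grid[OF n])
      have dec: "AE \<omega> in M. rem_sum \<kappa> n i j \<omega> = rem_sum \<kappa> n i k \<omega> + rem_sum \<kappa> n k j \<omega> + (\<Sum>w\<in>?W. ?P w \<omega>)"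
        using rho_difference[of Y]
      proof eventually_elim
        case (elim \<omega>)
        have d: "rho Y (grid n i) (grid n q) [] \<omega> = rho Y (grid n k) (grid n q) [] \<omega>
           + (\<Sum>w\<in>?W. rho Y (grid n i) (grid n k) w \<omega> * x (grid n k) (grid n q) \<omega> w)" if q: "q \<in> {k..<j}" for q
        proof -
          have "0 \<le> grid n i \<and> grid n i \<le> grid n k \<and> grid n k \<le> grid n q \<and> grid n q \<le> 1"
            using q \<open>i < k\<close> \<open>j \<le> n\<close> grid_mono[of i k n] grid_mono[of k q n] grid_unit[of q n] grid_unit[of i n] by auto
          then have "rho Y (grid n i) (grid n q) [] \<omega> - rho Y (grid n k) (grid n q) [] \<omega>
            = (\<Sum>w\<in>?W. rho Y (grid n i) (grid n k) w \<omega> * x (grid n k) (grid n q) \<omega> w)"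
            using elim by blast
          then show ?thesis by linarith
        qed
        have "rem_sum \<kappa> n i j \<omega> = rem_sum \<kappa> n i k \<omega> + (\<Sum>q\<in>{k..<j}. rho Y (grid n i) (grid n q) [] \<omega> * cell \<kappa> n q \<omega>)"
          unfolding rem_sum_def using that by (simp add: sum.atLeastLessThan_concat)
        also have "(\<Sum>q\<in>{k..<j}. rho Y (grid n i) (grid n q) [] \<omega> * cell \<kappa> n q \<omega>)
          = rem_sum \<kappa> n k j \<omega> + (\<Sum>q\<in>{k..<j}. \<Sum>w\<in>?W. rho Y (grid n i) (grid n k) w \<omega> * (x (grid n k) (grid n q) \<omega> w * cell \<kappa> n q \<omega>))"
          unfolding rem_sum_def sum.distrib[symmetric]
          by (intro sum.cong refl) (simp add: d distrib_right sum_distrib_right mult.assoc)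
        also have "(\<Sum>q\<in>{k..<j}. \<Sum>w\<in>?W. rho Y (grid n i) (grid n k) w \<omega> * (x (grid n k) (grid n q) \<omega> w * cell \<kappa> n q \<omega>))
           = (\<Sum>w\<in>?W. ?P w \<omega>)"
          unfolding Jx_eq gb eps_grid[OF n] sum_distrib_left by (rule sum.swap)
        finally show ?case by simp
      qed
      have Pm: "?P w \<in> borel_measurable M" if "w \<in> ?W" for w
        using that by (intro borel_measurable_times rho_measurable Jx_measurable S) auto
      have Pb: "(\<integral>\<^sup>+\<omega>. ennreal \<bar>?P w \<omega>\<bar> \<partial>M) \<le> ennreal (K1 * \<bar>K\<bar> * (grid n j - grid n i) powr \<mu>)" if "w \<in> ?W" for w
      proof -
        let ?u = "grid n k - grid n i" and ?v = "grid n j - grid n k"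
        have w: "length w < l" using that by simp
        have uv: "0 \<le> ?u" "0 \<le> ?v" "?u \<le> grid n j - grid n i" "?v \<le> grid n j - grid n i" "0 < grid n j - grid n i"
          using S S2_D[OF S(1)] S2_D[OF S(2)] \<open>i < k\<close> \<open>k < j\<close> n by (auto simp: grid_def divide_strict_right_mono)
        have "(\<integral>\<^sup>+\<omega>. ennreal \<bar>?P w \<omega>\<bar> \<partial>M) \<le> ennreal (K1 * ?u powr (real (l - length w) * \<nu>) * (\<bar>K\<bar> * ?v powr (1/2 + \<nu> * real (length w))))"
        proof (rule Cauchy_Schwarz_product)
          show "(\<integral>\<^sup>+\<omega>. ennreal ((rho Y (grid n i) (grid n k) w \<omega>)\<^sup>2) \<partial>M) \<le> ennreal ((K1 * ?u powr (real (l - length w) * \<nu>))\<^sup>2)"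
            by (rule rem[OF S(1) w])
          show "(\<integral>\<^sup>+\<omega>. ennreal ((Jx \<kappa> n (grid n k) (grid n j) w \<omega>)\<^sup>2) \<partial>M) \<le> ennreal ((\<bar>K\<bar> * ?v powr (1/2 + \<nu> * real (length w)))\<^sup>2)"
            using Jx_L2[OF n S(2) w, of \<kappa>] unfolding eps_grid[OF n] .
        qed (use K1 w in \<open>auto intro!: rho_measurable Jx_measurable S\<close>)
        also have "\<dots> \<le> ennreal (K1 * \<bar>K\<bar> * (grid n j - grid n i) powr \<mu>)"
        proof (rule ennreal_leI)
          let ?L = "grid n j - grid n i"
          have "?u powr (real (l - length w) * \<nu>) \<le> ?L powr (real (l - length w) * \<nu>)"
            "?v powr (1/2 + \<nu> * real (length w)) \<le> ?L powr (1/2 + \<nu> * real (length w))"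
            using uv nu by (intro powr_mono2; simp)+
          then have "K1 * ?u powr (real (l - length w) * \<nu>) * (\<bar>K\<bar> * ?v powr (1/2 + \<nu> * real (length w)))
            \<le> K1 * ?L powr (real (l - length w) * \<nu>) * (\<bar>K\<bar> * ?L powr (1/2 + \<nu> * real (length w)))"
            using K1 by (intro mult_mono mult_left_mono) auto
          also have "\<dots> = K1 * \<bar>K\<bar> * (?L powr (real (l - length w) * \<nu>) * ?L powr (1/2 + \<nu> * real (length w)))" by simp
          also have "?L powr (real (l - length w) * \<nu>) * ?L powr (1/2 + \<nu> * real (length w)) = ?L powr \<mu>"
          proof -
            have "real (l - length w) * \<nu> + (1/2 + \<nu> * real (length w)) = \<mu>"
              using w by (simp add: \<mu>_def of_nat_diff algebra_simps)
            then show ?thesis by (metis powr_add)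
          qed
          finally show "K1 * ?u powr (real (l - length w) * \<nu>) * (\<bar>K\<bar> * ?v powr (1/2 + \<nu> * real (length w))) \<le> K1 * \<bar>K\<bar> * ?L powr \<mu>" .
        qed
        finally show ?thesis .
      qed
      have "N i j \<le> (\<integral>\<^sup>+\<omega>. ennreal \<bar>rem_sum \<kappa> n i k \<omega>\<bar> + ennreal \<bar>rem_sum \<kappa> n k j \<omega>\<bar> + (\<Sum>w\<in>?W. ennreal \<bar>?P w \<omega>\<bar>) \<partial>M)"
        unfolding N_def
      proof (rule nn_integral_mono_AE, use dec in eventually_elim)
        case (elim \<omega>)
        have "\<bar>rem_sum \<kappa> n i j \<omega>\<bar> \<le> \<bar>rem_sum \<kappa> n i k \<omega>\<bar> + \<bar>rem_sum \<kappa> n k j \<omega>\<bar> + (\<Sum>w\<in>?W. \<bar>?P w \<omega>\<bar>)"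
          unfolding elim using sum_abs[of "\<lambda>w. ?P w \<omega>" ?W] by linarith
        then have "ennreal \<bar>rem_sum \<kappa> n i j \<omega>\<bar> \<le> ennreal (\<bar>rem_sum \<kappa> n i k \<omega>\<bar> + \<bar>rem_sum \<kappa> n k j \<omega>\<bar> + (\<Sum>w\<in>?W. \<bar>?P w \<omega>\<bar>))"
          by (rule ennreal_leI)
        also have "\<dots> = ennreal \<bar>rem_sum \<kappa> n i k \<omega>\<bar> + ennreal \<bar>rem_sum \<kappa> n k j \<omega>\<bar> + (\<Sum>w\<in>?W. ennreal \<bar>?P w \<omega>\<bar>)"
          by (subst sum_ennreal) (auto simp: ennreal_plus sum_nonneg)
        finally show ?case .
      qed
      also have "\<dots> = N i k + N k j + (\<Sum>w\<in>?W. (\<integral>\<^sup>+\<omega>. ennreal \<bar>?P w \<omega>\<bar> \<partial>M))"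
      proof -
        have [measurable]: "rem_sum \<kappa> n i k \<in> borel_measurable M" "rem_sum \<kappa> n k j \<in> borel_measurable M"
          using that by (auto intro!: rem_sum_measurable)
        have m: "(\<lambda>\<omega>. ennreal \<bar>?P w \<omega>\<bar>) \<in> borel_measurable M" if "w \<in> ?W" for w
          using Pm[OF that] by measurable
        have "(\<lambda>\<omega>. \<Sum>w\<in>?W. ennreal \<bar>?P w \<omega>\<bar>) \<in> borel_measurable M" using m by (rule borel_measurable_sum)
        then show ?thesis unfolding N_def
          by (subst nn_integral_add, simp, simp, subst nn_integral_add, simp, simp, subst nn_integral_sum) (use m in auto)
      qed
      also have "\<dots> \<le> N i k + N k j + (\<Sum>w\<in>?W. ennreal (K1 * \<bar>K\<bar> * (grid n j - grid n i) powr \<mu>))"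
        using Pb by (intro add_left_mono sum_mono)
      also have "(\<Sum>w\<in>?W. ennreal (K1 * \<bar>K\<bar> * (grid n j - grid n i) powr \<mu>)) = ennreal (C * real (j - i) powr \<mu>)"
      proof -
        have "(\<Sum>w\<in>?W. ennreal (K1 * \<bar>K\<bar> * (grid n j - grid n i) powr \<mu>)) = ennreal (\<Sum>w\<in>?W. K1 * \<bar>K\<bar> * (grid n j - grid n i) powr \<mu>)"
          using K1 by (intro sum_ennreal) auto
        also have "(\<Sum>w\<in>?W. K1 * \<bar>K\<bar> * (grid n j - grid n i) powr \<mu>) = C * real (j - i) powr \<mu>"
          unfolding Cg[of i j, OF less_imp_le[OF less_trans[OF that(1,2)]]] c0_def by simp
        finally show ?thesis .
      qed
      finally show ?thesis .
    qed
    show "(\<integral>\<^sup>+\<omega>. ennreal \<bar>rem_sum \<kappa> n i j \<omega>\<bar> \<partial>M) \<le> ennreal (D * (grid n j - grid n i) powr (\<nu> * real l + 1/2))"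
    proof (cases "i < j")
      case True
      have "N i j \<le> ennreal (C / (1 - (2/3) powr (\<mu> - 1)) * real (j - i) powr \<mu>)"
        by (rule discrete_sewing[OF \<mu> C step tri True ij(2)])
      also have "C / (1 - (2/3) powr (\<mu> - 1)) * real (j - i) powr \<mu> = D * (grid n j - grid n i) powr \<mu>"
        using Cg[OF ij(1)] by (simp add: D_def)
      finally show ?thesis unfolding N_def \<mu>_def .
    next
      case False
      then show ?thesis using ij by (simp add: rem_sum_def)
    qed
  qed
qed

text \<open>
  After the expansion at the left ends of the pieces, the levels \<open>i \<ge> 1\<close> vanish by
  \<open>weighted_J_vanishes\<close>, and the \<open>m\<close> remainders contribute at most \<open>m (1/m + 1/n)\<^bsup>\<mu>\<^esup>\<close> up to a constant,
  the extra \<open>1/n\<close> being the distance of the division points from the grid.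
\<close>

theorem controlled_sums_vanish:
  assumes ab: "0 \<le> a" "a < b" "b \<le> 1"
  shows "vanishes M iter (\<lambda>(m, n) \<omega>. (\<Sum>k\<in>grid_between n a b. Y (grid n k) [] \<omega> * cell \<kappa> n k \<omega>) -
     (\<Sum>j<m. Y (unif_point a b m j) [] \<omega> * incr \<kappa> n (unif_point a b m j) (unif_point a b m (Suc j)) \<omega>))"
proof -
  let ?s = "unif_point a b"
  let ?J = "\<lambda>m n j v \<omega>. Jx \<kappa> n (?s m j) (?s m (Suc j)) v \<omega>"
  let ?W = "{w :: 'd list. length w < l}"
  let ?c = "\<lambda>m n j. grid_index n (?s m j)"
  define Freeze where "Freeze = (\<lambda>(m, n) \<omega>. \<Sum>w\<in>?W. \<Sum>j<m. (Y (eps n (?s m j)) w \<omega> - Y (?s m j) w \<omega>) * ?J m n j w \<omega>)"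
  define Mixed where "Mixed = (\<lambda>(m, n) \<omega>. \<Sum>w\<in>?W - {[]}. \<Sum>j<m. Y (?s m j) w \<omega> * ?J m n j w \<omega>)"
  define Top where "Top = (\<lambda>(m, n) \<omega>. \<Sum>j<m. rem_sum \<kappa> n (?c m n j) (?c m n (Suc j)) \<omega>)"
  have S2: "(?s m j, ?s m (Suc j)) \<in> S2" "?s m j \<in> {0..1}" if "m \<ge> 1" "j < m" for m j
    using unif_S2[OF that(1), of a b j "Suc j"] unif_point_bounds[OF that(1), of a b j] ab that by auto
  have V1: "vanishes M iter Freeze"
  proof (rule vanishes_iterI)
    fix m :: nat assume m: "m \<ge> 1"
    show "vanishes M sequentially (\<lambda>n. Freeze (m, n))"
      unfolding Freeze_def prod.case
      by (intro vanishes_sum vanishes_mult_tight Ycont Jx_tight S2[OF m]) auto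
  qed
  obtain C where C: "C \<ge> 0" "\<And>s t w. (s, t) \<in> S2 \<Longrightarrow> w \<noteq> [] \<Longrightarrow> length w \<le> l \<Longrightarrow>
     (\<integral>\<^sup>+\<omega>. ennreal ((x s t \<omega> w)\<^sup>2) \<partial>M) \<le> ennreal (C * (t - s) powr (2 * \<nu> * real (length w)))"
    using x_L2_bounds by blast
  have "vanishes M iter (\<lambda>q \<omega>. \<Sum>w\<in>?W - {[]}. (\<lambda>(m, n) \<omega>. \<Sum>j<m. Y (?s m j) w \<omega> * ?J m n j w \<omega>) q \<omega>)"
  proof (rule vanishes_sum)
    fix w assume "w \<in> ?W - {[]}"
    then have w: "w \<noteq> []" "length w < l" by auto
    show "vanishes M iter (\<lambda>(m, n) \<omega>. \<Sum>j<m. Y (?s m j) w \<omega> * ?J m n j w \<omega>)"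
    proof (rule weighted_J_vanishes[OF riemann_sums_converge_all[OF w] w ab, where C="R\<^sup>2 * C"])
      show "Y (?s m j) w \<in> borel_measurable F" if "m \<ge> 1" "j < m" for m j
        by (rule YF[OF S2(2)[OF that] w(2)])
      fix m j u assume m: "m \<ge> 1" "j < m" and u: "?s m j \<le> u" "u \<le> ?s m (Suc j)"
      have S: "(?s m j, u) \<in> S2" using S2(1)[OF m] u by (auto simp: S2_def)
      have "(\<integral>\<^sup>+\<omega>. ennreal ((Y (?s m j) w \<omega> * x (?s m j) u \<omega> w)\<^sup>2) \<partial>M) \<le> (\<integral>\<^sup>+\<omega>. ennreal (R\<^sup>2) * ennreal ((x (?s m j) u \<omega> w)\<^sup>2) \<partial>M)"
      proof (rule nn_integral_mono_AE, use YR[OF S2(2)[OF m] w(2)] in eventually_elim)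
        case (elim \<omega>)
        have "(Y (?s m j) w \<omega>)\<^sup>2 \<le> R\<^sup>2" using elim by (intro abs_le_square_iff[THEN iffD1]) simp
        then have "(Y (?s m j) w \<omega> * x (?s m j) u \<omega> w)\<^sup>2 \<le> R\<^sup>2 * (x (?s m j) u \<omega> w)\<^sup>2"
          unfolding power_mult_distrib by (rule mult_right_mono) simp
        then show ?case by (simp add: ennreal_mult[symmetric] ennreal_leI)
      qed
      also have "\<dots> = ennreal (R\<^sup>2) * (\<integral>\<^sup>+\<omega>. ennreal ((x (?s m j) u \<omega> w)\<^sup>2) \<partial>M)"
        using x_measurable[OF S, of w] w by (intro nn_integral_cmult) auto
      also have "\<dots> \<le> ennreal (R\<^sup>2) * ennreal (C * (u - ?s m j) powr (2 * \<nu> * real (length w)))"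
        using w by (intro mult_left_mono C(2)[OF S]) auto
      also have "\<dots> = ennreal (R\<^sup>2 * C * (u - ?s m j) powr (2 * \<nu> * real (length w)))"
        using C(1) by (subst ennreal_mult[symmetric]) (auto simp: mult.assoc)
      also have "\<dots> \<le> ennreal (R\<^sup>2 * C * (1 / real m) powr (2 * \<nu> * real (length w)))"
        using C(1) by (intro ennreal_leI mult_left_mono mesh_powr[OF m(1) ab u]) auto
      finally show "(\<integral>\<^sup>+\<omega>. ennreal ((Y (?s m j) w \<omega> * x (?s m j) u \<omega> w)\<^sup>2) \<partial>M)
         \<le> ennreal (R\<^sup>2 * C * (1 / real m) powr (2 * \<nu> * real (length w)))" .
    qed (use C(1) in simp)
  qed
  then have V2: "vanishes M iter Mixed"
    unfolding Mixed_def by (simp add: case_prod_unfold)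
  define \<mu> where "\<mu> = \<nu> * real l + 1/2"
  have \<mu>: "\<mu> > 1" using l_exponent by (simp add: \<mu>_def)
  from rem_sum_bound[of \<kappa>, folded \<mu>_def] obtain D where D0: "D \<ge> 0" and D1: "\<forall>n\<ge>1. \<forall>i j. i \<le> j \<and> j \<le> n \<longrightarrow>
     (\<integral>\<^sup>+\<omega>. ennreal \<bar>rem_sum \<kappa> n i j \<omega>\<bar> \<partial>M) \<le> ennreal (D * (grid n j - grid n i) powr \<mu>)"
    by (elim exE conjE)
  have D: "D \<ge> 0" "\<And>n i j. n \<ge> 1 \<Longrightarrow> i \<le> j \<Longrightarrow> j \<le> n \<Longrightarrow>
     (\<integral>\<^sup>+\<omega>. ennreal \<bar>rem_sum \<kappa> n i j \<omega>\<bar> \<partial>M) \<le> ennreal (D * (grid n j - grid n i) powr \<mu>)"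
    using D0 D1[rule_format, OF _ conjI] by simp_all
  have V3: "vanishes M iter Top"
  proof (rule vanishes_nn_integral[where a="\<lambda>(m, n). real m * (D * (1 / real m + 1 / real n) powr \<mu>)"])
    have "(\<lambda>m. (D * 2 powr \<mu>) * real m powr (1 - \<mu>)) \<longlonglongrightarrow> (D * 2 powr \<mu>) * 0"
      using \<mu> by (intro tendsto_mult tendsto_const tendsto_neg_powr filterlim_real_sequentially) auto
    then have lim: "(\<lambda>m. (D * 2 powr \<mu>) * real m powr (1 - \<mu>)) \<longlonglongrightarrow> 0" by simp
    show "((\<lambda>(m, n). real m * (D * (1 / real m + 1 / real n) powr \<mu>)) \<longlongrightarrow> 0) iter"
    proof (rule tendstoI)
      fix e :: real assume "e > 0"
      then have "\<forall>\<^sub>F m in sequentially. (D * 2 powr \<mu>) * real m powr (1 - \<mu>) < e"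
        by (rule order_tendstoD(2)[OF lim])
      then show "\<forall>\<^sub>F q in iter. dist (case q of (m, n) \<Rightarrow> real m * (D * (1 / real m + 1 / real n) powr \<mu>)) 0 < e"
        unfolding eventually_iter prod.case using eventually_ge_at_top[of 1]
      proof eventually_elim
        case (elim m)
        show ?case using eventually_ge_at_top[of m]
        proof eventually_elim
          case (elim n)
          have m: "m \<ge> 1" by fact
          have "1 / real m + 1 / real n \<le> 2 / real m" using m elim by (simp add: field_simps)
          then have "(1 / real m + 1 / real n) powr \<mu> \<le> (2 / real m) powr \<mu>"
            using \<mu> by (intro powr_mono2) auto
          then have "real m * (D * (1 / real m + 1 / real n) powr \<mu>) \<le> real m * (D * (2 / real m) powr \<mu>)"
            using D(1) by (intro mult_left_mono) auto
          also have "\<dots> = (D * 2 powr \<mu>) * real m powr (1 - \<mu>)"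
            using m by (simp add: powr_divide powr_diff)
          also have "\<dots> < e" by fact
          finally show ?case using D(1) by (simp add: dist_real_def)
        qed
      qed
    qed
    show "\<forall>\<^sub>F i in iter. Top i \<in> borel_measurable M \<and>
        (\<integral>\<^sup>+\<omega>. ennreal \<bar>Top i \<omega>\<bar> \<partial>M) \<le> ennreal (case i of (m, n) \<Rightarrow> real m * (D * (1 / real m + 1 / real n) powr \<mu>))"
      unfolding eventually_iter prod.case using eventually_ge_at_top[of 1]
    proof eventually_elim
      case (elim m)
      note m = elim
      show ?case using eventually_ge_at_top[of 1]
      proof eventually_elim
        case (elim n)
        note n = elim
        have le: "?c m n (Suc j) \<le> n" "?c m n j \<le> ?c m n (Suc j)" if "j < m" for j
          using S2_D[OF S2(1)[OF m that]] by (auto intro: grid_index_le grid_index_mono)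
        have rm: "rem_sum \<kappa> n (?c m n j) (?c m n (Suc j)) \<in> borel_measurable M" if "j < m" for j
          using le[OF that] by (intro rem_sum_measurable) auto
        have "(\<integral>\<^sup>+\<omega>. ennreal \<bar>Top (m, n) \<omega>\<bar> \<partial>M) \<le> (\<integral>\<^sup>+\<omega>. (\<Sum>j<m. ennreal \<bar>rem_sum \<kappa> n (?c m n j) (?c m n (Suc j)) \<omega>\<bar>) \<partial>M)"
          unfolding Top_def prod.case
          by (intro nn_integral_mono) (subst sum_ennreal, auto intro!: ennreal_leI sum_abs)
        also have "\<dots> = (\<Sum>j<m. (\<integral>\<^sup>+\<omega>. ennreal \<bar>rem_sum \<kappa> n (?c m n j) (?c m n (Suc j)) \<omega>\<bar> \<partial>M))"
          using rm by (intro nn_integral_sum) auto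
        also have "\<dots> \<le> (\<Sum>j<m. ennreal (D * (1 / real m + 1 / real n) powr \<mu>))"
        proof (rule sum_mono)
          fix j assume "j \<in> {..<m}"
          then have j: "j < m" by simp
          have o: "0 \<le> ?s m j" "?s m j \<le> ?s m (Suc j)" "?s m (Suc j) \<le> 1" using S2_D[OF S2(1)[OF m j]] by auto
          have "(\<integral>\<^sup>+\<omega>. ennreal \<bar>rem_sum \<kappa> n (?c m n j) (?c m n (Suc j)) \<omega>\<bar> \<partial>M)
              \<le> ennreal (D * (grid n (?c m n (Suc j)) - grid n (?c m n j)) powr \<mu>)"
            using le[OF j] by (intro D(2)[OF n])
          also have "\<dots> \<le> ennreal (D * (1 / real m + 1 / real n) powr \<mu>)"
          proof (intro ennreal_leI mult_left_mono powr_mono2)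
            have "eps n (?s m (Suc j)) - eps n (?s m j) \<le> ?s m (Suc j) + 1 / real n - ?s m j"
              using eps_bounds(2)[OF n, of "?s m (Suc j)"] eps_bounds(1)[OF n, of "?s m j"] by linarith
            also have "\<dots> = (b - a) / real m + 1 / real n" using unif_point_step[OF m, of a b j] by linarith
            also have "\<dots> \<le> 1 / real m + 1 / real n" using ab by (intro add_right_mono divide_right_mono) auto
            finally show "grid n (?c m n (Suc j)) - grid n (?c m n j) \<le> 1 / real m + 1 / real n"
              using o by (simp add: eps_eq)
            show "0 \<le> grid n (?c m n (Suc j)) - grid n (?c m n j)" using grid_mono[OF le(2)[OF j], of n] by simp
          qed (use \<mu> D(1) in auto)
          finally show "(\<integral>\<^sup>+\<omega>. ennreal \<bar>rem_sum \<kappa> n (?c m n j) (?c m n (Suc j)) \<omega>\<bar> \<partial>M) \<le> ennreal (D * (1 / real m + 1 / real n) powr \<mu>)" .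
        qed
        also have "\<dots> = ennreal (\<Sum>j<m. D * (1 / real m + 1 / real n) powr \<mu>)"
          using D(1) by (intro sum_ennreal) auto
        also have "(\<Sum>j<m. D * (1 / real m + 1 / real n) powr \<mu>) = real m * (D * (1 / real m + 1 / real n) powr \<mu>)" by simp
        finally have "(\<integral>\<^sup>+\<omega>. ennreal \<bar>Top (m, n) \<omega>\<bar> \<partial>M) \<le> ennreal (real m * (D * (1 / real m + 1 / real n) powr \<mu>))" .
        moreover have "Top (m, n) \<in> borel_measurable M"
          unfolding Top_def prod.case using rm by (intro borel_measurable_sum) auto
        ultimately show ?case by simp
      qed
    qed
  qed
  have "vanishes M iter (\<lambda>q \<omega>. Freeze q \<omega> + Mixed q \<omega> + Top q \<omega>)"
    by (intro vanishes_add V1 V2 V3)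
  then show ?thesis
  proof (rule vanishes_cong)
    show "\<forall>\<^sub>F q in iter. AE \<omega> in M. (case q of (m, n) \<Rightarrow> \<lambda>\<omega>. (\<Sum>k\<in>grid_between n a b. Y (grid n k) [] \<omega> * cell \<kappa> n k \<omega>) -
     (\<Sum>j<m. Y (?s m j) [] \<omega> * incr \<kappa> n (?s m j) (?s m (Suc j)) \<omega>)) \<omega> = Freeze q \<omega> + Mixed q \<omega> + Top q \<omega>"
      unfolding eventually_iter prod.case
      using eventually_ge_at_top[of 1]
    proof eventually_elim
      case (elim m)
      note m = elim
      show ?case
        using eventually_ge_at_top[of 1]
      proof eventually_elim
        case (elim n)
        note n = elim
        show ?case
        proof (rule AE_I2)
          fix \<omega> assume \<omega>: "\<omega> \<in> space M"
          have cell_sum: "(\<Sum>k\<in>grid_between n (?s m j) (?s m (Suc j)). Y (grid n k) [] \<omega> * cell \<kappa> n k \<omega>)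
            = rem_sum \<kappa> n (?c m n j) (?c m n (Suc j)) \<omega> + (\<Sum>w\<in>?W. Y (eps n (?s m j)) w \<omega> * ?J m n j w \<omega>)"
            if j: "j < m" for j
          proof -
            have o: "0 \<le> ?s m j" "?s m (Suc j) \<le> 1" using S2_D[OF S2(1)[OF m j]] by auto
            let ?e = "eps n (?s m j)" and ?g = "grid_between n (?s m j) (?s m (Suc j))"
            have "(\<Sum>k\<in>?g. Y (grid n k) [] \<omega> * cell \<kappa> n k \<omega>)
              = (\<Sum>k\<in>?g. rho Y ?e (grid n k) [] \<omega> * cell \<kappa> n k \<omega>
                 + (\<Sum>w\<in>?W. Y ?e w \<omega> * (x ?e (grid n k) \<omega> w * cell \<kappa> n k \<omega>)))"
            proof (rule sum.cong)
              fix k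
              have e: "Y (grid n k) [] \<omega> = rho Y ?e (grid n k) [] \<omega> + (\<Sum>w\<in>?W. x ?e (grid n k) \<omega> w * Y ?e w \<omega>)"
                by (simp add: rho_def)
              show "Y (grid n k) [] \<omega> * cell \<kappa> n k \<omega> = rho Y ?e (grid n k) [] \<omega> * cell \<kappa> n k \<omega>
                 + (\<Sum>w\<in>?W. Y ?e w \<omega> * (x ?e (grid n k) \<omega> w * cell \<kappa> n k \<omega>))"
                unfolding e distrib_right sum_distrib_right by (simp only: mult_ac)
            qed simp
            also have "\<dots> = (\<Sum>k\<in>?g. rho Y ?e (grid n k) [] \<omega> * cell \<kappa> n k \<omega>)
                + (\<Sum>w\<in>?W. Y ?e w \<omega> * ?J m n j w \<omega>)"
              unfolding sum.distrib Jx_eq sum_distrib_left by (subst sum.swap) simp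
            also have "(\<Sum>k\<in>?g. rho Y ?e (grid n k) [] \<omega> * cell \<kappa> n k \<omega>) = rem_sum \<kappa> n (?c m n j) (?c m n (Suc j)) \<omega>"
              unfolding rem_sum_def grid_between_eq[OF n o] eps_eq[OF o(1)] ..
            finally show ?thesis .
          qed
          have A: "(\<Sum>k\<in>grid_between n a b. Y (grid n k) [] \<omega> * cell \<kappa> n k \<omega>)
            = Top (m, n) \<omega> + (\<Sum>w\<in>?W. \<Sum>j<m. Y (eps n (?s m j)) w \<omega> * ?J m n j w \<omega>)"
          proof -
            have "(\<Sum>k\<in>grid_between n a b. Y (grid n k) [] \<omega> * cell \<kappa> n k \<omega>)
              = (\<Sum>j<m. \<Sum>k\<in>grid_between n (?s m j) (?s m (Suc j)). Y (grid n k) [] \<omega> * cell \<kappa> n k \<omega>)"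
              using ab by (intro grid_sum_split[OF n m]) auto
            also have "\<dots> = (\<Sum>j<m. rem_sum \<kappa> n (?c m n j) (?c m n (Suc j)) \<omega> + (\<Sum>w\<in>?W. Y (eps n (?s m j)) w \<omega> * ?J m n j w \<omega>))"
              by (rule sum.cong) (use cell_sum in auto)
            also have "\<dots> = Top (m, n) \<omega> + (\<Sum>w\<in>?W. \<Sum>j<m. Y (eps n (?s m j)) w \<omega> * ?J m n j w \<omega>)"
              unfolding Top_def prod.case sum.distrib by (subst sum.swap) simp
            finally show ?thesis .
          qed
          have W: "?W = insert [] (?W - {[]})" using l_pos by auto
          have B: "(\<Sum>w\<in>?W. \<Sum>j<m. Y (?s m j) w \<omega> * ?J m n j w \<omega>)
             = (\<Sum>j<m. Y (?s m j) [] \<omega> * incr \<kappa> n (?s m j) (?s m (Suc j)) \<omega>) + Mixed (m, n) \<omega>"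
          proof -
            have "(\<Sum>w\<in>?W. \<Sum>j<m. Y (?s m j) w \<omega> * ?J m n j w \<omega>)
               = (\<Sum>j<m. Y (?s m j) [] \<omega> * ?J m n j [] \<omega>) + Mixed (m, n) \<omega>"
              unfolding Mixed_def prod.case using l_pos by (intro sum.remove) (auto simp: finite_words_less)
            then show ?thesis using Jx_empty[OF n S2(1)[OF m] \<omega>] by simp
          qed
          have C: "Freeze (m, n) \<omega> = (\<Sum>w\<in>?W. \<Sum>j<m. Y (eps n (?s m j)) w \<omega> * ?J m n j w \<omega>)
             - (\<Sum>w\<in>?W. \<Sum>j<m. Y (?s m j) w \<omega> * ?J m n j w \<omega>)"
            unfolding Freeze_def prod.case by (simp only: left_diff_distrib sum_subtractf)
          show "(\<Sum>k\<in>grid_between n a b. Y (grid n k) [] \<omega> * cell \<kappa> n k \<omega>) -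
     (\<Sum>j<m. Y (?s m j) [] \<omega> * incr \<kappa> n (?s m j) (?s m (Suc j)) \<omega>) = Freeze (m, n) \<omega> + Mixed (m, n) \<omega> + Top (m, n) \<omega>"
            using A B C by linarith
        qed
      qed
    qed
  qed
qed

end

end

section \<open>Localisation of the weight\<close>

lemma sum_words_levels:
  fixes f :: "'d::finite list \<Rightarrow> 'b::comm_monoid_add"
  assumes k: "k < l"
  shows "(\<Sum>v\<in>{v. length v + k < l}. f v) = f [] + (\<Sum>j=1..l - 1 - k. \<Sum>v\<in>words j. f v)"
proof -
  have "{v :: 'd list. length v + k < l} = (\<Union>j\<in>{..l - 1 - k}. words j)"
    using k by (auto simp: words_def)
  then have "(\<Sum>v\<in>{v. length v + k < l}. f v) = (\<Sum>j\<in>{..l - 1 - k}. \<Sum>v\<in>words j. f v)"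
    by (simp only:) (rule sum.UNION_disjoint, auto simp: finite_words, auto simp: words_def)
  also have "{..l - 1 - k} = insert 0 {1..l - 1 - k}" by auto
  also have "(\<Sum>j\<in>insert 0 {1..l - 1 - k}. \<Sum>v\<in>words j. f v) = (\<Sum>v\<in>words 0. f v) + (\<Sum>j=1..l - 1 - k. \<Sum>v\<in>words j. f v)"
    by (subst sum.insert) auto
  also have "words 0 = {[] :: 'd list}" by (auto simp: words_def)
  finally show ?thesis by simp
qed

context indep_brownian
begin

lemma real_cond_exp_sum_finite:
  fixes f :: "'i \<Rightarrow> 'a \<Rightarrow> real"
  assumes "\<And>i. i \<in> S \<Longrightarrow> integrable M (f i)"
  shows "AE \<omega> in M. real_cond_exp M F (\<lambda>\<omega>. \<Sum>i\<in>S. f i \<omega>) \<omega> = (\<Sum>i\<in>S. real_cond_exp M F (f i) \<omega>)"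
proof -
  define g where "g i = (if i \<in> S then f i else (\<lambda>_. 0))" for i
  have "AE \<omega> in M. real_cond_exp M F (\<lambda>\<omega>. \<Sum>i\<in>S. g i \<omega>) \<omega> = (\<Sum>i\<in>S. real_cond_exp M F (g i) \<omega>)"
    by (rule real_cond_exp_sum) (use assms in \<open>auto simp: g_def\<close>)
  moreover have "(\<lambda>\<omega>. \<Sum>i\<in>S. g i \<omega>) = (\<lambda>\<omega>. \<Sum>i\<in>S. f i \<omega>)"
    by (intro ext sum.cong) (auto simp: g_def)
  moreover have "(\<Sum>i\<in>S. real_cond_exp M F (g i) \<omega>) = (\<Sum>i\<in>S. real_cond_exp M F (f i) \<omega>)" for \<omega>
    by (intro sum.cong) (auto simp: g_def)
  ultimately show ?thesis by simp
qed

lemma nn_integral_abs_cond_exp: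
  assumes [measurable]: "f \<in> borel_measurable M"
  shows "(\<integral>\<^sup>+\<omega>. ennreal \<bar>real_cond_exp M F f \<omega>\<bar> \<partial>M) \<le> (\<integral>\<^sup>+\<omega>. ennreal \<bar>f \<omega>\<bar> \<partial>M)"
proof -
  have "(\<integral>\<^sup>+\<omega>. ennreal \<bar>real_cond_exp M F f \<omega>\<bar> \<partial>M) \<le> (\<integral>\<^sup>+\<omega>. 1 * nn_cond_exp M F (\<lambda>\<omega>. ennreal \<bar>f \<omega>\<bar>) \<omega> \<partial>M)"
    using real_cond_exp_abs[OF assms] by (intro nn_integral_mono_AE) simp
  also have "\<dots> = (\<integral>\<^sup>+\<omega>. 1 * ennreal \<bar>f \<omega>\<bar> \<partial>M)"
    by (rule nn_cond_exp_intg) auto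
  finally show ?thesis by simp
qed

lemma nn_integral_square_cond_exp:
  assumes f: "integrable M f" and sq: "(\<integral>\<^sup>+\<omega>. ennreal ((f \<omega>)\<^sup>2) \<partial>M) \<le> ennreal c"
  shows "(\<integral>\<^sup>+\<omega>. ennreal ((real_cond_exp M F f \<omega>)\<^sup>2) \<partial>M) \<le> ennreal c"
proof -
  have fm: "f \<in> borel_measurable M" using f by auto
  have i2: "integrable M (\<lambda>\<omega>. (f \<omega>)\<^sup>2)"
  proof (rule integrableI_nonneg)
    show "(\<integral>\<^sup>+\<omega>. ennreal ((f \<omega>)\<^sup>2) \<partial>M) < \<infinity>" using sq by (rule order.strict_trans1) simp
  qed (use fm in auto)
  have cv: "convex_on UNIV (\<lambda>x::real. x\<^sup>2)" by (rule convex_power2)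
  have J: "AE \<omega> in M. (real_cond_exp M F f \<omega>)\<^sup>2 \<le> real_cond_exp M F (\<lambda>\<omega>. (f \<omega>)\<^sup>2) \<omega>"
    by (rule real_cond_exp_jensens_inequality(2)[OF f _ _ i2 cv]) auto
  have "(\<integral>\<^sup>+\<omega>. ennreal ((real_cond_exp M F f \<omega>)\<^sup>2) \<partial>M) \<le> (\<integral>\<^sup>+\<omega>. ennreal \<bar>real_cond_exp M F (\<lambda>\<omega>. (f \<omega>)\<^sup>2) \<omega>\<bar> \<partial>M)"
    using J by (intro nn_integral_mono_AE) (auto elim!: eventually_mono intro!: ennreal_leI)
  also have "\<dots> \<le> (\<integral>\<^sup>+\<omega>. ennreal \<bar>(f \<omega>)\<^sup>2\<bar> \<partial>M)"
    by (rule nn_integral_abs_cond_exp) (use fm in auto)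
  also have "\<dots> \<le> ennreal c" using sq by simp
  finally show ?thesis .
qed

end

context rough_increments
begin

lemma x_integrable:
  assumes st: "(s, t) \<in> S2" and w: "length w \<le> l"
  shows "integrable M (\<lambda>\<omega>. x s t \<omega> w)"
proof (cases "w = []")
  case True
  have "integrable M (\<lambda>\<omega>. x s t \<omega> []) \<longleftrightarrow> integrable M (\<lambda>\<omega>. 1 :: real)"
    by (rule Bochner_Integration.integrable_cong) (use x_empty[OF st] in auto)
  then show ?thesis using True by simp
next
  case False
  obtain C where C: "C \<ge> 0" "\<And>s t w. (s, t) \<in> S2 \<Longrightarrow> w \<noteq> [] \<Longrightarrow> length w \<le> l \<Longrightarrow>
     (\<integral>\<^sup>+\<omega>. ennreal ((x s t \<omega> w)\<^sup>2) \<partial>M) \<le> ennreal (C * (t - s) powr (2 * \<nu> * real (length w)))"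
    using x_L2_bounds by blast
  have i2: "integrable M (\<lambda>\<omega>. (x s t \<omega> w)\<^sup>2)"
  proof (rule integrableI_nonneg)
    show "(\<integral>\<^sup>+\<omega>. ennreal ((x s t \<omega> w)\<^sup>2) \<partial>M) < \<infinity>"
      using C(2)[OF st False w] by (rule order.strict_trans1) simp
  qed (use x_measurable[OF st w] in auto)
  show ?thesis
    by (rule square_integrable_imp_integrable[OF x_measurable[OF st w] i2])
qed

context
  fixes y :: "real \<Rightarrow> 'a \<Rightarrow> 'd list \<Rightarrow> real^'v"
  assumes paths: "controlled_paths M l y"
    and control: "(\<exists>K::real. \<forall>k<l. \<forall>(s, t)\<in>S2.
           Lp_norm 2 M (\<lambda>\<omega>. tnorm k (remainder l x y k s t \<omega>))
             \<le> ennreal (K * (t - s) powr (real (l - k) * \<nu>))) \<or>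
        (\<exists>G::'a \<Rightarrow> real. G \<in> borel_measurable M \<and>
           (AE \<omega> in M. \<forall>k<l. \<forall>(s, t)\<in>S2.
              tnorm k (remainder l x y k s t \<omega>) \<le> G \<omega> * (t - s) powr (real (l - k) * \<nu>)))"
    and adapted: "\<forall>t\<in>{0..1}. \<exists>z \<in> borel_measurable F. AE \<omega> in M. y t \<omega> [] = z \<omega>"
begin

definition y_coord :: "'v \<Rightarrow> real \<Rightarrow> 'd list \<Rightarrow> 'a \<Rightarrow> real" where
  "y_coord \<iota> t w \<omega> = y t \<omega> w $ \<iota>"

lemma y_measurable: "t \<in> {0..1} \<Longrightarrow> length w < l \<Longrightarrow> (\<lambda>\<omega>. y t \<omega> w) \<in> borel_measurable M"
  using paths unfolding controlled_paths_def words_def by blast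

lemma y_coord_measurable: "t \<in> {0..1} \<Longrightarrow> length w < l \<Longrightarrow> y_coord \<iota> t w \<in> borel_measurable M"
  unfolding y_coord_def[abs_def] by (rule measurable_compose[OF y_measurable]) auto

lemma y_coord_continuous: "AE \<omega> in M. \<forall>w. length w < l \<longrightarrow> continuous_on {0..1} (\<lambda>t. y_coord \<iota> t w \<omega>)"
proof -
  have "AE \<omega> in M. \<forall>k<l. \<forall>w\<in>words k. continuous_on {0..1} (\<lambda>t. y t \<omega> w)"
    using paths unfolding controlled_paths_def by blast
  then show ?thesis
  proof eventually_elim
    case (elim \<omega>)
    show ?case
    proof (intro allI impI)
      fix w :: "'d list" assume "length w < l"
      then have "continuous_on {0..1} (\<lambda>t. y t \<omega> w)" using elim by (auto simp: words_def)
      then show "continuous_on {0..1} (\<lambda>t. y_coord \<iota> t w \<omega>)"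
        unfolding y_coord_def by (rule continuous_on_component)
    qed
  qed
qed

lemma remainder_component:
  assumes "\<omega> \<in> space M" "(s, t) \<in> S2" "length w < l"
  shows "remainder l x y (length w) s t \<omega> w $ \<iota> = rho (y_coord \<iota>) s t w \<omega>"
  unfolding remainder_def rho_def sum_words_levels[OF assms(3)] y_coord_def
  using x_empty[OF assms(2,1)] by (simp add: sum_component)

lemma rho_le_tnorm:
  assumes "\<omega> \<in> space M" "(s, t) \<in> S2" "length w < l"
  shows "\<bar>rho (y_coord \<iota>) s t w \<omega>\<bar> \<le> tnorm (length w) (remainder l x y (length w) s t \<omega>)"
  unfolding remainder_component[OF assms, symmetric]
  using component_le_norm_cart[of "remainder l x y (length w) s t \<omega> w" \<iota>] norm_le_tnorm[of "remainder l x y (length w) s t \<omega>" w]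
  by linarith

text \<open>
  Both kinds of control have one consequence in common: where a finite random variable \<open>G\<close> stays below
  a level, the remainders are bounded in \<open>L\<^sub>2\<close>. Control in \<open>L\<^sub>2\<close> corresponds to \<open>G = 0\<close>.
\<close>

lemma localised_control:
  "\<exists>G :: 'a \<Rightarrow> real. G \<in> borel_measurable M \<and> (\<forall>R\<ge>0. \<exists>K1\<ge>0. \<forall>s t w \<iota> E. E \<in> sets M \<and> (\<forall>\<omega>\<in>E. G \<omega> \<le> R) \<and> (s, t) \<in> S2 \<and> length w < l \<longrightarrow>
     (\<integral>\<^sup>+\<omega>. ennreal ((indicator E \<omega> * rho (y_coord \<iota>) s t w \<omega>)\<^sup>2) \<partial>M) \<le> ennreal ((K1 * (t - s) powr (real (l - length w) * \<nu>))\<^sup>2))"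
  using control
proof (elim disjE exE conjE)
  fix K :: real
  assume K: "\<forall>k<l. \<forall>(s, t)\<in>S2. Lp_norm 2 M (\<lambda>\<omega>. tnorm k (remainder l x y k s t \<omega>)) \<le> ennreal (K * (t - s) powr (real (l - k) * \<nu>))"
  have "(\<integral>\<^sup>+\<omega>. ennreal ((indicator E \<omega> * rho (y_coord \<iota>) s t w \<omega>)\<^sup>2) \<partial>M) \<le> ennreal ((\<bar>K\<bar> * (t - s) powr (real (l - length w) * \<nu>))\<^sup>2)"
    if "(s, t) \<in> S2" "length w < l" for E s t w \<iota>
  proof -
    have "(\<integral>\<^sup>+\<omega>. ennreal ((indicator E \<omega> * rho (y_coord \<iota>) s t w \<omega>)\<^sup>2) \<partial>M)
       \<le> (\<integral>\<^sup>+\<omega>. ennreal ((tnorm (length w) (remainder l x y (length w) s t \<omega>))\<^sup>2) \<partial>M)"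
    proof (intro nn_integral_mono ennreal_leI)
      fix \<omega> assume "\<omega> \<in> space M"
      then have "\<bar>indicator E \<omega> * rho (y_coord \<iota>) s t w \<omega>\<bar> \<le> \<bar>tnorm (length w) (remainder l x y (length w) s t \<omega>)\<bar>"
        using rho_le_tnorm[OF _ that, of \<omega> \<iota>] by (auto simp: indicator_def)
      then show "(indicator E \<omega> * rho (y_coord \<iota>) s t w \<omega>)\<^sup>2 \<le> (tnorm (length w) (remainder l x y (length w) s t \<omega>))\<^sup>2"
        by (rule abs_le_square_iff[THEN iffD1])
    qed
    also have "\<dots> \<le> ennreal ((\<bar>K\<bar> * (t - s) powr (real (l - length w) * \<nu>))\<^sup>2)"
    proof (rule Lp_norm_2_le)
      have "Lp_norm 2 M (\<lambda>\<omega>. tnorm (length w) (remainder l x y (length w) s t \<omega>)) \<le> ennreal (K * (t - s) powr (real (l - length w) * \<nu>))"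
        using K that by blast
      also have "\<dots> \<le> ennreal (\<bar>K\<bar> * (t - s) powr (real (l - length w) * \<nu>))"
        by (intro ennreal_leI mult_right_mono) auto
      finally show "Lp_norm 2 M (\<lambda>\<omega>. tnorm (length w) (remainder l x y (length w) s t \<omega>)) \<le> ennreal (\<bar>K\<bar> * (t - s) powr (real (l - length w) * \<nu>))" .
    qed simp
    finally show ?thesis .
  qed
  then show ?thesis
    by (intro exI[of _ "\<lambda>_. 0"] conjI allI impI exI[of _ "\<bar>K\<bar>"]) auto
next
  fix G :: "'a \<Rightarrow> real" assume G: "G \<in> borel_measurable M"
    and ae: "AE \<omega> in M. \<forall>k<l. \<forall>(s, t)\<in>S2. tnorm k (remainder l x y k s t \<omega>) \<le> G \<omega> * (t - s) powr (real (l - k) * \<nu>)"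
  have ae': "AE \<omega> in M. \<omega> \<in> space M" by simp
  have "(\<integral>\<^sup>+\<omega>. ennreal ((indicator E \<omega> * rho (y_coord \<iota>) s t w \<omega>)\<^sup>2) \<partial>M) \<le> ennreal ((R * (t - s) powr (real (l - length w) * \<nu>))\<^sup>2)"
    if "(s, t) \<in> S2" "length w < l" and E: "\<forall>\<omega>\<in>E. G \<omega> \<le> R" and R: "R \<ge> 0" for E s t w \<iota> R
  proof -
    have "(\<integral>\<^sup>+\<omega>. ennreal ((indicator E \<omega> * rho (y_coord \<iota>) s t w \<omega>)\<^sup>2) \<partial>M)
       \<le> (\<integral>\<^sup>+\<omega>. ennreal ((R * (t - s) powr (real (l - length w) * \<nu>))\<^sup>2) \<partial>M)"
    proof (rule nn_integral_mono_AE, use ae ae' in eventually_elim)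
      case (elim \<omega>)
      have "\<bar>indicator E \<omega> * rho (y_coord \<iota>) s t w \<omega>\<bar> \<le> \<bar>R * (t - s) powr (real (l - length w) * \<nu>)\<bar>"
      proof (cases "\<omega> \<in> E")
        case True
        have "\<bar>rho (y_coord \<iota>) s t w \<omega>\<bar> \<le> G \<omega> * (t - s) powr (real (l - length w) * \<nu>)"
          using rho_le_tnorm[OF elim(2) that(1,2), of \<iota>] elim(1) that by fastforce
        also have "\<dots> \<le> R * (t - s) powr (real (l - length w) * \<nu>)" using E True by (intro mult_right_mono) auto
        finally show ?thesis using True by simp
      qed simp
      then have "(indicator E \<omega> * rho (y_coord \<iota>) s t w \<omega>)\<^sup>2 \<le> (R * (t - s) powr (real (l - length w) * \<nu>))\<^sup>2"
        by (rule abs_le_square_iff[THEN iffD1])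
      then show ?case by (rule ennreal_leI)
    qed
    also have "\<dots> = ennreal ((R * (t - s) powr (real (l - length w) * \<nu>))\<^sup>2)" by (simp add: emeasure_space_1)
    finally show ?thesis .
  qed
  then show ?thesis
    by (intro exI[of _ G] conjI G) (intro allI impI, rule_tac x=R in exI, blast)
qed

text \<open>
  The process \<open>Y = E(1\<^sub>E y | F)\<close> satisfies the hypotheses of \<open>controlled_sums_vanish\<close>: it is adapted and
  bounded by construction, and since \<open>x\<close> is measurable with respect to \<open>F\<close> its remainders are the
  conditional expectations of those of \<open>y\<close> on \<open>E\<close>, which do not increase in \<open>L\<^sub>2\<close>. As \<open>y\<^bsup>(0)\<^esup>\<close> is
  itself measurable with respect to \<open>F\<close>, the lowest level of \<open>Y\<close> is the product of \<open>y\<^bsup>(0)\<^esup>\<close> and the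
  conditional probability of \<open>E\<close>, a factor that does not depend on time and can be taken out of both sums.
\<close>

lemma localised_sums_vanish:
  assumes E: "E \<in> sets M"
    and bd: "\<And>t w. t \<in> {0..1} \<Longrightarrow> length w < l \<Longrightarrow> AE \<omega> in M. \<bar>indicator E \<omega> * y_coord \<iota> t w \<omega>\<bar> \<le> R"
    and K1: "K1 \<ge> 0"
    and rem: "\<And>s t w. (s, t) \<in> S2 \<Longrightarrow> length w < l \<Longrightarrow>
       (\<integral>\<^sup>+\<omega>. ennreal ((indicator E \<omega> * rho (y_coord \<iota>) s t w \<omega>)\<^sup>2) \<partial>M) \<le> ennreal ((K1 * (t - s) powr (real (l - length w) * \<nu>))\<^sup>2)"
    and ab: "0 \<le> a" "a < b" "b \<le> 1"
  shows "vanishes M iter (\<lambda>(m, n) \<omega>. real_cond_exp M F (indicator E) \<omega> *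
     ((\<Sum>k\<in>grid_between n a b. y_coord \<iota> (grid n k) [] \<omega> * cell \<kappa> n k \<omega>) -
      (\<Sum>j<m. y_coord \<iota> (unif_point a b m j) [] \<omega> * incr \<kappa> n (unif_point a b m j) (unif_point a b m (Suc j)) \<omega>)))"
proof -
  define g where "g t w \<omega> = indicator E \<omega> * y_coord \<iota> t w \<omega>" for t w \<omega>
  define Y where "Y t w = real_cond_exp M F (g t w)" for t w
  let ?c = "real_cond_exp M F (indicator E)"
  have gm: "g t w \<in> borel_measurable M" if "t \<in> {0..1}" "length w < l" for t w
    unfolding g_def[abs_def] using y_coord_measurable[OF that, of \<iota>] E by auto
  have gb: "AE \<omega> in M. \<bar>g t w \<omega>\<bar> \<le> R" if "t \<in> {0..1}" "length w < l" for t w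
    unfolding g_def using bd[OF that] .
  have gi: "integrable M (g t w)" if "t \<in> {0..1}" "length w < l" for t w
    by (rule integrable_const_bound[OF _ gm[OF that], of R]) (use gb[OF that] in simp)
  have YF: "Y t w \<in> borel_measurable F" for t w unfolding Y_def by simp
  have YR: "AE \<omega> in M. \<bar>Y t w \<omega>\<bar> \<le> R" if "t \<in> {0..1}" "length w < l" for t w
  proof -
    have "AE \<omega> in M. g t w \<omega> \<le> R" "AE \<omega> in M. - R \<le> g t w \<omega>"
      using gb[OF that] by (auto elim!: eventually_mono)
    then have "AE \<omega> in M. Y t w \<omega> \<le> R" "AE \<omega> in M. - R \<le> Y t w \<omega>"
      unfolding Y_def using real_cond_exp_le_c[OF gi[OF that]] real_cond_exp_ge_c[OF gi[OF that]] by auto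
    then show ?thesis by eventually_elim auto
  qed
  have Ycont: "vanishes M sequentially (\<lambda>n \<omega>. Y (eps n t) w \<omega> - Y t w \<omega>)" if t: "t \<in> {0..1}" and w: "length w < l" for t w
  proof (rule vanishes_nn_integral[where a="\<lambda>n. \<integral>\<omega>. \<bar>g (eps n t) w \<omega> - g t w \<omega>\<bar> \<partial>M"])
    have e: "eps n t \<in> {0..1}" for n by (rule eps_unit[OF t])
    note m = gm[OF e w] gm[OF t w]
    show "\<forall>\<^sub>F n in sequentially. (\<lambda>\<omega>. Y (eps n t) w \<omega> - Y t w \<omega>) \<in> borel_measurable M \<and>
      (\<integral>\<^sup>+\<omega>. ennreal \<bar>Y (eps n t) w \<omega> - Y t w \<omega>\<bar> \<partial>M) \<le> ennreal (\<integral>\<omega>. \<bar>g (eps n t) w \<omega> - g t w \<omega>\<bar> \<partial>M)"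
    proof (intro always_eventually allI conjI)
      fix n
      show "(\<lambda>\<omega>. Y (eps n t) w \<omega> - Y t w \<omega>) \<in> borel_measurable M"
        using measurable_F[OF YF] by auto
      have d: "integrable M (\<lambda>\<omega>. g (eps n t) w \<omega> - g t w \<omega>)" using gi[OF e w] gi[OF t w] by auto
      have "(\<integral>\<^sup>+\<omega>. ennreal \<bar>Y (eps n t) w \<omega> - Y t w \<omega>\<bar> \<partial>M)
         = (\<integral>\<^sup>+\<omega>. ennreal \<bar>real_cond_exp M F (\<lambda>\<omega>. g (eps n t) w \<omega> - g t w \<omega>) \<omega>\<bar> \<partial>M)"
        using real_cond_exp_diff[OF gi[OF e w, of n] gi[OF t w]] unfolding Y_def
        by (intro nn_integral_cong_AE) (auto elim!: eventually_mono)
      also have "\<dots> \<le> (\<integral>\<^sup>+\<omega>. ennreal \<bar>g (eps n t) w \<omega> - g t w \<omega>\<bar> \<partial>M)"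
        by (rule nn_integral_abs_cond_exp) (use m in auto)
      also have "\<dots> = ennreal (\<integral>\<omega>. \<bar>g (eps n t) w \<omega> - g t w \<omega>\<bar> \<partial>M)"
        using d by (intro nn_integral_eq_integral) auto
      finally show "(\<integral>\<^sup>+\<omega>. ennreal \<bar>Y (eps n t) w \<omega> - Y t w \<omega>\<bar> \<partial>M) \<le> ennreal (\<integral>\<omega>. \<bar>g (eps n t) w \<omega> - g t w \<omega>\<bar> \<partial>M)" .
    qed
    have "(\<lambda>n. \<integral>\<omega>. \<bar>g (eps n t) w \<omega> - g t w \<omega>\<bar> \<partial>M) \<longlonglongrightarrow> (\<integral>\<omega>. 0 \<partial>M)"
    proof (rule integral_dominated_convergence[where w="\<lambda>_. 2 * R"])
      show "AE \<omega> in M. (\<lambda>n. \<bar>g (eps n t) w \<omega> - g t w \<omega>\<bar>) \<longlonglongrightarrow> 0"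
        using y_coord_continuous[of \<iota>]
      proof eventually_elim
        case (elim \<omega>)
        then have c: "continuous_on {0..1} (\<lambda>t. y_coord \<iota> t w \<omega>)" using w by blast
        have "(\<lambda>n. y_coord \<iota> (eps n t) w \<omega>) \<longlonglongrightarrow> y_coord \<iota> t w \<omega>"
          by (rule continuous_on_tendsto_compose[OF c eps_tendsto t]) (use e in auto)
        then have "(\<lambda>n. \<bar>g (eps n t) w \<omega> - g t w \<omega>\<bar>) \<longlonglongrightarrow> \<bar>g t w \<omega> - g t w \<omega>\<bar>"
          unfolding g_def by (intro tendsto_intros)
        then show ?case by simp
      qed
      show "AE \<omega> in M. norm \<bar>g (eps n t) w \<omega> - g t w \<omega>\<bar> \<le> 2 * R" for n
        using gb[OF e w, of n] gb[OF t w] by eventually_elim auto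
    qed (use m in auto)
    then show "(\<lambda>n. \<integral>\<omega>. \<bar>g (eps n t) w \<omega> - g t w \<omega>\<bar> \<partial>M) \<longlonglongrightarrow> 0" by simp
  qed
  have Yrem: "(\<integral>\<^sup>+\<omega>. ennreal ((rho Y s t w \<omega>)\<^sup>2) \<partial>M) \<le> ennreal ((K1 * (t - s) powr (real (l - length w) * \<nu>))\<^sup>2)"
    if st: "(s, t) \<in> S2" and w: "length w < l" for s t w
  proof -
    have o: "s \<in> {0..1}" "t \<in> {0..1}" using S2_D[OF st] by auto
    let ?V = "{v :: 'd list. length v + length w < l}"
    have V: "length v \<le> l" "length (v @ w) < l" if "v \<in> ?V" for v using that by auto
    have xg: "integrable M (\<lambda>\<omega>. x s t \<omega> v * g s (v @ w) \<omega>)" if "v \<in> ?V" for v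
    proof (rule Bochner_Integration.integrable_bound[where f="\<lambda>\<omega>. R * x s t \<omega> v"])
      show "integrable M (\<lambda>\<omega>. R * x s t \<omega> v)" using x_integrable[OF st V(1)[OF that]] by simp
      show "(\<lambda>\<omega>. x s t \<omega> v * g s (v @ w) \<omega>) \<in> borel_measurable M"
        using x_measurable[OF st V(1)[OF that]] gm[OF o(1) V(2)[OF that]] by auto
      show "AE \<omega> in M. norm (x s t \<omega> v * g s (v @ w) \<omega>) \<le> norm (R * x s t \<omega> v)"
        using gb[OF o(1) V(2)[OF that]]
      proof eventually_elim
        case (elim \<omega>)
        have "\<bar>x s t \<omega> v\<bar> * \<bar>g s (v @ w) \<omega>\<bar> \<le> \<bar>x s t \<omega> v\<bar> * \<bar>R\<bar>" using elim by (intro mult_left_mono) auto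
        then show ?case by (simp add: abs_mult mult.commute)
      qed
    qed
    have ri: "integrable M (\<lambda>\<omega>. g t w \<omega> - (\<Sum>v\<in>?V. x s t \<omega> v * g s (v @ w) \<omega>))"
      using gi[OF o(2) w] xg by (intro Bochner_Integration.integrable_diff Bochner_Integration.integrable_sum) auto
    have eq: "g t w \<omega> - (\<Sum>v\<in>?V. x s t \<omega> v * g s (v @ w) \<omega>) = indicator E \<omega> * rho (y_coord \<iota>) s t w \<omega>" for \<omega>
      unfolding g_def rho_def by (simp add: right_diff_distrib sum_distrib_left mult.left_commute)
    have mult: "AE \<omega> in M. \<forall>v\<in>?V. real_cond_exp M F (\<lambda>\<omega>. x s t \<omega> v * g s (v @ w) \<omega>) \<omega> = x s t \<omega> v * Y s (v @ w) \<omega>"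
    proof (rule AE_finite_allI)
      show "finite ?V" by (rule finite_subset[OF _ finite_words_less[of l]]) auto
      fix v assume v: "v \<in> ?V"
      show "AE \<omega> in M. real_cond_exp M F (\<lambda>\<omega>. x s t \<omega> v * g s (v @ w) \<omega>) \<omega> = x s t \<omega> v * Y s (v @ w) \<omega>"
        unfolding Y_def by (rule real_cond_exp_mult[OF x_F_measurable[OF st V(1)[OF v]] gm[OF o(1) V(2)[OF v]] xg[OF v]])
    qed
    have "AE \<omega> in M. real_cond_exp M F (\<lambda>\<omega>. g t w \<omega> - (\<Sum>v\<in>?V. x s t \<omega> v * g s (v @ w) \<omega>)) \<omega>
       = Y t w \<omega> - real_cond_exp M F (\<lambda>\<omega>. \<Sum>v\<in>?V. x s t \<omega> v * g s (v @ w) \<omega>) \<omega>"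
      unfolding Y_def using xg by (intro real_cond_exp_diff gi[OF o(2) w] Bochner_Integration.integrable_sum) auto
    moreover have "AE \<omega> in M. real_cond_exp M F (\<lambda>\<omega>. \<Sum>v\<in>?V. x s t \<omega> v * g s (v @ w) \<omega>) \<omega>
       = (\<Sum>v\<in>?V. real_cond_exp M F (\<lambda>\<omega>. x s t \<omega> v * g s (v @ w) \<omega>) \<omega>)"
      by (rule real_cond_exp_sum_finite) (rule xg)
    ultimately have "AE \<omega> in M. rho Y s t w \<omega> = real_cond_exp M F (\<lambda>\<omega>. g t w \<omega> - (\<Sum>v\<in>?V. x s t \<omega> v * g s (v @ w) \<omega>)) \<omega>"
      using mult
    proof eventually_elim
      case (elim \<omega>)
      have "(\<Sum>v\<in>?V. real_cond_exp M F (\<lambda>\<omega>. x s t \<omega> v * g s (v @ w) \<omega>) \<omega>) = (\<Sum>v\<in>?V. x s t \<omega> v * Y s (v @ w) \<omega>)"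
        using elim(3) by (intro sum.cong) auto
      then show ?case unfolding rho_def elim(1) elim(2) by simp
    qed
    then have "(\<integral>\<^sup>+\<omega>. ennreal ((rho Y s t w \<omega>)\<^sup>2) \<partial>M)
       = (\<integral>\<^sup>+\<omega>. ennreal ((real_cond_exp M F (\<lambda>\<omega>. g t w \<omega> - (\<Sum>v\<in>?V. x s t \<omega> v * g s (v @ w) \<omega>)) \<omega>)\<^sup>2) \<partial>M)"
      by (intro nn_integral_cong_AE) (auto elim!: eventually_mono)
    also have "\<dots> \<le> ennreal ((K1 * (t - s) powr (real (l - length w) * \<nu>))\<^sup>2)"
      by (rule nn_integral_square_cond_exp[OF ri]) (use rem[OF st w] in \<open>simp add: eq\<close>)
    finally show ?thesis .
  qed
  have V: "vanishes M iter (\<lambda>(m, n) \<omega>. (\<Sum>k\<in>grid_between n a b. Y (grid n k) [] \<omega> * cell \<kappa> n k \<omega>) -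
     (\<Sum>j<m. Y (unif_point a b m j) [] \<omega> * incr \<kappa> n (unif_point a b m j) (unif_point a b m (Suc j)) \<omega>))"
    by (rule controlled_sums_vanish[OF YF YR Ycont K1 Yrem ab])
  have cY: "AE \<omega> in M. ?c \<omega> * y_coord \<iota> t [] \<omega> = Y t [] \<omega>" if t: "t \<in> {0..1}" for t
  proof -
    obtain z0 where z0: "z0 \<in> borel_measurable F" "AE \<omega> in M. y t \<omega> [] = z0 \<omega>" using adapted t by blast
    define z where "z \<omega> = z0 \<omega> $ \<iota>" for \<omega>
    have zF: "z \<in> borel_measurable F" unfolding z_def by (rule measurable_compose[OF z0(1)]) auto
    have zy: "AE \<omega> in M. y_coord \<iota> t [] \<omega> = z \<omega>" using z0(2) by (auto simp: y_coord_def z_def elim!: eventually_mono)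
    have w: "length [] < l" using l_pos by simp
    have Im: "(indicator E :: 'a \<Rightarrow> real) \<in> borel_measurable M" using E by simp
    have zm: "(\<lambda>\<omega>. z \<omega> * indicator E \<omega>) \<in> borel_measurable M" using measurable_F[OF zF] Im by auto
    have ge: "AE \<omega> in M. g t [] \<omega> = z \<omega> * indicator E \<omega>" using zy by eventually_elim (simp add: g_def)
    have zi: "integrable M (\<lambda>\<omega>. z \<omega> * indicator E \<omega>)"
      using integrable_cong_AE[OF gm[OF t w] zm ge] gi[OF t w] by blast
    have "AE \<omega> in M. Y t [] \<omega> = real_cond_exp M F (\<lambda>\<omega>. z \<omega> * indicator E \<omega>) \<omega>"
      unfolding Y_def by (rule real_cond_exp_cong[OF ge gm[OF t w] zm])
    moreover have "AE \<omega> in M. real_cond_exp M F (\<lambda>\<omega>. z \<omega> * indicator E \<omega>) \<omega> = z \<omega> * ?c \<omega>"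
      by (rule real_cond_exp_mult[OF zF Im zi])
    ultimately show ?thesis using zy by eventually_elim (simp add: mult.commute)
  qed
  show ?thesis
  proof (rule vanishes_cong[OF V])
    show "\<forall>\<^sub>F i in iter. AE \<omega> in M.
      (case i of (m, n) \<Rightarrow> \<lambda>\<omega>. ?c \<omega> * ((\<Sum>k\<in>grid_between n a b. y_coord \<iota> (grid n k) [] \<omega> * cell \<kappa> n k \<omega>) -
      (\<Sum>j<m. y_coord \<iota> (unif_point a b m j) [] \<omega> * incr \<kappa> n (unif_point a b m j) (unif_point a b m (Suc j)) \<omega>))) \<omega> =
      (case i of (m, n) \<Rightarrow> \<lambda>\<omega>. (\<Sum>k\<in>grid_between n a b. Y (grid n k) [] \<omega> * cell \<kappa> n k \<omega>) -
      (\<Sum>j<m. Y (unif_point a b m j) [] \<omega> * incr \<kappa> n (unif_point a b m j) (unif_point a b m (Suc j)) \<omega>)) \<omega>"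
      unfolding eventually_iter prod.case using eventually_ge_at_top[of 1]
    proof eventually_elim
      case (elim m)
      show ?case
      proof (rule always_eventually, rule allI)
        fix n
        have "AE \<omega> in M. \<forall>k\<in>{..n}. ?c \<omega> * y_coord \<iota> (grid n k) [] \<omega> = Y (grid n k) [] \<omega>"
          by (rule AE_finite_allI) (use cY grid_unit[of _ n] in auto)
        moreover have "AE \<omega> in M. \<forall>j\<in>{..m}. ?c \<omega> * y_coord \<iota> (unif_point a b m j) [] \<omega> = Y (unif_point a b m j) [] \<omega>"
        proof (rule AE_finite_allI)
          fix j assume "j \<in> {..m}"
          then have "unif_point a b m j \<in> {0..1}" using unif_point_bounds[OF elim, of a b j] ab by auto
          then show "AE \<omega> in M. ?c \<omega> * y_coord \<iota> (unif_point a b m j) [] \<omega> = Y (unif_point a b m j) [] \<omega>" by (rule cY)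
        qed simp
        ultimately show "AE \<omega> in M. ?c \<omega> * ((\<Sum>k\<in>grid_between n a b. y_coord \<iota> (grid n k) [] \<omega> * cell \<kappa> n k \<omega>) -
            (\<Sum>j<m. y_coord \<iota> (unif_point a b m j) [] \<omega> * incr \<kappa> n (unif_point a b m j) (unif_point a b m (Suc j)) \<omega>)) =
          (\<Sum>k\<in>grid_between n a b. Y (grid n k) [] \<omega> * cell \<kappa> n k \<omega>) -
            (\<Sum>j<m. Y (unif_point a b m j) [] \<omega> * incr \<kappa> n (unif_point a b m j) (unif_point a b m (Suc j)) \<omega>)"
        proof eventually_elim
          case (elim \<omega>)
          have "?c \<omega> * (\<Sum>k\<in>grid_between n a b. y_coord \<iota> (grid n k) [] \<omega> * cell \<kappa> n k \<omega>)
            = (\<Sum>k\<in>grid_between n a b. Y (grid n k) [] \<omega> * cell \<kappa> n k \<omega>)"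
            unfolding sum_distrib_left mult.assoc[symmetric] using elim(1) by (intro sum.cong) (auto simp: grid_between_def)
          moreover have "?c \<omega> * (\<Sum>j<m. y_coord \<iota> (unif_point a b m j) [] \<omega> * incr \<kappa> n (unif_point a b m j) (unif_point a b m (Suc j)) \<omega>)
            = (\<Sum>j<m. Y (unif_point a b m j) [] \<omega> * incr \<kappa> n (unif_point a b m j) (unif_point a b m (Suc j)) \<omega>)"
            unfolding sum_distrib_left mult.assoc[symmetric] using elim(2) by (intro sum.cong) auto
          ultimately show ?case by (simp add: right_diff_distrib)
        qed
      qed
    qed
  qed
qed

text \<open>
  The events \<open>E r\<close> on which \<open>G\<close> and all paths of \<open>y\<close> stay below \<open>r\<close> exhaust almost all of the space. Off a small event
  the conditional probability of a large \<open>E r\<close> is at least one half, and the factor in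
  \<open>localised_sums_vanish\<close> can be removed.
\<close>

theorem weighted_sums_vanish:
  assumes ab: "0 \<le> a" "a < b" "b \<le> 1"
  shows "vanishes M iter (\<lambda>(m, n) \<omega>.
     (\<Sum>k\<in>grid_between n a b. y_coord \<iota> (grid n k) [] \<omega> * cell \<kappa> n k \<omega>) -
      (\<Sum>j<m. y_coord \<iota> (unif_point a b m j) [] \<omega> * incr \<kappa> n (unif_point a b m j) (unif_point a b m (Suc j)) \<omega>))"
proof -
  let ?D = "\<lambda>(m, n) \<omega>.
     (\<Sum>k\<in>grid_between n a b. y_coord \<iota> (grid n k) [] \<omega> * cell \<kappa> n k \<omega>) -
      (\<Sum>j<m. y_coord \<iota> (unif_point a b m j) [] \<omega> * incr \<kappa> n (unif_point a b m j) (unif_point a b m (Suc j)) \<omega>)"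
  from localised_control obtain G :: "'a \<Rightarrow> real" where G: "G \<in> borel_measurable M" and ctl: "\<forall>R\<ge>0. \<exists>K1\<ge>0. \<forall>s t w \<iota> E. E \<in> sets M \<and> (\<forall>\<omega>\<in>E. G \<omega> \<le> R) \<and> (s, t) \<in> S2 \<and> length w < l \<longrightarrow>
     (\<integral>\<^sup>+\<omega>. ennreal ((indicator E \<omega> * rho (y_coord \<iota>) s t w \<omega>)\<^sup>2) \<partial>M) \<le> ennreal ((K1 * (t - s) powr (real (l - length w) * \<nu>))\<^sup>2)"
    by (elim exE conjE)
  let ?W = "{w :: 'd list. length w < l}"
  \<comment> \<open>bounding \<open>y\<close> on the grids only makes \<open>E r\<close> an event; the other times follow by continuity\<close>
  define E where "E r = {\<omega>\<in>space M. G \<omega> \<le> real r \<and> (\<forall>w\<in>?W. \<forall>n. \<forall>k\<in>{..n}. \<bar>y_coord \<iota> (grid n k) w \<omega>\<bar> \<le> real r)}" for r :: nat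
  have Em [measurable]: "E r \<in> sets M" for r
  proof -
    have "{\<omega>\<in>space M. \<forall>w\<in>?W. \<forall>n. \<forall>k\<in>{..n}. \<bar>y_coord \<iota> (grid n k) w \<omega>\<bar> \<le> real r} \<in> sets M"
    proof (intro sets.sets_Collect_finite_All sets.sets_Collect_countable_All finite_words_less borel_measurable_le borel_measurable_abs y_coord_measurable)
      fix w :: "'d list" and n k :: nat assume "w \<in> ?W" "k \<in> {..n}"
      then show "grid n k \<in> {0..1}" "length w < l" using grid_unit[of k n] by auto
    qed auto
    moreover have "{\<omega>\<in>space M. G \<omega> \<le> real r} \<in> sets M" using G by measurable
    ultimately have "{\<omega>\<in>space M. G \<omega> \<le> real r} \<inter> {\<omega>\<in>space M. \<forall>w\<in>?W. \<forall>n. \<forall>k\<in>{..n}. \<bar>y_coord \<iota> (grid n k) w \<omega>\<bar> \<le> real r} \<in> sets M"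
      by (intro sets.Int)
    moreover have "E r = {\<omega>\<in>space M. G \<omega> \<le> real r} \<inter> {\<omega>\<in>space M. \<forall>w\<in>?W. \<forall>n. \<forall>k\<in>{..n}. \<bar>y_coord \<iota> (grid n k) w \<omega>\<bar> \<le> real r}"
      unfolding E_def by auto
    ultimately show ?thesis by (simp only:)
  qed
  have bd: "AE \<omega> in M. \<bar>indicator (E r) \<omega> * y_coord \<iota> t w \<omega>\<bar> \<le> real r" if t: "t \<in> {0..1}" and w: "length w < l" for r t w
    using y_coord_continuous[of \<iota>]
  proof eventually_elim
    case (elim \<omega>)
    show ?case
    proof (cases "\<omega> \<in> E r")
      case True
      have c: "continuous_on {0..1} (\<lambda>t. y_coord \<iota> t w \<omega>)" using elim w by blast
      have "(\<lambda>n. y_coord \<iota> (eps n t) w \<omega>) \<longlonglongrightarrow> y_coord \<iota> t w \<omega>"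
        by (rule continuous_on_tendsto_compose[OF c eps_tendsto t]) (use eps_unit[OF t] in auto)
      then have "(\<lambda>n. \<bar>y_coord \<iota> (eps n t) w \<omega>\<bar>) \<longlonglongrightarrow> \<bar>y_coord \<iota> t w \<omega>\<bar>" by (rule tendsto_rabs)
      moreover have "\<bar>y_coord \<iota> (eps n t) w \<omega>\<bar> \<le> real r" for n
      proof -
        have "eps n t = grid n (grid_index n t)" "grid_index n t \<in> {..n}" using t eps_eq[of t n] grid_index_le[of t n] by auto
        then show ?thesis using True w unfolding E_def by auto
      qed
      ultimately have "\<bar>y_coord \<iota> t w \<omega>\<bar> \<le> real r" by (intro LIMSEQ_le_const2) auto
      then show ?thesis using True by simp
    qed simp
  qed
  have inc: "incseq E"
    unfolding incseq_def E_def by (auto intro: order_trans[OF _ of_nat_mono])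
  have un: "AE \<omega> in M. \<omega> \<in> (\<Union>r. E r)"
  proof -
    have "AE \<omega> in M. \<omega> \<in> space M" by simp
    with y_coord_continuous[of \<iota>] show ?thesis
    proof eventually_elim
      case (elim \<omega>)
      have "\<exists>B. \<forall>t\<in>{0..1}. \<bar>y_coord \<iota> t w \<omega>\<bar> \<le> B" if w: "w \<in> ?W" for w
      proof -
        have "continuous_on {0..1} (\<lambda>t. y_coord \<iota> t w \<omega>)" using elim(1) w by blast
        then have "bounded ((\<lambda>t. y_coord \<iota> t w \<omega>) ` {0..1})"
          by (intro compact_imp_bounded compact_continuous_image) auto
        then show ?thesis by (auto simp: bounded_iff)
      qed
      then have "\<forall>w\<in>?W. \<exists>B. \<forall>t\<in>{0..1}. \<bar>y_coord \<iota> t w \<omega>\<bar> \<le> B" by blast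
      then obtain B where B: "\<forall>w\<in>?W. \<forall>t\<in>{0..1}. \<bar>y_coord \<iota> t w \<omega>\<bar> \<le> B w" by (rule bchoice[THEN exE])
      obtain r :: nat where r: "max (G \<omega>) (Max (B ` ?W)) \<le> real r" using real_arch_simple by blast
      have "\<omega> \<in> E r"
        unfolding E_def
      proof (intro CollectI conjI ballI allI elim(2))
        show "G \<omega> \<le> real r" using r by simp
        fix w :: "'d list" and n k :: nat assume w: "w \<in> ?W" and k: "k \<in> {..n}"
        have "\<bar>y_coord \<iota> (grid n k) w \<omega>\<bar> \<le> B w" using B w grid_unit[of k n] k by auto
        also have "\<dots> \<le> Max (B ` ?W)" using w by (intro Max_ge) (auto simp: finite_words_less)
        also have "\<dots> \<le> real r" using r by simp
        finally show "\<bar>y_coord \<iota> (grid n k) w \<omega>\<bar> \<le> real r" .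
      qed
      then show ?case by blast
    qed
  qed
  have "(\<lambda>r. measure M (E r)) \<longlonglongrightarrow> measure M (\<Union>r. E r)"
    using inc by (intro finite_Lim_measure_incseq) auto
  moreover have "measure M (\<Union>r. E r) = 1"
    using un by (subst prob_eq_1) auto
  ultimately have lim: "(\<lambda>r. measure M (E r)) \<longlonglongrightarrow> 1" by simp
  show ?thesis
    unfolding vanishes_def
  proof (intro allI impI)
    fix \<eta> \<epsilon> :: real assume h: "\<eta> > 0" "\<epsilon> > 0"
    have "\<forall>\<^sub>F r in sequentially. 1 - \<epsilon>/4 < measure M (E r)"
      using h by (intro order_tendstoD(1)[OF lim]) auto
    then obtain r where r: "1 - \<epsilon>/4 < measure M (E r)" by (meson eventually_happens' sequentially_bot)
    let ?c = "real_cond_exp M F (indicator (E r))"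
    have Ii: "integrable M (indicator (E r) :: 'a \<Rightarrow> real)" by (rule integrable_indicator_event) simp
    have c1: "AE \<omega> in M. ?c \<omega> \<le> 1" by (rule real_cond_exp_le_c[OF Ii]) (auto simp: indicator_def)
    have cm: "?c \<in> borel_measurable M" by (rule measurable_F) simp
    have ci: "integrable M ?c" "(\<integral>\<omega>. ?c \<omega> \<partial>M) = measure M (E r)" using real_cond_exp_int[OF Ii] by auto
    have "(\<integral>\<^sup>+\<omega>. ennreal \<bar>1 - ?c \<omega>\<bar> \<partial>M) = (\<integral>\<^sup>+\<omega>. ennreal (1 - ?c \<omega>) \<partial>M)"
      using c1 by (intro nn_integral_cong_AE) (auto elim!: eventually_mono)
    also have "\<dots> = ennreal (\<integral>\<omega>. 1 - ?c \<omega> \<partial>M)"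
      using ci c1 by (intro nn_integral_eq_integral) (auto elim!: eventually_mono)
    also have "(\<integral>\<omega>. 1 - ?c \<omega> \<partial>M) = 1 - measure M (E r)"
      using ci by (simp add: prob_space)
    finally have "(\<integral>\<^sup>+\<omega>. ennreal \<bar>1 - ?c \<omega>\<bar> \<partial>M) \<le> ennreal (1 - measure M (E r))" by simp
    then have n1: "near M (1/2) (\<epsilon>/2) (\<lambda>\<omega>. 1 - ?c \<omega>)"
      using cm r by (intro near_nn_integral[where a="1 - measure M (E r)"]) auto
    obtain K1 where K1: "K1 \<ge> 0" "\<forall>s t w \<iota> E. E \<in> sets M \<and> (\<forall>\<omega>\<in>E. G \<omega> \<le> real r) \<and> (s, t) \<in> S2 \<and> length w < l \<longrightarrow>
     (\<integral>\<^sup>+\<omega>. ennreal ((indicator E \<omega> * rho (y_coord \<iota>) s t w \<omega>)\<^sup>2) \<partial>M) \<le> ennreal ((K1 * (t - s) powr (real (l - length w) * \<nu>))\<^sup>2)"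
      using ctl[THEN spec, of "real r"] by (elim impE) (simp, elim exE conjE, rule that)
    have EG: "\<forall>\<omega>\<in>E r. G \<omega> \<le> real r" unfolding E_def by simp
    have rem: "(\<integral>\<^sup>+\<omega>. ennreal ((indicator (E r) \<omega> * rho (y_coord \<iota>) s t w \<omega>)\<^sup>2) \<partial>M) \<le> ennreal ((K1 * (t - s) powr (real (l - length w) * \<nu>))\<^sup>2)"
      if "(s, t) \<in> S2" "length w < l" for s t w
      by (rule K1(2)[rule_format]) (use that EG in auto)
    have "vanishes M iter (\<lambda>(m, n) \<omega>. ?c \<omega> *
     ((\<Sum>k\<in>grid_between n a b. y_coord \<iota> (grid n k) [] \<omega> * cell \<kappa> n k \<omega>) -
      (\<Sum>j<m. y_coord \<iota> (unif_point a b m j) [] \<omega> * incr \<kappa> n (unif_point a b m j) (unif_point a b m (Suc j)) \<omega>)))"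
      by (rule localised_sums_vanish[OF Em bd K1(1) rem ab])
    then have "\<forall>\<^sub>F i in iter. near M (\<eta>/2) (\<epsilon>/2) (\<lambda>\<omega>. ?c \<omega> * ?D i \<omega>)"
      using h unfolding vanishes_def by (simp add: case_prod_unfold)
    then show "\<forall>\<^sub>F i in iter. near M \<eta> \<epsilon> (?D i)"
    proof eventually_elim
      case (elim i)
      have "near M \<eta> (\<epsilon>/2 + \<epsilon>/2) (?D i)"
      proof (rule near_comb[OF n1 elim])
        fix \<omega> assume 1: "\<bar>1 - ?c \<omega>\<bar> \<le> 1/2" and 2: "\<bar>?c \<omega> * ?D i \<omega>\<bar> \<le> \<eta>/2"
        have "1/2 \<le> ?c \<omega>" using 1 by linarith
        then have "1/2 * \<bar>?D i \<omega>\<bar> \<le> ?c \<omega> * \<bar>?D i \<omega>\<bar>" by (intro mult_right_mono) auto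
        also have "\<dots> = \<bar>?c \<omega> * ?D i \<omega>\<bar>" using \<open>1/2 \<le> ?c \<omega>\<close> by (simp add: abs_mult)
        finally show "\<bar>?D i \<omega>\<bar> \<le> \<eta>" using 2 by linarith
      qed
      then show ?case by simp
    qed
  qed
qed

end

end

section \<open>Convergence of the weighted integrals\<close>

lemma borel_measurable_matrix:
  fixes f :: "'v::finite \<Rightarrow> 'w::finite \<Rightarrow> 'a \<Rightarrow> real"
  assumes "\<And>i j. f i j \<in> borel_measurable M"
  shows "(\<lambda>\<omega>. \<chi> i j. f i j \<omega>) \<in> borel_measurable M"
proof -
  have "(\<lambda>\<omega>. (\<chi> i j. f i j \<omega>) \<bullet> b) \<in> borel_measurable M" if "b \<in> Basis" for b :: "real^'w^'v"
  proof -
    have "(\<chi> i j. f i j \<omega>) \<bullet> b = (\<Sum>i\<in>UNIV. \<Sum>j\<in>UNIV. f i j \<omega> * (b $ i $ j))" for \<omega>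
      by (simp add: inner_vec_def)
    then show ?thesis using assms by simp
  qed
  then show ?thesis by (subst borel_measurable_euclidean_space) auto
qed

lemma norm_matrix_le:
  fixes A :: "real^'w^'v"
  shows "norm A \<le> (\<Sum>i\<in>UNIV. \<Sum>j\<in>UNIV. \<bar>A $ i $ j\<bar>)"
proof -
  have "norm A \<le> (\<Sum>i\<in>UNIV. norm (A $ i))"
    unfolding norm_vec_def by (rule L2_set_le_sum) auto
  also have "\<dots> \<le> (\<Sum>i\<in>UNIV. \<Sum>j\<in>UNIV. \<bar>A $ i $ j\<bar>)"
    by (intro sum_mono norm_le_l1_cart)
  finally show ?thesis .
qed

lemma norm_matrix_square:
  fixes A :: "real^'w^'v"
  shows "(norm A)\<^sup>2 = (\<Sum>i\<in>UNIV. \<Sum>j\<in>UNIV. (A $ i $ j)\<^sup>2)"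
proof -
  have "(norm A)\<^sup>2 = A \<bullet> A" by (rule power2_norm_eq_inner)
  then show ?thesis by (simp add: inner_vec_def power2_eq_square)
qed

lemma (in indep_brownian) nn_cond_exp_sum_finite:
  assumes "finite S" "\<And>i. i \<in> S \<Longrightarrow> f i \<in> borel_measurable M"
  shows "AE \<omega> in M. nn_cond_exp M F (\<lambda>\<omega>. \<Sum>i\<in>S. f i \<omega>) \<omega> = (\<Sum>i\<in>S. nn_cond_exp M F (f i) \<omega>)"
  using assms
proof (induction S rule: finite_induct)
  case empty
  have "AE \<omega> in M. (\<lambda>_. 0) \<omega> = nn_cond_exp M F (\<lambda>\<omega>. 0) \<omega>"
    by (rule nn_cond_exp_charact) auto
  then show ?case by (auto elim!: eventually_mono)
next
  case (insert k S)
  have "AE \<omega> in M. nn_cond_exp M F (f k) \<omega> + nn_cond_exp M F (\<lambda>\<omega>. \<Sum>i\<in>S. f i \<omega>) \<omega>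
     = nn_cond_exp M F (\<lambda>\<omega>. f k \<omega> + (\<Sum>i\<in>S. f i \<omega>)) \<omega>"
    by (rule nn_cond_exp_sum) (use insert in auto)
  moreover have "AE \<omega> in M. nn_cond_exp M F (\<lambda>\<omega>. \<Sum>i\<in>S. f i \<omega>) \<omega> = (\<Sum>i\<in>S. nn_cond_exp M F (f i) \<omega>)"
    using insert by auto
  ultimately show ?case
    by eventually_elim (simp add: insert(1,2))
qed

lemma vanishes_abs: "vanishes M F A \<Longrightarrow> vanishes M F (\<lambda>i \<omega>. \<bar>A i \<omega>\<bar>)"
  unfolding vanishes_def near_def by simp

context rough_increments
begin

text \<open>
  The limit \<open>v\<close> is assembled from the scalar conditional Wiener integrals of the coordinates. For the
  interchange of limits the weighted increments over the uniform partition, \<open>H\<close>, stand for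
  \<open>J(y; h\<^sup>n)\<close>, and the Wiener sums \<open>L\<close> for \<open>v\<close>; both are the same continuous function of the values
  that converge jointly.
\<close>

theorem weighted_increments_converge:
  fixes y :: "real \<Rightarrow> 'a \<Rightarrow> 'd list \<Rightarrow> real^'v"
  assumes paths: "controlled_paths M l y"
    and control: "(\<exists>K::real. \<forall>k<l. \<forall>(s, t)\<in>S2.
           Lp_norm 2 M (\<lambda>\<omega>. tnorm k (remainder l x y k s t \<omega>))
             \<le> ennreal (K * (t - s) powr (real (l - k) * \<nu>))) \<or>
        (\<exists>G::'a \<Rightarrow> real. G \<in> borel_measurable M \<and>
           (AE \<omega> in M. \<forall>k<l. \<forall>(s, t)\<in>S2.
              tnorm k (remainder l x y k s t \<omega>) \<le> G \<omega> * (t - s) powr (real (l - k) * \<nu>)))"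
    and adapted: "\<forall>t\<in>{0..1}. \<exists>z \<in> borel_measurable F. AE \<omega> in M. y t \<omega> [] = z \<omega>"
  shows "\<exists>v :: real \<Rightarrow> real \<Rightarrow> 'a \<Rightarrow> real^'w^'v.
           (\<forall>(s, t)\<in>S2. conditional_Wiener_integral M F (\<lambda>u \<omega>. y u \<omega> []) W s t (v s t)) \<and>
           fdd_conv M
             (\<lambda>n s t \<omega>. (trunc l (x s t \<omega>), J_weight n (\<lambda>u \<omega>. y u \<omega> []) (h n) s t \<omega>))
             (\<lambda>s t \<omega>. (trunc l (x s t \<omega>), v s t \<omega>))"
proof -
  define \<eta> where "\<eta> \<iota> t \<omega> = y t \<omega> [] $ \<iota>" for \<iota> t \<omega>
  have y_coord: "y_coord y \<iota> t [] \<omega> = \<eta> \<iota> t \<omega>" for \<iota> t \<omega> by (simp add: y_coord_def[OF paths control adapted] \<eta>_def)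
  have l0: "length ([] :: 'd list) < l" using l_pos by simp
  have ym: "(\<lambda>\<omega>. y t \<omega> []) \<in> borel_measurable M" if "t \<in> {0..1}" for t
    by (rule y_measurable[OF paths control adapted that l0])
  have \<eta>m: "\<eta> \<iota> t \<in> borel_measurable M" if "t \<in> {0..1}" for \<iota> t
    unfolding \<eta>_def[abs_def] by (rule measurable_compose[OF ym[OF that]]) auto
  have \<eta>c: "AE \<omega> in M. continuous_on {0..1} (\<lambda>t. \<eta> \<iota> t \<omega>)" for \<iota>
    using y_coord_continuous[OF paths control adapted, of \<iota>] l0 unfolding y_coord[symmetric] by (auto elim!: eventually_mono)
  obtain z where z: "\<And>t. t \<in> {0..1} \<Longrightarrow> z t \<in> borel_measurable F" "\<And>t. t \<in> {0..1} \<Longrightarrow> AE \<omega> in M. y t \<omega> [] = z t \<omega>"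
    using bchoice[OF adapted[unfolded Bex_def]] by (elim exE) (rule that, auto)
  define \<zeta> where "\<zeta> \<iota> t \<omega> = z t \<omega> $ \<iota>" for \<iota> t \<omega>
  have \<zeta>F: "\<zeta> \<iota> t \<in> borel_measurable F" if "t \<in> {0..1}" for \<iota> t
    unfolding \<zeta>_def[abs_def] by (rule measurable_compose[OF z(1)[OF that]]) auto
  have \<eta>\<zeta>: "AE \<omega> in M. \<eta> \<iota> t \<omega> = \<zeta> \<iota> t \<omega>" if "t \<in> {0..1}" for \<iota> t
    using z(2)[OF that] by (auto simp: \<eta>_def \<zeta>_def elim!: eventually_mono)
  have wi: "\<exists>I\<in>borel_measurable M.
     vanishes M sequentially (\<lambda>m \<omega>. wiener_sum \<kappa> (\<eta> \<iota>) m (unif_point s t m) \<omega> - I \<omega>) \<and>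
     (\<forall>N \<pi>. (\<forall>m. partition_of s t (N m) (\<pi> m)) \<longrightarrow>
        (\<forall>e>0. \<forall>\<^sub>F m in sequentially. \<forall>j<N m. \<pi> m (Suc j) - \<pi> m j < e) \<longrightarrow>
        (AE \<omega> in M. (\<lambda>m. nn_cond_exp M F (\<lambda>\<omega>. ennreal ((I \<omega> - wiener_sum \<kappa> (\<eta> \<iota>) (N m) (\<pi> m) \<omega>)\<^sup>2)) \<omega>) \<longlonglongrightarrow> 0))"
    if st: "(s, t) \<in> S2" for s t \<iota> \<kappa>
  proof (rule wiener_integral_exists[OF \<eta>m \<eta>c])
    show "\<exists>z\<in>borel_measurable F. AE \<omega> in M. \<eta> \<iota> t \<omega> = z \<omega>" if "t \<in> {0..1}" for t
      using \<zeta>F[OF that] \<eta>\<zeta>[OF that] by blast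
  qed (use S2_D[OF st] in auto)
  define Q where "Q s t \<iota> \<kappa> I \<longleftrightarrow> I \<in> borel_measurable M \<and>
     vanishes M sequentially (\<lambda>m \<omega>. wiener_sum \<kappa> (\<eta> \<iota>) m (unif_point s t m) \<omega> - I \<omega>) \<and>
     (\<forall>N \<pi>. (\<forall>m. partition_of s t (N m) (\<pi> m)) \<longrightarrow>
        (\<forall>e>0. \<forall>\<^sub>F m in sequentially. \<forall>j<N m. \<pi> m (Suc j) - \<pi> m j < e) \<longrightarrow>
        (AE \<omega> in M. (\<lambda>m. nn_cond_exp M F (\<lambda>\<omega>. ennreal ((I \<omega> - wiener_sum \<kappa> (\<eta> \<iota>) (N m) (\<pi> m) \<omega>)\<^sup>2)) \<omega>) \<longlonglongrightarrow> 0))"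
    for s t \<iota> \<kappa> I
  define I where "I s t \<iota> \<kappa> = (SOME I. Q s t \<iota> \<kappa> I)" for s t \<iota> \<kappa>
  have "Q s t \<iota> \<kappa> (I s t \<iota> \<kappa>)" if st: "(s, t) \<in> S2" for s t \<iota> \<kappa>
  proof -
    obtain J where "Q s t \<iota> \<kappa> J" using wi[OF st, of \<kappa> \<iota>] unfolding Q_def by blast
    then show ?thesis unfolding I_def by (rule someI[of "Q s t \<iota> \<kappa>"])
  qed
  then have Im: "\<And>s t \<iota> \<kappa>. (s, t) \<in> S2 \<Longrightarrow> I s t \<iota> \<kappa> \<in> borel_measurable M"
    and Iv: "\<And>s t \<iota> \<kappa>. (s, t) \<in> S2 \<Longrightarrow> vanishes M sequentially (\<lambda>m \<omega>. wiener_sum \<kappa> (\<eta> \<iota>) m (unif_point s t m) \<omega> - I s t \<iota> \<kappa> \<omega>)"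
    and Ic: "\<And>s t \<iota> \<kappa> N \<pi>. (s, t) \<in> S2 \<Longrightarrow> (\<forall>m. partition_of s t (N m) (\<pi> m)) \<Longrightarrow>
        (\<forall>e>0. \<forall>\<^sub>F m in sequentially. \<forall>j<N m. \<pi> m (Suc j) - \<pi> m j < e) \<Longrightarrow>
        (AE \<omega> in M. (\<lambda>m. nn_cond_exp M F (\<lambda>\<omega>. ennreal ((I s t \<iota> \<kappa> \<omega> - wiener_sum \<kappa> (\<eta> \<iota>) (N m) (\<pi> m) \<omega>)\<^sup>2)) \<omega>) \<longlonglongrightarrow> 0)"
    unfolding Q_def by blast+
  define v where "v s t \<omega> = (\<chi> \<iota> \<kappa>. I s t \<iota> \<kappa> \<omega>)" for s t \<omega>
  have vm: "v s t \<in> borel_measurable M" if "(s, t) \<in> S2" for s t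
    unfolding v_def[abs_def] by (rule borel_measurable_matrix) (rule Im[OF that])
  have integral: "conditional_Wiener_integral M F (\<lambda>u \<omega>. y u \<omega> []) W s t (v s t)" if st: "(s, t) \<in> S2" for s t
    unfolding conditional_Wiener_integral_def
  proof (intro conjI allI impI vm[OF st])
    fix N :: "nat \<Rightarrow> nat" and \<pi> :: "nat \<Rightarrow> nat \<Rightarrow> real"
    assume h: "(\<forall>m. \<pi> m 0 = s \<and> \<pi> m (N m) = t \<and> (\<forall>j<N m. \<pi> m j \<le> \<pi> m (Suc j))) \<and>
      (\<forall>e>0. \<forall>\<^sub>F m in sequentially. \<forall>j<N m. \<pi> m (Suc j) - \<pi> m j < e)"
    have P: "\<forall>m. partition_of s t (N m) (\<pi> m)" using h unfolding partition_of_def by blast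
    have mesh: "\<forall>e>0. \<forall>\<^sub>F m in sequentially. \<forall>j<N m. \<pi> m (Suc j) - \<pi> m j < e" using h by blast
    let ?d = "\<lambda>m \<iota> \<kappa> \<omega>. ennreal ((I s t \<iota> \<kappa> \<omega> - wiener_sum \<kappa> (\<eta> \<iota>) (N m) (\<pi> m) \<omega>)\<^sup>2)"
    let ?A = "\<lambda>m \<omega>. v s t \<omega> - (\<Sum>j<N m. outer (y (\<pi> m j) \<omega> []) (W (\<pi> m (Suc j)) \<omega> - W (\<pi> m j) \<omega>))"
    have wm: "wiener_sum \<kappa> (\<eta> \<iota>) (N m) (\<pi> m) \<in> borel_measurable M" for \<iota> \<kappa> m
      using S2_D[OF st] P by (intro wiener_sum_measurable[OF \<eta>m]) auto
    have dm: "?d m \<iota> \<kappa> \<in> borel_measurable M" for m \<iota> \<kappa>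
      using wm[of \<kappa> \<iota> m] Im[OF st, of \<iota> \<kappa>] by measurable
    have comp: "?A m \<omega> $ \<iota> $ \<kappa> = I s t \<iota> \<kappa> \<omega> - wiener_sum \<kappa> (\<eta> \<iota>) (N m) (\<pi> m) \<omega>" for m \<omega> \<iota> \<kappa>
      by (simp add: v_def wiener_sum_def outer_def sum_component \<eta>_def)
    have nrm: "ennreal ((norm (?A m \<omega>))\<^sup>2) = (\<Sum>c\<in>UNIV. ?d m (fst c) (snd c) \<omega>)" for m \<omega>
    proof -
      have "(norm (?A m \<omega>))\<^sup>2 = (\<Sum>c\<in>UNIV. (I s t (fst c) (snd c) \<omega> - wiener_sum (snd c) (\<eta> (fst c)) (N m) (\<pi> m) \<omega>)\<^sup>2)"
        unfolding norm_matrix_square comp by (simp add: sum.cartesian_product case_prod_unfold UNIV_Times_UNIV)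
      then show ?thesis by (simp add: sum_ennreal)
    qed
    have "AE \<omega> in M. \<forall>m. nn_cond_exp M F (\<lambda>\<omega>. \<Sum>c\<in>UNIV. ?d m (fst c) (snd c) \<omega>) \<omega> = (\<Sum>c\<in>UNIV. nn_cond_exp M F (?d m (fst c) (snd c)) \<omega>)"
      unfolding AE_all_countable by (intro allI nn_cond_exp_sum_finite dm) simp
    moreover have "AE \<omega> in M. \<forall>c\<in>UNIV. (\<lambda>m. nn_cond_exp M F (?d m (fst c) (snd c)) \<omega>) \<longlonglongrightarrow> 0"
      by (rule AE_finite_allI) (use Ic[OF st P mesh] in auto)
    ultimately show "AE \<omega> in M. (\<lambda>m. nn_cond_exp M F (\<lambda>\<omega>. ennreal ((norm (?A m \<omega>))\<^sup>2)) \<omega>) \<longlonglongrightarrow> 0"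
      unfolding nrm
    proof eventually_elim
      case (elim \<omega>)
      have "(\<lambda>m. \<Sum>c\<in>UNIV. nn_cond_exp M F (?d m (fst c) (snd c)) \<omega>) \<longlonglongrightarrow> (\<Sum>c\<in>(UNIV :: ('v \<times> 'w) set). 0)"
        using elim(2) by (intro tendsto_sum) auto
      then show ?case using elim(1) by simp
    qed
  qed
  have J: "J_weight n (\<lambda>u \<omega>. y u \<omega> []) (h n) s t \<omega> $ \<iota> $ \<kappa> = (\<Sum>k\<in>grid_between n s t. \<eta> \<iota> (grid n k) \<omega> * cell \<kappa> n k \<omega>)" for n s t \<omega> \<iota> \<kappa>
    by (simp add: J_weight_def sum_component outer_def \<eta>_def cell_def)
  have Jeq: "J_weight n (\<lambda>u \<omega>. y u \<omega> []) (h n) s t \<omega> = (\<chi> \<iota> \<kappa>. \<Sum>k\<in>grid_between n s t. \<eta> \<iota> (grid n k) \<omega> * cell \<kappa> n k \<omega>)" for n s t \<omega>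
    by (simp add: vec_eq_iff J)
  have Jm: "J_weight n (\<lambda>u \<omega>. y u \<omega> []) (h n) s t \<in> borel_measurable M" for n s t
    unfolding Jeq[abs_def]
  proof (rule borel_measurable_matrix, intro borel_measurable_sum borel_measurable_times \<eta>m cell_measurable)
    fix k assume "k \<in> grid_between n s t"
    then show "k < n" "grid n k \<in> {0..1}" using grid_unit[of k n] by (auto simp: grid_between_def)
  qed
  define H where "H \<iota> \<kappa> s t m n \<omega> = (\<Sum>j<m. \<zeta> \<iota> (unif_point s t m j) \<omega> * incr \<kappa> n (unif_point s t m j) (unif_point s t m (Suc j)) \<omega>)" for \<iota> \<kappa> s t m n \<omega>
  define L where "L \<iota> \<kappa> s t m = wiener_sum \<kappa> (\<zeta> \<iota>) m (unif_point s t m)" for \<iota> \<kappa> s t m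
  have pt: "unif_point s t m j \<in> {0..1}" if "(s, t) \<in> S2" "m \<ge> 1" "j \<le> m" for s t m j
    using unif_point_bounds[OF that(2), of s t j] that S2_D[OF that(1)] by auto
  have \<zeta>M: "\<zeta> \<iota> t \<in> borel_measurable M" if "t \<in> {0..1}" for \<iota> t using \<zeta>F[OF that] by (rule measurable_F)
  have ae_pts: "AE \<omega> in M. \<forall>j\<in>{..m}. \<eta> \<iota> (unif_point s t m j) \<omega> = \<zeta> \<iota> (unif_point s t m j) \<omega>" if "(s, t) \<in> S2" "m \<ge> 1" for s t m \<iota>
    by (rule AE_finite_allI) (use \<eta>\<zeta> pt[OF that] in auto)
  have Hv: "vanishes M iter (\<lambda>(m, n) \<omega>. J_weight n (\<lambda>u \<omega>. y u \<omega> []) (h n) s t \<omega> $ \<iota> $ \<kappa> - H \<iota> \<kappa> s t m n \<omega>)" if st: "(s, t) \<in> S2" for s t \<iota> \<kappa>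
  proof (cases "s = t")
    case True
    have "grid_between n t t = {}" for n by (auto simp: grid_between_def)
    then have "(\<lambda>(m, n) \<omega>. J_weight n (\<lambda>u \<omega>. y u \<omega> []) (h n) s t \<omega> $ \<iota> $ \<kappa> - H \<iota> \<kappa> s t m n \<omega>) = (\<lambda>_ _. 0)"
      unfolding J H_def incr_eq True by (simp add: unif_point_def fun_eq_iff)
    then show ?thesis by (simp add: vanishes_zero)
  next
    case False
    then have o: "0 \<le> s" "s < t" "t \<le> 1" using S2_D[OF st] by auto
    show ?thesis
    proof (rule vanishes_cong[OF weighted_sums_vanish[OF paths control adapted o, of \<iota> \<kappa>, unfolded y_coord]])
      show "\<forall>\<^sub>F i in iter. AE \<omega> in M. (case i of (m, n) \<Rightarrow> \<lambda>\<omega>. J_weight n (\<lambda>u \<omega>. y u \<omega> []) (h n) s t \<omega> $ \<iota> $ \<kappa> - H \<iota> \<kappa> s t m n \<omega>) \<omega> =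
         (case i of (m, n) \<Rightarrow> \<lambda>\<omega>. (\<Sum>k\<in>grid_between n s t. \<eta> \<iota> (grid n k) \<omega> * cell \<kappa> n k \<omega>) -
          (\<Sum>j<m. \<eta> \<iota> (unif_point s t m j) \<omega> * incr \<kappa> n (unif_point s t m j) (unif_point s t m (Suc j)) \<omega>)) \<omega>"
        unfolding eventually_iter prod.case using eventually_ge_at_top[of 1]
      proof eventually_elim
        case (elim m)
        show ?case
        proof (rule always_eventually, rule allI)
          fix n
          show "AE \<omega> in M. J_weight n (\<lambda>u \<omega>. y u \<omega> []) (h n) s t \<omega> $ \<iota> $ \<kappa> - H \<iota> \<kappa> s t m n \<omega> =
            (\<Sum>k\<in>grid_between n s t. \<eta> \<iota> (grid n k) \<omega> * cell \<kappa> n k \<omega>) -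
            (\<Sum>j<m. \<eta> \<iota> (unif_point s t m j) \<omega> * incr \<kappa> n (unif_point s t m j) (unif_point s t m (Suc j)) \<omega>)"
            using ae_pts[OF st elim, of \<iota>]
          proof eventually_elim
            case (elim \<omega>)
            have "H \<iota> \<kappa> s t m n \<omega> = (\<Sum>j<m. \<eta> \<iota> (unif_point s t m j) \<omega> * incr \<kappa> n (unif_point s t m j) (unif_point s t m (Suc j)) \<omega>)"
              unfolding H_def using elim by (intro sum.cong) auto
            then show ?case unfolding J by simp
          qed
        qed
      qed
    qed
  qed
  have Lv: "vanishes M sequentially (\<lambda>m \<omega>. L \<iota> \<kappa> s t m \<omega> - I s t \<iota> \<kappa> \<omega>)" if st: "(s, t) \<in> S2" for s t \<iota> \<kappa>
  proof (rule vanishes_cong[OF Iv[OF st, of \<kappa> \<iota>]])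
    show "\<forall>\<^sub>F m in sequentially. AE \<omega> in M. L \<iota> \<kappa> s t m \<omega> - I s t \<iota> \<kappa> \<omega> = wiener_sum \<kappa> (\<eta> \<iota>) m (unif_point s t m) \<omega> - I s t \<iota> \<kappa> \<omega>"
      using eventually_ge_at_top[of 1]
    proof eventually_elim
      case (elim m)
      show ?case using ae_pts[OF st elim, of \<iota>]
      proof eventually_elim
        case (elim \<omega>)
        have "L \<iota> \<kappa> s t m \<omega> = wiener_sum \<kappa> (\<eta> \<iota>) m (unif_point s t m) \<omega>"
          unfolding L_def wiener_sum_def using elim by (intro sum.cong) auto
        then show ?case by simp
      qed
    qed
  qed
  have Hm: "H \<iota> \<kappa> s t m n \<in> borel_measurable M" if "(s, t) \<in> S2" for \<iota> \<kappa> s t m n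
    unfolding H_def[abs_def] by (intro borel_measurable_sum borel_measurable_times \<zeta>M incr_measurable pt[OF that]) auto
  have Lm: "L \<iota> \<kappa> s t m \<in> borel_measurable M" if "(s, t) \<in> S2" for \<iota> \<kappa> s t m
    unfolding L_def wiener_sum_def[abs_def] by (intro borel_measurable_sum borel_measurable_times borel_measurable_diff \<zeta>M W_comp_measurable pt[OF that]) auto
  have fdd': "fdd_conv M
             (\<lambda>n s t \<omega>. (trunc l (x s t \<omega>), J_weight n (\<lambda>u \<omega>. y u \<omega> []) (h n) s t \<omega>))
             (\<lambda>s t \<omega>. (trunc l (x s t \<omega>), v s t \<omega>))"
    unfolding fdd_conv_def
  proof (intro allI impI)
    fix q :: nat and p :: "nat \<Rightarrow> real \<times> real" assume p: "\<forall>i<q. p i \<in> S2"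
    let ?a = "\<lambda>i. fst (p i)" and ?b = "\<lambda>i. snd (p i)"
    have S: "(?a i, ?b i) \<in> S2" if "i < q" for i using p that by simp
    let ?X = "\<lambda>i \<omega>. trunc l (x (?a i) (?b i) \<omega>)"
    let ?U = "\<lambda>m n \<omega>. \<lambda>i\<in>{..<q}. (?X i \<omega>, (\<chi> \<iota> \<kappa>. H \<iota> \<kappa> (?a i) (?b i) m n \<omega>) :: real^'w^'v)"
    let ?V = "\<lambda>m \<omega>. \<lambda>i\<in>{..<q}. (?X i \<omega>, (\<chi> \<iota> \<kappa>. L \<iota> \<kappa> (?a i) (?b i) m \<omega>) :: real^'w^'v)"
    let ?J = "\<lambda>n i. J_weight n (\<lambda>u \<omega>. y u \<omega> []) (h n) (?a i) (?b i)"
    have dist_le: "dist (\<lambda>i\<in>{..<q}. (?X i \<omega>, A i)) (\<lambda>i\<in>{..<q}. (?X i \<omega>, B i))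
        \<le> 2 * (\<Sum>i<q. \<Sum>\<iota>\<in>UNIV. \<Sum>\<kappa>\<in>UNIV. \<bar>A i $ \<iota> $ \<kappa> - B i $ \<iota> $ \<kappa>\<bar>)" for A B :: "nat \<Rightarrow> real^'w^'v" and \<omega>
    proof (rule dist_fun_le)
      fix i
      show "dist ((\<lambda>i\<in>{..<q}. (?X i \<omega>, A i)) i) ((\<lambda>i\<in>{..<q}. (?X i \<omega>, B i)) i) \<le> (\<Sum>i<q. \<Sum>\<iota>\<in>UNIV. \<Sum>\<kappa>\<in>UNIV. \<bar>A i $ \<iota> $ \<kappa> - B i $ \<iota> $ \<kappa>\<bar>)"
      proof (cases "i < q")
        case True
        have "dist ((\<lambda>i\<in>{..<q}. (?X i \<omega>, A i)) i) ((\<lambda>i\<in>{..<q}. (?X i \<omega>, B i)) i) = norm (A i - B i)"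
          using True by (simp add: dist_Pair_Pair dist_norm)
        also have "\<dots> \<le> (\<Sum>\<iota>\<in>UNIV. \<Sum>\<kappa>\<in>UNIV. \<bar>A i $ \<iota> $ \<kappa> - B i $ \<iota> $ \<kappa>\<bar>)"
          using norm_matrix_le[of "A i - B i"] by simp
        also have "\<dots> \<le> (\<Sum>i<q. \<Sum>\<iota>\<in>UNIV. \<Sum>\<kappa>\<in>UNIV. \<bar>A i $ \<iota> $ \<kappa> - B i $ \<iota> $ \<kappa>\<bar>)"
          using True by (intro member_le_sum[where f="\<lambda>i. \<Sum>\<iota>\<in>UNIV. \<Sum>\<kappa>\<in>UNIV. \<bar>A i $ \<iota> $ \<kappa> - B i $ \<iota> $ \<kappa>\<bar>"]) (auto intro!: sum_nonneg)
        finally show ?thesis .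
      next
        case False
        then show ?thesis by (auto intro!: sum_nonneg)
      qed
    qed
    show "conv_in_distr M
       (\<lambda>n \<omega>. \<lambda>i\<in>{..<q}. (?X i \<omega>, ?J n i \<omega>)) (\<lambda>\<omega>. \<lambda>i\<in>{..<q}. (?X i \<omega>, v (?a i) (?b i) \<omega>))"
    proof (rule convergence_together[where U="?U" and V="?V"])
      show "(\<lambda>\<omega>. \<lambda>i\<in>{..<q}. (?X i \<omega>, ?J n i \<omega>)) \<in> borel_measurable M" for n
        by (intro measurable_restrict_family borel_measurable_Pair trunc_measurable Jm S) auto
      show "(\<lambda>\<omega>. \<lambda>i\<in>{..<q}. (?X i \<omega>, v (?a i) (?b i) \<omega>)) \<in> borel_measurable M"
        by (intro measurable_restrict_family borel_measurable_Pair trunc_measurable vm S) auto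
      show "?U m n \<in> borel_measurable M" for m n
        by (intro measurable_restrict_family borel_measurable_Pair trunc_measurable borel_measurable_matrix Hm S) auto
      show "?V m \<in> borel_measurable M" for m
        by (intro measurable_restrict_family borel_measurable_Pair trunc_measurable borel_measurable_matrix Lm S) auto
    next
      fix m :: nat assume m: "m \<ge> 1"
      let ?u = "\<lambda>i j. unif_point (?a i) (?b i) m j"
      let ?I = "{..<q} \<times> {..m}"
      \<comment> \<open>index \<open>(i, 0)\<close> carries the value of \<open>x\<close> at the \<open>i\<close>-th pair, index \<open>(i, j + 1)\<close> the increment
        over the \<open>j\<close>-th piece of that pair\<close>
      define P where "P = (\<lambda>(i, k). case k of 0 \<Rightarrow> p i | Suc j \<Rightarrow> (?u i j, ?u i (Suc j)))"
      \<comment> \<open>the coordinates of the weight are numbered, because families of random variables converging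
        jointly are indexed by a countable type\<close>
      define e :: "'v \<Rightarrow> nat" where "e = to_nat_on UNIV"
      have inj: "from_nat_into UNIV (e \<iota>) = \<iota>" for \<iota>
        unfolding e_def by (rule from_nat_into_to_nat_on) (auto intro: countable_finite)
      define C where "C = {..<q} \<times> {..<m} \<times> range e"
      define Z where "Z = (\<lambda>(i, j, a). \<zeta> (from_nat_into UNIV a) (?u i j))"
      have PS: "P c \<in> S2" if cI: "c \<in> ?I" for c
      proof -
        obtain i k where c: "c = (i, k)" "i < q" "k \<le> m" using cI by auto
        show ?thesis
        proof (cases k)
          case 0
          then show ?thesis using c p by (simp add: P_def)
        next
          case (Suc j)
          then show ?thesis using c unif_S2[OF m, of "?a i" "?b i" j "Suc j"] S2_D[OF S[OF c(2)]] by (simp add: P_def)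
        qed
      qed
      have ZF: "Z c \<in> borel_measurable F" if "c \<in> C" for c
        using that pt[OF S m] by (auto simp: Z_def C_def intro!: \<zeta>F) 
      have fin: "finite ?I" "finite C" unfolding C_def by auto
      let ?\<Phi> = "\<lambda>(f, g). \<lambda>i\<in>{..<q}. (fst (f (i, 0)), (\<chi> \<iota> \<kappa>. \<Sum>j<m. g (i, j, e \<iota>) * (snd (f (i, Suc j)) $ \<kappa>)) :: real^'w^'v)"
      have coord1: "continuous_on UNIV (\<lambda>w :: (nat \<times> nat \<Rightarrow> ('d list \<Rightarrow> real) \<times> (real^'w)) \<times> (nat \<times> nat \<times> nat \<Rightarrow> real). fst w c)" for c
        by (rule continuous_on_product_then_coordinatewise) (intro continuous_intros)
      have coord2: "continuous_on UNIV (\<lambda>w :: (nat \<times> nat \<Rightarrow> ('d list \<Rightarrow> real) \<times> (real^'w)) \<times> (nat \<times> nat \<times> nat \<Rightarrow> real). snd w c)" for c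
        by (rule continuous_on_product_then_coordinatewise) (intro continuous_intros)
      have cont: "continuous_on UNIV (?\<Phi> :: (nat \<times> nat \<Rightarrow> ('d list \<Rightarrow> real) \<times> (real^'w)) \<times> (nat \<times> nat \<times> nat \<Rightarrow> real) \<Rightarrow> nat \<Rightarrow> ('d list \<Rightarrow> real) \<times> (real^'w^'v))"
        unfolding case_prod_unfold
        by (intro continuous_on_restrict_family continuous_on_Pair continuous_on_fst continuous_on_vec_lambda
          continuous_on_sum continuous_on_mult continuous_on_component continuous_on_snd coord1 coord2)
      have ev: "?\<Phi> (\<lambda>c\<in>?I. (trunc l (x (fst (P c)) (snd (P c)) \<omega>), D (fst (P c)) (snd (P c))), \<lambda>c\<in>C. Z c \<omega>)
        = (\<lambda>i\<in>{..<q}. (?X i \<omega>, (\<chi> \<iota> \<kappa>. \<Sum>j<m. \<zeta> \<iota> (?u i j) \<omega> * (D (?u i j) (?u i (Suc j)) $ \<kappa>)) :: real^'w^'v))" for \<omega> and D :: "real \<Rightarrow> real \<Rightarrow> real^'w"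
        unfolding prod.case
      proof (rule restrict_ext)
        fix i assume i: "i \<in> {..<q}"
        have "(\<Sum>j<m. (\<lambda>c\<in>C. Z c \<omega>) (i, j, e \<iota>) * (snd ((\<lambda>c\<in>?I. (trunc l (x (fst (P c)) (snd (P c)) \<omega>), D (fst (P c)) (snd (P c)))) (i, Suc j)) $ \<kappa>))
          = (\<Sum>j<m. \<zeta> \<iota> (?u i j) \<omega> * (D (?u i j) (?u i (Suc j)) $ \<kappa>))" for \<iota> \<kappa>
          using i by (intro sum.cong) (auto simp: C_def Z_def P_def inj)
        then show "(fst ((\<lambda>c\<in>?I. (trunc l (x (fst (P c)) (snd (P c)) \<omega>), D (fst (P c)) (snd (P c)))) (i, 0)),
          (\<chi> \<iota> \<kappa>. \<Sum>j<m. (\<lambda>c\<in>C. Z c \<omega>) (i, j, e \<iota>) * (snd ((\<lambda>c\<in>?I. (trunc l (x (fst (P c)) (snd (P c)) \<omega>), D (fst (P c)) (snd (P c)))) (i, Suc j)) $ \<kappa>)) :: real^'w^'v)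
          = (?X i \<omega>, (\<chi> \<iota> \<kappa>. \<Sum>j<m. \<zeta> \<iota> (?u i j) \<omega> * (D (?u i j) (?u i (Suc j)) $ \<kappa>)))"
          using i by (simp add: P_def)
      qed
      have U: "?U m n \<omega> = (\<lambda>i\<in>{..<q}. (?X i \<omega>, (\<chi> \<iota> \<kappa>. \<Sum>j<m. \<zeta> \<iota> (?u i j) \<omega> * ((\<lambda>s t. increment n (h n) s t \<omega>) (?u i j) (?u i (Suc j)) $ \<kappa>))))" for n \<omega>
        by (simp add: H_def incr_def)
      have V: "?V m \<omega> = (\<lambda>i\<in>{..<q}. (?X i \<omega>, (\<chi> \<iota> \<kappa>. \<Sum>j<m. \<zeta> \<iota> (?u i j) \<omega> * ((\<lambda>s t. W t \<omega> - W s \<omega>) (?u i j) (?u i (Suc j)) $ \<kappa>))))" for \<omega>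
        by (simp add: L_def wiener_sum_def)
      show "conv_in_distr M (?U m) (?V m)"
        using conv_in_distr_compose[OF joint_convergence[OF fin(1) PS fin(2) ZF] cont]
        unfolding U V ev[of _ "\<lambda>s t. increment n (h n) s t \<omega>" for n \<omega>, symmetric] ev[of _ "\<lambda>s t. W t \<omega> - W s \<omega>" for \<omega>, symmetric] .
    next
      fix \<delta> :: real assume \<delta>: "\<delta> > 0"
      have "vanishes M iter (\<lambda>c \<omega>. \<Sum>i<q. \<Sum>\<iota>\<in>UNIV. \<Sum>\<kappa>\<in>UNIV. \<bar>(\<lambda>(m, n) \<omega>. ?J n i \<omega> $ \<iota> $ \<kappa> - H \<iota> \<kappa> (?a i) (?b i) m n \<omega>) c \<omega>\<bar>)"
      proof (intro vanishes_sum)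
        fix i and \<iota> :: 'v and \<kappa> :: 'w assume "i \<in> {..<q}"
        then show "vanishes M iter (\<lambda>c \<omega>. \<bar>(\<lambda>(m, n) \<omega>. ?J n i \<omega> $ \<iota> $ \<kappa> - H \<iota> \<kappa> (?a i) (?b i) m n \<omega>) c \<omega>\<bar>)"
          by (intro vanishes_abs Hv S) simp
      qed
      then have 1: "\<forall>\<^sub>F m in sequentially. \<forall>\<^sub>F n in sequentially. near M (\<delta>/2) \<delta>
          (\<lambda>\<omega>. \<Sum>i<q. \<Sum>\<iota>\<in>UNIV. \<Sum>\<kappa>\<in>UNIV. \<bar>?J n i \<omega> $ \<iota> $ \<kappa> - H \<iota> \<kappa> (?a i) (?b i) m n \<omega>\<bar>)"
        using \<delta> unfolding vanishes_def eventually_iter by simp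
      have "vanishes M sequentially (\<lambda>m \<omega>. \<Sum>i<q. \<Sum>\<iota>\<in>UNIV. \<Sum>\<kappa>\<in>UNIV. \<bar>L \<iota> \<kappa> (?a i) (?b i) m \<omega> - I (?a i) (?b i) \<iota> \<kappa> \<omega>\<bar>)"
      proof (intro vanishes_sum)
        fix i and \<iota> :: 'v and \<kappa> :: 'w assume "i \<in> {..<q}"
        then show "vanishes M sequentially (\<lambda>m \<omega>. \<bar>L \<iota> \<kappa> (?a i) (?b i) m \<omega> - I (?a i) (?b i) \<iota> \<kappa> \<omega>\<bar>)"
          by (intro vanishes_abs Lv S) simp
      qed
      then have 2: "\<forall>\<^sub>F m in sequentially. near M (\<delta>/2) \<delta> (\<lambda>\<omega>. \<Sum>i<q. \<Sum>\<iota>\<in>UNIV. \<Sum>\<kappa>\<in>UNIV. \<bar>L \<iota> \<kappa> (?a i) (?b i) m \<omega> - I (?a i) (?b i) \<iota> \<kappa> \<omega>\<bar>)"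
        using \<delta> unfolding vanishes_def by simp
      have near2: "near M \<delta> \<delta> f" if g: "near M (\<delta>/2) \<delta> g" and le: "\<And>\<omega>. \<bar>f \<omega>\<bar> \<le> 2 * \<bar>g \<omega>\<bar>" for f g :: "'a \<Rightarrow> real"
      proof -
        have "\<bar>f \<omega>\<bar> \<le> \<delta>" if "\<bar>g \<omega>\<bar> \<le> \<delta>/2" for \<omega> using that le[of \<omega>] by linarith
        then show ?thesis using g unfolding near_def by meson
      qed
      have "\<forall>\<^sub>F m in sequentially. near M \<delta> \<delta> (\<lambda>\<omega>. dist (?V m \<omega>) (\<lambda>i\<in>{..<q}. (?X i \<omega>, v (?a i) (?b i) \<omega>))) \<and>
         (\<forall>\<^sub>F n in sequentially. near M \<delta> \<delta> (\<lambda>\<omega>. dist (\<lambda>i\<in>{..<q}. (?X i \<omega>, ?J n i \<omega>)) (?U m n \<omega>)))"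
        using 1 2
      proof eventually_elim
        case (elim m)
        show ?case
        proof
          show "near M \<delta> \<delta> (\<lambda>\<omega>. dist (?V m \<omega>) (\<lambda>i\<in>{..<q}. (?X i \<omega>, v (?a i) (?b i) \<omega>)))"
          proof (rule near2[OF elim(2)])
            fix \<omega>
            show "\<bar>dist (?V m \<omega>) (\<lambda>i\<in>{..<q}. (?X i \<omega>, v (?a i) (?b i) \<omega>))\<bar> \<le> 2 * \<bar>\<Sum>i<q. \<Sum>\<iota>\<in>UNIV. \<Sum>\<kappa>\<in>UNIV. \<bar>L \<iota> \<kappa> (?a i) (?b i) m \<omega> - I (?a i) (?b i) \<iota> \<kappa> \<omega>\<bar>\<bar>"
              using dist_le[of \<omega> "\<lambda>i. \<chi> \<iota> \<kappa>. L \<iota> \<kappa> (?a i) (?b i) m \<omega>" "\<lambda>i. v (?a i) (?b i) \<omega>"]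
              by (simp add: v_def)
          qed
          show "\<forall>\<^sub>F n in sequentially. near M \<delta> \<delta> (\<lambda>\<omega>. dist (\<lambda>i\<in>{..<q}. (?X i \<omega>, ?J n i \<omega>)) (?U m n \<omega>))"
            using elim(1)
          proof eventually_elim
            case (elim n)
            show ?case
            proof (rule near2[OF elim])
              fix \<omega>
              show "\<bar>dist (\<lambda>i\<in>{..<q}. (?X i \<omega>, ?J n i \<omega>)) (?U m n \<omega>)\<bar> \<le> 2 * \<bar>\<Sum>i<q. \<Sum>\<iota>\<in>UNIV. \<Sum>\<kappa>\<in>UNIV. \<bar>?J n i \<omega> $ \<iota> $ \<kappa> - H \<iota> \<kappa> (?a i) (?b i) m n \<omega>\<bar>\<bar>"
                using dist_le[of \<omega> "\<lambda>i. ?J n i \<omega>" "\<lambda>i. \<chi> \<iota> \<kappa>. H \<iota> \<kappa> (?a i) (?b i) m n \<omega>"] by simp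
            qed
          qed
        qed
      qed
      from eventually_sequentially_ge1[OF this]
      show "\<exists>m\<ge>1. near M \<delta> \<delta> (\<lambda>\<omega>. dist (?V m \<omega>) (\<lambda>i\<in>{..<q}. (?X i \<omega>, v (?a i) (?b i) \<omega>))) \<and>
         (\<forall>\<^sub>F n in sequentially. near M \<delta> \<delta> (\<lambda>\<omega>. dist (\<lambda>i\<in>{..<q}. (?X i \<omega>, ?J n i \<omega>)) (?U m n \<omega>)))" .
    qed
  qed
  show ?thesis
    using integral fdd' by (intro exI[of _ v]) auto
qed

end

theorem theorem1p2:
  fixes M :: "'a measure"
    and \<nu> K :: real
    and l :: nat
    and x :: "real \<Rightarrow> real \<Rightarrow> 'a \<Rightarrow> 'd::finite list \<Rightarrow> real"
    and y :: "real \<Rightarrow> 'a \<Rightarrow> 'd list \<Rightarrow> real^'v"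
    and h :: "nat \<Rightarrow> real \<Rightarrow> real \<Rightarrow> 'a \<Rightarrow> real^'w"
    and W :: "real \<Rightarrow> 'a \<Rightarrow> real^'w"
  assumes "prob_space M"
    and "0 < \<nu>" "\<nu> < 1"
    and "l = controlled_order \<nu> (1/2)"
    and "rough_path M 4 \<nu> l x"
    and "controlled_Lp M 2 \<nu> (1/2) x y \<or> controlled_as M \<nu> (1/2) x y"
    (* conditionally on x the integrand of the limit is deterministic *)
    and "\<forall>t\<in>{0..1}. \<exists>z \<in> borel_measurable (sigma_path M l x). AE \<omega> in M. y t \<omega> [] = z \<omega>"
    and "\<forall>n\<ge>1. one_increment M n (h n)"
    and "\<forall>n\<ge>1. \<forall>i<l. \<forall>(s, t)\<in>S2_grid n.
           Lp_norm 2 M (\<lambda>\<omega>. tnorm i (J_path n x (h n) s t \<omega>))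
             \<le> ennreal (K * (t - s) powr (1/2 + \<nu> * real i))"
    and "standard_Brownian_motion M W"
    and "prob_space.indep_set M (sets (sigma_path M l x)) (sets (sigma_process M W))"
    and "fdd_conv M
           (\<lambda>n s t \<omega>. (trunc l (x s t \<omega>), increment n (h n) s t \<omega>))
           (\<lambda>s t \<omega>. (trunc l (x s t \<omega>), W t \<omega> - W s \<omega>))"
    and "\<forall>i\<in>{1..l - 1}. \<forall>\<sigma> :: nat \<Rightarrow> nat \<Rightarrow> real.
           (\<forall>m\<ge>1. 0 \<le> \<sigma> m 0 \<and> \<sigma> m m \<le> 1 \<and>
              (\<forall>j<m. \<sigma> m j < \<sigma> m (Suc j) \<and> \<sigma> m (Suc j) - \<sigma> m j \<le> 1 / real m)) \<longrightarrow>
           lim_limsup_in_prob M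
             (\<lambda>m n \<omega>. tnorm i (\<lambda>w. \<Sum>j<m. J_path n x (h n) (\<sigma> m j) (\<sigma> m (Suc j)) \<omega> w))"
  shows "\<exists>v :: real \<Rightarrow> real \<Rightarrow> 'a \<Rightarrow> real^'w^'v.
           (\<forall>(s, t)\<in>S2. conditional_Wiener_integral M (sigma_path M l x)
                           (\<lambda>u \<omega>. y u \<omega> []) W s t (v s t)) \<and>
           fdd_conv M
             (\<lambda>n s t \<omega>. (trunc l (x s t \<omega>), J_weight n (\<lambda>u \<omega>. y u \<omega> []) (h n) s t \<omega>))
             (\<lambda>s t \<omega>. (trunc l (x s t \<omega>), v s t \<omega>))"
proof -
  interpret rough_increments M \<nu> K l x h W
    using assms by (intro rough_increments.intro rough_increments_axioms.intro) auto
  have paths: "controlled_paths M l y"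
    using assms(4,6) unfolding controlled_Lp_def controlled_as_def Let_def by auto
  have control: "(\<exists>K::real. \<forall>k<l. \<forall>(s, t)\<in>S2.
           Lp_norm 2 M (\<lambda>\<omega>. tnorm k (remainder l x y k s t \<omega>))
             \<le> ennreal (K * (t - s) powr (real (l - k) * \<nu>))) \<or>
        (\<exists>G::'a \<Rightarrow> real. G \<in> borel_measurable M \<and>
           (AE \<omega> in M. \<forall>k<l. \<forall>(s, t)\<in>S2.
              tnorm k (remainder l x y k s t \<omega>) \<le> G \<omega> * (t - s) powr (real (l - k) * \<nu>)))"
    using assms(6) unfolding controlled_Lp_def controlled_as_def Let_def assms(4)[symmetric] by blast
  show ?thesis
    by (rule weighted_increments_converge[OF paths control assms(7)])
qed

end
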